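(* Let $N$ be a paraquaternionic CR-submanifold of a paraquaternionic K\"ahler manifold $(M,\sigma,g)$. Then the following assertions are mutually equivalent: (i) $N$ is a totally real ruled paraquaternionic CR-submanifold. (ii) $N$ is $\mathcal{D}^\perp$-geodesic (i.e. $B(X,Y)=0$ for all $X,Y\in\Gamma(\mathcal{D}^\perp)$) and $B(X,Y)\in\Gamma(\nu)$ for all $X\in\Gamma(\mathcal{D})$, $Y\in\Gamma(\mathcal{D}^\perp)$. (iii) The subbundle $\nu^\perp$ is $\mathcal{D}^\perp$-parallel, i.e. $\nabla^\perp_XJ_\alpha Z\in\Gamma(\nu^\perp)$ for all $X,Z\in\Gamma(\mathcal{D}^\perp)$, $\alpha\in\{1,2,3\}$, and the second fundamental form satisfies $B(X,Y)\in\Gamma(\nu)$ for all $X\in\Gamma(\mathcal{D}^\perp)$, $Y\in\Gamma(TN)$. (iv) The shape operator satisfies $A_{J_\alpha Z}X=0$ for all $X,Z\in\Gamma(\mathcal{D}^\perp)$, $\alpha\in\{1,2,3\}$, and $A_\xi X\in\Gamma(\mathcal{D})$ for all $X\in\Gamma(\mathcal{D}^\perp)$, $\xi\in\Gamma(\nu)$. Here $\{J_1,J_2,J_3\}$ runs over canonical local bases of $\sigma$.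
   Context: Everything is smooth; $\Gamma(E)$ denotes the sections of a bundle $E$. Put $\epsilon_1=1$, $\epsilon_2=\epsilon_3=-1$; indices $\alpha\in\{1,2,3\}$ are taken modulo 3. An almost paraquaternionic structure on $M$ is a rank-3 subbundle $\sigma\subset \mathrm{End}(TM)$ admitting on coordinate neighborhoods $U$ a canonical local basis $\{J_1,J_2,J_3\}$ with $J_\alpha^2=-\epsilon_\alpha \mathrm{Id}$ and $J_\alpha J_{\alpha+1}=-J_{\alpha+1}J_\alpha=\epsilon_{\alpha+2}J_{\alpha+2}$; on overlaps two canonical local bases are related by an $SO(2,1)$-valued matrix of functions. $(M,\sigma,g)$ is almost paraquaternionic hermitian if $g$ is a semi-Riemannian metric with $g(J_\alpha X,J_\alpha Y)=\epsilon_\alpha g(X,Y)$ for all $\alpha$ and all canonical local bases. It is paraquaternionic K\"ahler if moreover $\sigma$ is parallel with respect to the Levi-Civita connection $\overline\nabla$ of $g$; equivalently there are local 1-forms $\omega_1,\omega_2,\omega_3$ with $\overline\nabla_XJ_\alpha=-\epsilon_\alpha[\omega_{\alpha+2}(X)J_{\alpha+1}-\omega_{\alpha+1}(X)J_{\alpha+2}]$. A non-degenerate (immersed) submanifold $N$ of $M$ is one on which the induced metric, again denoted $g$, is non-degenerate; $TN^\perp$ is the normal bundle. It is a paraquaternionic CR-submanifold if there is a non-degenerate distribution $\mathcal{D}\subset TN$ such that, for every canonical local basis on $U$ and $x\in U\cap N$, $J_\alpha\mathcal{D}_x=\mathcal{D}_x$ and $J_\alpha\mathcal{D}^\perp_x\subset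 T_x^\perp N$ for $\alpha\in\{1,2,3\}$, where $\mathcal{D}^\perp$ is the orthogonal complement of $\mathcal{D}$ in $TN$. Let $\nu^\perp=J_1\mathcal{D}^\perp\oplus J_2\mathcal{D}^\perp\oplus J_3\mathcal{D}^\perp\subset TN^\perp$ (independent of the canonical local basis) and $\nu$ its orthogonal complement in $TN^\perp$. With $\nabla$ the Levi-Civita connection of $N$, the Gauss and Weingarten formulas are $\overline\nabla_XY=\nabla_XY+B(X,Y)$ and $\overline\nabla_X\xi=-A_\xi X+\nabla^\perp_X\xi$ for $X,Y\in\Gamma(TN)$, $\xi\in\Gamma(TN^\perp)$, with $B(X,Y),\nabla^\perp_X\xi$ normal and $A_\xi X$ tangent to $N$. The distribution $\mathcal{D}^\perp$ is always integrable; $\mathfrak{F}^\perp$ denotes the foliation of $N$ whose leaves are the integral manifolds of $\mathcal{D}^\perp$. $N$ is called a totally real ruled paraquaternionic CR-submanifold if the leaves of $\mathfrak{F}^\perp$ are totally geodesic submanifolds immersed in $(M,g)$. *)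

theory Defs
  imports "HOL-Analysis.Analysis" "HOL-Library.Numeral_Type"
begin

section \<open>Smooth functions between normed spaces\<close>

text \<open>Meant for open \<open>S\<close>: all iterated directional derivatives up to order \<open>k\<close> exist
  (as Frechet derivatives up to order \<open>k\<close>) and are continuous.\<close>

fun Ck_on :: "nat \<Rightarrow> ('e::euclidean_space \<Rightarrow> 'f::real_normed_vector) \<Rightarrow> 'e set \<Rightarrow> bool" where
  "Ck_on 0 f S \<longleftrightarrow> continuous_on S f"
| "Ck_on (Suc k) f S \<longleftrightarrow>
     (\<forall>x\<in>S. f differentiable (at x)) \<and>
     (\<forall>v. Ck_on k (\<lambda>x. frechet_derivative f (at x) v) S)"

definition smooth_on :: "('e::euclidean_space \<Rightarrow> 'f::real_normed_vector) \<Rightarrow> 'e set \<Rightarrow> bool" where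
  "smooth_on f S \<longleftrightarrow> (\<forall>k. Ck_on k f S)"


section \<open>Smooth manifolds\<close>

text \<open>The underlying space of a manifold is a type (in all uses a second countable Hausdorff
  space); the smooth structure is an atlas of charts with values in a Euclidean space.\<close>

type_synonym ('a, 'e) chart = "'a set \<times> ('a \<Rightarrow> 'e)"

abbreviation cdom :: "('a, 'e) chart \<Rightarrow> 'a set" where "cdom c \<equiv> fst c"
abbreviation cmap :: "('a, 'e) chart \<Rightarrow> 'a \<Rightarrow> 'e" where "cmap c \<equiv> snd c"
abbreviation cinv :: "('a, 'e) chart \<Rightarrow> 'e \<Rightarrow> 'a" where "cinv c \<equiv> inv_into (fst c) (snd c)"

definition is_chart :: "('a::topological_space, 'e::euclidean_space) chart \<Rightarrow> bool" where
  "is_chart c \<longleftrightarrow> open (cdom c) \<and> open (cmap c ` cdom c) \<and>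
     homeomorphism (cdom c) (cmap c ` cdom c) (cmap c) (cinv c)"

definition compatible ::
  "('a::topological_space, 'e::euclidean_space) chart \<Rightarrow> ('a, 'e) chart \<Rightarrow> bool" where
  "compatible c d \<longleftrightarrow>
     smooth_on (cmap d \<circ> cinv c) (cmap c ` (cdom c \<inter> cdom d)) \<and>
     smooth_on (cmap c \<circ> cinv d) (cmap d ` (cdom c \<inter> cdom d))"

definition smooth_manifold :: "('a::topological_space, 'e::euclidean_space) chart set \<Rightarrow> bool" where
  "smooth_manifold A \<longleftrightarrow>
     (\<forall>c\<in>A. is_chart c) \<and> (\<Union>c\<in>A. cdom c) = UNIV \<and> (\<forall>c\<in>A. \<forall>d\<in>A. compatible c d)"

definition max_atlas ::
  "('a::topological_space, 'e::euclidean_space) chart set \<Rightarrow> ('a, 'e) chart set" where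
  "max_atlas A = {c. is_chart c \<and> (\<forall>d\<in>A. compatible c d)}"

definition coordinate_nbhd :: "('a::topological_space, 'e::euclidean_space) chart set \<Rightarrow> 'a set \<Rightarrow> bool" where
  "coordinate_nbhd A U \<longleftrightarrow> (\<exists>\<phi>. (U, \<phi>) \<in> max_atlas A)"


subsection \<open>Tangent vectors\<close>

text \<open>The tangent space at \<open>p\<close> is identified with the model space \<open>'e\<close> by means of a chosen
  chart \<open>chart_at A p\<close> around \<open>p\<close>: a vector \<open>v :: 'e\<close> at \<open>p\<close> stands for the tangent vector whose
  components in \<open>chart_at A p\<close> are \<open>v\<close>.  Its components in an arbitrary chart \<open>c\<close> around \<open>p\<close>
  are \<open>to_chart A c p v\<close>, and \<open>from_chart A c p\<close> is the inverse passage.  As the chosen chart varies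
  with \<open>p\<close> in an arbitrary way, smoothness and derivatives of tensor fields always refer to
  components in a fixed chart.\<close>

definition chart_at :: "('a, 'e) chart set \<Rightarrow> 'a \<Rightarrow> ('a, 'e) chart" where
  "chart_at A p = (SOME c. c \<in> A \<and> p \<in> cdom c)"

definition coord_change ::
  "('a, 'e::euclidean_space) chart \<Rightarrow> ('a, 'e) chart \<Rightarrow> 'a \<Rightarrow> 'e \<Rightarrow> 'e" where
  "coord_change c d p = frechet_derivative (cmap d \<circ> cinv c) (at (cmap c p))"

definition to_chart ::
  "('a, 'e::euclidean_space) chart set \<Rightarrow> ('a, 'e) chart \<Rightarrow> 'a \<Rightarrow> 'e \<Rightarrow> 'e" where
  "to_chart A c p = coord_change (chart_at A p) c p"

definition from_chart ::
  "('a, 'e::euclidean_space) chart set \<Rightarrow> ('a, 'e) chart \<Rightarrow> 'a \<Rightarrow> 'e \<Rightarrow> 'e" where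
  "from_chart A c p = coord_change c (chart_at A p) p"

definition smooth_map ::
  "('b::topological_space, 'n::euclidean_space) chart set \<Rightarrow>
   ('a::topological_space, 'm::euclidean_space) chart set \<Rightarrow> ('b \<Rightarrow> 'a) \<Rightarrow> bool" where
  "smooth_map N M f \<longleftrightarrow> continuous_on UNIV f \<and>
     (\<forall>c\<in>N. \<forall>d\<in>M. smooth_on (cmap d \<circ> f \<circ> cinv c) (cmap c ` (cdom c \<inter> f -` cdom d)))"

definition differential ::
  "('b, 'n::euclidean_space) chart set \<Rightarrow> ('a, 'm::euclidean_space) chart set \<Rightarrow>
   ('b \<Rightarrow> 'a) \<Rightarrow> 'b \<Rightarrow> 'n \<Rightarrow> 'm" where
  "differential N M f p =
     frechet_derivative (cmap (chart_at M (f p)) \<circ> f \<circ> cinv (chart_at N p))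
       (at (cmap (chart_at N p) p))"

definition immersion ::
  "('b::topological_space, 'n::euclidean_space) chart set \<Rightarrow>
   ('a::topological_space, 'm::euclidean_space) chart set \<Rightarrow> ('b \<Rightarrow> 'a) \<Rightarrow> bool" where
  "immersion N M f \<longleftrightarrow> smooth_map N M f \<and> (\<forall>p. inj (differential N M f p))"


subsection \<open>Sections\<close>

text \<open>Smoothness on the open set \<open>W\<close> of a section \<open>\<xi>\<close> of the pull-back bundle \<open>f\<^sup>*TM\<close>, i.e.
  \<open>\<xi> p\<close> is a tangent vector of \<open>M\<close> at \<open>f p\<close>.  Vector fields are the case of the identity map.\<close>

definition smooth_along ::
  "('b, 'n::euclidean_space) chart set \<Rightarrow> ('a, 'm::euclidean_space) chart set \<Rightarrow>
   ('b \<Rightarrow> 'a) \<Rightarrow> 'b set \<Rightarrow> ('b \<Rightarrow> 'm) \<Rightarrow> bool" where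
  "smooth_along N M f W \<xi> \<longleftrightarrow>
     (\<forall>c\<in>N. \<forall>d\<in>M. smooth_on (\<lambda>x. to_chart M d (f (cinv c x)) (\<xi> (cinv c x)))
                     (cmap c ` (W \<inter> cdom c \<inter> f -` cdom d)))"

abbreviation vector_field_on ::
  "('a, 'e::euclidean_space) chart set \<Rightarrow> 'a set \<Rightarrow> ('a \<Rightarrow> 'e) \<Rightarrow> bool" where
  "vector_field_on M W X \<equiv> smooth_along M M id W X"

text \<open>The global smooth sections of a subbundle \<open>E\<close> of \<open>TN\<close>, respectively of \<open>f\<^sup>*TM\<close>.\<close>

definition tangent_sections ::
  "('b, 'n::euclidean_space) chart set \<Rightarrow> ('b \<Rightarrow> 'n set) \<Rightarrow> ('b \<Rightarrow> 'n) set" where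
  "tangent_sections N E = {X. vector_field_on N UNIV X \<and> (\<forall>p. X p \<in> E p)}"

definition sections_along ::
  "('b, 'n::euclidean_space) chart set \<Rightarrow> ('a, 'm::euclidean_space) chart set \<Rightarrow>
   ('b \<Rightarrow> 'a) \<Rightarrow> ('b \<Rightarrow> 'm set) \<Rightarrow> ('b \<Rightarrow> 'm) set" where
  "sections_along N M f E = {\<xi>. smooth_along N M f UNIV \<xi> \<and> (\<forall>p. \<xi> p \<in> E p)}"

definition smooth_endo ::
  "('a, 'e::euclidean_space) chart set \<Rightarrow> 'a set \<Rightarrow> ('a \<Rightarrow> 'e \<Rightarrow>\<^sub>L 'e) \<Rightarrow> bool" where
  "smooth_endo M U S \<longleftrightarrow>
     (\<forall>c\<in>M. \<forall>v. smooth_on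
        (\<lambda>x. to_chart M c (cinv c x) (blinfun_apply (S (cinv c x)) (from_chart M c (cinv c x) v)))
        (cmap c ` (U \<inter> cdom c)))"

definition distribution ::
  "('a::topological_space, 'e::euclidean_space) chart set \<Rightarrow> ('a \<Rightarrow> 'e set) \<Rightarrow> bool" where
  "distribution M E \<longleftrightarrow> (\<exists>r.
     (\<forall>p. subspace (E p) \<and> dim (E p) = r) \<and>
     (\<forall>p. \<exists>W X. open W \<and> p \<in> W \<and> (\<forall>i<r. vector_field_on M W (X i)) \<and>
        (\<forall>q\<in>W. E q = span ((\<lambda>i::nat. X i q) ` {..<r}))))"


section \<open>Semi-Riemannian metrics and the Levi-Civita connection\<close>

text \<open>A metric assigns to \<open>p\<close> a bilinear form on the tangent space at \<open>p\<close>.\<close>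

definition nondegenerate_on :: "('e::euclidean_space \<Rightarrow> 'e \<Rightarrow> real) \<Rightarrow> 'e set \<Rightarrow> bool" where
  "nondegenerate_on h V \<longleftrightarrow> (\<forall>v\<in>V. (\<forall>w\<in>V. h v w = 0) \<longrightarrow> v = 0)"

definition metric_index :: "('e::euclidean_space \<Rightarrow> 'e \<Rightarrow> real) \<Rightarrow> nat" where
  "metric_index h = Max (dim ` {V. subspace V \<and> (\<forall>v\<in>V. v \<noteq> 0 \<longrightarrow> h v v < 0)})"

text \<open>The function \<open>x \<mapsto> g(u, v)\<close> on the image of the chart \<open>c\<close>, where \<open>u\<close> and \<open>v\<close> are the
  fields with constant components in \<open>c\<close>.\<close>

definition metric_coeff ::
  "('a, 'e::euclidean_space) chart set \<Rightarrow> ('a \<Rightarrow> 'e \<Rightarrow> 'e \<Rightarrow> real) \<Rightarrow>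
   ('a, 'e) chart \<Rightarrow> 'e \<Rightarrow> 'e \<Rightarrow> 'e \<Rightarrow> real" where
  "metric_coeff M g c u v x =
     g (cinv c x) (from_chart M c (cinv c x) u) (from_chart M c (cinv c x) v)"

definition semi_riemannian_metric ::
  "('a, 'e::euclidean_space) chart set \<Rightarrow> ('a \<Rightarrow> 'e \<Rightarrow> 'e \<Rightarrow> real) \<Rightarrow> bool" where
  "semi_riemannian_metric M g \<longleftrightarrow>
     (\<forall>p. bilinear (g p) \<and> (\<forall>v w. g p v w = g p w v) \<and> nondegenerate_on (g p) UNIV) \<and>
     (\<forall>p q. metric_index (g p) = metric_index (g q)) \<and>
     (\<forall>c\<in>M. \<forall>u v. smooth_on (metric_coeff M g c u v) (cmap c ` cdom c))"

text \<open>The Christoffel symbols at \<open>p\<close> in the chart \<open>chart_at M p\<close>, as a bilinear map: the Koszul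
  formula for fields with constant components in this chart.\<close>

definition christoffel ::
  "('a, 'e::euclidean_space) chart set \<Rightarrow> ('a \<Rightarrow> 'e \<Rightarrow> 'e \<Rightarrow> real) \<Rightarrow> 'a \<Rightarrow> 'e \<Rightarrow> 'e \<Rightarrow> 'e" where
  "christoffel M g p u v =
     (let c = chart_at M p; x = cmap c p in
      THE w. \<forall>z. 2 * g p w z =
          frechet_derivative (metric_coeff M g c v z) (at x) u
        + frechet_derivative (metric_coeff M g c u z) (at x) v
        - frechet_derivative (metric_coeff M g c u v) (at x) z)"

text \<open>The Levi-Civita connection of \<open>(M, g)\<close>, pulled back along \<open>f\<close>: the covariant derivative at
  \<open>p\<close> of a section \<open>\<xi>\<close> of \<open>f\<^sup>*TM\<close> in the direction of the vector \<open>v\<close> of \<open>N\<close> at \<open>p\<close>.\<close>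

definition levi_civita_along ::
  "('b, 'n::euclidean_space) chart set \<Rightarrow> ('a, 'm::euclidean_space) chart set \<Rightarrow>
   ('a \<Rightarrow> 'm \<Rightarrow> 'm \<Rightarrow> real) \<Rightarrow> ('b \<Rightarrow> 'a) \<Rightarrow> ('b \<Rightarrow> 'm) \<Rightarrow> 'b \<Rightarrow> 'n \<Rightarrow> 'm" where
  "levi_civita_along N M g f \<xi> p v =
     (let c = chart_at N p; d = chart_at M (f p) in
      frechet_derivative (\<lambda>x. to_chart M d (f (cinv c x)) (\<xi> (cinv c x))) (at (cmap c p)) v
      + christoffel M g (f p) (differential N M f p v) (\<xi> p))"

definition levi_civita ::
  "('a, 'e::euclidean_space) chart set \<Rightarrow> ('a \<Rightarrow> 'e \<Rightarrow> 'e \<Rightarrow> real) \<Rightarrow> ('a \<Rightarrow> 'e) \<Rightarrow> 'a \<Rightarrow> 'e \<Rightarrow> 'e" where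
  "levi_civita M g Y p v = levi_civita_along M M g id Y p v"

text \<open>\<open>(\<nabla>\<^sub>u S) v = \<nabla>\<^sub>u (S V) - S (\<nabla>\<^sub>u V)\<close> at \<open>p\<close>, where \<open>V\<close> has the constant components \<open>v\<close>
  in \<open>chart_at M p\<close>, so that \<open>\<nabla>\<^sub>u V\<close> is the Christoffel term alone.\<close>

definition levi_civita_endo ::
  "('a, 'e::euclidean_space) chart set \<Rightarrow> ('a \<Rightarrow> 'e \<Rightarrow> 'e \<Rightarrow> real) \<Rightarrow>
   ('a \<Rightarrow> 'e \<Rightarrow>\<^sub>L 'e) \<Rightarrow> 'a \<Rightarrow> 'e \<Rightarrow> 'e \<Rightarrow> 'e" where
  "levi_civita_endo M g S p u v =
     (let V = (\<lambda>q. from_chart M (chart_at M p) q v) in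
      levi_civita M g (\<lambda>q. blinfun_apply (S q) (V q)) p u
      - blinfun_apply (S p) (levi_civita M g V p u))"


section \<open>Paraquaternionic Kaehler manifolds\<close>

text \<open>Indices are elements of the three-element type \<open>3\<close>, whose arithmetic is modulo 3.\<close>

definition eps :: "3 \<Rightarrow> real" where
  "eps \<alpha> = (if \<alpha> = 1 then 1 else -1)"

definition SO21 :: "(real^3^3) set" where
  "SO21 = (let \<eta> = (\<chi> i j. if i = j then eps i else 0) in
     {a. transpose a ** \<eta> ** a = \<eta> \<and> det a = 1})"

definition canonical_local_basis ::
  "('a::topological_space, 'm::euclidean_space) chart set \<Rightarrow> ('a \<Rightarrow> ('m \<Rightarrow>\<^sub>L 'm) set) \<Rightarrow>
   'a set \<Rightarrow> (3 \<Rightarrow> 'a \<Rightarrow> 'm \<Rightarrow>\<^sub>L 'm) \<Rightarrow> bool" where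
  "canonical_local_basis M \<sigma> U J \<longleftrightarrow>
     coordinate_nbhd M U \<and> (\<forall>\<alpha>. smooth_endo M U (J \<alpha>)) \<and>
     (\<forall>p\<in>U. \<sigma> p = span (range (\<lambda>\<alpha>. J \<alpha> p)) \<and>
       (\<forall>\<alpha>. J \<alpha> p o\<^sub>L J \<alpha> p = - eps \<alpha> *\<^sub>R id_blinfun \<and>
            J \<alpha> p o\<^sub>L J (\<alpha> + 1) p = eps (\<alpha> + 2) *\<^sub>R J (\<alpha> + 2) p \<and>
            - (J (\<alpha> + 1) p o\<^sub>L J \<alpha> p) = eps (\<alpha> + 2) *\<^sub>R J (\<alpha> + 2) p))"

text \<open>The entries of the transition matrices below are automatically smooth functions of \<open>p\<close>.\<close>

definition almost_paraquaternionic ::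
  "('a::topological_space, 'm::euclidean_space) chart set \<Rightarrow> ('a \<Rightarrow> ('m \<Rightarrow>\<^sub>L 'm) set) \<Rightarrow> bool" where
  "almost_paraquaternionic M \<sigma> \<longleftrightarrow>
     (\<forall>p. subspace (\<sigma> p) \<and> dim (\<sigma> p) = 3) \<and>
     (\<forall>p. \<exists>U J. p \<in> U \<and> canonical_local_basis M \<sigma> U J) \<and>
     (\<forall>U J U' J'. canonical_local_basis M \<sigma> U J \<and> canonical_local_basis M \<sigma> U' J' \<longrightarrow>
        (\<forall>p\<in>U \<inter> U'. \<exists>a\<in>SO21. \<forall>\<alpha>. J' \<alpha> p = (\<Sum>\<beta>\<in>UNIV. (a $ \<alpha> $ \<beta>) *\<^sub>R J \<beta> p)))"

definition almost_paraquaternionic_hermitian ::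
  "('a::topological_space, 'm::euclidean_space) chart set \<Rightarrow> ('a \<Rightarrow> ('m \<Rightarrow>\<^sub>L 'm) set) \<Rightarrow>
   ('a \<Rightarrow> 'm \<Rightarrow> 'm \<Rightarrow> real) \<Rightarrow> bool" where
  "almost_paraquaternionic_hermitian M \<sigma> g \<longleftrightarrow>
     almost_paraquaternionic M \<sigma> \<and> semi_riemannian_metric M g \<and>
     (\<forall>U J. canonical_local_basis M \<sigma> U J \<longrightarrow>
        (\<forall>p\<in>U. \<forall>\<alpha> v w. g p (blinfun_apply (J \<alpha> p) v) (blinfun_apply (J \<alpha> p) w) = eps \<alpha> * g p v w))"

definition parallel_subbundle ::
  "('a::topological_space, 'm::euclidean_space) chart set \<Rightarrow> ('a \<Rightarrow> 'm \<Rightarrow> 'm \<Rightarrow> real) \<Rightarrow>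
   ('a \<Rightarrow> ('m \<Rightarrow>\<^sub>L 'm) set) \<Rightarrow> bool" where
  "parallel_subbundle M g \<sigma> \<longleftrightarrow>
     (\<forall>U S. open U \<and> smooth_endo M U S \<and> (\<forall>p\<in>U. S p \<in> \<sigma> p) \<longrightarrow>
        (\<forall>p\<in>U. \<forall>u. \<exists>T\<in>\<sigma> p. blinfun_apply T = levi_civita_endo M g S p u))"

definition paraquaternionic_kaehler ::
  "('a::topological_space, 'm::euclidean_space) chart set \<Rightarrow> ('a \<Rightarrow> ('m \<Rightarrow>\<^sub>L 'm) set) \<Rightarrow>
   ('a \<Rightarrow> 'm \<Rightarrow> 'm \<Rightarrow> real) \<Rightarrow> bool" where
  "paraquaternionic_kaehler M \<sigma> g \<longleftrightarrow>
     almost_paraquaternionic_hermitian M \<sigma> g \<and> parallel_subbundle M g \<sigma>"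


section \<open>Submanifolds\<close>

definition induced_metric ::
  "('b, 'n::euclidean_space) chart set \<Rightarrow> ('a, 'm::euclidean_space) chart set \<Rightarrow>
   ('a \<Rightarrow> 'm \<Rightarrow> 'm \<Rightarrow> real) \<Rightarrow> ('b \<Rightarrow> 'a) \<Rightarrow> 'b \<Rightarrow> 'n \<Rightarrow> 'n \<Rightarrow> real" where
  "induced_metric N M g f p v w = g (f p) (differential N M f p v) (differential N M f p w)"

definition nondegenerate_submanifold ::
  "('b::topological_space, 'n::euclidean_space) chart set \<Rightarrow>
   ('a::topological_space, 'm::euclidean_space) chart set \<Rightarrow>
   ('a \<Rightarrow> 'm \<Rightarrow> 'm \<Rightarrow> real) \<Rightarrow> ('b \<Rightarrow> 'a) \<Rightarrow> bool" where
  "nondegenerate_submanifold N M g f \<longleftrightarrow>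
     immersion N M f \<and> (\<forall>p. nondegenerate_on (induced_metric N M g f p) UNIV)"

definition normal_space ::
  "('b, 'n::euclidean_space) chart set \<Rightarrow> ('a, 'm::euclidean_space) chart set \<Rightarrow>
   ('a \<Rightarrow> 'm \<Rightarrow> 'm \<Rightarrow> real) \<Rightarrow> ('b \<Rightarrow> 'a) \<Rightarrow> 'b \<Rightarrow> 'm set" where
  "normal_space N M g f p = {\<xi>. \<forall>v. g (f p) \<xi> (differential N M f p v) = 0}"

text \<open>Gauss formula: \<open>B(X,Y)\<close> is the ambient covariant derivative minus the one of \<open>N\<close>.\<close>

definition second_fundamental_form ::
  "('b, 'n::euclidean_space) chart set \<Rightarrow> ('a, 'm::euclidean_space) chart set \<Rightarrow>
   ('a \<Rightarrow> 'm \<Rightarrow> 'm \<Rightarrow> real) \<Rightarrow> ('b \<Rightarrow> 'a) \<Rightarrow> ('b \<Rightarrow> 'n) \<Rightarrow> ('b \<Rightarrow> 'n) \<Rightarrow> 'b \<Rightarrow> 'm" where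
  "second_fundamental_form N M g f X Y p =
     levi_civita_along N M g f (\<lambda>q. differential N M f q (Y q)) p (X p)
     - differential N M f p (levi_civita N (induced_metric N M g f) Y p (X p))"

text \<open>Weingarten formula: \<open>A\<^sub>\<xi> X\<close> is the unique tangent vector of \<open>N\<close> whose image, added to the ambient
  covariant derivative of \<open>\<xi>\<close>, makes it normal; the sum is the normal connection.\<close>

definition shape_operator ::
  "('b, 'n::euclidean_space) chart set \<Rightarrow> ('a, 'm::euclidean_space) chart set \<Rightarrow>
   ('a \<Rightarrow> 'm \<Rightarrow> 'm \<Rightarrow> real) \<Rightarrow> ('b \<Rightarrow> 'a) \<Rightarrow> ('b \<Rightarrow> 'm) \<Rightarrow> ('b \<Rightarrow> 'n) \<Rightarrow> 'b \<Rightarrow> 'n" where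
  "shape_operator N M g f \<xi> X p =
     (THE a. levi_civita_along N M g f \<xi> p (X p) + differential N M f p a \<in> normal_space N M g f p)"

definition normal_connection ::
  "('b, 'n::euclidean_space) chart set \<Rightarrow> ('a, 'm::euclidean_space) chart set \<Rightarrow>
   ('a \<Rightarrow> 'm \<Rightarrow> 'm \<Rightarrow> real) \<Rightarrow> ('b \<Rightarrow> 'a) \<Rightarrow> ('b \<Rightarrow> 'n) \<Rightarrow> ('b \<Rightarrow> 'm) \<Rightarrow> 'b \<Rightarrow> 'm" where
  "normal_connection N M g f X \<xi> p =
     levi_civita_along N M g f \<xi> p (X p) + differential N M f p (shape_operator N M g f \<xi> X p)"


subsection \<open>Subsets with an immersed submanifold structure, leaves\<close>

text \<open>An immersed submanifold of \<open>N\<close> given by an injective immersion is a subset \<open>topspace L\<close> of \<open>N\<close>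
  with a topology \<open>L\<close> of its own, in general finer than the subspace topology.  Every point has an
  \<open>L\<close>-open neighbourhood \<open>V\<close> which some chart of the maximal atlas of \<open>N\<close> maps homeomorphically
  (for the topology \<open>L\<close>) onto an open piece of an affine subspace; \<open>E\<close> is the direction of that
  affine subspace.  (For \<open>E = {0}\<close> this includes dimension 0.)\<close>

definition slice_chart ::
  "('b::topological_space, 'n::euclidean_space) chart set \<Rightarrow> 'b topology \<Rightarrow>
   ('b, 'n) chart \<Rightarrow> 'n set \<Rightarrow> 'b set \<Rightarrow> bool" where
  "slice_chart N L c E V \<longleftrightarrow>
     c \<in> max_atlas N \<and> subspace E \<and> openin L V \<and> V \<subseteq> cdom c \<and>
     (\<exists>a. openin (top_of_set ((+) a ` E)) (cmap c ` V)) \<and>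
     homeomorphic_map (subtopology L V) (top_of_set (cmap c ` V)) (cmap c)"

definition immersed_subset ::
  "('b::topological_space, 'n::euclidean_space) chart set \<Rightarrow> 'b topology \<Rightarrow> bool" where
  "immersed_subset N L \<longleftrightarrow> (\<forall>p\<in>topspace L. \<exists>c E V. slice_chart N L c E V \<and> p \<in> V)"

definition tangent_space_of ::
  "('b::topological_space, 'n::euclidean_space) chart set \<Rightarrow> 'b topology \<Rightarrow> 'b \<Rightarrow> 'n set" where
  "tangent_space_of N L p = {v. \<exists>c E V. slice_chart N L c E V \<and> p \<in> V \<and> to_chart N c p v \<in> E}"

definition integral_manifold ::
  "('b::topological_space, 'n::euclidean_space) chart set \<Rightarrow> ('b \<Rightarrow> 'n set) \<Rightarrow> 'b topology \<Rightarrow> bool" where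
  "integral_manifold N \<Delta> L \<longleftrightarrow>
     immersed_subset N L \<and> (\<forall>p\<in>topspace L. tangent_space_of N L p = \<Delta> p)"

text \<open>The leaves of the foliation defined by an integrable distribution are its maximal connected
  integral manifolds.  Their topology is automatically second countable, since they are
  connected and immersed in a second countable manifold.\<close>

definition leaf ::
  "('b::topological_space, 'n::euclidean_space) chart set \<Rightarrow> ('b \<Rightarrow> 'n set) \<Rightarrow> 'b topology \<Rightarrow> bool" where
  "leaf N \<Delta> L \<longleftrightarrow>
     integral_manifold N \<Delta> L \<and> connected_space L \<and> topspace L \<noteq> {} \<and>
     (\<forall>L'. integral_manifold N \<Delta> L' \<and> connected_space L' \<and> topspace L \<subseteq> topspace L' \<longrightarrow>
        topspace L' = topspace L)"

text \<open>Value at \<open>p\<close> of the second fundamental form of \<open>f \<circ> incl : L \<rightarrow> M\<close>, i.e. the component normal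
  to \<open>L\<close> of the ambient covariant derivative of \<open>Y\<close> in the direction \<open>v\<close>.  The field \<open>Y\<close> on \<open>L\<close> is
  given by a local extension to \<open>N\<close>; every smooth vector field on \<open>L\<close> has such extensions
  locally, as is seen in a slice chart, and the choice of the extension does not matter for \<open>v\<close>
  tangent to \<open>L\<close>.\<close>

definition leaf_second_fundamental_form ::
  "('b::topological_space, 'n::euclidean_space) chart set \<Rightarrow> ('a, 'm::euclidean_space) chart set \<Rightarrow>
   ('a \<Rightarrow> 'm \<Rightarrow> 'm \<Rightarrow> real) \<Rightarrow> ('b \<Rightarrow> 'a) \<Rightarrow> 'b topology \<Rightarrow> ('b \<Rightarrow> 'n) \<Rightarrow> 'b \<Rightarrow> 'n \<Rightarrow> 'm" where
  "leaf_second_fundamental_form N M g f L Y p v =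
     (THE h. (\<forall>w\<in>tangent_space_of N L p. g (f p) h (differential N M f p w) = 0) \<and>
        levi_civita_along N M g f (\<lambda>q. differential N M f q (Y q)) p v - h
          \<in> differential N M f p ` tangent_space_of N L p)"

definition totally_geodesic ::
  "('b::topological_space, 'n::euclidean_space) chart set \<Rightarrow> ('a, 'm::euclidean_space) chart set \<Rightarrow>
   ('a \<Rightarrow> 'm \<Rightarrow> 'm \<Rightarrow> real) \<Rightarrow> ('b \<Rightarrow> 'a) \<Rightarrow> 'b topology \<Rightarrow> bool" where
  "totally_geodesic N M g f L \<longleftrightarrow>
     (\<forall>W V Y. open W \<and> vector_field_on N W Y \<and> openin L V \<and> V \<subseteq> W \<and>
          (\<forall>q\<in>V. Y q \<in> tangent_space_of N L q) \<longrightarrow>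
        (\<forall>p\<in>V. \<forall>v\<in>tangent_space_of N L p. leaf_second_fundamental_form N M g f L Y p v = 0))"


section \<open>Paraquaternionic CR-submanifolds\<close>

definition Dperp ::
  "('b, 'n::euclidean_space) chart set \<Rightarrow> ('a, 'm::euclidean_space) chart set \<Rightarrow>
   ('a \<Rightarrow> 'm \<Rightarrow> 'm \<Rightarrow> real) \<Rightarrow> ('b \<Rightarrow> 'a) \<Rightarrow> ('b \<Rightarrow> 'n set) \<Rightarrow> 'b \<Rightarrow> 'n set" where
  "Dperp N M g f D p = {v. \<forall>w\<in>D p. induced_metric N M g f p v w = 0}"

definition paraquaternionic_CR_submanifold ::
  "('b::topological_space, 'n::euclidean_space) chart set \<Rightarrow>
   ('a::topological_space, 'm::euclidean_space) chart set \<Rightarrow> ('a \<Rightarrow> ('m \<Rightarrow>\<^sub>L 'm) set) \<Rightarrow>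
   ('a \<Rightarrow> 'm \<Rightarrow> 'm \<Rightarrow> real) \<Rightarrow> ('b \<Rightarrow> 'a) \<Rightarrow> ('b \<Rightarrow> 'n set) \<Rightarrow> bool" where
  "paraquaternionic_CR_submanifold N M \<sigma> g f D \<longleftrightarrow>
     nondegenerate_submanifold N M g f \<and>
     distribution N D \<and> (\<forall>x. nondegenerate_on (induced_metric N M g f x) (D x)) \<and>
     (\<forall>U J x. canonical_local_basis M \<sigma> U J \<and> f x \<in> U \<longrightarrow>
        (\<forall>\<alpha>. blinfun_apply (J \<alpha> (f x)) ` differential N M f x ` D x = differential N M f x ` D x \<and>
             blinfun_apply (J \<alpha> (f x)) ` differential N M f x ` Dperp N M g f D x
               \<subseteq> normal_space N M g f x))"

text \<open>The sum of the \<open>J\<^sub>\<alpha> D\<^sup>\<perp>\<close> does not depend on the canonical local basis, so admitting all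
  canonical local bases around \<open>f x\<close> gives the same space as any fixed one.\<close>

definition nu_perp ::
  "('b, 'n::euclidean_space) chart set \<Rightarrow> ('a::topological_space, 'm::euclidean_space) chart set \<Rightarrow>
   ('a \<Rightarrow> ('m \<Rightarrow>\<^sub>L 'm) set) \<Rightarrow> ('a \<Rightarrow> 'm \<Rightarrow> 'm \<Rightarrow> real) \<Rightarrow> ('b \<Rightarrow> 'a) \<Rightarrow> ('b \<Rightarrow> 'n set) \<Rightarrow>
   'b \<Rightarrow> 'm set" where
  "nu_perp N M \<sigma> g f D x =
     {\<Sum>\<alpha>\<in>UNIV. blinfun_apply (J \<alpha> (f x)) (differential N M f x (z \<alpha>)) | U J z.
        canonical_local_basis M \<sigma> U J \<and> f x \<in> U \<and> (\<forall>\<alpha>. z \<alpha> \<in> Dperp N M g f D x)}"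

definition nu ::
  "('b, 'n::euclidean_space) chart set \<Rightarrow> ('a::topological_space, 'm::euclidean_space) chart set \<Rightarrow>
   ('a \<Rightarrow> ('m \<Rightarrow>\<^sub>L 'm) set) \<Rightarrow> ('a \<Rightarrow> 'm \<Rightarrow> 'm \<Rightarrow> real) \<Rightarrow> ('b \<Rightarrow> 'a) \<Rightarrow> ('b \<Rightarrow> 'n set) \<Rightarrow>
   'b \<Rightarrow> 'm set" where
  "nu N M \<sigma> g f D x =
     {\<xi> \<in> normal_space N M g f x. \<forall>\<zeta>\<in>nu_perp N M \<sigma> g f D x. g (f x) \<xi> \<zeta> = 0}"

definition totally_real_ruled ::
  "('b::topological_space, 'n::euclidean_space) chart set \<Rightarrow> ('a, 'm::euclidean_space) chart set \<Rightarrow>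
   ('a \<Rightarrow> 'm \<Rightarrow> 'm \<Rightarrow> real) \<Rightarrow> ('b \<Rightarrow> 'a) \<Rightarrow> ('b \<Rightarrow> 'n set) \<Rightarrow> bool" where
  "totally_real_ruled N M g f D \<longleftrightarrow>
     (\<forall>L. leaf N (Dperp N M g f D) L \<longrightarrow> totally_geodesic N M g f L)"

text \<open>The section \<open>J\<^sub>\<alpha> Z\<close> of \<open>f\<^sup>*TM\<close>, for \<open>Z\<close> a vector field on \<open>N\<close> and \<open>J\<close> an endomorphism field;
  only meaningful over the preimage of the set where \<open>J\<close> is defined.\<close>

definition endo_along ::
  "('b, 'n::euclidean_space) chart set \<Rightarrow> ('a, 'm::euclidean_space) chart set \<Rightarrow> ('b \<Rightarrow> 'a) \<Rightarrow>
   ('a \<Rightarrow> 'm \<Rightarrow>\<^sub>L 'm) \<Rightarrow> ('b \<Rightarrow> 'n) \<Rightarrow> 'b \<Rightarrow> 'm" where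
  "endo_along N M f S Z q = blinfun_apply (S (f q)) (differential N M f q (Z q))"

text \<open>The second fundamental form, the shape operator and the normal connection produce smooth
  sections from smooth sections, so that in the following conditions \<open>B(X,Y) \<in> \<Gamma>(\<nu>)\<close> and
  the like amount to membership in the fibre at each point.\<close>

definition Dperp_geodesic ::
  "('b, 'n::euclidean_space) chart set \<Rightarrow> ('a, 'm::euclidean_space) chart set \<Rightarrow>
   ('a \<Rightarrow> 'm \<Rightarrow> 'm \<Rightarrow> real) \<Rightarrow> ('b \<Rightarrow> 'a) \<Rightarrow> ('b \<Rightarrow> 'n set) \<Rightarrow> bool" where
  "Dperp_geodesic N M g f D \<longleftrightarrow>
     (\<forall>X\<in>tangent_sections N (Dperp N M g f D). \<forall>Y\<in>tangent_sections N (Dperp N M g f D). \<forall>x.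
        second_fundamental_form N M g f X Y x = 0)"

definition nu_perp_Dperp_parallel ::
  "('b, 'n::euclidean_space) chart set \<Rightarrow> ('a::topological_space, 'm::euclidean_space) chart set \<Rightarrow>
   ('a \<Rightarrow> ('m \<Rightarrow>\<^sub>L 'm) set) \<Rightarrow> ('a \<Rightarrow> 'm \<Rightarrow> 'm \<Rightarrow> real) \<Rightarrow> ('b \<Rightarrow> 'a) \<Rightarrow> ('b \<Rightarrow> 'n set) \<Rightarrow> bool" where
  "nu_perp_Dperp_parallel N M \<sigma> g f D \<longleftrightarrow>
     (\<forall>X\<in>tangent_sections N (Dperp N M g f D). \<forall>Z\<in>tangent_sections N (Dperp N M g f D).
      \<forall>U J \<alpha> x. canonical_local_basis M \<sigma> U J \<and> f x \<in> U \<longrightarrow>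
        normal_connection N M g f X (endo_along N M f (J \<alpha>) Z) x \<in> nu_perp N M \<sigma> g f D x)"

end

(* The Frobenius theorem is proved by solving the total differential equation of the distribution along
   rays; integral patches are then glued to leaves, so that D^perp, which is involutive, has a leaf
   through every point.  Equality of Y with the section obtained by projecting it to D^perp along a leaf
   allows one to test the leaves with global sections of D^perp: (i) says that the ambient derivative of a
   section of D^perp along D^perp stays in D^perp.  By the Gauss formula its normal part is B(X, Y).  Its
   D-part is found by writing W in D as J Z with Z in D: since nabla J preserves the span of the J_alpha,
   g(nabla_X Y, J Z) = g(B(X, Z), J Y), so the D-part vanishes exactly if B(X, Z) lies in nu.  The
   conditions (iii) and (iv) follow by metric duality: g(A_xi X, W) = g(xi, B(X, W)), and modulo nu^perp
   the derivative of J Y is J applied to the derivative of Y. *)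
theory Submission
  imports Defs
begin

section \<open>Calculus of smooth functions\<close>

text \<open>Three obstacles shape the development. A tangent space is a copy of the model space
  through an arbitrarily chosen chart, so nothing can be differentiated before it is written in
  components of one fixed chart. The fields in the assertions are global sections, whereas frames
  and canonical bases are local; to pass to single vectors, each vector of D, D^perp or \<nu> is
  extended by projecting a field with constant components and cutting it off. For an indefinite
  metric this needs non-degenerate subspaces and smooth inverses of Gram matrices. Finally, (i)
  quantifies over leaves and would say nothing at a point that lies on none, so a pointwise
  condition follows from it only once leaves, including their maximality, exist everywhere. The
  common pointwise core is: B vanishes on D^perp and B(D^perp, D) lies in \<nu>. Since 0 lies in
  \<nu>, this is the same as: B vanishes on D^perp and B(D^perp, TN) lies in \<nu>. The first form
  fits (i) and (ii), the second (iii) and (iv).\<close>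

lemma Ck_on_subset: "Ck_on k f S \<Longrightarrow> T \<subseteq> S \<Longrightarrow> Ck_on k f T"
  by (induction k arbitrary: f) (auto intro: continuous_on_subset)

lemma Ck_on_cong:
  assumes "open S" "\<And>x. x \<in> S \<Longrightarrow> f x = g x" "Ck_on k f S"
  shows "Ck_on k g S"
  using assms(2,3)
proof (induction k arbitrary: f g)
  case 0
  then show ?case by (metis Ck_on.simps(1) continuous_on_cong)
next
  case (Suc k)
  have d: "f differentiable (at x)" if "x \<in> S" for x using Suc.prems(2) that by simp
  have eq: "frechet_derivative f (at x) = frechet_derivative g (at x)" if "x \<in> S" for x
    using frechet_derivative_transform_within_open[OF d[OF that] assms(1) that] Suc.prems(1) by blast
  have "g differentiable (at x)" if "x \<in> S" for x
    using d[OF that] Suc.prems(1) assms(1) that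
    by (metis differentiable_def has_derivative_transform_within_open)
  moreover have "Ck_on k (\<lambda>x. frechet_derivative g (at x) v) S" for v
    by (rule Suc.IH[of "\<lambda>x. frechet_derivative f (at x) v"]) (use eq Suc.prems(2) in auto)
  ultimately show ?case by simp
qed

lemma Ck_on_imp_continuous: "Ck_on k f S \<Longrightarrow> continuous_on S f"
  by (cases k) (auto simp: continuous_at_imp_continuous_on differentiable_imp_continuous_within)

lemma Ck_on_Suc_imp: "Ck_on (Suc k) f S \<Longrightarrow> Ck_on k f S"
proof (induction k arbitrary: f)
  case 0 then show ?case using Ck_on_imp_continuous by (metis Ck_on.simps(1))
next
  case (Suc k) then show ?case by (metis Ck_on.simps(2))
qed

text \<open>Smoothness in charts is usually obtained only near each point, by factoring through
  another chart; this rule glues such local statements.\<close>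

lemma Ck_on_local:
  assumes "\<And>x. x \<in> S \<Longrightarrow> \<exists>T. open T \<and> x \<in> T \<and> Ck_on k f (T \<inter> S)" "open S"
  shows "Ck_on k f S"
  using assms(1)
proof (induction k arbitrary: f)
  case 0
  show ?case
    unfolding Ck_on.simps continuous_on_eq_continuous_at[OF assms(2)]
  proof
    fix x assume "x \<in> S"
    then obtain T where T: "open T" "x \<in> T" "continuous_on (T \<inter> S) f" using 0 by (metis Ck_on.simps(1))
    then have "open (T \<inter> S)" using assms(2) by blast
    then show "isCont f x" using T \<open>x \<in> S\<close> continuous_on_eq_continuous_at by blast
  qed
next
  case (Suc k)
  have "\<exists>T. open T \<and> x \<in> T \<and> Ck_on k (\<lambda>x. frechet_derivative f (at x) v) (T \<inter> S) \<and> f differentiable (at x)"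
    if x: "x \<in> S" for x v
  proof -
    obtain T where "open T" "x \<in> T" "Ck_on (Suc k) f (T \<inter> S)" using Suc.prems[OF x] by blast
    then show ?thesis using x by (intro exI[of _ T]) simp
  qed
  then show ?case using Suc.IH by (metis Ck_on.simps(2))
qed

text \<open>\<open>Ck_on\<close> speaks of \<open>frechet_derivative\<close>, which is a choice; any
  explicit derivative agrees with it by uniqueness. The product, chain and inverse rules enter the
  induction on \<open>k\<close> through this lemma.\<close>

lemma Ck_on_SucI:
  assumes "open S" "\<And>x. x \<in> S \<Longrightarrow> (f has_derivative F x) (at x)" "\<And>v. Ck_on k (\<lambda>x. F x v) S"
  shows "Ck_on (Suc k) f S"
proof -
  have "frechet_derivative f (at x) = F x" if "x \<in> S" for x
    using assms(2)[OF that] frechet_derivative_at by metis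
  moreover have "f differentiable (at x)" if "x \<in> S" for x
    using assms(2)[OF that] differentiableI by blast
  ultimately show ?thesis
    using Ck_on_cong[OF assms(1) _ assms(3)] by simp
qed

lemma Ck_on_SucD:
  assumes "Ck_on (Suc k) f S"
  shows "x \<in> S \<Longrightarrow> (f has_derivative frechet_derivative f (at x)) (at x)"
    and "Ck_on k (\<lambda>x. frechet_derivative f (at x) v) S"
  using assms frechet_derivative_works by auto

lemma Ck_on_const: "open S \<Longrightarrow> Ck_on k (\<lambda>_. c) S"
proof (induction k arbitrary: c)
  case (Suc k)
  then show ?case by (intro Ck_on_SucI[where F="\<lambda>_ _. 0"]) auto
qed simp

lemma Ck_on_bounded_linear:
  assumes "open S" "bounded_linear L" "Ck_on k f S"
  shows "Ck_on k (\<lambda>x. L (f x)) S"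
  using assms(3)
proof (induction k arbitrary: f)
  case 0
  then show ?case
    using bounded_linear.continuous_on[OF assms(2)] by auto
next
  case (Suc k)
  note D = Ck_on_SucD[OF Suc.prems]
  show ?case
    by (rule Ck_on_SucI[OF assms(1) bounded_linear.has_derivative[OF assms(2) D(1)] Suc.IH[OF D(2)]])
qed

lemma Ck_on_linear:
  assumes "open S" "bounded_linear L"
  shows "Ck_on k L S"
proof (cases k)
  case 0
  then show ?thesis by (simp add: assms linear_continuous_on)
next
  case (Suc j)
  show ?thesis unfolding Suc
    by (rule Ck_on_SucI[OF assms(1) bounded_linear_imp_has_derivative[OF assms(2)] Ck_on_const[OF assms(1)]])
qed

lemma Ck_on_add:
  assumes "open S" "Ck_on k f S" "Ck_on k g S"
  shows "Ck_on k (\<lambda>x. f x + g x) S"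
  using assms(2,3)
proof (induction k arbitrary: f g)
  case 0
  then show ?case by (auto intro: continuous_intros)
next
  case (Suc k)
  note D = Ck_on_SucD[OF Suc.prems(1)] and E = Ck_on_SucD[OF Suc.prems(2)]
  show ?case
    by (rule Ck_on_SucI[OF assms(1) has_derivative_add[OF D(1) E(1)] Suc.IH[OF D(2) E(2)]])
qed

lemma Ck_on_sum:
  assumes "open S" "\<And>i. i \<in> I \<Longrightarrow> Ck_on k (f i) S"
  shows "Ck_on k (\<lambda>x. \<Sum>i\<in>I. f i x) S"
  using assms(2)
  by (induction I rule: infinite_finite_induct) (simp_all add: Ck_on_const Ck_on_add assms(1))

lemma Ck_on_bilinear:
  assumes "bounded_bilinear h" "open S" "Ck_on k f S" "Ck_on k g S"
  shows "Ck_on k (\<lambda>x. h (f x) (g x)) S"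
  using assms(3,4)
proof (induction k arbitrary: f g)
  case 0
  then show ?case using bounded_bilinear.continuous_on[OF assms(1)] by auto
next
  case (Suc k)
  show ?case
  proof (rule Ck_on_SucI[OF assms(2)])
    show "((\<lambda>x. h (f x) (g x)) has_derivative
      (\<lambda>v. h (f x) (frechet_derivative g (at x) v) + h (frechet_derivative f (at x) v) (g x))) (at x)"
      if "x \<in> S" for x
      using bounded_bilinear.FDERIV[OF assms(1) Ck_on_SucD(1)[OF Suc.prems(1) that]
        Ck_on_SucD(1)[OF Suc.prems(2) that]] .
    show "Ck_on k (\<lambda>x. h (f x) (frechet_derivative g (at x) v) + h (frechet_derivative f (at x) v) (g x)) S" for v
      by (intro Ck_on_add assms Suc.IH Ck_on_SucD[OF Suc.prems(1)] Ck_on_SucD[OF Suc.prems(2)]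
          Ck_on_Suc_imp[OF Suc.prems(1)] Ck_on_Suc_imp[OF Suc.prems(2)])
  qed
qed

section \<open>Families of linear operators depending on a parameter\<close>

lemma linear_basis_expand:
  fixes L :: "'e::euclidean_space \<Rightarrow> 'f::real_vector"
  assumes "linear L"
  shows "L v = (\<Sum>b\<in>Basis. (v \<bullet> b) *\<^sub>R L b)"
proof -
  have "L v = L (\<Sum>b\<in>Basis. (v \<bullet> b) *\<^sub>R b)" by (simp add: euclidean_representation)
  also have "\<dots> = (\<Sum>b\<in>Basis. (v \<bullet> b) *\<^sub>R L b)"
    using assms by (simp add: linear_sum linear_scale)
  finally show ?thesis .
qed

text \<open>An operator family is controlled through its values on fixed vectors, without a norm on
  operators. Expanding the moving argument in \<open>Basis\<close> reduces the claim to products of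
  scalar and vector functions.\<close>

lemma Ck_on_linear_apply:
  fixes L :: "'d::euclidean_space \<Rightarrow> 'e::euclidean_space \<Rightarrow> 'f::real_normed_vector"
  assumes "open S" "\<And>x. x \<in> S \<Longrightarrow> linear (L x)" "\<And>v. Ck_on k (\<lambda>x. L x v) S" "Ck_on k h S"
  shows "Ck_on k (\<lambda>x. L x (h x)) S"
proof (rule Ck_on_cong[OF assms(1)])
  show "Ck_on k (\<lambda>x. \<Sum>b\<in>Basis. (h x \<bullet> b) *\<^sub>R L x b) S"
    by (intro Ck_on_sum assms Ck_on_bilinear[OF bounded_bilinear_scaleR]
        Ck_on_bounded_linear[OF _ bounded_linear_inner_left])
  show "(\<Sum>b\<in>Basis. (h x \<bullet> b) *\<^sub>R L x b) = L x (h x)" if "x \<in> S" for x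
    using linear_basis_expand[OF assms(2)[OF that]] by metis
qed

lemma Ck_on_compose:
  fixes f :: "'e::euclidean_space \<Rightarrow> 'f::real_normed_vector" and g :: "'d::euclidean_space \<Rightarrow> 'e"
  assumes "open S" "open T" "g ` S \<subseteq> T" "Ck_on k f T" "Ck_on k g S"
  shows "Ck_on k (\<lambda>x. f (g x)) S"
  using assms(4,5)
proof (induction k arbitrary: f)
  case 0
  then show ?case using assms(3) continuous_on_compose2 by auto
next
  case (Suc k)
  have gx: "g x \<in> T" if "x \<in> S" for x using that assms(3) by auto
  show ?case
  proof (rule Ck_on_SucI[OF assms(1)])
    show "((\<lambda>x. f (g x)) has_derivative
        (\<lambda>v. frechet_derivative f (at (g x)) (frechet_derivative g (at x) v))) (at x)" if "x \<in> S" for x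
      using has_derivative_compose[OF Ck_on_SucD(1)[OF Suc.prems(2) that]
        Ck_on_SucD(1)[OF Suc.prems(1) gx[OF that]]] .
    show "Ck_on k (\<lambda>x. frechet_derivative f (at (g x)) (frechet_derivative g (at x) v)) S" for v
    proof (rule Ck_on_linear_apply[OF assms(1)])
      show "linear (frechet_derivative f (at (g x)))" if "x \<in> S" for x
        using Ck_on_SucD(1)[OF Suc.prems(1) gx[OF that]] has_derivative_linear by blast
      show "Ck_on k (\<lambda>x. frechet_derivative f (at (g x)) w) S" for w
        by (rule Suc.IH[OF Ck_on_SucD(2)[OF Suc.prems(1)] Ck_on_Suc_imp[OF Suc.prems(2)]])
      show "Ck_on k (\<lambda>x. frechet_derivative g (at x) v) S"
        by (rule Ck_on_SucD(2)[OF Suc.prems(2)])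
    qed
  qed
qed

text \<open>Injectivity is an open condition: a lower bound at \<open>x0\<close> survives with half
  the constant where the operator has moved little on the basis. Its uniformity on \<open>T\<close>
  is what bounds all the inverses there at once.\<close>

lemma linear_lower_bound_nearby:
  fixes B :: "'d::euclidean_space \<Rightarrow> 'e::euclidean_space \<Rightarrow> 'e"
  assumes "open S" "x0 \<in> S" "\<And>x. x \<in> S \<Longrightarrow> linear (B x)" "inj (B x0)"
    "\<And>v. continuous_on S (\<lambda>x. B x v)"
  obtains m T where "m > 0" "open T" "x0 \<in> T" "T \<subseteq> S" "\<And>x v. x \<in> T \<Longrightarrow> norm v * m \<le> norm (B x v)"
proof -
  obtain m where m: "m > 0" "\<And>v. norm v * m \<le> norm (B x0 v)"
    using linear_inj_bounded_below_pos[OF assms(3)[OF assms(2)] assms(4)] by (metis mult.commute)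
  define e where "e x = (\<Sum>b\<in>Basis. norm (B x b - B x0 b))" for x
  have "continuous_on S e" unfolding e_def
    by (intro continuous_intros assms(5))
  then have "isCont e x0" using assms(1,2) continuous_on_eq_continuous_at by blast
  moreover have "e x0 = 0" by (simp add: e_def)
  ultimately have "\<forall>\<^sub>F x in nhds x0. e x < m/2"
    using m(1) by (metis half_gt_zero isCont_def order_tendstoD(2) tendsto_at_iff_tendsto_nhds)
  then obtain T where T: "open T" "x0 \<in> T" "\<And>x. x \<in> T \<Longrightarrow> e x < m/2"
    by (auto simp: eventually_nhds)
  have "norm v * (m/2) \<le> norm (B x v)" if "x \<in> T \<inter> S" for x v
  proof -
    have lin: "linear (\<lambda>v. B x v - B x0 v)"
      using assms(2,3) that by (simp add: linear_compose_sub)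
    have "norm (B x v - B x0 v) = norm (\<Sum>b\<in>Basis. (v \<bullet> b) *\<^sub>R (B x b - B x0 b))"
      using linear_basis_expand[OF lin, of v] by metis
    also have "\<dots> \<le> (\<Sum>b\<in>Basis. norm ((v \<bullet> b) *\<^sub>R (B x b - B x0 b)))"
      by (rule norm_sum)
    also have "\<dots> \<le> (\<Sum>b\<in>Basis. norm v * norm (B x b - B x0 b))"
      by (intro sum_mono) (simp add: Basis_le_norm mult_right_mono)
    also have "\<dots> = norm v * e x" by (simp add: e_def sum_distrib_left)
    also have "\<dots> \<le> norm v * (m/2)"
      using T(3)[of x] that by (intro mult_left_mono) auto
    finally have "norm (B x v - B x0 v) \<le> norm v * (m/2)" .
    moreover have "norm (B x0 v) \<le> norm (B x v - B x0 v) + norm (B x v)"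
      by (metis norm_minus_commute norm_triangle_sub add.commute)
    ultimately show ?thesis using m(2)[of v] by simp
  qed
  then show ?thesis using that[of "m/2" "T \<inter> S"] m(1) T assms(1,2) by auto
qed

lemma has_derivative_inverse_operator:
  fixes B :: "'d::euclidean_space \<Rightarrow> 'e::euclidean_space \<Rightarrow> 'e"
  assumes "open S" "x0 \<in> S" "\<And>x. x \<in> S \<Longrightarrow> linear (B x)" "\<And>x. x \<in> S \<Longrightarrow> inj (B x)"
    "\<And>v. continuous_on S (\<lambda>x. B x v)"
  shows "isCont (\<lambda>x. inv (B x) v) x0"
    and "((\<lambda>x. B x (inv (B x0) v)) has_derivative D) (at x0) \<Longrightarrow>
      ((\<lambda>x. inv (B x) v) has_derivative (\<lambda>h. - inv (B x0) (D h))) (at x0)"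
proof -
  have surj: "surj (B x)" if "x \<in> S" for x
    using assms(3,4)[OF that] linear_injective_imp_surjective by blast
  have BI: "B x (inv (B x) v) = v" if "x \<in> S" for x v
    using surj[OF that] by (simp add: surj_f_inv_f)
  have IB: "inv (B x) (B x v) = v" if "x \<in> S" for x v
    using assms(4)[OF that] by simp
  have linI: "linear (inv (B x))" if "x \<in> S" for x
    by (metis BI IB assms(3) injI linear_injective_left_inverse o_apply that surj assms(4)
        inj_linear_imp_inv_linear)
  obtain m T where m: "m > 0" "open T" "x0 \<in> T" "T \<subseteq> S" "\<And>x v. x \<in> T \<Longrightarrow> norm v * m \<le> norm (B x v)"
    using linear_lower_bound_nearby[OF assms(1,2,3) assms(4)[OF assms(2)] assms(5)] by metis
  define w where "w = inv (B x0) v"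
  have cw: "isCont (\<lambda>x. B x u) x0" for u
    using assms(1,2,5) continuous_on_eq_continuous_at by blast
  have cont: "isCont (\<lambda>x. inv (B x) v) x0" for v
  proof -
    define w where "w = inv (B x0) v"
    have "norm (inv (B x) v - w) \<le> norm (B x w - B x0 w) / m" if "x \<in> T" for x
    proof -
      have xS: "x \<in> S" using that m(4) by auto
      have "B x (inv (B x) v - w) = B x0 w - B x w"
        using BI[OF xS] BI[OF assms(2)] assms(3)[OF xS] by (simp add: linear_diff w_def)
      then have "norm (inv (B x) v - w) * m \<le> norm (B x w - B x0 w)"
        using m(5)[OF that, of "inv (B x) v - w"] by (simp only: norm_minus_commute)
      then show ?thesis using m(1) by (simp add: pos_le_divide_eq)
    qed
    then have ev: "\<forall>\<^sub>F x in at x0. norm (inv (B x) v - w) \<le> norm (B x w - B x0 w) / m"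
      using m(2,3) eventually_at_topological by blast
    have "((\<lambda>x. norm (B x w - B x0 w) / m) \<longlongrightarrow> norm (B x0 w - B x0 w) / m) (at x0)"
      using m(1) cw[of w] by (intro tendsto_intros) (auto simp: isCont_def)
    then have "((\<lambda>x. inv (B x) v - w) \<longlongrightarrow> 0) (at x0)"
      using Lim_null_comparison[OF ev] by simp
    then show ?thesis unfolding isCont_def w_def using LIM_zero_iff by blast
  qed
  then show "isCont (\<lambda>x. inv (B x) v) x0" .
  show "((\<lambda>x. inv (B x) v) has_derivative (\<lambda>h. - inv (B x0) (D h))) (at x0)"
    if D: "((\<lambda>x. B x (inv (B x0) v)) has_derivative D) (at x0)"
  proof -
    have D': "((\<lambda>x. B x w) has_derivative D) (at x0)" using D by (simp add: w_def)
    have blI: "bounded_linear (inv (B x0))"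
      using linI[OF assms(2)] linear_conv_bounded_linear by blast
    define R where "R y = (B y w - B x0 w - D (y - x0)) /\<^sub>R norm (y - x0)" for y
    have R: "(R \<longlongrightarrow> 0) (at x0)"
      using D' unfolding has_derivative_def R_def by simp
    obtain K where K: "K \<ge> 0" "\<And>h. norm (D h) \<le> norm h * K"
      using has_derivative_bounded_linear[OF D'] bounded_linear.nonneg_bounded by blast
    define E where "E y = (inv (B y) v - inv (B x0) v - (- inv (B x0) (D (y - x0)))) /\<^sub>R norm (y - x0)" for y
    define u where "u y = (D (y - x0)) /\<^sub>R norm (y - x0)" for y
    \<comment> \<open>\<open>B(y)\<^sup>-\<^sup>1 v - B(x\<^sub>0)\<^sup>-\<^sup>1 v = B(y)\<^sup>-\<^sup>1 (v - B(y) w)\<close>, so the remainder is controlled by the one of \<open>B\<close>.\<close>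
    have id: "E y = - inv (B y) (R y) - (inv (B y) (u y) - inv (B x0) (u y))" if "y \<in> S" for y
    proof -
      have l: "inv (B y) v = w + inv (B y) (v - B y w)"
        using linI[OF that] IB[OF that] by (simp add: linear_diff)
      have "v = B x0 w" using BI[OF assms(2)] w_def by simp
      then have vb: "v - B y w = - norm (y - x0) *\<^sub>R R y - D (y - x0)"
        by (cases "y = x0") (auto simp: R_def linear_simps(3)[OF has_derivative_bounded_linear[OF D']])
      show ?thesis
      proof (cases "y = x0")
        case True
        then show ?thesis
          by (simp add: E_def R_def u_def linear_0[OF linI[OF assms(2)]])
      next
        case False
        have e: "inv (B y) v - inv (B x0) v = - norm (y - x0) *\<^sub>R inv (B y) (R y) - inv (B y) (D (y - x0))"
          using l unfolding vb w_def[symmetric]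
          by (simp add: linear_diff[OF linI[OF that]] linear_scale[OF linI[OF that]] linear_neg[OF linI[OF that]])
        show ?thesis
          unfolding E_def e using False linI[OF that] linI[OF assms(2)]
          by (simp add: u_def linear_scale scaleR_right_diff_distrib scaleR_add_right scaleR_minus_right)
      qed
    qed
    have Ilow: "norm (inv (B y) z) \<le> norm z / m" if "y \<in> T" for y z
      using m(5)[OF that, of "inv (B y) z"] BI[of y z] m(1,4) that by (auto simp: field_simps)
    have t1: "((\<lambda>y. inv (B y) (R y)) \<longlongrightarrow> 0) (at x0)"
    proof (rule Lim_null_comparison)
      show "\<forall>\<^sub>F y in at x0. norm (inv (B y) (R y)) \<le> norm (R y) / m"
        using m(2,3) eventually_at_topological Ilow by blast
      show "((\<lambda>y. norm (R y) / m) \<longlongrightarrow> 0) (at x0)"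
        using tendsto_divide[OF tendsto_norm[OF R] tendsto_const[of m]] m(1) by simp
    qed
    have un: "norm (u y) \<le> K" for y
      using K(1) K(2)[of "y - x0"]
      by (cases "y = x0") (auto simp: u_def field_simps linear_simps(3)[OF has_derivative_bounded_linear[OF D']])
    \<comment> \<open>\<open>u y\<close> is bounded but need not converge as \<open>y\<close> tends
      to \<open>x0\<close>. Expanding in \<open>Basis\<close> turns pointwise convergence of the
      inverses into uniform convergence on bounded sets.\<close>
    have t2: "((\<lambda>y. inv (B y) (u y) - inv (B x0) (u y)) \<longlongrightarrow> 0) (at x0)"
    proof (rule Lim_null_comparison)
      have "norm (inv (B y) (u y) - inv (B x0) (u y)) \<le> (\<Sum>b\<in>Basis. K * norm (inv (B y) b - inv (B x0) b))"
        if "y \<in> S" for y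
      proof -
        have lin: "linear (\<lambda>v. inv (B y) v - inv (B x0) v)"
          using linI[OF that] linI[OF assms(2)] by (simp add: linear_compose_sub)
        have "norm (inv (B y) (u y) - inv (B x0) (u y))
            = norm (\<Sum>b\<in>Basis. (u y \<bullet> b) *\<^sub>R (inv (B y) b - inv (B x0) b))"
          using linear_basis_expand[OF lin, of "u y"] by metis
        also have "\<dots> \<le> (\<Sum>b\<in>Basis. norm ((u y \<bullet> b) *\<^sub>R (inv (B y) b - inv (B x0) b)))"
          by (rule norm_sum)
        also have "\<dots> \<le> (\<Sum>b\<in>Basis. K * norm (inv (B y) b - inv (B x0) b))"
        proof (rule sum_mono)
          fix b :: 'e assume "b \<in> Basis"
          then have "\<bar>u y \<bullet> b\<bar> \<le> K" using un[of y] Basis_le_norm order_trans by blast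
          then show "norm ((u y \<bullet> b) *\<^sub>R (inv (B y) b - inv (B x0) b)) \<le> K * norm (inv (B y) b - inv (B x0) b)"
            by (simp add: mult_right_mono)
        qed
        finally show ?thesis .
      qed
      then show "\<forall>\<^sub>F y in at x0. norm (inv (B y) (u y) - inv (B x0) (u y))
          \<le> (\<Sum>b\<in>Basis. K * norm (inv (B y) b - inv (B x0) b))"
        using assms(1,2) eventually_at_topological by blast
      have "((\<lambda>y. \<Sum>b\<in>Basis. K * norm (inv (B y) b - inv (B x0) b))
          \<longlongrightarrow> (\<Sum>b\<in>Basis. K * norm (inv (B x0) b - inv (B x0) b))) (at x0)"
        using cont by (intro tendsto_intros) (auto simp: isCont_def)
      then show "((\<lambda>y. \<Sum>b\<in>Basis. K * norm (inv (B y) b - inv (B x0) b)) \<longlongrightarrow> 0) (at x0)"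
        by simp
    qed
    have "((\<lambda>y. - inv (B y) (R y) - (inv (B y) (u y) - inv (B x0) (u y))) \<longlongrightarrow> 0) (at x0)"
      using tendsto_diff[OF tendsto_minus[OF t1] t2] by simp
    then have "(E \<longlongrightarrow> 0) (at x0)"
      by (rule Lim_transform_within_open[OF _ assms(1,2)]) (simp add: id)
    then show ?thesis
      unfolding has_derivative_def E_def
      using bounded_linear_minus[OF bounded_linear_compose[OF blI has_derivative_bounded_linear[OF D']]]
      by simp
  qed
qed

text \<open>The derivative of the inverse is minus the inverse, after the derivative of
  \<open>B\<close>, after the inverse. It contains one derivative of \<open>B\<close> and otherwise
  the inverse itself, so each order of regularity of the inverse yields the next.\<close>

lemma Ck_on_inverse_operator:
  fixes B :: "'d::euclidean_space \<Rightarrow> 'e::euclidean_space \<Rightarrow> 'e"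
  assumes "open S" "\<And>x. x \<in> S \<Longrightarrow> linear (B x)" "\<And>x. x \<in> S \<Longrightarrow> inj (B x)" "\<And>v. Ck_on k (\<lambda>x. B x v) S"
  shows "Ck_on k (\<lambda>x. inv (B x) v) S"
  using assms(4)
proof (induction k arbitrary: v)
  case 0
  then show ?case
    using has_derivative_inverse_operator(1)[OF assms(1) _ assms(2,3)] 
    by (auto simp: continuous_on_eq_continuous_at[OF assms(1)])
next
  case (Suc k)
  have cont: "continuous_on S (\<lambda>x. B x w)" for w using Ck_on_imp_continuous[OF Suc.prems] .
  have IH: "Ck_on k (\<lambda>x. inv (B x) w) S" for w
    using Suc.IH Ck_on_Suc_imp[OF Suc.prems] by blast
  have linI: "linear (inv (B x))" if "x \<in> S" for x
    using assms(2,3)[OF that] linear_injective_imp_surjective inj_linear_imp_inv_linear by blast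
  \<comment> \<open>The derivative was taken for each \<open>w\<close> separately. Its linearity in
    \<open>w\<close>, recovered here from uniqueness of derivatives, is required before
    \<open>w\<close> can be replaced by a moving vector.\<close>
  have linD: "linear (\<lambda>w. frechet_derivative (\<lambda>x. B x w) (at x) u)" if "x \<in> S" for x u
  proof (rule linearI)
    note D = Ck_on_SucD(1)[OF Suc.prems that]
    show "frechet_derivative (\<lambda>x. B x (a + b)) (at x) u
      = frechet_derivative (\<lambda>x. B x a) (at x) u + frechet_derivative (\<lambda>x. B x b) (at x) u" for a b
    proof -
      have "((\<lambda>x. B x (a + b)) has_derivative
        (\<lambda>u. frechet_derivative (\<lambda>x. B x a) (at x) u + frechet_derivative (\<lambda>x. B x b) (at x) u)) (at x)"
        by (rule has_derivative_transform_within_open[OF has_derivative_add[OF D D] assms(1) that])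
           (simp add: assms(2) linear_add)
      from frechet_derivative_at[OF this] show ?thesis by metis
    qed
    show "frechet_derivative (\<lambda>x. B x (r *\<^sub>R b)) (at x) u
      = r *\<^sub>R frechet_derivative (\<lambda>x. B x b) (at x) u" for r b
    proof -
      have "((\<lambda>x. B x (r *\<^sub>R b)) has_derivative
        (\<lambda>u. r *\<^sub>R frechet_derivative (\<lambda>x. B x b) (at x) u)) (at x)"
        by (rule has_derivative_transform_within_open[OF has_derivative_scaleR_right[OF D] assms(1) that])
           (simp add: assms(2) linear_scale)
      from frechet_derivative_at[OF this] show ?thesis by metis
    qed
  qed
  show ?case
  proof (rule Ck_on_SucI[OF assms(1)])
    show "((\<lambda>x. inv (B x) v) has_derivative
        (\<lambda>u. - inv (B x) (frechet_derivative (\<lambda>y. B y (inv (B x) v)) (at x) u))) (at x)" if "x \<in> S" for x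
      by (rule has_derivative_inverse_operator(2)[OF assms(1) that assms(2,3) cont])
         (use Ck_on_SucD(1)[OF Suc.prems that] in auto)
    show "Ck_on k (\<lambda>x. - inv (B x) (frechet_derivative (\<lambda>y. B y (inv (B x) v)) (at x) u)) S" for u
      by (intro Ck_on_bounded_linear[OF assms(1) bounded_linear_minus[OF bounded_linear_ident]]
          Ck_on_linear_apply[OF assms(1) linI IH] 
          Ck_on_linear_apply[OF assms(1) linD _ IH] Ck_on_SucD(2)[OF Suc.prems])
  qed
qed

section \<open>Closure properties of smooth functions\<close>

lemma smooth_onD: "smooth_on f S \<Longrightarrow> x \<in> S \<Longrightarrow> (f has_derivative frechet_derivative f (at x)) (at x)"
  unfolding smooth_on_def by (metis Ck_on_SucD(1))

lemma smooth_on_frechet_derivative: "smooth_on f S \<Longrightarrow> smooth_on (\<lambda>x. frechet_derivative f (at x) v) S"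
  unfolding smooth_on_def by (metis Ck_on.simps(2))

lemma linear_frechet_derivative:
  assumes "smooth_on f S" "x \<in> S"
  shows "linear (frechet_derivative f (at x))"
  using has_derivative_linear[OF smooth_onD[OF assms]] .

lemma smooth_on_subset: "smooth_on f S \<Longrightarrow> T \<subseteq> S \<Longrightarrow> smooth_on f T"
  unfolding smooth_on_def by (metis Ck_on_subset)

lemma smooth_on_imp_continuous: "smooth_on f S \<Longrightarrow> continuous_on S f"
  unfolding smooth_on_def by (metis Ck_on_imp_continuous)

lemma smooth_on_cong: "open S \<Longrightarrow> (\<And>x. x \<in> S \<Longrightarrow> f x = g x) \<Longrightarrow> smooth_on f S \<Longrightarrow> smooth_on g S"
  unfolding smooth_on_def by (intro allI Ck_on_cong[of S f g]) auto

lemma smooth_on_local: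
  assumes "open S" "\<And>x. x \<in> S \<Longrightarrow> \<exists>T. open T \<and> x \<in> T \<and> smooth_on f T"
  shows "smooth_on f S"
  unfolding smooth_on_def
proof
  fix k
  show "Ck_on k f S"
  proof (rule Ck_on_local[OF _ assms(1)])
    fix x assume "x \<in> S"
    then obtain T where "open T" "x \<in> T" "smooth_on f T" using assms(2) by blast
    then show "\<exists>T. open T \<and> x \<in> T \<and> Ck_on k f (T \<inter> S)"
      using Ck_on_subset[of k f T "T \<inter> S"] by (auto simp: smooth_on_def)
  qed
qed

lemma smooth_on_const: "open S \<Longrightarrow> smooth_on (\<lambda>_. c) S"
  by (simp add: smooth_on_def Ck_on_const)

lemma smooth_on_bounded_linear:
  "open S \<Longrightarrow> bounded_linear L \<Longrightarrow> smooth_on f S \<Longrightarrow> smooth_on (\<lambda>x. L (f x)) S"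
  by (simp add: smooth_on_def Ck_on_bounded_linear)

lemma smooth_on_linear: "open S \<Longrightarrow> bounded_linear L \<Longrightarrow> smooth_on L S"
  by (simp add: smooth_on_def Ck_on_linear)

lemma smooth_on_ident: "open S \<Longrightarrow> smooth_on (\<lambda>x. x) S"
  by (rule smooth_on_linear[OF _ bounded_linear_ident])

lemma smooth_on_add: "open S \<Longrightarrow> smooth_on f S \<Longrightarrow> smooth_on g S \<Longrightarrow> smooth_on (\<lambda>x. f x + g x) S"
  by (simp add: smooth_on_def Ck_on_add)

lemma smooth_on_minus: "open S \<Longrightarrow> smooth_on f S \<Longrightarrow> smooth_on (\<lambda>x. - f x) S"
  by (rule smooth_on_bounded_linear[OF _ bounded_linear_minus[OF bounded_linear_ident]])

lemma smooth_on_diff: "open S \<Longrightarrow> smooth_on f S \<Longrightarrow> smooth_on g S \<Longrightarrow> smooth_on (\<lambda>x. f x - g x) S"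
  using smooth_on_add[of S f "\<lambda>x. - g x"] smooth_on_minus by auto

lemma smooth_on_sum:
  "open S \<Longrightarrow> (\<And>i. i \<in> I \<Longrightarrow> smooth_on (f i) S) \<Longrightarrow> smooth_on (\<lambda>x. \<Sum>i\<in>I. f i x) S"
  by (simp add: smooth_on_def Ck_on_sum)

lemma smooth_on_bilinear:
  "bounded_bilinear h \<Longrightarrow> open S \<Longrightarrow> smooth_on f S \<Longrightarrow> smooth_on g S \<Longrightarrow> smooth_on (\<lambda>x. h (f x) (g x)) S"
  by (simp add: smooth_on_def Ck_on_bilinear)

lemmas smooth_on_scaleR = smooth_on_bilinear[OF bounded_bilinear_scaleR]
lemmas smooth_on_mult = smooth_on_bilinear[OF bounded_bilinear_mult]

lemma smooth_on_linear_apply: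
  fixes L :: "'d::euclidean_space \<Rightarrow> 'e::euclidean_space \<Rightarrow> 'f::real_normed_vector"
  assumes "open S" "\<And>x. x \<in> S \<Longrightarrow> linear (L x)" "\<And>v. smooth_on (\<lambda>x. L x v) S" "smooth_on h S"
  shows "smooth_on (\<lambda>x. L x (h x)) S"
  unfolding smooth_on_def
  by (rule allI, rule Ck_on_linear_apply[OF assms(1,2)]) (use assms(3,4) in \<open>simp_all add: smooth_on_def\<close>)

lemma smooth_on_compose:
  fixes f :: "'e::euclidean_space \<Rightarrow> 'f::real_normed_vector" and g :: "'d::euclidean_space \<Rightarrow> 'e"
  shows "open S \<Longrightarrow> open T \<Longrightarrow> g ` S \<subseteq> T \<Longrightarrow> smooth_on f T \<Longrightarrow> smooth_on g S \<Longrightarrow> smooth_on (\<lambda>x. f (g x)) S"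
  by (simp add: smooth_on_def Ck_on_compose)

lemma smooth_on_inverse_operator:
  fixes B :: "'d::euclidean_space \<Rightarrow> 'e::euclidean_space \<Rightarrow> 'e"
  assumes "open S" "\<And>x. x \<in> S \<Longrightarrow> linear (B x)" "\<And>x. x \<in> S \<Longrightarrow> inj (B x)" "\<And>v. smooth_on (\<lambda>x. B x v) S"
  shows "smooth_on (\<lambda>x. inv (B x) v) S"
  unfolding smooth_on_def
  by (rule allI, rule Ck_on_inverse_operator[OF assms(1-3)]) (use assms(4) in \<open>simp_all add: smooth_on_def\<close>)

lemma smooth_on_frechet_apply:
  fixes f :: "'e::euclidean_space \<Rightarrow> 'f::real_normed_vector" and g :: "'d::euclidean_space \<Rightarrow> 'e"
  assumes "open S" "open T" "g ` S \<subseteq> T" "smooth_on f T" "smooth_on g S" "smooth_on h S"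
  shows "smooth_on (\<lambda>x. frechet_derivative f (at (g x)) (h x)) S"
proof (rule smooth_on_linear_apply[OF assms(1) _ _ assms(6)])
  show "linear (frechet_derivative f (at (g x)))" if "x \<in> S" for x
    using linear_frechet_derivative[OF assms(4)] assms(3) that by blast
  show "smooth_on (\<lambda>x. frechet_derivative f (at (g x)) v) S" for v
    using smooth_on_compose[OF assms(1-3) smooth_on_frechet_derivative[OF assms(4)] assms(5)] .
qed

section \<open>Symmetry of second derivatives\<close>

lemma second_difference_mvt:
  fixes f :: "'e::euclidean_space \<Rightarrow> real"
  assumes f: "smooth_on f S" and "h > 0"
    and S: "\<And>s t. 0 \<le> s \<Longrightarrow> s \<le> h \<Longrightarrow> 0 \<le> t \<Longrightarrow> t \<le> h \<Longrightarrow> x + s *\<^sub>R v + t *\<^sub>R w \<in> S"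
  shows "\<exists>s t. 0 \<le> s \<and> s \<le> h \<and> 0 \<le> t \<and> t \<le> h \<and>
    f (x + h *\<^sub>R v + h *\<^sub>R w) - f (x + h *\<^sub>R v) - f (x + h *\<^sub>R w) + f x =
     h * h * frechet_derivative (\<lambda>y. frechet_derivative f (at y) v) (at (x + s *\<^sub>R v + t *\<^sub>R w)) w"
proof -
  \<comment> \<open>\<open>p h - p 0\<close> is the second difference of \<open>f\<close>. The mean
    value theorem in \<open>s\<close> leaves a first difference of the \<open>v\<close>-derivative,
    to which the mean value theorem in \<open>t\<close> applies.\<close>
  define p where "p s = f (x + s *\<^sub>R v + h *\<^sub>R w) - f (x + s *\<^sub>R v + 0 *\<^sub>R w)" for s
  have dp: "((\<lambda>s. f (x + s *\<^sub>R v + t *\<^sub>R w)) has_real_derivative frechet_derivative f (at (x + s *\<^sub>R v + t *\<^sub>R w)) v) (at s)"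
    if "0 \<le> s" "s \<le> h" "0 \<le> t" "t \<le> h" for s t
  proof -
    have "((\<lambda>s. x + s *\<^sub>R v + t *\<^sub>R w) has_derivative (\<lambda>r. r *\<^sub>R v)) (at s)"
      by (auto intro!: derivative_eq_intros)
    from has_derivative_compose[OF this smooth_onD[OF f S[OF that]]]
    show ?thesis using linear_scale[OF linear_frechet_derivative[OF f S[OF that]]]
      by (simp add: has_field_derivative_def mult.commute[of _ "frechet_derivative _ _ _"])
  qed
  have "\<exists>s. 0 < s \<and> s < h \<and> p h - p 0 = (h - 0) * (frechet_derivative f (at (x + s *\<^sub>R v + h *\<^sub>R w)) v - frechet_derivative f (at (x + s *\<^sub>R v + 0 *\<^sub>R w)) v)"
    unfolding p_def using assms(2) by (intro MVT2 DERIV_diff dp) auto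
  then obtain s where s: "0 < s" "s < h"
    "p h - p 0 = h * (frechet_derivative f (at (x + s *\<^sub>R v + h *\<^sub>R w)) v - frechet_derivative f (at (x + s *\<^sub>R v + 0 *\<^sub>R w)) v)"
    by auto
  define q where "q y = frechet_derivative f (at y) v" for y
  have q: "smooth_on q S" unfolding q_def using smooth_on_frechet_derivative[OF f] .
  have dq: "((\<lambda>t. q (x + s *\<^sub>R v + t *\<^sub>R w)) has_real_derivative frechet_derivative q (at (x + s *\<^sub>R v + t *\<^sub>R w)) w) (at t)"
    if "0 \<le> t" "t \<le> h" for t
  proof -
    have "((\<lambda>t. x + s *\<^sub>R v + t *\<^sub>R w) has_derivative (\<lambda>r. r *\<^sub>R w)) (at t)"
      by (auto intro!: derivative_eq_intros)
    from has_derivative_compose[OF this smooth_onD[OF q S]]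
    show ?thesis using linear_scale[OF linear_frechet_derivative[OF q S]] s that
      by (simp add: has_field_derivative_def mult.commute[of _ "frechet_derivative _ _ _"])
  qed
  have "\<exists>t. 0 < t \<and> t < h \<and> q (x + s *\<^sub>R v + h *\<^sub>R w) - q (x + s *\<^sub>R v + 0 *\<^sub>R w) = (h - 0) * frechet_derivative q (at (x + s *\<^sub>R v + t *\<^sub>R w)) w"
    using assms(2) by (intro MVT2[of 0 h "\<lambda>t. q (x + s *\<^sub>R v + t *\<^sub>R w)"] dq) auto
  then obtain t where t: "0 < t" "t < h" "q (x + s *\<^sub>R v + h *\<^sub>R w) - q (x + s *\<^sub>R v + 0 *\<^sub>R w) = h * frechet_derivative q (at (x + s *\<^sub>R v + t *\<^sub>R w)) w"
    by auto
  have "p h - p 0 = h * (h * frechet_derivative q (at (x + s *\<^sub>R v + t *\<^sub>R w)) w)"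
    using s(3) t(3) by (simp add: q_def)
  then show ?thesis using s(1,2) t(1,2)
    by (intro exI[of _ s] exI[of _ t]) (simp add: p_def q_def[abs_def] algebra_simps)
qed

text \<open>The second difference is symmetric in \<open>v\<close> and \<open>w\<close>. Divided by
  \<open>h * h\<close> it is a value of either mixed derivative at a point near \<open>x\<close>, so
  by continuity the two cannot differ at \<open>x\<close>.\<close>

lemma symmetric_second_derivative_real:
  fixes f :: "'e::euclidean_space \<Rightarrow> real"
  assumes f: "smooth_on f S" and S: "open S" "x \<in> S"
  shows "frechet_derivative (\<lambda>y. frechet_derivative f (at y) v) (at x) w =
    frechet_derivative (\<lambda>y. frechet_derivative f (at y) w) (at x) v"
proof (rule ccontr)
  define F where "F v w y = frechet_derivative (\<lambda>y. frechet_derivative f (at y) v) (at y) w" for v w y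
  assume "\<not> ?thesis"
  then have ne: "F v w x \<noteq> F w v x" by (simp add: F_def)
  define e where "e = \<bar>F v w x - F w v x\<bar> / 2"
  have e: "e > 0" using ne by (simp add: e_def)
  have cF: "isCont (F v w) x" for v w
  proof -
    have "continuous_on S (F v w)" unfolding F_def
      by (rule smooth_on_imp_continuous[OF smooth_on_frechet_derivative[OF smooth_on_frechet_derivative[OF f]]])
    then show ?thesis using S continuous_on_eq_continuous_at by blast
  qed
  have "\<forall>\<^sub>F y in nhds x. dist (F v w y) (F v w x) < e \<and> dist (F w v y) (F w v x) < e \<and> y \<in> S"
    using cF[of v w] cF[of w v] e S eventually_nhds_in_open[OF S]
    by (auto simp: isCont_def tendsto_at_iff_tendsto_nhds intro!: eventually_conj tendstoD)
  then obtain d where d: "d > 0" "\<And>y. dist y x < d \<Longrightarrow> dist (F v w y) (F v w x) < e \<and> dist (F w v y) (F w v x) < e \<and> y \<in> S"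
    by (auto simp: eventually_nhds_metric)
  \<comment> \<open>This keeps the parallelogram spanned by \<open>h\<close> times \<open>v\<close>
    and \<open>h\<close> times \<open>w\<close> within \<open>d / 2\<close> of \<open>x\<close>; the
    summand 1 covers the case that both vectors vanish.\<close>
  define c where "c = norm v + norm w + 1"
  define h where "h = (d / 2) / c"
  have n: "c > 0" unfolding c_def by (smt (verit) norm_ge_zero)
  then have h: "h > 0" using d by (simp add: h_def)
  have near: "dist (x + s *\<^sub>R v + t *\<^sub>R w) x < d" if "0 \<le> s" "s \<le> h" "0 \<le> t" "t \<le> h" for s t
  proof -
    have "norm (s *\<^sub>R v + t *\<^sub>R w) \<le> s * norm v + t * norm w"
      using norm_triangle_ineq[of "s *\<^sub>R v" "t *\<^sub>R w"] that by simp
    also have "\<dots> \<le> h * norm v + h * norm w" using that by (intro add_mono mult_right_mono) auto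
    also have "\<dots> \<le> h * c" using h by (simp add: c_def algebra_simps)
    also have "\<dots> = d / 2" using n by (simp add: h_def)
    also have "\<dots> < d" using d by simp
    finally show ?thesis by (simp add: dist_norm algebra_simps)
  qed
  have near': "dist (x + s *\<^sub>R w + t *\<^sub>R v) x < d" if "0 \<le> s" "s \<le> h" "0 \<le> t" "t \<le> h" for s t
    using near[of t s] that by (simp add: add.assoc add.commute add.left_commute)
  obtain s t where 1: "0 \<le> s" "s \<le> h" "0 \<le> t" "t \<le> h"
    "f (x + h *\<^sub>R v + h *\<^sub>R w) - f (x + h *\<^sub>R v) - f (x + h *\<^sub>R w) + f x = h * h * F v w (x + s *\<^sub>R v + t *\<^sub>R w)"
    using second_difference_mvt[OF f h, of x v w] near d(2) unfolding F_def by metis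
  obtain s' t' where 2: "0 \<le> s'" "s' \<le> h" "0 \<le> t'" "t' \<le> h"
    "f (x + h *\<^sub>R w + h *\<^sub>R v) - f (x + h *\<^sub>R w) - f (x + h *\<^sub>R v) + f x = h * h * F w v (x + s' *\<^sub>R w + t' *\<^sub>R v)"
    using second_difference_mvt[OF f h, of x w v] near' d(2) unfolding F_def by metis
  have "h * h * F v w (x + s *\<^sub>R v + t *\<^sub>R w) = h * h * F w v (x + s' *\<^sub>R w + t' *\<^sub>R v)"
    using 1(5) 2(5) unfolding add.assoc[of x] add.commute[of "h *\<^sub>R w"] by linarith
  then have eq: "F v w (x + s *\<^sub>R v + t *\<^sub>R w) = F w v (x + t' *\<^sub>R v + s' *\<^sub>R w)"
    using h by (simp add: add.assoc add.commute add.left_commute)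
  have "dist (F v w (x + s *\<^sub>R v + t *\<^sub>R w)) (F v w x) < e" "dist (F w v (x + t' *\<^sub>R v + s' *\<^sub>R w)) (F w v x) < e"
    using d(2) near 1 2 by blast+
  then show False unfolding eq e_def dist_real_def by (smt (verit) field_sum_of_halves)
qed

lemma frechet_derivative_bounded_linear:
  assumes "bounded_linear L" "f differentiable (at x)"
  shows "frechet_derivative (\<lambda>y. L (f y)) (at x) v = L (frechet_derivative f (at x) v)"
  using frechet_derivative_at[OF bounded_linear.has_derivative[OF assms(1)
      assms(2)[unfolded frechet_derivative_works]]] by metis

lemma symmetric_second_derivative:
  fixes f :: "'e::euclidean_space \<Rightarrow> 'f::euclidean_space"
  assumes f: "smooth_on f S" and S: "open S" "x \<in> S"
  shows "frechet_derivative (\<lambda>y. frechet_derivative f (at y) v) (at x) w =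
    frechet_derivative (\<lambda>y. frechet_derivative f (at y) w) (at x) v"
proof (rule euclidean_eqI)
  fix b :: 'f assume "b \<in> Basis"
  have fb: "smooth_on (\<lambda>x. f x \<bullet> b) S"
    by (rule smooth_on_bounded_linear[OF S(1) bounded_linear_inner_left f])
  have eq: "frechet_derivative (\<lambda>y. frechet_derivative f (at y) v) (at x) w \<bullet> b =
     frechet_derivative (\<lambda>y. frechet_derivative (\<lambda>x. f x \<bullet> b) (at y) v) (at x) w" for v w
  proof -
    have 1: "frechet_derivative (\<lambda>y. frechet_derivative f (at y) v \<bullet> b) (at x) w =
      frechet_derivative (\<lambda>y. frechet_derivative f (at y) v) (at x) w \<bullet> b"
      by (rule frechet_derivative_bounded_linear[OF bounded_linear_inner_left])
         (use smooth_onD[OF smooth_on_frechet_derivative[OF f] S(2)] differentiableI in blast)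
    have 2: "frechet_derivative (\<lambda>x. f x \<bullet> b) (at y) v = frechet_derivative f (at y) v \<bullet> b" if "y \<in> S" for y
      by (rule frechet_derivative_bounded_linear[OF bounded_linear_inner_left])
         (use smooth_onD[OF f that] differentiableI in blast)
    have "frechet_derivative (\<lambda>y. frechet_derivative (\<lambda>x. f x \<bullet> b) (at y) v) (at x)
        = frechet_derivative (\<lambda>y. frechet_derivative f (at y) v \<bullet> b) (at x)"
      by (rule frechet_derivative_transform_within_open[OF _ S])
         (use 2 smooth_onD[OF smooth_on_frechet_derivative[OF fb] S(2)] differentiableI in blast)+
    then show ?thesis using 1 by simp
  qed
  show "frechet_derivative (\<lambda>y. frechet_derivative f (at y) v) (at x) w \<bullet> b =
     frechet_derivative (\<lambda>y. frechet_derivative f (at y) w) (at x) v \<bullet> b"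
    unfolding eq using symmetric_second_derivative_real[OF fb S] .
qed

section \<open>Bump functions\<close>

definition flat_exp :: "nat \<Rightarrow> real \<Rightarrow> real" where
  "flat_exp n t = (if t > 0 then (1 / t) ^ n * exp (- (1 / t)) else 0)"

text \<open>With \<open>s = 1 / t\<close>, the single term of index \<open>n + 2\<close> in the
  series of \<open>exp s\<close> bounds \<open>s ^ (n + 2)\<close>. The two spare powers of
  \<open>s\<close> become the factor \<open>t\<^sup>2\<close>.\<close>

lemma flat_exp_bound: "\<bar>flat_exp n t\<bar> \<le> fact (n + 2) * t\<^sup>2"
proof (cases "t > 0")
  case True
  define s where "s = 1 / t"
  have s: "s > 0" using True by (simp add: s_def)
  have "s ^ (n + 2) /\<^sub>R fact (n + 2) \<le> exp s"
    using exp_converges[of s] s sums_unique[OF exp_converges[of s]]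
      sum_le_suminf[OF sums_summable[OF exp_converges[of s]], of "{n + 2}"] by simp
  then have "s ^ (n + 2) \<le> fact (n + 2) * exp s"
    by (simp add: field_simps del: fact_Suc)
  then have "s ^ (n + 2) * exp (- s) \<le> fact (n + 2)"
    by (simp add: exp_minus field_simps del: fact_Suc)
  moreover have "s ^ n * exp (- s) = s ^ (n + 2) * exp (- s) * t\<^sup>2"
    using True by (simp add: s_def power_add power2_eq_square)
  ultimately have "s ^ n * exp (- s) \<le> fact (n + 2) * t\<^sup>2"
    by (metis mult_right_mono zero_le_power2)
  then show ?thesis using True s by (simp add: flat_exp_def s_def)
qed (simp add: flat_exp_def)

text \<open>The power \<open>n\<close> is carried along because the functions
  \<open>s ^ n * exp (- s)\<close> with \<open>s = 1 / t\<close> have derivatives that are linear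
  combinations of functions of the same family. At 0 the quadratic bound forces derivative
  0.\<close>

lemma flat_exp_has_derivative:
  "(flat_exp n has_real_derivative (flat_exp (n + 2) t - n * flat_exp (n + 1) t)) (at t)"
proof -
  consider "t > 0" | "t < 0" | "t = 0" by linarith
  then show ?thesis
  proof cases
    case 1
    have "((\<lambda>t. (1 / t) ^ n * exp (- (1 / t))) has_real_derivative (flat_exp (n + 2) t - n * flat_exp (n + 1) t)) (at t)"
      using 1
      by (auto intro!: derivative_eq_intros simp: flat_exp_def power2_eq_square field_simps)
         (cases n; simp add: field_simps)
    then show ?thesis
      by (rule has_field_derivative_transform_within_open[of _ _ _ "{0<..}"]) (use 1 in \<open>auto simp: flat_exp_def\<close>)
  next
    case 2
    have "((\<lambda>t. 0) has_real_derivative (flat_exp (n + 2) t - n * flat_exp (n + 1) t)) (at t)"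
      using 2 by (simp add: flat_exp_def)
    then show ?thesis
      by (rule has_field_derivative_transform_within_open[of _ _ _ "{..<0}"]) (use 2 in \<open>auto simp: flat_exp_def\<close>)
  next
    case 3
    have "((\<lambda>h. flat_exp n h / h) \<longlongrightarrow> 0) (at 0)"
    proof (rule Lim_null_comparison)
      have "norm (flat_exp n h / h) \<le> fact (n + 2) * \<bar>h\<bar>" for h
      proof (cases "h = 0")
        case False
        have "\<bar>flat_exp n h\<bar> / \<bar>h\<bar> \<le> (fact (n + 2) * h\<^sup>2) / \<bar>h\<bar>"
          by (intro divide_right_mono flat_exp_bound) simp
        also have "\<dots> = fact (n + 2) * \<bar>h\<bar>"
          using False by (simp add: divide_eq_eq power2_eq_square mult.assoc del: fact_Suc add_2_eq_Suc')
        finally show ?thesis by (simp add: abs_divide del: fact_Suc add_2_eq_Suc')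
      qed simp
      then show "\<forall>\<^sub>F h in at 0. norm (flat_exp n h / h) \<le> fact (n + 2) * \<bar>h\<bar>"
        by simp
      show "((\<lambda>h. fact (n + 2) * \<bar>h\<bar>) \<longlongrightarrow> 0) (at (0::real))"
        by (auto intro!: tendsto_eq_intros simp del: fact_Suc)
    qed
    then show ?thesis using 3 by (simp add: DERIV_def flat_exp_def)
  qed
qed

lemma Ck_on_flat_exp: "Ck_on k (flat_exp n) UNIV"
proof (induction k arbitrary: n)
  case 0
  show ?case
    by (simp add: continuous_on_eq_continuous_at DERIV_isCont[OF flat_exp_has_derivative])
next
  case (Suc k)
  show ?case
  proof (rule Ck_on_SucI)
    show "(flat_exp n has_derivative (\<lambda>v. v * (flat_exp (n + 2) t - n * flat_exp (n + 1) t))) (at t)" for t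
      using flat_exp_has_derivative[of n t]
      by (simp add: has_field_derivative_def mult.commute[of _ "_ - _"])
    have "Ck_on k (\<lambda>t. v *\<^sub>R flat_exp (n + 2) t + (- (v * real n)) *\<^sub>R flat_exp (n + 1) t) UNIV" for v
      by (intro Ck_on_add Ck_on_bounded_linear[OF _ bounded_linear_scaleR_right] Suc.IH) auto
    then show "Ck_on k (\<lambda>t. v * (flat_exp (n + 2) t - n * flat_exp (n + 1) t)) UNIV" for v
      by (simp add: algebra_simps)
  qed simp
qed

text \<open>Composing with the squared distance keeps smoothness at the centre; division by the
  central value normalises.\<close>

lemma smooth_bump:
  fixes x0 :: "'e::euclidean_space"
  assumes "r > 0"
  obtains \<phi> :: "'e \<Rightarrow> real" where "smooth_on \<phi> UNIV" "\<phi> x0 = 1" "\<And>x. dist x0 x \<ge> r \<Longrightarrow> \<phi> x = 0"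
proof
  define \<psi> where "\<psi> x = flat_exp 0 (r\<^sup>2 - (x - x0) \<bullet> (x - x0))" for x :: 'e
  have "smooth_on (\<lambda>x::'e. r\<^sup>2 - (x - x0) \<bullet> (x - x0)) UNIV"
    by (intro smooth_on_diff smooth_on_const smooth_on_ident smooth_on_bilinear[OF bounded_bilinear_inner] open_UNIV)
  moreover have "smooth_on (flat_exp 0) UNIV" by (simp add: smooth_on_def Ck_on_flat_exp)
  ultimately have "smooth_on \<psi> UNIV"
    unfolding \<psi>_def using smooth_on_compose[of UNIV UNIV] by auto
  then show "smooth_on (\<lambda>x. \<psi> x * (1 / \<psi> x0)) UNIV"
    by (intro smooth_on_mult smooth_on_const open_UNIV)
  show "\<psi> x0 * (1 / \<psi> x0) = 1" using assms by (simp add: \<psi>_def flat_exp_def)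
  show "\<psi> x * (1 / \<psi> x0) = 0" if "dist x0 x \<ge> r" for x
  proof -
    have "r\<^sup>2 \<le> (x - x0) \<bullet> (x - x0)"
      using that assms power_mono[of r "norm (x - x0)" 2]
      by (simp add: dot_square_norm dist_norm norm_minus_commute)
    then show ?thesis by (simp add: \<psi>_def flat_exp_def)
  qed
qed

section \<open>Charts and coordinate changes\<close>

locale smooth_mfd =
  fixes A :: "('a::t2_space, 'e::euclidean_space) chart set"
  assumes manifold: "smooth_manifold A"
begin

lemma max_atlasI: "c \<in> A \<Longrightarrow> c \<in> max_atlas A"
  using manifold by (simp add: smooth_manifold_def max_atlas_def)

lemma is_chart: "c \<in> max_atlas A \<Longrightarrow> is_chart c"
  by (simp add: max_atlas_def)

lemma open_cdom: "c \<in> max_atlas A \<Longrightarrow> open (cdom c)"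
  using is_chart by (simp add: is_chart_def)

lemma cinv_cmap: "c \<in> max_atlas A \<Longrightarrow> p \<in> cdom c \<Longrightarrow> cinv c (cmap c p) = p"
  using is_chart[of c] by (auto simp: is_chart_def homeomorphism_def)

lemma inj_on_cmap: "c \<in> max_atlas A \<Longrightarrow> inj_on (cmap c) (cdom c)"
  using cinv_cmap by (metis inj_on_inverseI)

lemma continuous_on_cmap: "c \<in> max_atlas A \<Longrightarrow> continuous_on (cdom c) (cmap c)"
  using is_chart by (simp add: is_chart_def homeomorphism_def)

lemma continuous_on_cinv: "c \<in> max_atlas A \<Longrightarrow> continuous_on (cmap c ` cdom c) (cinv c)"
  using is_chart by (simp add: is_chart_def homeomorphism_def)

lemma cmap_image_eq:
  assumes "c \<in> max_atlas A"
  shows "cmap c ` (T \<inter> cdom c) = cmap c ` cdom c \<inter> cinv c -` T"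
  using cinv_cmap[OF assms] by force

lemma open_cmap_image:
  assumes c: "c \<in> max_atlas A" and "open T"
  shows "open (cmap c ` (T \<inter> cdom c))"
  unfolding cmap_image_eq[OF c]
  using is_chart[OF c] continuous_on_cinv[OF c] assms(2)
  by (metis Int_commute is_chart_def continuous_on_open_vimage)

lemma open_cmap_image':
  "c \<in> max_atlas A \<Longrightarrow> open T \<Longrightarrow> T \<subseteq> cdom c \<Longrightarrow> open (cmap c ` T)"
  using open_cmap_image by (metis Int_absorb2)

lemma chart_at: "chart_at A p \<in> A" "p \<in> cdom (chart_at A p)"
proof -
  have "p \<in> (\<Union>c\<in>A. cdom c)" using manifold by (simp add: smooth_manifold_def)
  then have "\<exists>c. c \<in> A \<and> p \<in> cdom c" by blast
  from someI_ex[OF this] show "chart_at A p \<in> A" "p \<in> cdom (chart_at A p)"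
    by (auto simp: chart_at_def)
qed

lemma chart_at_max: "chart_at A p \<in> max_atlas A"
  using chart_at max_atlasI by blast

text \<open>Charts of the maximal atlas are compatible with \<open>A\<close> by definition, not yet
  with each other. Near each point the transition is factored through a chart \<open>e\<close> of
  \<open>A\<close>.\<close>

lemma smooth_transition:
  assumes c: "c \<in> max_atlas A" and d: "d \<in> max_atlas A"
  shows "smooth_on (cmap d \<circ> cinv c) (cmap c ` (cdom c \<inter> cdom d))"
proof (rule smooth_on_local)
  show "open (cmap c ` (cdom c \<inter> cdom d))"
    using open_cmap_image[OF c open_cdom[OF d]] by (simp add: Int_commute)
  fix x assume "x \<in> cmap c ` (cdom c \<inter> cdom d)"
  then obtain p where p: "p \<in> cdom c" "p \<in> cdom d" "x = cmap c p" by auto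
  define e where "e = chart_at A p"
  have e: "e \<in> A" "p \<in> cdom e" using chart_at by (auto simp: e_def)
  define T where "T = cmap c ` (cdom e \<inter> cdom d \<inter> cdom c)"
  have oT: "open T" unfolding T_def
    by (intro open_cmap_image open_Int open_cdom c d max_atlasI e)
  have "smooth_on (\<lambda>x. (cmap d \<circ> cinv e) ((cmap e \<circ> cinv c) x)) T"
  proof (rule smooth_on_compose[where f="cmap d \<circ> cinv e" and g="cmap e \<circ> cinv c", OF oT])
    show "open (cmap e ` (cdom d \<inter> cdom e))"
      by (intro open_cmap_image max_atlasI e open_cdom d)
    show "smooth_on (cmap d \<circ> cinv e) (cmap e ` (cdom d \<inter> cdom e))"
    proof -
      have "compatible d e" using d e(1) by (simp add: max_atlas_def)
      then show ?thesis by (simp add: compatible_def Int_commute)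
    qed
    have "smooth_on (cmap e \<circ> cinv c) (cmap c ` (cdom c \<inter> cdom e))"
      using c e by (simp add: max_atlas_def compatible_def)
    then show "smooth_on (cmap e \<circ> cinv c) T"
      by (rule smooth_on_subset) (auto simp: T_def)
    show "(cmap e \<circ> cinv c) ` T \<subseteq> cmap e ` (cdom d \<inter> cdom e)"
      by (auto simp: T_def cinv_cmap[OF c])
  qed
  then have "smooth_on (cmap d \<circ> cinv c) T"
    by (rule smooth_on_cong[OF oT, rotated])
       (auto simp: T_def cinv_cmap[OF c] cinv_cmap[OF max_atlasI[OF e(1)]])
  moreover have "x \<in> T" using p e by (auto simp: T_def)
  ultimately show "\<exists>T. open T \<and> x \<in> T \<and> smooth_on (cmap d \<circ> cinv c) T"
    using oT by blast
qed

lemma transition_has_derivative: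
  assumes "c \<in> max_atlas A" "d \<in> max_atlas A" "p \<in> cdom c" "p \<in> cdom d"
  shows "((cmap d \<circ> cinv c) has_derivative coord_change c d p) (at (cmap c p))"
  unfolding coord_change_def
  by (rule smooth_onD[OF smooth_transition]) (use assms in auto)

lemma linear_coord_change:
  assumes "c \<in> max_atlas A" "d \<in> max_atlas A" "p \<in> cdom c" "p \<in> cdom d"
  shows "linear (coord_change c d p)"
  using has_derivative_linear[OF transition_has_derivative[OF assms]] .

lemma coord_change_compose:
  assumes c: "c \<in> max_atlas A" "p \<in> cdom c" and d: "d \<in> max_atlas A" "p \<in> cdom d"
    and e: "e \<in> max_atlas A" "p \<in> cdom e"
  shows "coord_change d e p (coord_change c d p v) = coord_change c e p v"
proof -
  have "((cmap e \<circ> cinv d) has_derivative coord_change d e p) (at ((cmap d \<circ> cinv c) (cmap c p)))"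
    using transition_has_derivative[OF d(1) e(1) d(2) e(2)] by (simp add: cinv_cmap c)
  from has_derivative_compose[OF transition_has_derivative[OF c(1) d(1) c(2) d(2)] this]
  have "((\<lambda>x. (cmap e \<circ> cinv d) ((cmap d \<circ> cinv c) x)) has_derivative
    (\<lambda>v. coord_change d e p (coord_change c d p v))) (at (cmap c p))" .
  then have "((cmap e \<circ> cinv c) has_derivative
    (\<lambda>v. coord_change d e p (coord_change c d p v))) (at (cmap c p))"
    by (rule has_derivative_transform_within_open[OF _ open_cmap_image[OF c(1) open_cdom[OF d(1)]]])
       (use c d in \<open>auto simp: cinv_cmap\<close>)
  from has_derivative_unique[OF this transition_has_derivative[OF c(1) e(1) c(2) e(2)]]
  show ?thesis by metis
qed

lemma coord_change_self:
  assumes c: "c \<in> max_atlas A" "p \<in> cdom c"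
  shows "coord_change c c p v = v"
proof -
  have "((\<lambda>x. x) has_derivative (\<lambda>v. v)) (at (cmap c p))" by simp
  then have "((cmap c \<circ> cinv c) has_derivative (\<lambda>v. v)) (at (cmap c p))"
    by (rule has_derivative_transform_within_open[OF _ open_cmap_image'[OF c(1) open_cdom[OF c(1)]]])
       (use c in \<open>auto simp: cinv_cmap\<close>)
  from has_derivative_unique[OF this transition_has_derivative[OF c(1) c(1) c(2) c(2)]]
  show ?thesis by metis
qed

lemma linear_to_chart: "c \<in> max_atlas A \<Longrightarrow> p \<in> cdom c \<Longrightarrow> linear (to_chart A c p)"
  unfolding to_chart_def by (intro linear_coord_change chart_at_max chart_at)

lemma linear_from_chart: "c \<in> max_atlas A \<Longrightarrow> p \<in> cdom c \<Longrightarrow> linear (from_chart A c p)"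
  unfolding from_chart_def by (intro linear_coord_change chart_at_max chart_at)

lemma to_chart_chart_at [simp]: "to_chart A (chart_at A p) p v = v"
  by (simp add: to_chart_def coord_change_self chart_at_max chart_at)

lemma from_chart_chart_at [simp]: "from_chart A (chart_at A p) p v = v"
  by (simp add: from_chart_def coord_change_self chart_at_max chart_at)

lemma to_chart_from_chart: "c \<in> max_atlas A \<Longrightarrow> p \<in> cdom c \<Longrightarrow> to_chart A c p (from_chart A c p v) = v"
  unfolding to_chart_def from_chart_def
  by (simp add: coord_change_compose[of c p] chart_at_max chart_at coord_change_self)

lemma from_chart_to_chart: "c \<in> max_atlas A \<Longrightarrow> p \<in> cdom c \<Longrightarrow> from_chart A c p (to_chart A c p v) = v"
  unfolding to_chart_def from_chart_def
  by (simp add: coord_change_compose[of "chart_at A p" p] chart_at_max chart_at coord_change_self)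

lemma coord_change_to_chart:
  "c \<in> max_atlas A \<Longrightarrow> p \<in> cdom c \<Longrightarrow> d \<in> max_atlas A \<Longrightarrow> p \<in> cdom d \<Longrightarrow>
    coord_change c d p (to_chart A c p v) = to_chart A d p v"
  unfolding to_chart_def by (simp add: coord_change_compose[of "chart_at A p" p] chart_at_max chart_at)

lemma to_chart_eq_iff: "c \<in> max_atlas A \<Longrightarrow> p \<in> cdom c \<Longrightarrow> to_chart A c p v = to_chart A c p w \<longleftrightarrow> v = w"
  by (metis from_chart_to_chart)

end

section \<open>Maps between manifolds and sections along them\<close>

locale smooth_mfd_map = N: smooth_mfd N + M: smooth_mfd M
  for N :: "('b::t2_space, 'n::euclidean_space) chart set"
    and M :: "('a::t2_space, 'm::euclidean_space) chart set" +
  fixes f :: "'b \<Rightarrow> 'a"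
  assumes smooth_map: "smooth_map N M f"
begin

definition loc_map :: "('b, 'n) chart \<Rightarrow> ('a, 'm) chart \<Rightarrow> 'n \<Rightarrow> 'm" where
  "loc_map c d = cmap d \<circ> f \<circ> cinv c"

definition loc_sec :: "('b, 'n) chart \<Rightarrow> ('a, 'm) chart \<Rightarrow> ('b \<Rightarrow> 'm) \<Rightarrow> 'n \<Rightarrow> 'm" where
  "loc_sec c d \<xi> x = to_chart M d (f (cinv c x)) (\<xi> (cinv c x))"

definition loc_dom :: "('b, 'n) chart \<Rightarrow> ('a, 'm) chart \<Rightarrow> 'b set \<Rightarrow> 'n set" where
  "loc_dom c d W = cmap c ` (W \<inter> cdom c \<inter> f -` cdom d)"

lemma smooth_along_def': "smooth_along N M f W \<xi> \<longleftrightarrow> (\<forall>c\<in>N. \<forall>d\<in>M. smooth_on (loc_sec c d \<xi>) (loc_dom c d W))"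
  by (simp add: smooth_along_def loc_sec_def[abs_def] loc_dom_def)

lemma open_vimage_map: "open T \<Longrightarrow> open (f -` T)"
  using smooth_map unfolding smooth_map_def
  using continuous_on_open_vimage[OF open_UNIV, of f] by auto

lemma loc_domE:
  assumes "x \<in> loc_dom c d W" "c \<in> max_atlas N"
  obtains q where "q \<in> W" "q \<in> cdom c" "f q \<in> cdom d" "x = cmap c q" "cinv c x = q"
  using assms N.cinv_cmap by (auto simp: loc_dom_def)

lemma loc_domI: "q \<in> W \<Longrightarrow> q \<in> cdom c \<Longrightarrow> f q \<in> cdom d \<Longrightarrow> cmap c q \<in> loc_dom c d W"
  by (auto simp: loc_dom_def)

lemma loc_dom_mono: "V \<subseteq> W \<Longrightarrow> loc_dom c d V \<subseteq> loc_dom c d W"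
  by (auto simp: loc_dom_def)

lemma open_loc_dom: "c \<in> max_atlas N \<Longrightarrow> d \<in> max_atlas M \<Longrightarrow> open W \<Longrightarrow> open (loc_dom c d W)"
  unfolding loc_dom_def
  by (rule N.open_cmap_image') (auto simp: N.open_cdom M.open_cdom open_vimage_map intro!: open_Int)

lemma smooth_loc_map:
  assumes "c \<in> N" "d \<in> M"
  shows "smooth_on (loc_map c d) (loc_dom c d W)"
proof -
  have "smooth_on (loc_map c d) (cmap c ` (cdom c \<inter> f -` cdom d))"
    using smooth_map assms unfolding smooth_map_def loc_map_def by blast
  then show ?thesis by (rule smooth_on_subset) (auto simp: loc_dom_def)
qed

text \<open>\<open>differential\<close> is defined in the preferred charts at \<open>q\<close> and
  \<open>f q\<close> only. Composing with the transitions on both sides, which is what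
  \<open>from_chart\<close> and \<open>to_chart\<close> do to first order, gives the derivative in
  all charts of the atlases.\<close>

lemma differential_has_derivative:
  assumes "c \<in> N" "d \<in> M" "q \<in> cdom c" "f q \<in> cdom d"
  shows "(loc_map c d has_derivative (\<lambda>v. to_chart M d (f q) (differential N M f q (from_chart N c q v)))) (at (cmap c q))"
proof -
  let ?c = "chart_at N q" and ?d = "chart_at M (f q)"
  note cc = N.max_atlasI[OF assms(1)] N.chart_at_max M.max_atlasI[OF assms(2)] M.chart_at_max
    assms N.chart_at M.chart_at
  have D: "(loc_map ?c ?d has_derivative differential N M f q) (at (cmap ?c q))"
    using smooth_onD[OF smooth_loc_map[OF N.chart_at(1) M.chart_at(1)] loc_domI, of q UNIV q "f q"]
    by (simp add: differential_def loc_map_def N.chart_at M.chart_at)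
  have 1: "((cmap ?c \<circ> cinv c) has_derivative from_chart N c q) (at (cmap c q))"
    unfolding from_chart_def by (intro N.transition_has_derivative cc)
  have "(loc_map ?c ?d has_derivative differential N M f q) (at ((cmap ?c \<circ> cinv c) (cmap c q)))"
    using D by (simp add: N.cinv_cmap cc)
  from has_derivative_compose[OF 1 this]
  have 2: "((\<lambda>x. loc_map ?c ?d ((cmap ?c \<circ> cinv c) x)) has_derivative (\<lambda>v. differential N M f q (from_chart N c q v))) (at (cmap c q))" .
  have "((cmap d \<circ> cinv ?d) has_derivative to_chart M d (f q)) (at (cmap ?d (f q)))"
    unfolding to_chart_def by (intro M.transition_has_derivative cc)
  then have "((cmap d \<circ> cinv ?d) has_derivative to_chart M d (f q)) (at (loc_map ?c ?d ((cmap ?c \<circ> cinv c) (cmap c q))))"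
    by (simp add: loc_map_def N.cinv_cmap cc)
  from has_derivative_compose[OF 2 this]
  show ?thesis
    by (rule has_derivative_transform_within_open[OF _ open_loc_dom[of c ?d "cdom ?c \<inter> f -` cdom d"]])
       (auto simp: cc loc_map_def N.open_cdom M.open_cdom open_Int open_vimage_map N.cinv_cmap M.cinv_cmap
          intro!: loc_domI elim!: loc_domE)
qed

lemma linear_differential: "linear (differential N M f q)"
proof -
  have "linear (\<lambda>v. to_chart M (chart_at M (f q)) (f q) (differential N M f q (from_chart N (chart_at N q) q v)))"
    by (rule has_derivative_linear[OF differential_has_derivative]) (auto simp: N.chart_at M.chart_at)
  then show ?thesis by simp
qed

text \<open>One pair of charts around each point suffices: a change of charts composes the section
  with a transition of \<open>N\<close> and applies the Jacobian of a transition of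
  \<open>M\<close>, both of which are smooth.\<close>

lemma smooth_alongI:
  assumes "open W"
    and "\<And>p. p \<in> W \<Longrightarrow> \<exists>c\<in>N. \<exists>d\<in>M. \<exists>T. open T \<and> p \<in> T \<and> p \<in> cdom c \<and> f p \<in> cdom d \<and> smooth_on (loc_sec c d \<xi>) (loc_dom c d T)"
  shows "smooth_along N M f W \<xi>"
  unfolding smooth_along_def'
proof (intro ballI)
  fix c' d' assume c'd': "c' \<in> N" "d' \<in> M"
  note c' = N.max_atlasI[OF c'd'(1)] and d' = M.max_atlasI[OF c'd'(2)]
  show "smooth_on (loc_sec c' d' \<xi>) (loc_dom c' d' W)"
  proof (rule smooth_on_local[OF open_loc_dom[OF c' d' assms(1)]])
    fix x assume "x \<in> loc_dom c' d' W"
    then obtain p where p: "p \<in> W" "p \<in> cdom c'" "f p \<in> cdom d'" "x = cmap c' p"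
      using c' by (auto elim: loc_domE)
    obtain c d T where cd: "c \<in> N" "d \<in> M" and T: "open T" "p \<in> T" "p \<in> cdom c" "f p \<in> cdom d"
      "smooth_on (loc_sec c d \<xi>) (loc_dom c d T)" using assms(2)[OF p(1)] by blast
    note c = N.max_atlasI[OF cd(1)] and d = M.max_atlasI[OF cd(2)]
    define V where "V = T \<inter> W \<inter> cdom c \<inter> f -` cdom d"
    have oV: "open V" unfolding V_def
      by (intro open_Int T assms open_vimage_map N.open_cdom M.open_cdom c d)
    define S where "S = loc_dom c' d' V"
    have oS: "open S" unfolding S_def by (intro open_loc_dom c' d' oV)
    have tr: "smooth_on (cmap c \<circ> cinv c') S"
      by (rule smooth_on_subset[OF N.smooth_transition[OF c' c]]) (auto simp: S_def loc_dom_def V_def)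
    have "smooth_on (\<lambda>x. frechet_derivative (cmap d' \<circ> cinv d) (at (loc_map c' d x)) (loc_sec c d \<xi> ((cmap c \<circ> cinv c') x))) S"
    proof (rule smooth_on_frechet_apply[OF oS])
      show "open (cmap d ` (cdom d' \<inter> cdom d))" by (intro M.open_cmap_image d M.open_cdom d')
      show "loc_map c' d ` S \<subseteq> cmap d ` (cdom d' \<inter> cdom d)"
        using c' by (auto simp: S_def V_def loc_map_def elim!: loc_domE)
      show "smooth_on (cmap d' \<circ> cinv d) (cmap d ` (cdom d' \<inter> cdom d))"
        using M.smooth_transition[OF d d'] by (simp add: Int_commute)
      show "smooth_on (loc_map c' d) S"
        by (rule smooth_on_subset[OF smooth_loc_map[OF c'd'(1) cd(2), of V]]) (auto simp: S_def loc_dom_def V_def)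
      show "smooth_on (\<lambda>x. loc_sec c d \<xi> ((cmap c \<circ> cinv c') x)) S"
        by (rule smooth_on_compose[where f="loc_sec c d \<xi>" and g="cmap c \<circ> cinv c'", OF oS open_loc_dom[OF c d T(1)] _ T(5) tr])
           (use c' in \<open>auto simp: S_def V_def elim!: loc_domE intro!: loc_domI\<close>)
    qed
    then have "smooth_on (loc_sec c' d' \<xi>) S"
    proof (rule smooth_on_cong[OF oS, rotated])
      fix x assume "x \<in> S"
      then obtain q where "q \<in> V" "q \<in> cdom c'" "f q \<in> cdom d'" "x = cmap c' q" "cinv c' x = q"
        using c' unfolding S_def by (auto elim!: loc_domE)
      then show "frechet_derivative (cmap d' \<circ> cinv d) (at (loc_map c' d x)) (loc_sec c d \<xi> ((cmap c \<circ> cinv c') x)) = loc_sec c' d' \<xi> x"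
        using M.coord_change_to_chart[OF d _ d', of "f q" "\<xi> q"]
        by (simp add: loc_map_def loc_sec_def V_def N.cinv_cmap[OF c] coord_change_def)
    qed
    moreover have "x \<in> S" using p T by (auto simp: S_def V_def intro!: loc_domI)
    ultimately show "\<exists>T. open T \<and> x \<in> T \<and> smooth_on (loc_sec c' d' \<xi>) T"
      using oS by blast
  qed
qed

lemma smooth_alongD: "smooth_along N M f W \<xi> \<Longrightarrow> c \<in> N \<Longrightarrow> d \<in> M \<Longrightarrow> smooth_on (loc_sec c d \<xi>) (loc_dom c d W)"
  by (simp add: smooth_along_def')

lemma smooth_along_subset: "smooth_along N M f W \<xi> \<Longrightarrow> V \<subseteq> W \<Longrightarrow> smooth_along N M f V \<xi>"
  unfolding smooth_along_def' using smooth_on_subset[of _ "loc_dom _ _ W" "loc_dom _ _ V"] loc_dom_mono by blast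

lemma smooth_along_cong:
  assumes "open W" "\<And>p. p \<in> W \<Longrightarrow> \<xi> p = \<eta> p" "smooth_along N M f W \<xi>"
  shows "smooth_along N M f W \<eta>"
  unfolding smooth_along_def'
proof (intro ballI)
  fix c d assume cd: "c \<in> N" "d \<in> M"
  show "smooth_on (loc_sec c d \<eta>) (loc_dom c d W)"
    by (rule smooth_on_cong[OF open_loc_dom _ smooth_alongD[OF assms(3) cd]])
       (use cd assms(1,2) in \<open>auto simp: loc_sec_def N.max_atlasI M.max_atlasI elim!: loc_domE\<close>)
qed

lemma smooth_along_local:
  assumes "open W" "\<And>p. p \<in> W \<Longrightarrow> \<exists>V. open V \<and> p \<in> V \<and> smooth_along N M f V \<xi>"
  shows "smooth_along N M f W \<xi>"
proof (rule smooth_alongI[OF assms(1)])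
  fix p assume "p \<in> W"
  then obtain V where "open V" "p \<in> V" "smooth_along N M f V \<xi>" using assms(2) by blast
  then show "\<exists>c\<in>N. \<exists>d\<in>M. \<exists>T. open T \<and> p \<in> T \<and> p \<in> cdom c \<and> f p \<in> cdom d \<and> smooth_on (loc_sec c d \<xi>) (loc_dom c d T)"
    using smooth_alongD N.chart_at M.chart_at by metis
qed

lemma smooth_along_add:
  assumes "open W" "smooth_along N M f W \<xi>" "smooth_along N M f W \<eta>"
  shows "smooth_along N M f W (\<lambda>p. \<xi> p + \<eta> p)"
  unfolding smooth_along_def'
proof (intro ballI)
  fix c d assume cd: "c \<in> N" "d \<in> M"
  note o = open_loc_dom[OF N.max_atlasI[OF cd(1)] M.max_atlasI[OF cd(2)] assms(1)]
  show "smooth_on (loc_sec c d (\<lambda>p. \<xi> p + \<eta> p)) (loc_dom c d W)"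
    by (rule smooth_on_cong[OF o _ smooth_on_add[OF o smooth_alongD[OF assms(2) cd] smooth_alongD[OF assms(3) cd]]])
       (use cd in \<open>auto simp: loc_sec_def N.max_atlasI M.max_atlasI linear_add[OF M.linear_to_chart] elim!: loc_domE\<close>)
qed

end

section \<open>Smooth coefficient functions and cut-offs\<close>

definition smooth_fun :: "('b, 'n::euclidean_space) chart set \<Rightarrow> 'b set \<Rightarrow> ('b \<Rightarrow> real) \<Rightarrow> bool" where
  "smooth_fun N W a \<longleftrightarrow> (\<forall>c\<in>N. smooth_on (\<lambda>x. a (cinv c x)) (cmap c ` (W \<inter> cdom c)))"

context smooth_mfd
begin

lemma smooth_funD: "smooth_fun A W a \<Longrightarrow> c \<in> A \<Longrightarrow> smooth_on (\<lambda>x. a (cinv c x)) (cmap c ` (W \<inter> cdom c))"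
  by (simp add: smooth_fun_def)

lemma smooth_funI:
  assumes "open W"
    and "\<And>p. p \<in> W \<Longrightarrow> \<exists>c\<in>A. \<exists>T. open T \<and> p \<in> T \<and> p \<in> cdom c \<and> smooth_on (\<lambda>x. a (cinv c x)) (cmap c ` (T \<inter> cdom c))"
  shows "smooth_fun A W a"
  unfolding smooth_fun_def
proof
  fix c' assume c': "c' \<in> A"
  note c'm = max_atlasI[OF c']
  show "smooth_on (\<lambda>x. a (cinv c' x)) (cmap c' ` (W \<inter> cdom c'))"
  proof (rule smooth_on_local[OF open_cmap_image[OF c'm assms(1)]])
    fix x assume "x \<in> cmap c' ` (W \<inter> cdom c')"
    then obtain p where p: "p \<in> W" "p \<in> cdom c'" "x = cmap c' p" by auto
    obtain c T where c: "c \<in> A" "open T" "p \<in> T" "p \<in> cdom c"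
      "smooth_on (\<lambda>x. a (cinv c x)) (cmap c ` (T \<inter> cdom c))" using assms(2)[OF p(1)] by blast
    note cm = max_atlasI[OF c(1)]
    define S where "S = cmap c' ` (T \<inter> cdom c \<inter> cdom c')"
    have oS: "open S" unfolding S_def by (intro open_cmap_image c'm open_Int c open_cdom cm)
    have tr: "smooth_on (cmap c \<circ> cinv c') S"
      by (rule smooth_on_subset[OF smooth_transition[OF c'm cm]]) (auto simp: S_def)
    have "smooth_on (\<lambda>x. a (cinv c ((cmap c \<circ> cinv c') x))) S"
      by (rule smooth_on_compose[where f="\<lambda>x. a (cinv c x)" and g="cmap c \<circ> cinv c'", OF oS open_cmap_image[OF cm c(2)] _ c(5) tr])
         (auto simp: S_def cinv_cmap[OF c'm])
    then have "smooth_on (\<lambda>x. a (cinv c' x)) S"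
      by (rule smooth_on_cong[OF oS, rotated]) (auto simp: S_def cinv_cmap[OF c'm] cinv_cmap[OF cm])
    moreover have "x \<in> S" using p c by (auto simp: S_def)
    ultimately show "\<exists>T. open T \<and> x \<in> T \<and> smooth_on (\<lambda>x. a (cinv c' x)) T"
      using oS by blast
  qed
qed

end

lemma (in smooth_mfd) smooth_mfd_map_id: "smooth_mfd_map A A id"
proof (unfold_locales)
  show "smooth_map A A id"
    unfolding smooth_map_def
  proof (intro conjI ballI)
    fix c d assume "c \<in> A" "d \<in> A"
    then show "smooth_on (cmap d \<circ> id \<circ> cinv c) (cmap c ` (cdom c \<inter> id -` cdom d))"
      using smooth_transition[of c d] max_atlasI by simp
  qed simp
qed

context smooth_mfd_map
begin

lemma smooth_fun_loc: "smooth_fun N W a \<Longrightarrow> c \<in> N \<Longrightarrow> smooth_on (\<lambda>x. a (cinv c x)) (loc_dom c d W)"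
  by (rule smooth_on_subset[OF N.smooth_funD]) (auto simp: loc_dom_def)

lemma smooth_along_scale:
  assumes "open W" "smooth_fun N W a" "smooth_along N M f W \<xi>"
  shows "smooth_along N M f W (\<lambda>p. a p *\<^sub>R \<xi> p)"
  unfolding smooth_along_def'
proof (intro ballI)
  fix c d assume cd: "c \<in> N" "d \<in> M"
  note o = open_loc_dom[OF N.max_atlasI[OF cd(1)] M.max_atlasI[OF cd(2)] assms(1)]
  show "smooth_on (loc_sec c d (\<lambda>p. a p *\<^sub>R \<xi> p)) (loc_dom c d W)"
    by (rule smooth_on_cong[OF o _ smooth_on_scaleR[OF o smooth_fun_loc[OF assms(2) cd(1)] smooth_alongD[OF assms(3) cd]]])
       (use cd in \<open>auto simp: loc_sec_def N.max_atlasI M.max_atlasI linear_scale[OF M.linear_to_chart] elim!: loc_domE\<close>)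
qed

lemma smooth_along_zero: "open W \<Longrightarrow> smooth_along N M f W (\<lambda>_. 0)"
  unfolding smooth_along_def'
proof (intro ballI)
  fix c d assume "open W" and cd: "c \<in> N" "d \<in> M"
  note o = open_loc_dom[OF N.max_atlasI[OF cd(1)] M.max_atlasI[OF cd(2)] \<open>open W\<close>]
  show "smooth_on (loc_sec c d (\<lambda>_. 0)) (loc_dom c d W)"
    by (rule smooth_on_cong[OF o _ smooth_on_const[OF o, of 0]])
       (use cd in \<open>auto simp: loc_sec_def N.max_atlasI M.max_atlasI linear_0[OF M.linear_to_chart] elim!: loc_domE\<close>)
qed

lemma smooth_along_sum:
  "open W \<Longrightarrow> (\<And>i. i \<in> I \<Longrightarrow> smooth_along N M f W (\<xi> i)) \<Longrightarrow> smooth_along N M f W (\<lambda>p. \<Sum>i\<in>I. \<xi> i p)"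
  by (induction I rule: infinite_finite_induct) (simp_all add: smooth_along_zero smooth_along_add)

lemma smooth_fun_const: "smooth_fun N W (\<lambda>_. r)" if "open W"
  unfolding smooth_fun_def using that
  by (auto intro!: smooth_on_const N.open_cmap_image N.max_atlasI)

lemma smooth_along_diff:
  assumes "open W" "smooth_along N M f W \<xi>" "smooth_along N M f W \<eta>"
  shows "smooth_along N M f W (\<lambda>p. \<xi> p - \<eta> p)"
  using smooth_along_add[OF assms(1,2) smooth_along_scale[OF assms(1) smooth_fun_const[OF assms(1), of "-1"] assms(3)]]
  by simp

text \<open>A constant vector of the model space is not a smooth section, since the preferred chart
  jumps from point to point. Constant components in one fixed chart are the basic supply of smooth
  sections.\<close>

lemma smooth_along_const_coeff:
  assumes d: "d0 \<in> M" and "open W" "W \<subseteq> f -` cdom d0"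
  shows "smooth_along N M f W (\<lambda>q. from_chart M d0 (f q) w)"
proof (rule smooth_alongI[OF assms(2)])
  fix p assume p: "p \<in> W"
  let ?c = "chart_at N p"
  note o = open_loc_dom[OF N.chart_at_max[of p] M.max_atlasI[OF d] assms(2)]
  have "smooth_on (loc_sec ?c d0 (\<lambda>q. from_chart M d0 (f q) w)) (loc_dom ?c d0 W)"
    by (rule smooth_on_cong[OF o _ smooth_on_const[OF o, of w]])
       (auto simp: loc_sec_def M.to_chart_from_chart M.max_atlasI d elim!: loc_domE intro: N.chart_at_max)
  then show "\<exists>c\<in>N. \<exists>d\<in>M. \<exists>T. open T \<and> p \<in> T \<and> p \<in> cdom c \<and> f p \<in> cdom d \<and>
      smooth_on (loc_sec c d (\<lambda>q. from_chart M d0 (f q) w)) (loc_dom c d T)"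
    using assms p N.chart_at by blast
qed

lemma smooth_along_differential:
  assumes "open W" and X: "vector_field_on N W X"
  shows "smooth_along N M f W (\<lambda>q. differential N M f q (X q))"
proof (rule smooth_alongI[OF assms(1)])
  fix p assume p: "p \<in> W"
  let ?c = "chart_at N p" and ?d = "chart_at M (f p)"
  note cd = N.chart_at(1)[of p] M.chart_at(1)[of "f p"] N.chart_at_max[of p] M.chart_at_max[of "f p"]
  define S where "S = loc_dom ?c ?d W"
  have oS: "open S" unfolding S_def by (rule open_loc_dom[OF cd(3,4) assms(1)])
  have "smooth_on (\<lambda>x. to_chart N ?c (cinv ?c x) (X (cinv ?c x))) (cmap ?c ` (W \<inter> cdom ?c))"
    using X cd(1) unfolding smooth_along_def by force
  then have Xs: "smooth_on (\<lambda>x. to_chart N ?c (cinv ?c x) (X (cinv ?c x))) S"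
    by (rule smooth_on_subset) (auto simp: S_def loc_dom_def)
  have "smooth_on (\<lambda>x. frechet_derivative (loc_map ?c ?d) (at x) (to_chart N ?c (cinv ?c x) (X (cinv ?c x)))) S"
    by (rule smooth_on_frechet_apply[OF oS oS _ _ smooth_on_ident[OF oS] Xs])
       (auto simp: S_def smooth_loc_map cd)
  then have "smooth_on (loc_sec ?c ?d (\<lambda>q. differential N M f q (X q))) S"
  proof (rule smooth_on_cong[OF oS, rotated])
    fix x assume "x \<in> S"
    then obtain q where q: "q \<in> W" "q \<in> cdom ?c" "f q \<in> cdom ?d" "x = cmap ?c q" "cinv ?c x = q"
      using cd(3) unfolding S_def by (auto elim!: loc_domE)
    show "frechet_derivative (loc_map ?c ?d) (at x) (to_chart N ?c (cinv ?c x) (X (cinv ?c x)))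
        = loc_sec ?c ?d (\<lambda>q. differential N M f q (X q)) x"
      using frechet_derivative_at[OF differential_has_derivative[OF cd(1,2) q(2,3)]] q
      by (simp add: loc_sec_def N.from_chart_to_chart cd) (metis N.from_chart_to_chart cd(3) q(2))
  qed
  then show "\<exists>c\<in>N. \<exists>d\<in>M. \<exists>T. open T \<and> p \<in> T \<and> p \<in> cdom c \<and> f p \<in> cdom d \<and>
      smooth_on (loc_sec c d (\<lambda>q. differential N M f q (X q))) (loc_dom c d T)"
    using assms(1) p N.chart_at M.chart_at unfolding S_def by blast
qed

lemma smooth_along_endo:
  assumes "open W" "open U" and S: "smooth_endo M U S" and \<xi>: "smooth_along N M f W \<xi>" and WU: "W \<subseteq> f -` U"
  shows "smooth_along N M f W (\<lambda>q. blinfun_apply (S (f q)) (\<xi> q))"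
  unfolding smooth_along_def'
proof (intro ballI)
  fix c d assume cd: "c \<in> N" "d \<in> M"
  note c = N.max_atlasI[OF cd(1)] and d = M.max_atlasI[OF cd(2)]
  note o = open_loc_dom[OF c d assms(1)]
  define L where "L y v = to_chart M d (cinv d y) (blinfun_apply (S (cinv d y)) (from_chart M d (cinv d y) v))" for y v
  have Ls: "smooth_on (\<lambda>y. L y v) (cmap d ` (U \<inter> cdom d))" for v
    using S cd(2) unfolding smooth_endo_def L_def by blast
  have im: "loc_map c d ` loc_dom c d W \<subseteq> cmap d ` (U \<inter> cdom d)"
    using c WU by (auto simp: loc_map_def elim!: loc_domE)
  have "smooth_on (\<lambda>x. L (loc_map c d x) (loc_sec c d \<xi> x)) (loc_dom c d W)"
  proof (rule smooth_on_linear_apply[OF o _ _ smooth_alongD[OF \<xi> cd]])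
    show "smooth_on (\<lambda>x. L (loc_map c d x) v) (loc_dom c d W)" for v
      by (rule smooth_on_compose[OF o M.open_cmap_image[OF d assms(2)] im Ls smooth_loc_map[OF cd]])
    show "linear (L (loc_map c d x))" if xd: "x \<in> loc_dom c d W" for x
    proof -
      obtain q where q: "q \<in> cdom c" "f q \<in> cdom d" "x = cmap c q" using loc_domE[OF xd c] by metis
      have "linear (to_chart M d (f q) \<circ> blinfun_apply (S (f q)) \<circ> from_chart M d (f q))"
        by (intro linear_compose M.linear_to_chart M.linear_from_chart d q
            bounded_linear.linear[OF blinfun.bounded_linear_right])
      then show ?thesis using q by (simp add: L_def[abs_def] loc_map_def N.cinv_cmap c M.cinv_cmap d o_def)
    qed
  qed
  then show "smooth_on (loc_sec c d (\<lambda>q. blinfun_apply (S (f q)) (\<xi> q))) (loc_dom c d W)"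
    by (rule smooth_on_cong[OF o, rotated])
       (auto simp: L_def loc_map_def loc_sec_def N.cinv_cmap c M.cinv_cmap d M.from_chart_to_chart elim!: loc_domE[OF _ c])
qed

text \<open>A single function \<open>a\<close> extends every section over \<open>W\<close> by zero
  to a global one without changing its value at \<open>p\<close>.\<close>

lemma smooth_cutoff:
  assumes "open W" "p \<in> W"
  obtains a where "a p = (1::real)"
    "\<And>\<xi>. smooth_along N M f W \<xi> \<Longrightarrow> smooth_along N M f UNIV (\<lambda>q. a q *\<^sub>R \<xi> q)" "\<And>q. q \<notin> W \<Longrightarrow> a q = 0"
proof -
  let ?c = "chart_at N p"
  note c = N.chart_at(1)[of p] N.chart_at_max[of p] N.chart_at(2)[of p]
  define V where "V = W \<inter> cdom ?c"
  have oV: "open V" and pV: "p \<in> V" using assms N.open_cdom[OF c(2)] c(3) by (auto simp: V_def)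
  have oi: "open (cmap ?c ` V)" by (rule N.open_cmap_image'[OF c(2) oV]) (auto simp: V_def)
  then obtain r where r: "r > 0" "cball (cmap ?c p) r \<subseteq> cmap ?c ` V"
    using pV open_contains_cball by blast
  obtain \<phi> :: "'n \<Rightarrow> real" where \<phi>: "smooth_on \<phi> UNIV" "\<phi> (cmap ?c p) = 1" "\<And>x. dist (cmap ?c p) x \<ge> r \<Longrightarrow> \<phi> x = 0"
    using smooth_bump[OF r(1)] by metis
  \<comment> \<open>\<open>K\<close> is compact, hence closed because the manifold is Hausdorff. So
    \<open>V\<close> and the complement of \<open>K\<close>, where \<open>a\<close> vanishes, form
    an open cover on which smoothness can be checked.\<close>
  define K where "K = cinv ?c ` cball (cmap ?c p) r"
  have r': "cball (cmap ?c p) r \<subseteq> cmap ?c ` cdom ?c" using r(2) by (auto simp: V_def)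
  have "compact K" unfolding K_def
    by (rule compact_continuous_image[OF continuous_on_subset[OF N.continuous_on_cinv[OF c(2)] r'] compact_cball])
  then have cK: "closed K" by (rule compact_imp_closed)
  have KV: "K \<subseteq> V"
  proof
    fix q assume "q \<in> K"
    then obtain q' where "q' \<in> V" "q = cinv ?c (cmap ?c q')" using r(2) unfolding K_def by blast
    then show "q \<in> V" using N.cinv_cmap[OF c(2)] by (simp add: V_def)
  qed
  define a where "a q = (if q \<in> V then \<phi> (cmap ?c q) else 0)" for q
  have a0: "a q = 0" if "q \<notin> K" for q
  proof (cases "q \<in> V")
    case True
    then have "q = cinv ?c (cmap ?c q)" using N.cinv_cmap[OF c(2)] by (simp add: V_def)
    then have "cmap ?c q \<notin> cball (cmap ?c p) r" using that unfolding K_def by blast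
    then show ?thesis using \<phi>(3)[of "cmap ?c q"] True by (auto simp: a_def)
  qed (simp add: a_def)
  have aV: "smooth_fun N V a"
  proof (rule N.smooth_funI[OF oV])
    fix q assume q: "q \<in> V"
    note oo = N.open_cmap_image[OF c(2) oV]
    have "smooth_on (\<lambda>x. a (cinv ?c x)) (cmap ?c ` (V \<inter> cdom ?c))"
      by (rule smooth_on_cong[OF oo _ smooth_on_subset[OF \<phi>(1)]]) (auto simp: a_def N.cinv_cmap[OF c(2)])
    then show "\<exists>c\<in>N. \<exists>T. open T \<and> q \<in> T \<and> q \<in> cdom c \<and> smooth_on (\<lambda>x. a (cinv c x)) (cmap c ` (T \<inter> cdom c))"
      using c(1) oV q by (intro bexI[of _ ?c] exI[of _ V]) (auto simp: V_def)
  qed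
  have "smooth_along N M f UNIV (\<lambda>q. a q *\<^sub>R \<xi> q)" if \<xi>: "smooth_along N M f W \<xi>" for \<xi>
  proof (rule smooth_along_local)
    have V: "smooth_along N M f V (\<lambda>q. a q *\<^sub>R \<xi> q)"
      by (rule smooth_along_scale[OF oV aV smooth_along_subset[OF \<xi>]]) (simp add: V_def)
    have co: "smooth_along N M f (- K) (\<lambda>q. a q *\<^sub>R \<xi> q)"
      by (rule smooth_along_cong[OF _ _ smooth_along_zero]) (use cK a0 in auto)
    show "\<exists>V. open V \<and> q \<in> V \<and> smooth_along N M f V (\<lambda>q. a q *\<^sub>R \<xi> q)" for q
      using V co oV cK KV by (cases "q \<in> K") (auto intro: exI[of _ V] exI[of _ "- K"])
  qed simp
  moreover have "a p = 1" using pV \<phi>(2) by (simp add: a_def)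
  moreover have "a q = 0" if "q \<notin> W" for q using that by (simp add: a_def V_def)
  ultimately show ?thesis using that by blast
qed

end

section \<open>Non-degenerate bilinear forms\<close>

lemma bilinear_simps:
  assumes "bilinear h"
  shows "h (x + y) z = h x z + h y z" "h z (x + y) = h z x + h z y"
    "h (r *\<^sub>R x) z = r *\<^sub>R h x z" "h z (r *\<^sub>R x) = r *\<^sub>R h z x"
    "h (x - y) z = h x z - h y z" "h z (x - y) = h z x - h z y"
    "h (- x) z = - h x z" "h z (- x) = - h z x"
    "h 0 z = 0" "h z 0 = 0"
  using assms bilinear_ladd[of h] bilinear_radd[of h] bilinear_lmul[of h] bilinear_rmul[of h]
    bilinear_lsub[of h] bilinear_rsub[of h] bilinear_lneg[of h] bilinear_rneg[of h]
    bilinear_lzero[of h] bilinear_rzero[of h] by auto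

lemma bilinear_sums:
  assumes "bilinear h"
  shows "h (\<Sum>i\<in>I. x i) z = (\<Sum>i\<in>I. h (x i) z)" "h z (\<Sum>i\<in>I. x i) = (\<Sum>i\<in>I. h z (x i))"
  using assms linear_sum[of "\<lambda>x. h x z" x I] linear_sum[of "h z" x I] unfolding bilinear_def by auto

text \<open>For an indefinite form, positivity is replaced by a dimension count: the Gram map
  \<open>T\<close> of a basis of \<open>F\<close> is injective on \<open>F\<close> by
  non-degeneracy, hence maps \<open>F\<close> onto itself.\<close>

lemma nondegenerate_riesz:
  fixes h :: "'e::euclidean_space \<Rightarrow> 'e \<Rightarrow> real"
  assumes h: "bilinear h" and F: "subspace F" and nd: "nondegenerate_on h F" and \<phi>: "linear \<phi>"
  shows "\<exists>!w. w \<in> F \<and> (\<forall>u\<in>F. h w u = \<phi> u)"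
proof (rule ex_ex1I)
  obtain Bs where Bs: "Bs \<subseteq> F" "independent Bs" "F \<subseteq> span Bs" "card Bs = dim F"
    using basis_exists[of F] by blast
  have fin: "finite Bs" using Bs(2) independent_bound by blast
  define T where "T w = (\<Sum>b\<in>Bs. h w b *\<^sub>R b)" for w
  have linT: "linear T"
    unfolding T_def by (auto intro!: linearI simp: bilinear_simps[OF h] scaleR_add_left sum.distrib scaleR_sum_right)
  have TF: "T ` F \<subseteq> F"
    unfolding T_def using Bs(1) F by (auto intro!: subspace_sum subspace_scale)
  have ext: "\<forall>u\<in>F. \<psi> u = 0" if "linear \<psi>" "\<And>b. b \<in> Bs \<Longrightarrow> \<psi> b = 0" for \<psi> :: "'e \<Rightarrow> real"
    using linear_eq_0_on_span[OF that] Bs(3) by blast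
  have lh: "linear (h w)" for w using h by (simp add: bilinear_def)
  have inj: "inj_on T (span F)"
  proof (rule inj_onI)
    fix v w assume vw: "v \<in> span F" "w \<in> span F" "T v = T w"
    have vwF: "v - w \<in> F" using vw(1,2) F by (metis span_eq_iff subspace_diff)
    have "T (v - w) = 0" using vw(3) linear_diff[OF linT] by simp
    then have z: "\<And>b. b \<in> Bs \<Longrightarrow> h (v - w) b = 0"
      using Bs(2) fin unfolding T_def independent_explicit by blast
    have "\<forall>u\<in>F. h (v - w) u = 0" by (rule ext[OF lh z])
    then have "v - w = 0" using nd vwF unfolding nondegenerate_on_def by blast
    then show "v = w" by simp
  qed
  have "T ` F = F"
  proof (rule subspace_dim_equal)
    show "dim (T ` F) \<ge> dim F" using dim_image_eq[OF linT inj] by simp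
  qed (use TF F linear_subspace_image[OF linT F] in auto)
  moreover have "(\<Sum>b\<in>Bs. \<phi> b *\<^sub>R b) \<in> F"
    using Bs(1) F by (auto intro!: subspace_sum subspace_scale)
  ultimately obtain w where w: "w \<in> F" "T w = (\<Sum>b\<in>Bs. \<phi> b *\<^sub>R b)" by (metis imageE)
  then have "(\<Sum>b\<in>Bs. (h w b - \<phi> b) *\<^sub>R b) = 0" by (simp add: T_def scaleR_diff_left sum_subtractf)
  moreover have "(\<Sum>b\<in>Bs. (h w b - \<phi> b) *\<^sub>R b) = 0 \<longrightarrow> (\<forall>b\<in>Bs. h w b - \<phi> b = 0)"
    using Bs(2)[unfolded independent_explicit] by (elim conjE allE[of _ "\<lambda>b. h w b - \<phi> b"])
  ultimately have "h w b - \<phi> b = 0" if "b \<in> Bs" for b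
    using that by blast
  then have "\<forall>u\<in>F. h w u - \<phi> u = 0"
    using ext[OF linear_compose_sub[OF lh \<phi>]] by blast
  then show "\<exists>w. w \<in> F \<and> (\<forall>u\<in>F. h w u = \<phi> u)" using w(1) by auto
  show "w = w'" if "w \<in> F \<and> (\<forall>u\<in>F. h w u = \<phi> u)" "w' \<in> F \<and> (\<forall>u\<in>F. h w' u = \<phi> u)" for w w'
  proof -
    have "w - w' \<in> F" "\<forall>u\<in>F. h (w - w') u = 0"
      using that F by (auto simp: subspace_diff bilinear_simps[OF h])
    then show ?thesis using nd unfolding nondegenerate_on_def by force
  qed
qed

definition orth_proj :: "('e::euclidean_space \<Rightarrow> 'e \<Rightarrow> real) \<Rightarrow> 'e set \<Rightarrow> 'e \<Rightarrow> 'e" where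
  "orth_proj h F v = (THE w. w \<in> F \<and> (\<forall>u\<in>F. h w u = h v u))"

definition orth_compl :: "('e::euclidean_space \<Rightarrow> 'e \<Rightarrow> real) \<Rightarrow> 'e set \<Rightarrow> 'e set" where
  "orth_compl h F = {v. \<forall>u\<in>F. h v u = 0}"

locale nondeg_subspace =
  fixes h :: "'e::euclidean_space \<Rightarrow> 'e \<Rightarrow> real" and F :: "'e set"
  assumes bil: "bilinear h" and sym: "h v w = h w v" and sub: "subspace F" and nd: "nondegenerate_on h F"
begin

lemma orth_proj: "orth_proj h F v \<in> F" "u \<in> F \<Longrightarrow> h (orth_proj h F v) u = h v u"
  using theI'[OF nondegenerate_riesz[OF bil sub nd, of "h v"]] bil
  unfolding orth_proj_def bilinear_def by auto

lemma orth_proj_unique: "w \<in> F \<Longrightarrow> (\<And>u. u \<in> F \<Longrightarrow> h w u = h v u) \<Longrightarrow> orth_proj h F v = w"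
  unfolding orth_proj_def
  by (rule the1_equality[OF nondegenerate_riesz[OF bil sub nd]]) (use bil in \<open>auto simp: bilinear_def\<close>)

lemma orth_proj_ident: "v \<in> F \<Longrightarrow> orth_proj h F v = v"
  by (rule orth_proj_unique) auto

lemma orth_proj_orth: "v \<in> orth_compl h F \<Longrightarrow> orth_proj h F v = 0"
  by (rule orth_proj_unique) (auto simp: orth_compl_def bilinear_simps[OF bil] subspace_0[OF sub])

lemma linear_orth_proj: "linear (orth_proj h F)"
  by (intro linearI orth_proj_unique)
     (auto simp: orth_proj bilinear_simps[OF bil] subspace_add[OF sub] subspace_scale[OF sub])

lemma diff_orth_proj: "v - orth_proj h F v \<in> orth_compl h F"
  by (auto simp: orth_compl_def bilinear_simps[OF bil] orth_proj)

lemma subspace_orth_compl: "subspace (orth_compl h F)"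
  by (auto simp: subspace_def orth_compl_def bilinear_simps[OF bil])

lemma orth_complD: "v \<in> orth_compl h F \<Longrightarrow> u \<in> F \<Longrightarrow> h v u = 0" "v \<in> orth_compl h F \<Longrightarrow> u \<in> F \<Longrightarrow> h u v = 0"
  using sym by (auto simp: orth_compl_def)

lemma nondegenerate_orth_compl:
  assumes "nondegenerate_on h UNIV"
  shows "nondegenerate_on h (orth_compl h F)"
  unfolding nondegenerate_on_def
proof (intro ballI impI)
  fix v assume v: "v \<in> orth_compl h F" "\<forall>w\<in>orth_compl h F. h v w = 0"
  have "h v w = 0" for w
  proof -
    have "h v w = h v (w - orth_proj h F w) + h v (orth_proj h F w)" by (simp add: bilinear_simps[OF bil])
    then show ?thesis using v diff_orth_proj orth_complD(1)[OF v(1)] orth_proj by simp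
  qed
  then show "v = 0" using assms unfolding nondegenerate_on_def by blast
qed

lemma double_orth_compl:
  assumes "nondegenerate_on h UNIV" "\<And>u. u \<in> orth_compl h F \<Longrightarrow> h v u = 0"
  shows "v \<in> F"
proof -
  let ?w = "v - orth_proj h F v"
  have "h ?w u = 0" for u
  proof -
    have "h ?w u = h ?w (u - orth_proj h F u) + h ?w (orth_proj h F u)" by (simp add: bilinear_simps[OF bil])
    moreover have "h ?w (orth_proj h F u) = 0" using diff_orth_proj orth_proj(1) orth_complD(1) by blast
    moreover have "h ?w (u - orth_proj h F u) = 0"
      using assms(2)[OF diff_orth_proj] orth_complD(2)[OF diff_orth_proj orth_proj(1)]
      by (simp add: bilinear_simps[OF bil])
    ultimately show ?thesis by simp
  qed
  then have "?w = 0" using assms(1) unfolding nondegenerate_on_def by blast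
  then show ?thesis using orth_proj(1) by (metis eq_iff_diff_eq_0)
qed

lemma dim_orth_compl: "dim (orth_compl h F) + dim F = DIM('e)"
proof -
  have "orth_compl h F \<inter> F = {0}"
  proof (rule equalityI)
    show "orth_compl h F \<inter> F \<subseteq> {0}"
      using nd by (auto simp: nondegenerate_on_def orth_compl_def)
  qed (use subspace_0[OF sub] subspace_0[OF subspace_orth_compl] in auto)
  moreover have "{x + y | x y. x \<in> orth_compl h F \<and> y \<in> F} = UNIV"
    using diff_orth_proj orth_proj(1) by (metis (mono_tags, lifting) UNIV_eq_I diff_add_cancel mem_Collect_eq)
  ultimately show ?thesis using dim_sums_Int[OF subspace_orth_compl sub] by (simp add: dim_UNIV)
qed

end

text \<open>Indexing the equations by a part \<open>I\<close> of \<open>Basis\<close> lets the Gram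
  matrix act on the model space itself. It is completed by the identity on the remaining
  coordinates, so that the smooth dependence of inverse operators applies.\<close>

lemma (in smooth_mfd) smooth_gram_solve:
  fixes G :: "'e \<Rightarrow> 'e \<Rightarrow> 'a \<Rightarrow> real"
  assumes "open W" and I: "I \<subseteq> Basis"
    and G: "\<And>i j. i \<in> I \<Longrightarrow> j \<in> I \<Longrightarrow> smooth_fun A W (G i j)"
    and b: "\<And>j. j \<in> I \<Longrightarrow> smooth_fun A W (b j)"
    and nd: "\<And>q t i. q \<in> W \<Longrightarrow> (\<forall>j\<in>I. (\<Sum>i\<in>I. t i * G i j q) = 0) \<Longrightarrow> i \<in> I \<Longrightarrow> t i = 0"
  obtains a where "\<And>i. i \<in> I \<Longrightarrow> smooth_fun A W (a i)"
    "\<And>q j. q \<in> W \<Longrightarrow> j \<in> I \<Longrightarrow> (\<Sum>i\<in>I. a i q * G i j q) = b j q"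
proof
  have fin: "finite I" using finite_subset[OF I finite_Basis] .
  define B where "B q v = (\<Sum>j\<in>I. (\<Sum>i\<in>I. (v \<bullet> i) * G i j q) *\<^sub>R j) + (\<Sum>j\<in>Basis - I. (v \<bullet> j) *\<^sub>R j)" for q v
  define \<beta> where "\<beta> q = (\<Sum>j\<in>I. b j q *\<^sub>R j)" for q
  have coord: "(\<Sum>j\<in>J. c j *\<^sub>R j) \<bullet> k = (if k \<in> J then c k else 0)" if "J \<subseteq> Basis" "k \<in> Basis" for J c and k :: 'e
  proof -
    have "(\<Sum>j\<in>J. c j *\<^sub>R j) \<bullet> k = (\<Sum>j\<in>J. if j = k then c j else 0)"
      unfolding inner_sum_left using that by (intro sum.cong) (auto simp: inner_Basis subset_iff)
    then show ?thesis using that finite_subset[OF that(1)] by simp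
  qed
  have B1: "B q v \<bullet> k = (\<Sum>i\<in>I. (v \<bullet> i) * G i k q)" if "k \<in> I" for q v k
    using that subsetD[OF I that] I by (simp add: B_def inner_add_left coord)
  have B2: "B q v \<bullet> k = v \<bullet> k" if "k \<in> Basis - I" for q v k
    using that I by (simp add: B_def inner_add_left coord)
  have lin: "linear (B q)" for q
    unfolding B_def
    by (intro linearI)
       (auto simp: inner_add_left algebra_simps sum.distrib scaleR_sum_right sum_distrib_left scaleR_add_left)
  have inj: "inj (B q)" if "q \<in> W" for q
    unfolding linear_injective_0[OF lin]
  proof (intro allI impI)
    fix v assume v: "B q v = 0"
    have "\<forall>j\<in>I. (\<Sum>i\<in>I. (v \<bullet> i) * G i j q) = 0" using v B1 by (metis inner_zero_left)
    then have "v \<bullet> k = 0" if "k \<in> I" for k using nd[OF \<open>q \<in> W\<close>, of "\<lambda>i. v \<bullet> i"] that by blast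
    moreover have "v \<bullet> k = 0" if "k \<in> Basis - I" for k using B2[OF that, of q v] v by simp
    ultimately have "\<forall>k\<in>Basis. v \<bullet> k = 0" by blast
    then show "v = 0" by (simp add: euclidean_all_zero_iff)
  qed
  define a where "a i q = inv (B q) (\<beta> q) \<bullet> i" for i q
  show "smooth_fun A W (a i)" if "i \<in> I" for i
    unfolding smooth_fun_def a_def
  proof
    fix c assume c: "c \<in> A"
    define S where "S = cmap c ` (W \<inter> cdom c)"
    have oS: "open S" unfolding S_def by (rule open_cmap_image[OF max_atlasI[OF c] assms(1)])
    have SW: "cinv c x \<in> W" if "x \<in> S" for x
      using that by (auto simp: S_def cinv_cmap[OF max_atlasI[OF c]])
    have linI: "linear (inv (B q))" if "q \<in> W" for q
      using lin inj[OF that] linear_injective_imp_surjective inj_linear_imp_inv_linear by blast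
    have Gs: "smooth_on (\<lambda>x. G i j (cinv c x)) S" if "i \<in> I" "j \<in> I" for i j
      using smooth_funD[OF G[OF that] c] by (simp add: S_def)
    have bs: "smooth_on (\<lambda>x. b j (cinv c x)) S" if "j \<in> I" for j
      using smooth_funD[OF b[OF that] c] by (simp add: S_def)
    have "smooth_on (\<lambda>x. inv (B (cinv c x)) (\<beta> (cinv c x))) S"
    proof (rule smooth_on_linear_apply[OF oS linI[OF SW]])
      show "smooth_on (\<lambda>x. inv (B (cinv c x)) v) S" for v
      proof (rule smooth_on_inverse_operator[OF oS lin inj[OF SW]])
        show "smooth_on (\<lambda>x. B (cinv c x) v) S" for v
          unfolding B_def
          by (intro smooth_on_add smooth_on_sum smooth_on_scaleR smooth_on_mult smooth_on_const Gs oS)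
      qed
      show "smooth_on (\<lambda>x. \<beta> (cinv c x)) S"
        unfolding \<beta>_def by (intro smooth_on_sum smooth_on_scaleR smooth_on_const bs oS)
    qed
    then show "smooth_on (\<lambda>x. inv (B (cinv c x)) (\<beta> (cinv c x)) \<bullet> i) (cmap c ` (W \<inter> cdom c))"
      unfolding S_def[symmetric] by (rule smooth_on_bounded_linear[OF oS bounded_linear_inner_left])
  qed
  show "(\<Sum>i\<in>I. a i q * G i j q) = b j q" if "q \<in> W" "j \<in> I" for q j
  proof -
    have "B q (inv (B q) (\<beta> q)) = \<beta> q"
      using linear_injective_imp_surjective[OF lin inj[OF that(1)]] by (simp add: surj_f_inv_f)
    then have "(\<Sum>i\<in>I. a i q * G i j q) = \<beta> q \<bullet> j" using B1[OF that(2), of q "inv (B q) (\<beta> q)"] by (simp add: a_def)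
    then show ?thesis using that subsetD[OF I that(2)] I by (simp add: \<beta>_def coord)
  qed
qed

section \<open>Metrics and the Levi-Civita connection\<close>

text \<open>The index is left free, so that induced metrics are instances of this locale.\<close>

locale metric_mfd = smooth_mfd A for A :: "('a::t2_space, 'e::euclidean_space) chart set" +
  fixes g :: "'a \<Rightarrow> 'e \<Rightarrow> 'e \<Rightarrow> real"
  assumes bil: "bilinear (g p)" and sym: "g p v w = g p w v" and nondeg: "nondegenerate_on (g p) UNIV"
    and smooth_coeff: "c \<in> A \<Longrightarrow> smooth_on (metric_coeff A g c u v) (cmap c ` cdom c)"
begin

lemmas gs = bilinear_simps[OF bil]

lemma metric_eqI: "(\<And>z. g p v z = g p w z) \<Longrightarrow> v = w"
proof -
  assume "\<And>z. g p v z = g p w z"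
  then have "\<forall>z\<in>UNIV. g p (v - w) z = 0" by (simp add: gs)
  then have "v - w = 0" using nondeg unfolding nondegenerate_on_def by blast
  then show "v = w" by simp
qed

lemma bilinear_metric_coeff:
  assumes "c \<in> max_atlas A" "x \<in> cmap c ` cdom c"
  shows "bilinear (\<lambda>u v. metric_coeff A g c u v x)"
proof -
  have "linear (from_chart A c (cinv c x))"
    using assms cinv_cmap by (auto intro!: linear_from_chart)
  then show ?thesis
    unfolding bilinear_def metric_coeff_def
    by (auto intro!: linearI simp: linear_add linear_scale gs)
qed

lemma metric_coeff_sym: "metric_coeff A g c u v = metric_coeff A g c v u"
  unfolding metric_coeff_def using sym by auto

definition dmetric :: "'a \<Rightarrow> 'e \<Rightarrow> 'e \<Rightarrow> 'e \<Rightarrow> real" where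
  "dmetric p u v w = frechet_derivative (metric_coeff A g (chart_at A p) v w) (at (cmap (chart_at A p) p)) u"

lemma dmetric: "(metric_coeff A g (chart_at A p) v w has_derivative (\<lambda>u. dmetric p u v w)) (at (cmap (chart_at A p) p))"
  unfolding dmetric_def
  using smooth_onD[OF smooth_coeff[OF chart_at(1)], of "cmap (chart_at A p) p" p v w] chart_at(2)[of p] by simp

lemma dmetric_sym: "dmetric p u v w = dmetric p u w v"
  unfolding dmetric_def using metric_coeff_sym by metis

lemma dmetric_linear: "linear (\<lambda>u. dmetric p u v w)" "linear (\<lambda>v. dmetric p u v w)" "linear (\<lambda>w. dmetric p u v w)"
proof -
  show 1: "linear (\<lambda>u. dmetric p u v w)" for v w using has_derivative_linear[OF dmetric] .
  let ?c = "chart_at A p"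
  have o: "open (cmap ?c ` cdom ?c)" "cmap ?c p \<in> cmap ?c ` cdom ?c"
    using open_cmap_image'[OF chart_at_max open_cdom[OF chart_at_max]] chart_at by auto
  note b = bilinear_simps[OF bilinear_metric_coeff[OF chart_at_max]]
  show 2: "linear (\<lambda>v. dmetric p u v w)" for u w
  proof (rule linearI)
    fix a b' r
    have "(metric_coeff A g ?c (a + b') w has_derivative (\<lambda>u. dmetric p u a w + dmetric p u b' w)) (at (cmap ?c p))"
      by (rule has_derivative_transform_within_open[OF has_derivative_add[OF dmetric dmetric] o]) (simp add: b)
    from has_derivative_unique[OF this dmetric] show "dmetric p u (a + b') w = dmetric p u a w + dmetric p u b' w" by metis
    have "(metric_coeff A g ?c (r *\<^sub>R a) w has_derivative (\<lambda>u. r *\<^sub>R dmetric p u a w)) (at (cmap ?c p))"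
      by (rule has_derivative_transform_within_open[OF has_derivative_scaleR_right[OF dmetric] o]) (simp add: b)
    from has_derivative_unique[OF this dmetric] show "dmetric p u (r *\<^sub>R a) w = r *\<^sub>R dmetric p u a w" by metis
  qed
  have "(\<lambda>w. dmetric p u v w) = (\<lambda>w. dmetric p u w v)" using dmetric_sym by blast
  then show "linear (\<lambda>w. dmetric p u v w)" using 2[of u v] by metis
qed

lemma christoffel: "2 * g p (christoffel A g p u v) z = dmetric p u v z + dmetric p v u z - dmetric p z u v"
proof -
  let ?\<phi> = "\<lambda>z. (dmetric p u v z + dmetric p v u z - dmetric p z u v) / 2"
  have lin: "linear ?\<phi>"
    by (auto intro!: linearI simp: linear_add[OF dmetric_linear(1)] linear_add[OF dmetric_linear(3)]
        linear_scale[OF dmetric_linear(1)] linear_scale[OF dmetric_linear(3)] algebra_simps add_divide_distrib diff_divide_distrib)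
  have "\<exists>!w. w \<in> UNIV \<and> (\<forall>z\<in>UNIV. g p w z = ?\<phi> z)"
    by (rule nondegenerate_riesz[OF bil subspace_UNIV nondeg lin])
  then have "\<exists>!w. \<forall>z. 2 * g p w z = dmetric p u v z + dmetric p v u z - dmetric p z u v"
    by (simp add: field_simps)
  from theI'[OF this] show ?thesis unfolding christoffel_def Let_def dmetric_def by blast
qed

lemma christoffel_sym: "christoffel A g p u v = christoffel A g p v u"
proof (rule metric_eqI[of p])
  show "g p (christoffel A g p u v) z = g p (christoffel A g p v u) z" for z
    using christoffel[of p u v z] christoffel[of p v u z] dmetric_sym[of p z u v] by simp
qed

text \<open>In the sum of the two Koszul formulas the other derivatives of the metric cancel. This
  is the metric property of the connection in coordinates.\<close>

lemma christoffel_metric: "g p (christoffel A g p u v) w + g p v (christoffel A g p u w) = dmetric p u v w"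
  using christoffel[of p u v w] christoffel[of p u w v] sym[of p v] dmetric_sym[of p u v w]
    dmetric_sym[of p v u w] dmetric_sym[of p w u v] by simp

lemma linear_christoffel: "linear (christoffel A g p u)"
proof (rule linearI; rule metric_eqI[of p])
  show "g p (christoffel A g p u (a + b)) z = g p (christoffel A g p u a + christoffel A g p u b) z" for a b z
    using christoffel[of p u "a + b" z] christoffel[of p u a z] christoffel[of p u b z]
    by (simp add: gs linear_add[OF dmetric_linear(1)] linear_add[OF dmetric_linear(2)] linear_add[OF dmetric_linear(3)])
  show "g p (christoffel A g p u (r *\<^sub>R a)) z = g p (r *\<^sub>R christoffel A g p u a) z" for r a z
    using christoffel[of p u "r *\<^sub>R a" z] arg_cong[OF christoffel[of p u a z], of "(*) r"]
    by (simp add: gs linear_scale[OF dmetric_linear(1)] linear_scale[OF dmetric_linear(2)] linear_scale[OF dmetric_linear(3)] algebra_simps)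
qed

end

text \<open>Product rule for evaluation, with \<open>L\<close> differentiated on fixed vectors only.
  That \<open>D w\<close> depends linearly on \<open>w\<close> is a consequence of uniqueness of
  derivatives.\<close>

lemma has_derivative_linear_apply:
  fixes L :: "'d::real_normed_vector \<Rightarrow> 'e::euclidean_space \<Rightarrow> 'f::real_normed_vector"
  assumes "open S" "x0 \<in> S" "\<And>x. x \<in> S \<Longrightarrow> linear (L x)"
    and D: "\<And>w. ((\<lambda>x. L x w) has_derivative D w) (at x0)" and h: "(h has_derivative h') (at x0)"
  shows "((\<lambda>x. L x (h x)) has_derivative (\<lambda>v. D (h x0) v + L x0 (h' v))) (at x0)"
proof -
  have Dexp: "D w v = (\<Sum>b\<in>Basis. (w \<bullet> b) *\<^sub>R D b v)" for w v
  proof -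
    have "((\<lambda>x. \<Sum>b\<in>Basis. (w \<bullet> b) *\<^sub>R L x b) has_derivative (\<lambda>v. \<Sum>b\<in>Basis. (w \<bullet> b) *\<^sub>R D b v)) (at x0)"
      by (intro has_derivative_sum has_derivative_scaleR_right D)
    then have "((\<lambda>x. L x w) has_derivative (\<lambda>v. \<Sum>b\<in>Basis. (w \<bullet> b) *\<^sub>R D b v)) (at x0)"
      by (rule has_derivative_transform_within_open[OF _ assms(1,2)])
         (use linear_basis_expand[OF assms(3), of _ w] in simp)
    from has_derivative_unique[OF D this] show ?thesis by metis
  qed
  have "((\<lambda>x. \<Sum>b\<in>Basis. (h x \<bullet> b) *\<^sub>R L x b) has_derivative
      (\<lambda>v. \<Sum>b\<in>Basis. (h x0 \<bullet> b) *\<^sub>R D b v + (h' v \<bullet> b) *\<^sub>R L x0 b)) (at x0)"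
    by (intro has_derivative_sum has_derivative_scaleR D has_derivative_inner_left h)
  then have "((\<lambda>x. L x (h x)) has_derivative
      (\<lambda>v. \<Sum>b\<in>Basis. (h x0 \<bullet> b) *\<^sub>R D b v + (h' v \<bullet> b) *\<^sub>R L x0 b)) (at x0)"
    by (rule has_derivative_transform_within_open[OF _ assms(1,2)])
       (use linear_basis_expand[OF assms(3)] in simp)
  moreover have "(\<Sum>b\<in>Basis. (h x0 \<bullet> b) *\<^sub>R D b v + (h' v \<bullet> b) *\<^sub>R L x0 b) = D (h x0) v + L x0 (h' v)" for v
    using Dexp[of "h x0" v] linear_basis_expand[OF assms(3)[OF assms(2)], of "h' v"] by (simp add: sum.distrib)
  ultimately show ?thesis by simp
qed

lemma (in smooth_mfd) differential_id [simp]: "differential A A id p v = v"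
proof -
  interpret I: smooth_mfd_map A A id by (rule smooth_mfd_map_id)
  have 1: "(I.loc_map (chart_at A p) (chart_at A p) has_derivative differential A A id p) (at (cmap (chart_at A p) p))"
    using I.differential_has_derivative[OF chart_at(1) chart_at(1), of p p p] chart_at by simp
  have "(cmap (chart_at A p) \<circ> cinv (chart_at A p) has_derivative (\<lambda>v. v)) (at (cmap (chart_at A p) p))"
    using transition_has_derivative[OF chart_at_max chart_at_max chart_at(2) chart_at(2), of p]
      coord_change_self[OF chart_at_max chart_at(2)] by (metis (no_types, lifting) ext)
  from has_derivative_unique[OF 1[unfolded I.loc_map_def comp_id] this] show ?thesis by metis
qed

context smooth_mfd
begin

text \<open>Not intrinsic by itself, since it depends on the chart chosen at \<open>p\<close>. It
  acquires a meaning together with Christoffel or Hessian terms, or antisymmetrised, as a Lie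
  bracket.\<close>

definition dvf :: "('a \<Rightarrow> 'e) \<Rightarrow> 'a \<Rightarrow> 'e \<Rightarrow> 'e" where
  "dvf Y p = frechet_derivative (\<lambda>x. to_chart A (chart_at A p) (cinv (chart_at A p) x) (Y (cinv (chart_at A p) x)))
     (at (cmap (chart_at A p) p))"

lemma vector_field_loc:
  assumes "vector_field_on A W Y" "c \<in> A"
  shows "smooth_on (\<lambda>x. to_chart A c (cinv c x) (Y (cinv c x))) (cmap c ` (W \<inter> cdom c))"
  using assms unfolding smooth_along_def by force

lemma dvf:
  assumes "vector_field_on A W Y" "p \<in> W"
  shows "((\<lambda>x. to_chart A (chart_at A p) (cinv (chart_at A p) x) (Y (cinv (chart_at A p) x))) has_derivative dvf Y p)
    (at (cmap (chart_at A p) p))"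
  unfolding dvf_def
  by (rule smooth_onD[OF vector_field_loc[OF assms(1) chart_at(1)]]) (use assms(2) chart_at in auto)

end

section \<open>The Levi-Civita connection along a map\<close>

locale metric_map = smooth_mfd_map N M f + M: metric_mfd M g
  for N :: "('b::t2_space, 'n::euclidean_space) chart set"
    and M :: "('a::t2_space, 'm::euclidean_space) chart set" and f and g
begin

abbreviation nabla :: "('b \<Rightarrow> 'm) \<Rightarrow> 'b \<Rightarrow> 'n \<Rightarrow> 'm" where
  "nabla \<equiv> levi_civita_along N M g f"

abbreviation pt :: "'b \<Rightarrow> 'n" where "pt p \<equiv> cmap (chart_at N p) p"

abbreviation sec_at :: "'b \<Rightarrow> ('b \<Rightarrow> 'm) \<Rightarrow> 'n \<Rightarrow> 'm" where
  "sec_at p \<equiv> loc_sec (chart_at N p) (chart_at M (f p))"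

lemma nabla_eq:
  "nabla \<xi> p v = frechet_derivative (sec_at p \<xi>) (at (pt p)) v + christoffel M g (f p) (differential N M f p v) (\<xi> p)"
  by (simp add: levi_civita_along_def Let_def loc_sec_def[abs_def])

lemma pt_in: "p \<in> W \<Longrightarrow> pt p \<in> loc_dom (chart_at N p) (chart_at M (f p)) W"
  by (simp add: loc_domI N.chart_at M.chart_at)

lemma cinv_pt [simp]: "cinv (chart_at N p) (pt p) = p"
  by (simp add: N.cinv_cmap N.chart_at_max N.chart_at)

lemma sec_at_pt [simp]: "sec_at p \<xi> (pt p) = \<xi> p"
  by (simp add: loc_sec_def)

lemma loc_map_pt [simp]: "loc_map (chart_at N p) d (pt p) = cmap d (f p)"
  by (simp add: loc_map_def)

lemma open_dom_at: "open W \<Longrightarrow> open (loc_dom (chart_at N p) (chart_at M (f p)) W)"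
  by (intro open_loc_dom N.chart_at_max M.chart_at_max)

lemma loc_map_at_derivative: "(loc_map (chart_at N p) (chart_at M (f p)) has_derivative differential N M f p) (at (pt p))"
  using differential_has_derivative[OF N.chart_at(1)[of p] M.chart_at(1)[of "f p"] N.chart_at(2)[of p] M.chart_at(2)] by simp

lemma sec_at_derivative:
  assumes "smooth_along N M f W \<xi>" "p \<in> W"
  shows "(sec_at p \<xi> has_derivative frechet_derivative (sec_at p \<xi>) (at (pt p))) (at (pt p))"
  using smooth_onD[OF smooth_alongD[OF assms(1) N.chart_at(1) M.chart_at(1)] pt_in[OF assms(2)]] .

lemma linear_christoffel_left: "linear (\<lambda>u. christoffel M g p u v)"
  using M.linear_christoffel[of p v] M.christoffel_sym[of p v] by (metis (no_types, lifting) ext)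

lemma linear_nabla:
  assumes "smooth_along N M f W \<xi>" "p \<in> W"
  shows "linear (nabla \<xi> p)"
proof -
  have "linear (\<lambda>v. frechet_derivative (sec_at p \<xi>) (at (pt p)) v + christoffel M g (f p) (differential N M f p v) (\<xi> p))"
    by (intro linear_compose_add has_derivative_linear[OF sec_at_derivative[OF assms]]
        linear_compose[OF linear_differential linear_christoffel_left, unfolded o_def])
  then show ?thesis unfolding nabla_eq[abs_def] .
qed

lemma metric_loc:
  assumes "c \<in> N" "d \<in> M" "x \<in> loc_dom c d W"
  shows "g (f (cinv c x)) (\<xi> (cinv c x)) (\<eta> (cinv c x))
    = metric_coeff M g d (loc_sec c d \<xi> x) (loc_sec c d \<eta> x) (loc_map c d x)"
proof -
  obtain q where q: "f q \<in> cdom d" "x = cmap c q" "cinv c x = q"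
    using loc_domE[OF assms(3) N.max_atlasI[OF assms(1)]] by metis
  note d = M.max_atlasI[OF assms(2)]
  have "cinv d (loc_map c d x) = f q" using q M.cinv_cmap[OF d q(1)] by (simp add: loc_map_def)
  then show ?thesis
    unfolding metric_coeff_def loc_sec_def q(3) using M.from_chart_to_chart[OF d q(1)] by simp
qed

lemma loc_map_in: "x \<in> loc_dom c d W \<Longrightarrow> c \<in> N \<Longrightarrow> loc_map c d x \<in> cmap d ` cdom d"
  by (auto simp: loc_map_def elim!: loc_domE[OF _ N.max_atlasI])

lemma smooth_metric:
  assumes "open W" "smooth_along N M f W \<xi>" "smooth_along N M f W \<eta>"
  shows "smooth_fun N W (\<lambda>q. g (f q) (\<xi> q) (\<eta> q))"
proof (rule N.smooth_funI[OF assms(1)])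
  fix p assume p: "p \<in> W"
  let ?c = "chart_at N p" and ?d = "chart_at M (f p)"
  note cd = N.chart_at(1)[of p] M.chart_at(1)[of "f p"]
  define S where "S = loc_dom ?c ?d W"
  have oS: "open S" unfolding S_def by (rule open_dom_at[OF assms(1)])
  let ?F = "loc_map ?c ?d" and ?G = "\<lambda>u v. metric_coeff M g ?d u v"
  have b: "bilinear (\<lambda>u v. ?G u v (?F x))" if "x \<in> S" for x
    by (rule M.bilinear_metric_coeff[OF M.chart_at_max loc_map_in[OF that[unfolded S_def] cd(1)]])
  have G: "smooth_on (\<lambda>x. ?G u v (?F x)) S" for u v
  proof (rule smooth_on_compose[where f="?G u v" and g="?F", OF oS _ _ M.smooth_coeff[OF cd(2)]])
    show "open (cmap ?d ` cdom ?d)"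
      by (rule M.open_cmap_image'[OF M.chart_at_max M.open_cdom[OF M.chart_at_max]]) simp
    show "?F ` S \<subseteq> cmap ?d ` cdom ?d" unfolding S_def using loc_map_in[OF _ cd(1)] by blast
    show "smooth_on ?F S" unfolding S_def by (rule smooth_loc_map[OF cd])
  qed
  have "smooth_on (\<lambda>x. ?G u (sec_at p \<eta> x) (?F x)) S" for u
    by (rule smooth_on_linear_apply[OF oS _ G]) (use b in \<open>auto simp: bilinear_def S_def smooth_alongD[OF assms(3) cd]\<close>)
  then have "smooth_on (\<lambda>x. ?G (sec_at p \<xi> x) (sec_at p \<eta> x) (?F x)) S"
    by (rule smooth_on_linear_apply[OF oS, rotated]) (use b in \<open>auto simp: bilinear_def S_def smooth_alongD[OF assms(2) cd]\<close>)
  then have "smooth_on (\<lambda>x. g (f (cinv ?c x)) (\<xi> (cinv ?c x)) (\<eta> (cinv ?c x))) S"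
    by (rule smooth_on_cong[OF oS, rotated]) (use metric_loc[OF cd] in \<open>auto simp: S_def\<close>)
  moreover have "S = cmap ?c ` (W \<inter> f -` cdom ?d \<inter> cdom ?c)"
    by (auto simp: S_def loc_dom_def)
  moreover have "open (W \<inter> f -` cdom ?d)"
    by (intro open_Int assms open_vimage_map M.open_cdom M.chart_at_max)
  ultimately show "\<exists>c\<in>N. \<exists>T. open T \<and> p \<in> T \<and> p \<in> cdom c \<and>
      smooth_on (\<lambda>x. g (f (cinv c x)) (\<xi> (cinv c x)) (\<eta> (cinv c x))) (cmap c ` (T \<inter> cdom c))"
    using p N.chart_at M.chart_at by (intro bexI[of _ ?c] exI[of _ "W \<inter> f -` cdom ?d"]) auto
qed

text \<open>Differentiating the inner product in components produces the derivatives of the two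
  sections and one term \<open>dmetric\<close> from the moving metric. The Christoffel terms of the
  two covariant derivatives account exactly for the latter.\<close>

lemma nabla_metric:
  assumes "open W" "p \<in> W" "smooth_along N M f W \<xi>" "smooth_along N M f W \<eta>"
  shows "((\<lambda>x. g (f (cinv (chart_at N p) x)) (\<xi> (cinv (chart_at N p) x)) (\<eta> (cinv (chart_at N p) x)))
    has_derivative (\<lambda>v. g (f p) (nabla \<xi> p v) (\<eta> p) + g (f p) (\<xi> p) (nabla \<eta> p v))) (at (pt p))"
proof -
  let ?c = "chart_at N p" and ?d = "chart_at M (f p)"
  note cd = N.chart_at(1)[of p] M.chart_at(1)[of "f p"]
  define S where "S = loc_dom ?c ?d W"
  have oS: "open S" "pt p \<in> S" unfolding S_def using open_dom_at[OF assms(1)] pt_in[OF assms(2)] by auto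
  let ?F = "loc_map ?c ?d" and ?G = "\<lambda>u v. metric_coeff M g ?d u v"
  let ?dF = "differential N M f p"
  let ?D\<xi> = "frechet_derivative (sec_at p \<xi>) (at (pt p))" and ?D\<eta> = "frechet_derivative (sec_at p \<eta>) (at (pt p))"
  have b: "bilinear (\<lambda>u v. ?G u v (?F x))" if "x \<in> S" for x
    by (rule M.bilinear_metric_coeff[OF M.chart_at_max loc_map_in[OF that[unfolded S_def] cd(1)]])
  have Gp: "?G u v (cmap ?d (f p)) = g (f p) u v" for u v
    by (simp add: metric_coeff_def M.cinv_cmap M.chart_at_max M.chart_at)
  have G: "((\<lambda>x. ?G u v (?F x)) has_derivative (\<lambda>w. M.dmetric (f p) (?dF w) u v)) (at (pt p))" for u v
    using has_derivative_compose[OF loc_map_at_derivative, of "?G u v"] M.dmetric[of "f p" u v] by simp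
  have 1: "((\<lambda>x. ?G u (sec_at p \<eta> x) (?F x)) has_derivative
      (\<lambda>w. M.dmetric (f p) (?dF w) u (\<eta> p) + g (f p) u (?D\<eta> w))) (at (pt p))" for u
    using has_derivative_linear_apply[where L="\<lambda>x v. ?G u v (?F x)", OF oS _ G[of u] sec_at_derivative[OF assms(4,2)]] b
    by (simp add: Gp bilinear_def)
  have 2: "((\<lambda>x. ?G (sec_at p \<xi> x) (sec_at p \<eta> x) (?F x)) has_derivative
      (\<lambda>w. (M.dmetric (f p) (?dF w) (\<xi> p) (\<eta> p) + g (f p) (\<xi> p) (?D\<eta> w)) + g (f p) (?D\<xi> w) (\<eta> p))) (at (pt p))"
    using has_derivative_linear_apply[where L="\<lambda>x u. ?G u (sec_at p \<eta> x) (?F x)", OF oS _ 1 sec_at_derivative[OF assms(3,2)]] b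
    by (simp add: Gp bilinear_def)
  have 3: "(\<lambda>w. (M.dmetric (f p) (?dF w) (\<xi> p) (\<eta> p) + g (f p) (\<xi> p) (?D\<eta> w)) + g (f p) (?D\<xi> w) (\<eta> p))
    = (\<lambda>v. g (f p) (nabla \<xi> p v) (\<eta> p) + g (f p) (\<xi> p) (nabla \<eta> p v))"
    by (simp add: nabla_eq M.gs M.christoffel_metric[symmetric] algebra_simps)
  show ?thesis
    by (rule has_derivative_transform_within_open[OF 2[unfolded 3] oS]) (use metric_loc[OF cd] in \<open>auto simp: S_def\<close>)
qed

lemma nabla_orthogonal:
  assumes "open W" "p \<in> W" "smooth_along N M f W \<xi>" "smooth_along N M f W \<eta>"
    and "\<And>q. q \<in> W \<Longrightarrow> g (f q) (\<xi> q) (\<eta> q) = 0"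
  shows "g (f p) (nabla \<xi> p v) (\<eta> p) = - g (f p) (\<xi> p) (nabla \<eta> p v)"
proof -
  let ?c = "chart_at N p"
  define S where "S = cmap ?c ` (W \<inter> cdom ?c)"
  have S: "open S" "pt p \<in> S"
    using N.open_cmap_image[OF N.chart_at_max assms(1)] assms(2) N.chart_at by (auto simp: S_def)
  have "((\<lambda>x. g (f (cinv ?c x)) (\<xi> (cinv ?c x)) (\<eta> (cinv ?c x))) has_derivative (\<lambda>_. 0)) (at (pt p))"
    by (rule has_derivative_transform_within_open[OF _ S, of "\<lambda>_. 0"])
       (auto simp: S_def N.cinv_cmap N.chart_at_max assms(5))
  from has_derivative_unique[OF this nabla_metric[OF assms(1-4)]]
  have "g (f p) (nabla \<xi> p v) (\<eta> p) + g (f p) (\<xi> p) (nabla \<eta> p v) = 0" by metis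
  then show ?thesis by simp
qed

text \<open>Leibniz rule along \<open>f\<close>. It makes parallelism of \<sigma>, a condition on
  \<open>M\<close>, usable for sections that exist only along the submanifold.\<close>

lemma nabla_endo:
  assumes "open W" "p \<in> W" "open U" "f p \<in> U" "smooth_endo M U S" "smooth_along N M f W \<xi>"
  shows "nabla (\<lambda>q. blinfun_apply (S (f q)) (\<xi> q)) p v
    = levi_civita_endo M g S (f p) (differential N M f p v) (\<xi> p) + blinfun_apply (S (f p)) (nabla \<xi> p v)"
proof -
  let ?c = "chart_at N p" and ?d = "chart_at M (f p)"
  note cd = N.chart_at(1)[of p] M.chart_at(1)[of "f p"]
  interpret I: smooth_mfd_map M M id by (rule M.smooth_mfd_map_id)
  define L where "L y w = to_chart M ?d (cinv ?d y) (blinfun_apply (S (cinv ?d y)) (from_chart M ?d (cinv ?d y) w))" for y w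
  define y where "y = cmap ?d (f p)"
  define DL where "DL w = frechet_derivative (\<lambda>y. L y w) (at y)" for w
  have Ls: "smooth_on (\<lambda>y. L y w) (cmap ?d ` (U \<inter> cdom ?d))" for w
    using assms(5) cd(2) unfolding smooth_endo_def L_def by blast
  have yU: "y \<in> cmap ?d ` (U \<inter> cdom ?d)" using assms(4) M.chart_at by (auto simp: y_def)
  have DL: "((\<lambda>y. L y w) has_derivative DL w) (at y)" for w
    unfolding DL_def by (rule smooth_onD[OF Ls yU])
  have cy: "cinv ?d y = f p" by (simp add: y_def M.cinv_cmap M.chart_at_max M.chart_at)
  define T where "T = loc_dom ?c ?d (W \<inter> f -` U)"
  have oT: "open T" "pt p \<in> T" unfolding T_def using assms
    by (auto intro!: open_dom_at pt_in open_vimage_map)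
  have lin: "linear (L (loc_map ?c ?d x))" if xT: "x \<in> T" for x
  proof -
    obtain q where q: "q \<in> cdom ?c" "f q \<in> cdom ?d" "x = cmap ?c q"
      using loc_domE[OF xT[unfolded T_def] N.chart_at_max] by metis
    have "linear (to_chart M ?d (f q) \<circ> blinfun_apply (S (f q)) \<circ> from_chart M ?d (f q))"
      by (intro linear_compose M.linear_to_chart M.linear_from_chart M.chart_at_max q
          bounded_linear.linear[OF blinfun.bounded_linear_right])
    then show ?thesis using q
      by (simp add: L_def[abs_def] loc_map_def N.cinv_cmap N.chart_at_max M.cinv_cmap M.chart_at_max o_def)
  qed
  have D1: "((\<lambda>x. L (loc_map ?c ?d x) w) has_derivative (\<lambda>v. DL w (differential N M f p v))) (at (pt p))" for w
    using has_derivative_compose[OF loc_map_at_derivative, of "\<lambda>y. L y w"] DL by (simp add: y_def)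
  have "((\<lambda>x. L (loc_map ?c ?d x) (sec_at p \<xi> x)) has_derivative
      (\<lambda>v. DL (\<xi> p) (differential N M f p v) + blinfun_apply (S (f p)) (frechet_derivative (sec_at p \<xi>) (at (pt p)) v))) (at (pt p))"
    using has_derivative_linear_apply[OF oT lin D1 sec_at_derivative[OF assms(6,2)]]
    by (simp add: y_def[symmetric] L_def cy)
  then have "((\<lambda>x. sec_at p (\<lambda>q. blinfun_apply (S (f q)) (\<xi> q)) x) has_derivative
      (\<lambda>v. DL (\<xi> p) (differential N M f p v) + blinfun_apply (S (f p)) (frechet_derivative (sec_at p \<xi>) (at (pt p)) v))) (at (pt p))"
    by (rule has_derivative_transform_within_open[OF _ oT])
       (auto simp: T_def L_def loc_map_def loc_sec_def N.cinv_cmap N.chart_at_max M.cinv_cmap M.chart_at_max M.from_chart_to_chart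
          elim!: loc_domE[OF _ N.chart_at_max])
  then have 1: "frechet_derivative (sec_at p (\<lambda>q. blinfun_apply (S (f q)) (\<xi> q))) (at (pt p)) v
    = DL (\<xi> p) (differential N M f p v) + blinfun_apply (S (f p)) (frechet_derivative (sec_at p \<xi>) (at (pt p)) v)"
    using sym[OF fun_cong[OF frechet_derivative_at]] by fast
  have 2: "levi_civita M g (\<lambda>q. blinfun_apply (S q) (from_chart M ?d q w)) (f p) u
      = DL w u + christoffel M g (f p) u (blinfun_apply (S (f p)) w)" for w u
    by (simp add: levi_civita_def levi_civita_along_def Let_def DL_def L_def[abs_def] y_def)
  \<comment> \<open>The components of this field are constant in the chart, so only the Christoffel
    term survives.\<close>
  have 3: "levi_civita M g (\<lambda>q. from_chart M ?d q w) (f p) u = christoffel M g (f p) u w" for w u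
  proof -
    have "((\<lambda>x. to_chart M ?d (cinv ?d x) (from_chart M ?d (cinv ?d x) w)) has_derivative (\<lambda>_. 0)) (at y)"
      by (rule has_derivative_transform_within_open[of "\<lambda>_. w" _ _ _ "cmap ?d ` cdom ?d"])
         (use M.chart_at M.chart_at_max in \<open>auto simp: y_def M.to_chart_from_chart M.cinv_cmap M.open_cmap_image' M.open_cdom\<close>)
    from fun_cong[OF frechet_derivative_at[OF this, symmetric], of u] show ?thesis
      by (simp add: levi_civita_def levi_civita_along_def Let_def y_def[symmetric])
  qed
  show ?thesis
    unfolding nabla_eq 1 levi_civita_endo_def Let_def 2 3 by (simp add: blinfun.add_right)
qed

end

section \<open>The second fundamental form\<close>

locale nondeg_submfd = metric_map N M f g
  for N :: "('b::t2_space, 'n::euclidean_space) chart set"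
    and M :: "('a::t2_space, 'm::euclidean_space) chart set" and f and g +
  assumes inj_differential: "inj (differential N M f p)"
    and nondeg_induced: "nondegenerate_on (induced_metric N M g f p) UNIV"
begin

abbreviation df :: "'b \<Rightarrow> 'n \<Rightarrow> 'm" where "df \<equiv> differential N M f"

abbreviation h :: "'b \<Rightarrow> 'n \<Rightarrow> 'n \<Rightarrow> real" where "h \<equiv> induced_metric N M g f"

lemma df_add: "df p (v + w) = df p v + df p w" and df_scale: "df p (r *\<^sub>R v) = r *\<^sub>R df p v"
  and df_diff: "df p (v - w) = df p v - df p w" and df_0: "df p 0 = 0" and df_minus: "df p (- v) = - df p v"
  using linear_differential[of p] linear_add linear_scale linear_diff linear_0 linear_neg by blast+

lemma vector_field_const_coeff: "c \<in> N \<Longrightarrow> vector_field_on N (cdom c) (\<lambda>q. from_chart N c q w)"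
  using smooth_mfd_map.smooth_along_const_coeff[OF N.smooth_mfd_map_id, of c "cdom c" w]
  by (simp add: N.open_cdom N.max_atlasI)

lemma metric_mfd_induced: "metric_mfd N h"
proof unfold_locales
  show "bilinear (h p)" for p
    by (auto intro!: linearI simp: bilinear_def induced_metric_def df_add df_scale M.gs)
  show "h p v w = h p w v" for p v w
    unfolding induced_metric_def by (rule M.sym)
  show "nondegenerate_on (h p) UNIV" for p by (rule nondeg_induced)
  show "smooth_on (metric_coeff N h c u v) (cmap c ` cdom c)" if "c \<in> N" for c u v
  proof -
    note o = N.open_cdom[OF N.max_atlasI[OF that]]
    have "smooth_fun N (cdom c) (\<lambda>q. g (f q) (df q (from_chart N c q u)) (df q (from_chart N c q v)))"
      by (intro smooth_metric smooth_along_differential vector_field_const_coeff that o)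
    from N.smooth_funD[OF this that] show ?thesis
      by (simp add: metric_coeff_def[abs_def] induced_metric_def)
  qed
qed

sublocale H: metric_mfd N h by (rule metric_mfd_induced)

text \<open>The second covariant derivative of \<open>f\<close>, i.e. the ambient derivative of the field along \<open>f\<close> which
  has constant components in the chart at \<open>p\<close>.\<close>

definition hess :: "'b \<Rightarrow> 'n \<Rightarrow> 'n \<Rightarrow> 'm" where
  "hess p v w = frechet_derivative (\<lambda>x. frechet_derivative (loc_map (chart_at N p) (chart_at M (f p))) (at x) w) (at (pt p)) v
     + christoffel M g (f p) (df p v) (df p w)"

lemma df_loc_map: "frechet_derivative (loc_map (chart_at N p) (chart_at M (f p))) (at (pt p)) = df p"
  using frechet_derivative_at[OF loc_map_at_derivative] by simp

lemma smooth_loc_map_at: "smooth_on (loc_map (chart_at N p) (chart_at M (f p))) (loc_dom (chart_at N p) (chart_at M (f p)) W)"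
  by (rule smooth_loc_map[OF N.chart_at(1) M.chart_at(1)])

text \<open>This is torsion-freeness: second partial derivatives commute and the Christoffel symbols
  are symmetric.\<close>

lemma hess_sym: "hess p v w = hess p w v"
  unfolding hess_def
  using symmetric_second_derivative[OF smooth_loc_map_at[of p UNIV] open_dom_at[OF open_UNIV] pt_in[OF UNIV_I], of w v]
    M.christoffel_sym[of "f p" "df p v"] by simp

lemma nabla_differential:
  assumes "open W" "p \<in> W" "vector_field_on N W Y"
  shows "nabla (\<lambda>q. df q (Y q)) p v = hess p v (Y p) + df p (N.dvf Y p v)"
proof -
  let ?c = "chart_at N p" and ?d = "chart_at M (f p)"
  let ?F = "loc_map ?c ?d" and ?Y = "\<lambda>x. to_chart N ?c (cinv ?c x) (Y (cinv ?c x))"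
  define S where "S = loc_dom ?c ?d W"
  have S: "open S" "pt p \<in> S" unfolding S_def by (auto intro!: open_dom_at pt_in assms)
  have Fs: "smooth_on ?F S" unfolding S_def by (rule smooth_loc_map_at)
  have lin: "linear (frechet_derivative ?F (at x))" if "x \<in> S" for x
    by (rule linear_frechet_derivative[OF Fs that])
  have D: "((\<lambda>x. frechet_derivative ?F (at x) w) has_derivative
      frechet_derivative (\<lambda>x. frechet_derivative ?F (at x) w) (at (pt p))) (at (pt p))" for w
    by (rule smooth_onD[OF smooth_on_frechet_derivative[OF Fs] S(2)])
  have "((\<lambda>x. frechet_derivative ?F (at x) (?Y x)) has_derivative
      (\<lambda>v. frechet_derivative (\<lambda>x. frechet_derivative ?F (at x) (Y p)) (at (pt p)) v + df p (N.dvf Y p v))) (at (pt p))"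
    using has_derivative_linear_apply[OF S lin D N.dvf[OF assms(3,2)]] by (simp add: df_loc_map)
  then have "(sec_at p (\<lambda>q. df q (Y q)) has_derivative
      (\<lambda>v. frechet_derivative (\<lambda>x. frechet_derivative ?F (at x) (Y p)) (at (pt p)) v + df p (N.dvf Y p v))) (at (pt p))"
  proof (rule has_derivative_transform_within_open[OF _ S])
    fix x assume "x \<in> S"
    then obtain q where q: "q \<in> cdom ?c" "f q \<in> cdom ?d" "x = cmap ?c q" "cinv ?c x = q"
      using loc_domE[OF _ N.chart_at_max] unfolding S_def by metis
    show "frechet_derivative ?F (at x) (?Y x) = sec_at p (\<lambda>q. df q (Y q)) x"
      using fun_cong[OF frechet_derivative_at[OF differential_has_derivative[OF N.chart_at(1) M.chart_at(1) q(1,2)], symmetric],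
          of "to_chart N ?c q (Y q)"]
      unfolding q(4) loc_sec_def by (simp add: q(3) N.from_chart_to_chart[OF N.chart_at_max q(1)])
  qed
  from fun_cong[OF frechet_derivative_at[OF this, symmetric], of v]
  show ?thesis by (simp add: nabla_eq hess_def algebra_simps)
qed

lemma hess_eq_nabla: "hess p v w = nabla (\<lambda>q. df q (from_chart N (chart_at N p) q w)) p v"
proof -
  have "((\<lambda>x. to_chart N (chart_at N p) (cinv (chart_at N p) x) (from_chart N (chart_at N p) (cinv (chart_at N p) x) w))
      has_derivative (\<lambda>_. 0)) (at (pt p))"
    by (rule has_derivative_transform_within_open[of "\<lambda>_. w" _ _ _ "cmap (chart_at N p) ` cdom (chart_at N p)"])
       (use N.chart_at N.chart_at_max in \<open>auto simp: N.to_chart_from_chart N.cinv_cmap N.open_cmap_image' N.open_cdom\<close>)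
  from fun_cong[OF frechet_derivative_at[OF this, symmetric], of v]
  have "N.dvf (\<lambda>q. from_chart N (chart_at N p) q w) p v = 0" by (simp add: N.dvf_def)
  then show ?thesis
    using nabla_differential[OF N.open_cdom[OF N.chart_at_max] N.chart_at(2) vector_field_const_coeff[OF N.chart_at(1)], of p w v]
    by (simp add: df_0)
qed

lemma linear_hess: "linear (\<lambda>v. hess p v w)" "linear (hess p v)"
proof -
  show 1: "linear (\<lambda>v. hess p v w)" for w
    unfolding hess_eq_nabla[abs_def]
    by (rule linear_nabla[OF smooth_along_differential[OF N.open_cdom[OF N.chart_at_max] vector_field_const_coeff[OF N.chart_at(1)]] N.chart_at(2)])
  have "hess p v = (\<lambda>w. hess p w v)" using hess_sym by blast
  then show "linear (hess p v)" using 1[of v] by metis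
qed

text \<open>The tangential part of \<open>hess\<close> is symmetric and compatible with the induced
  metric. The Koszul formula determines such an object, so it is the Levi-Civita connection of the
  submanifold.\<close>

lemma gauss: "g (f p) (hess p v w) (df p z) = h p (christoffel N h p v w) z"
proof -
  let ?c = "chart_at N p"
  define E where "E w q = df q (from_chart N ?c q w)" for w q
  have Es: "smooth_along N M f (cdom ?c) (E w)" for w
    unfolding E_def by (rule smooth_along_differential[OF N.open_cdom[OF N.chart_at_max] vector_field_const_coeff[OF N.chart_at(1)]])
  have Ep: "E w p = df p w" for w by (simp add: E_def)
  have dm: "H.dmetric p v w z = g (f p) (hess p v w) (df p z) + g (f p) (df p w) (hess p v z)" for v w z
  proof -
    have "metric_coeff N h ?c w z = (\<lambda>x. g (f (cinv ?c x)) (E w (cinv ?c x)) (E z (cinv ?c x)))"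
      by (simp add: metric_coeff_def[abs_def] E_def induced_metric_def)
    then have "(metric_coeff N h ?c w z has_derivative (\<lambda>v. g (f p) (hess p v w) (df p z) + g (f p) (df p w) (hess p v z))) (at (pt p))"
      using nabla_metric[OF N.open_cdom[OF N.chart_at_max] N.chart_at(2) Es[of w] Es[of z]]
      by (simp add: Ep hess_eq_nabla E_def[abs_def])
    from has_derivative_unique[OF this H.dmetric] show ?thesis by metis
  qed
  \<comment> \<open>Each derivative of the induced metric is a sum of two values of
    \<open>T\<close>. By symmetry of \<open>T\<close> in its first two arguments, all but
    \<open>2 * T v w z\<close> cancels in the Koszul combination.\<close>
  define T where "T v w z = g (f p) (hess p v w) (df p z)" for v w z
  have "H.dmetric p v w z = T v w z + T v z w" for v w z
    using dm M.sym[of "f p" "df p w" "hess p v z"] by (simp add: T_def)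
  moreover have "T w v z = T v w z" "T z v w = T v z w" "T z w v = T w z v"
    unfolding T_def using hess_sym[of p] by auto
  ultimately have "h p (christoffel N h p v w) z = T v w z"
    using H.christoffel[of p v w z] by simp
  then show ?thesis by (simp add: T_def)
qed

text \<open>Value of the second fundamental form on vectors instead of fields. It is a bilinear form
  on each tangent space, which allows the assertions of the theorem to be compared point by
  point.\<close>

definition sff :: "'b \<Rightarrow> 'n \<Rightarrow> 'n \<Rightarrow> 'm" where
  "sff p v w = hess p v w - df p (christoffel N h p v w)"

lemma sff_sym: "sff p v w = sff p w v"
  unfolding sff_def using hess_sym H.christoffel_sym by metis

lemma sff_normal: "sff p v w \<in> normal_space N M g f p"
  unfolding normal_space_def sff_def using gauss by (simp add: M.gs induced_metric_def)

lemma normal_df: "\<xi> \<in> normal_space N M g f p \<Longrightarrow> g (f p) \<xi> (df p v) = 0"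
  "\<xi> \<in> normal_space N M g f p \<Longrightarrow> g (f p) (df p v) \<xi> = 0"
  unfolding normal_space_def using M.sym by auto

lemma sff_hess: "\<xi> \<in> normal_space N M g f p \<Longrightarrow> g (f p) (sff p v w) \<xi> = g (f p) (hess p v w) \<xi>"
  unfolding sff_def by (simp add: M.gs normal_df)

lemma second_fundamental_form_eq:
  assumes "open W" "p \<in> W" "vector_field_on N W Y"
  shows "second_fundamental_form N M g f X Y p = sff p (X p) (Y p)"
proof -
  have "levi_civita N h Y p (X p) = N.dvf Y p (X p) + christoffel N h p (X p) (Y p)"
    by (simp add: levi_civita_def levi_civita_along_def Let_def N.dvf_def)
  then show ?thesis
    using nabla_differential[OF assms, of "X p"]
    by (simp add: second_fundamental_form_def sff_def df_add)
qed

lemma nabla_split: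
  assumes "open W" "p \<in> W" "vector_field_on N W Y"
  shows "nabla (\<lambda>q. df q (Y q)) p v = sff p v (Y p) + df p (N.dvf Y p v + christoffel N h p v (Y p))"
  using nabla_differential[OF assms, of v] by (simp add: sff_def df_add)

text \<open>The Weingarten condition says exactly that inner products with tangent vectors cancel,
  and non-degeneracy of \<open>h\<close> gives one and only one such vector.\<close>

lemma shape_operator: "h p (shape_operator N M g f \<xi> X p) z = - g (f p) (nabla \<xi> p (X p)) (df p z)"
proof -
  have lin: "linear (\<lambda>z. - g (f p) (nabla \<xi> p (X p)) (df p z))"
    by (auto intro!: linearI simp: df_add df_scale M.gs)
  have "\<exists>!a. a \<in> UNIV \<and> (\<forall>z\<in>UNIV. h p a z = - g (f p) (nabla \<xi> p (X p)) (df p z))"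
    by (rule nondegenerate_riesz[OF H.bil subspace_UNIV H.nondeg lin])
  moreover have "(nabla \<xi> p (X p) + df p a \<in> normal_space N M g f p) \<longleftrightarrow>
      (\<forall>z. h p a z = - g (f p) (nabla \<xi> p (X p)) (df p z))" for a
    by (auto simp: normal_space_def induced_metric_def M.gs add_eq_0_iff)
  ultimately have "\<exists>!a. nabla \<xi> p (X p) + df p a \<in> normal_space N M g f p"
    by simp
  from theI'[OF this] show ?thesis
    unfolding shape_operator_def by (simp add: normal_space_def induced_metric_def M.gs add_eq_0_iff)
qed

end

section \<open>Total differential equations and the Frobenius theorem\<close>

text \<open>A Gronwall estimate without exponentials: on an interval of length 1 with growth rate
  1/2, the maximum of the norm is at most half of itself plus \<open>c\<close>. The constants of the
  following estimates are scaled to this rate.\<close>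

lemma curve_bound:
  fixes \<phi> :: "real \<Rightarrow> 'e::real_normed_vector"
  assumes "\<phi> 0 = 0" and d: "\<And>t. t \<in> {0..1} \<Longrightarrow> (\<phi> has_vector_derivative \<phi>' t) (at t within {0..1})"
    and b: "\<And>t. t \<in> {0..1} \<Longrightarrow> norm (\<phi>' t) \<le> norm (\<phi> t) / 2 + c" and t: "t \<in> {0..1}"
  shows "norm (\<phi> t) \<le> 2 * c"
proof -
  have "continuous_on {0..1} \<phi>"
    using d has_vector_derivative_continuous continuous_on_eq_continuous_within by blast
  then have "continuous_on {0..1} (\<lambda>t. norm (\<phi> t))" by (intro continuous_intros)
  then obtain s where s: "s \<in> {0..1}" "\<And>t. t \<in> {0..1} \<Longrightarrow> norm (\<phi> t) \<le> norm (\<phi> s)"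
    using continuous_attains_sup[of "{0..1::real}" "\<lambda>t. norm (\<phi> t)"] by auto
  define B where "B = norm (\<phi> s) / 2 + c"
  have B: "norm (\<phi>' t) \<le> B" if "t \<in> {0..1}" for t
    using b[OF that] s(2)[OF that] by (simp add: B_def)
  then have B0: "0 \<le> B" using norm_ge_zero order_trans s(1) by blast
  have "norm (\<phi> s - \<phi> 0) \<le> B * norm (s - 0)"
  proof (rule differentiable_bound[where S="{0..1}" and f'="\<lambda>t h. h *\<^sub>R \<phi>' t"])
    show "(\<phi> has_derivative (\<lambda>h. h *\<^sub>R \<phi>' t)) (at t within {0..1})" if "t \<in> {0..1}" for t
      using d[OF that] by (simp add: has_vector_derivative_def)
    show "onorm (\<lambda>h. h *\<^sub>R \<phi>' t) \<le> B" if "t \<in> {0..1}" for t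
      using mult_left_mono[OF B[OF that] abs_ge_zero] by (intro onorm_le) (simp add: mult.commute[of B])
  qed (use s in auto)
  also have "\<dots> \<le> B" using s(1) B0 by (simp add: mult_left_le)
  finally have "norm (\<phi> s) \<le> 2 * c" using assms(1) by (simp add: B_def)
  then show ?thesis using s(2)[OF t] by simp
qed

text \<open>A bound on the finitely many basis vectors is a bound of the operator norm. The weight
  \<open>n\<close> and the free index type serve points, pairs of points and pairs of a point and a
  direction alike.\<close>

lemma uniform_bound_linear:
  fixes E :: "'z \<Rightarrow> 'e::euclidean_space \<Rightarrow> 'f::real_normed_vector"
  assumes lin: "\<And>z. z \<in> Z \<Longrightarrow> linear (E z)" and n: "\<And>z. z \<in> Z \<Longrightarrow> 0 \<le> n z"
    and b: "\<And>b. b \<in> Basis \<Longrightarrow> \<exists>C. \<forall>z\<in>Z. norm (E z b) \<le> C * n z"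
  obtains C where "C \<ge> 0" "\<And>z v. z \<in> Z \<Longrightarrow> norm (E z v) \<le> C * n z * norm v"
proof -
  obtain C where C: "\<And>b z. b \<in> Basis \<Longrightarrow> z \<in> Z \<Longrightarrow> norm (E z b) \<le> C b * n z" using b by metis
  define D where "D = (\<Sum>b\<in>(Basis::'e set). \<bar>C b\<bar>)"
  have "norm (E z v) \<le> D * n z * norm v" if z: "z \<in> Z" for z v
  proof -
    have "norm (E z v) = norm (\<Sum>b\<in>Basis. (v \<bullet> b) *\<^sub>R E z b)"
      using linear_basis_expand[OF lin[OF z], of v] by simp
    also have "\<dots> \<le> (\<Sum>b\<in>Basis. norm ((v \<bullet> b) *\<^sub>R E z b))" by (rule norm_sum)
    also have "\<dots> \<le> (\<Sum>b\<in>Basis. norm v * (\<bar>C b\<bar> * n z))"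
    proof (rule sum_mono)
      fix b :: 'e assume b: "b \<in> Basis"
      have "norm (E z b) \<le> \<bar>C b\<bar> * n z"
        using C[OF b z] n[OF z] by (smt (verit) mult_right_mono)
      then show "norm ((v \<bullet> b) *\<^sub>R E z b) \<le> norm v * (\<bar>C b\<bar> * n z)"
        using Basis_le_norm[OF b, of v] by (simp add: mult_mono)
    qed
    also have "\<dots> = D * n z * norm v" by (simp add: D_def sum_distrib_right sum_distrib_left mult_ac)
    finally show ?thesis .
  qed
  moreover have "D \<ge> 0" by (simp add: D_def sum_nonneg)
  ultimately show ?thesis using that by blast
qed

lemma continuous_bounded_on:
  fixes f :: "'e::topological_space \<Rightarrow> 'f::real_normed_vector"
  assumes "compact K" "continuous_on K f"
  shows "\<exists>C. \<forall>y\<in>K. norm (f y) \<le> C"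
  using compact_imp_bounded[OF compact_continuous_image[OF assms(2,1)]] by (auto simp: bounded_iff)

lemma smooth_derivative_bound:
  fixes f :: "'e::euclidean_space \<Rightarrow> 'f::real_normed_vector"
  assumes "compact K" "K \<subseteq> S" "smooth_on f S"
  obtains C where "C \<ge> 0" "\<And>y v. y \<in> K \<Longrightarrow> norm (frechet_derivative f (at y) v) \<le> C * norm v"
proof (rule uniform_bound_linear[of K "\<lambda>y. frechet_derivative f (at y)" "\<lambda>_. 1"])
  show "linear (frechet_derivative f (at y))" if "y \<in> K" for y
    using linear_frechet_derivative[OF assms(3)] assms(2) that by blast
  show "\<exists>C. \<forall>y\<in>K. norm (frechet_derivative f (at y) b) \<le> C * 1" for b
    using continuous_bounded_on[OF assms(1) continuous_on_subset[OF smooth_on_imp_continuous[OF smooth_on_frechet_derivative[OF assms(3)]] assms(2)]]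
    by simp
qed (use that in auto)

lemma smooth_lipschitz:
  fixes f :: "'e::euclidean_space \<Rightarrow> 'f::real_normed_vector"
  assumes "compact K" "convex K" "K \<subseteq> S" "smooth_on f S"
  obtains C where "C \<ge> 0" "\<And>y z. y \<in> K \<Longrightarrow> z \<in> K \<Longrightarrow> norm (f z - f y) \<le> C * norm (z - y)"
proof -
  obtain C where C: "C \<ge> 0" "\<And>y v. y \<in> K \<Longrightarrow> norm (frechet_derivative f (at y) v) \<le> C * norm v"
    using smooth_derivative_bound[OF assms(1,3,4)] by metis
  have "norm (f z - f y) \<le> C * norm (z - y)" if "y \<in> K" "z \<in> K" for y z
  proof (rule differentiable_bound[OF assms(2) _ _ that(2,1)])
    show "(f has_derivative frechet_derivative f (at x)) (at x within K)" if "x \<in> K" for x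
      using smooth_onD[OF assms(4)] assms(3) that has_derivative_at_withinI by blast
    show "onorm (frechet_derivative f (at x)) \<le> C" if "x \<in> K" for x
      using C(2)[OF that] by (intro onorm_le) simp
  qed
  then show ?thesis using that C(1) by blast
qed

text \<open>The derivative is Lipschitz on the compact convex set, so along the segment from
  \<open>y\<close> to \<open>z\<close> it deviates from its value at \<open>y\<close> by a multiple
  of the distance.\<close>

lemma smooth_taylor_bound:
  fixes f :: "'e::euclidean_space \<Rightarrow> 'f::real_normed_vector"
  assumes K: "compact K" "convex K" "K \<subseteq> S" and f: "smooth_on f S"
  shows "\<exists>C. \<forall>y\<in>K. \<forall>z\<in>K. norm (f z - f y - frechet_derivative f (at y) (z - y)) \<le> C * (norm (z - y))\<^sup>2"
proof -
  define E where "E = (\<lambda>(y, z) v. frechet_derivative f (at z) v - frechet_derivative f (at y) v)"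
  have "\<exists>C. \<forall>yz\<in>K \<times> K. norm (E yz b) \<le> C * norm (snd yz - fst yz)" for b
  proof -
    obtain C where "\<And>y z. y \<in> K \<Longrightarrow> z \<in> K \<Longrightarrow>
        norm (frechet_derivative f (at z) b - frechet_derivative f (at y) b) \<le> C * norm (z - y)"
      using smooth_lipschitz[OF K smooth_on_frechet_derivative[OF f]] by metis
    then show ?thesis by (auto simp: E_def)
  qed
  moreover have "linear (E yz)" if "yz \<in> K \<times> K" for yz
    using that K(3) linear_frechet_derivative[OF f] unfolding E_def
    by (auto intro!: linear_compose_sub)
  ultimately obtain C where C: "C \<ge> 0" "\<And>yz v. yz \<in> K \<times> K \<Longrightarrow> norm (E yz v) \<le> C * norm (snd yz - fst yz) * norm v"
    using uniform_bound_linear[of "K \<times> K" E "\<lambda>yz. norm (snd yz - fst yz)"] by (metis norm_ge_zero)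
  have "norm (f z - f y - frechet_derivative f (at y) (z - y)) \<le> C * (norm (z - y))\<^sup>2" if yz: "y \<in> K" "z \<in> K" for y z
  proof -
    let ?S = "closed_segment y z"
    have SK: "?S \<subseteq> K" using yz K(2) closed_segment_subset by blast
    have "norm (f z - f y - frechet_derivative f (at y) (z - y)) \<le> norm (z - y) * (C * norm (z - y))"
    proof (rule differentiable_bound_linearization[where S="?S"])
      show "y + t *\<^sub>R (z - y) \<in> ?S" if "t \<in> {0..1}" for t
        using that by (auto simp: closed_segment_def algebra_simps intro!: exI[of _ t])
      show "(f has_derivative frechet_derivative f (at x)) (at x within ?S)" if "x \<in> ?S" for x
        using smooth_onD[OF f] SK K(3) that has_derivative_at_withinI by blast
      show "onorm (frechet_derivative f (at x) - frechet_derivative f (at y)) \<le> C * norm (z - y)" if "x \<in> ?S" for x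
      proof (rule onorm_le)
        fix v
        have "norm ((frechet_derivative f (at x) - frechet_derivative f (at y)) v) \<le> C * norm (x - y) * norm v"
          using C(2)[of "(y, x)" v] yz SK that by (auto simp: E_def)
        also have "\<dots> \<le> C * norm (z - y) * norm v"
          using segment_bound(1)[OF that] C(1)
          by (intro mult_right_mono mult_left_mono) (auto simp: norm_minus_commute)
        finally show "norm ((frechet_derivative f (at x) - frechet_derivative f (at y)) v) \<le> C * norm (z - y) * norm v" .
      qed
    qed auto
    then show ?thesis by (simp add: power2_eq_square mult_ac)
  qed
  then show ?thesis by blast
qed

text \<open>The equation to be solved is \<open>X' = G(X)\<close> with \<open>X 0 = x0\<close>, for
  a map of a vector variable. \<open>compat\<close> is its integrability condition: it states the
  symmetry of the second derivative that a solution would have.\<close>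

locale total_differential =
  fixes G :: "'e::euclidean_space \<Rightarrow> 'e \<Rightarrow> 'e" and \<Omega> :: "'e set" and x0 :: 'e
  assumes open_dom: "open \<Omega>" and x0: "x0 \<in> \<Omega>" and lin: "x \<in> \<Omega> \<Longrightarrow> linear (G x)"
    and smooth: "smooth_on (\<lambda>x. G x v) \<Omega>"
    and compat: "x \<in> \<Omega> \<Longrightarrow> frechet_derivative (\<lambda>y. G y w) (at x) (G x v) = frechet_derivative (\<lambda>y. G y v) (at x) (G x w)"
begin

lemma local_bounds:
  obtains \<rho> C where "\<rho> > 0" "C > 0" "cball x0 \<rho> \<subseteq> \<Omega>"
    "\<And>y v. y \<in> cball x0 \<rho> \<Longrightarrow> norm (G y v) \<le> C * norm v"
    "\<And>y z v. y \<in> cball x0 \<rho> \<Longrightarrow> z \<in> cball x0 \<rho> \<Longrightarrow> norm (G z v - G y v) \<le> C * norm (z - y) * norm v"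
    "\<And>y k v. y \<in> cball x0 \<rho> \<Longrightarrow> norm (frechet_derivative (\<lambda>y. G y v) (at y) k) \<le> C * norm k * norm v"
    "\<And>y z v. y \<in> cball x0 \<rho> \<Longrightarrow> z \<in> cball x0 \<rho> \<Longrightarrow>
      norm (G z v - G y v - frechet_derivative (\<lambda>y. G y v) (at y) (z - y)) \<le> C * (norm (z - y))\<^sup>2 * norm v"
proof -
  obtain \<rho> where \<rho>: "\<rho> > 0" "cball x0 \<rho> \<subseteq> \<Omega>" using open_dom x0 open_contains_cball by blast
  let ?K = "cball x0 \<rho>" and ?D = "\<lambda>y v k. frechet_derivative (\<lambda>y. G y v) (at y) k"
  have linD: "linear (\<lambda>v. ?D y v k)" if "y \<in> ?K" for y k
  proof (rule linearI)
    have y: "y \<in> \<Omega>" using that \<rho> by blast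
    note D = smooth_onD[OF smooth y]
    have "((\<lambda>x. G x (a + b)) has_derivative (\<lambda>k. ?D y a k + ?D y b k)) (at y)" for a b
      by (rule has_derivative_transform_within_open[OF has_derivative_add[OF D D] open_dom y])
         (simp add: lin linear_add)
    from fun_cong[OF frechet_derivative_at[OF this, symmetric]]
    show "?D y (a + b) k = ?D y a k + ?D y b k" for a b .
    have "((\<lambda>x. G x (r *\<^sub>R b)) has_derivative (\<lambda>k. r *\<^sub>R ?D y b k)) (at y)" for r b
      by (rule has_derivative_transform_within_open[OF has_derivative_scaleR_right[OF D] open_dom y])
         (simp add: lin linear_scale)
    from fun_cong[OF frechet_derivative_at[OF this, symmetric]]
    show "?D y (r *\<^sub>R b) k = r *\<^sub>R ?D y b k" for r b .
  qed
  have linG: "linear (G y)" if "y \<in> ?K" for y using lin \<rho> that by blast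
  have K: "compact ?K" "convex ?K" by auto
  obtain C1 where C1: "C1 \<ge> 0" "\<And>y v. y \<in> ?K \<Longrightarrow> norm (G y v) \<le> C1 * 1 * norm v"
  proof (rule uniform_bound_linear[of ?K G "\<lambda>_. 1"])
    show "\<exists>C. \<forall>z\<in>?K. norm (G z b) \<le> C * 1" for b
      using continuous_bounded_on[OF K(1) continuous_on_subset[OF smooth_on_imp_continuous[OF smooth] \<rho>(2)], of b] by simp
  qed (use linG in auto)
  obtain C2 where C2: "C2 \<ge> 0" "\<And>yz v. yz \<in> ?K \<times> ?K \<Longrightarrow> norm (G (snd yz) v - G (fst yz) v) \<le> C2 * norm (snd yz - fst yz) * norm v"
  proof (rule uniform_bound_linear[of "?K \<times> ?K" "\<lambda>yz v. G (snd yz) v - G (fst yz) v" "\<lambda>yz. norm (snd yz - fst yz)"])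
    show "\<exists>C. \<forall>yz\<in>?K \<times> ?K. norm (G (snd yz) b - G (fst yz) b) \<le> C * norm (snd yz - fst yz)" for b
    proof -
      obtain C where "\<And>y z. y \<in> ?K \<Longrightarrow> z \<in> ?K \<Longrightarrow> norm (G z b - G y b) \<le> C * norm (z - y)"
        using smooth_lipschitz[OF K \<rho>(2) smooth] by metis
      then show ?thesis by (intro exI[of _ C]) auto
    qed
  qed (use linG in \<open>auto intro!: linear_compose_sub\<close>)
  obtain C3 where C3: "C3 \<ge> 0" "\<And>yk v. yk \<in> ?K \<times> UNIV \<Longrightarrow> norm (?D (fst yk) v (snd yk)) \<le> C3 * norm (snd yk) * norm v"
  proof (rule uniform_bound_linear[of "?K \<times> UNIV" "\<lambda>yk v. ?D (fst yk) v (snd yk)" "\<lambda>yk. norm (snd yk)"])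
    show "\<exists>C. \<forall>yk\<in>?K \<times> UNIV. norm (?D (fst yk) b (snd yk)) \<le> C * norm (snd yk)" for b
    proof -
      obtain C where "\<And>y v. y \<in> ?K \<Longrightarrow> norm (?D y b v) \<le> C * norm v"
        using smooth_derivative_bound[OF K(1) \<rho>(2) smooth] by metis
      then show ?thesis by (intro exI[of _ C]) auto
    qed
  qed (use linD in auto)
  obtain C4 where C4: "C4 \<ge> 0" "\<And>yz v. yz \<in> ?K \<times> ?K \<Longrightarrow>
      norm (G (snd yz) v - G (fst yz) v - ?D (fst yz) v (snd yz - fst yz)) \<le> C4 * (norm (snd yz - fst yz))\<^sup>2 * norm v"
  proof (rule uniform_bound_linear[of "?K \<times> ?K" "\<lambda>yz v. G (snd yz) v - G (fst yz) v - ?D (fst yz) v (snd yz - fst yz)"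
        "\<lambda>yz. (norm (snd yz - fst yz))\<^sup>2"])
    show "\<exists>C. \<forall>yz\<in>?K \<times> ?K. norm (G (snd yz) b - G (fst yz) b - ?D (fst yz) b (snd yz - fst yz)) \<le> C * (norm (snd yz - fst yz))\<^sup>2" for b
    proof -
      obtain C where "\<And>y z. y \<in> ?K \<Longrightarrow> z \<in> ?K \<Longrightarrow> norm (G z b - G y b - ?D y b (z - y)) \<le> C * (norm (z - y))\<^sup>2"
        using smooth_taylor_bound[OF K \<rho>(2) smooth] by metis
      then show ?thesis by (intro exI[of _ C]) auto
    qed
  qed (use linG linD in \<open>auto intro!: linear_compose_sub\<close>)
  define C where "C = C1 + C2 + C3 + C4 + 1"
  have C: "C > 0" "C1 \<le> C" "C2 \<le> C" "C3 \<le> C" "C4 \<le> C" using C1(1) C2(1) C3(1) C4(1) by (auto simp: C_def)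
  show ?thesis
  proof (rule that[OF \<rho>(1) C(1) \<rho>(2)])
    show "norm (G y v) \<le> C * norm v" if "y \<in> ?K" for y v
      using C1(2)[OF that, of v] C(2) by (smt (verit) mult_right_mono norm_ge_zero mult_cancel_left2)
    show "norm (G z v - G y v) \<le> C * norm (z - y) * norm v" if "y \<in> ?K" "z \<in> ?K" for y z v
    proof -
      have "norm (G z v - G y v) \<le> C2 * norm (z - y) * norm v" using C2(2)[of "(y, z)" v] that by simp
      also have "\<dots> \<le> C * norm (z - y) * norm v" using C(3) by (intro mult_right_mono) auto
      finally show ?thesis .
    qed
    show "norm (?D y v k) \<le> C * norm k * norm v" if "y \<in> ?K" for y k v
    proof -
      have "norm (?D y v k) \<le> C3 * norm k * norm v" using C3(2)[of "(y, k)" v] that by simp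
      also have "\<dots> \<le> C * norm k * norm v" using C(4) by (intro mult_right_mono) auto
      finally show ?thesis .
    qed
    show "norm (G z v - G y v - ?D y v (z - y)) \<le> C * (norm (z - y))\<^sup>2 * norm v" if "y \<in> ?K" "z \<in> ?K" for y z v
    proof -
      have "norm (G z v - G y v - ?D y v (z - y)) \<le> C4 * (norm (z - y))\<^sup>2 * norm v" using C4(2)[of "(y, z)" v] that by simp
      also have "\<dots> \<le> C * (norm (z - y))\<^sup>2 * norm v" using C(5) by (intro mult_right_mono) auto
      finally show ?thesis .
    qed
  qed
qed

text \<open>The equations on all rays are solved simultaneously, as one fixed point problem for
  continuous functions of \<xi>. \<open>C * \<delta> \<le> \<rho>\<close> keeps the values in the
  ball where the bounds hold, and \<open>C * \<delta> \<le> 1 / 2\<close> makes the integral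
  operator a contraction.\<close>

lemma solution_exists:
  assumes \<rho>: "\<rho> > 0" "cball x0 \<rho> \<subseteq> \<Omega>" and C: "C > 0" and \<delta>: "\<delta> > 0" "C * \<delta> \<le> \<rho>" "C * \<delta> \<le> 1 / 2"
    and Gb: "\<And>y v. y \<in> cball x0 \<rho> \<Longrightarrow> norm (G y v) \<le> C * norm v"
    and Gl: "\<And>y z v. y \<in> cball x0 \<rho> \<Longrightarrow> z \<in> cball x0 \<rho> \<Longrightarrow> norm (G z v - G y v) \<le> C * norm (z - y) * norm v"
  obtains X where "\<And>\<xi>. X \<xi> \<in> cball x0 \<rho>" "X 0 = x0"
    "\<And>\<xi> s. \<xi> \<in> cball 0 \<delta> \<Longrightarrow> s \<in> {0..1} \<Longrightarrow>
      ((\<lambda>s. X (s *\<^sub>R \<xi>)) has_vector_derivative G (X (s *\<^sub>R \<xi>)) \<xi>) (at s within {0..1})"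
proof -
  let ?K = "cball x0 \<rho>"
  \<comment> \<open>Nearest-point projections in values and arguments make the operator act on
    bounded continuous functions on the whole space. Both are the identity where the solution is
    needed.\<close>
  define pr where "pr = closest_point ?K"
  define \<kappa> where "\<kappa> = closest_point (cball (0::'e) \<delta>)"
  have K: "convex ?K" "closed ?K" "?K \<noteq> {}" using \<rho> by auto
  have B: "convex (cball (0::'e) \<delta>)" "closed (cball (0::'e) \<delta>)" "cball (0::'e) \<delta> \<noteq> {}" using \<delta> by auto
  have prK: "pr y \<in> ?K" for y unfolding pr_def by (rule closest_point_in_set[OF K(2,3)])
  have pr_lip: "norm (pr y - pr z) \<le> norm (y - z)" for y z
    using closest_point_lipschitz[OF K, of y z] by (simp add: pr_def dist_norm)
  have pr_id: "pr y = y" if "y \<in> ?K" for y unfolding pr_def by (rule closest_point_self[OF that])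
  have \<kappa>B: "norm (\<kappa> \<xi>) \<le> \<delta>" for \<xi> using closest_point_in_set[OF B(2,3), of \<xi>] by (simp add: \<kappa>_def)
  have \<kappa>_id: "\<kappa> \<xi> = \<xi>" if "\<xi> \<in> cball 0 \<delta>" for \<xi> unfolding \<kappa>_def by (rule closest_point_self[OF that])
  have \<kappa>c: "continuous_on UNIV \<kappa>" unfolding \<kappa>_def by (rule continuous_on_closest_point[OF B])
  have prc: "continuous_on UNIV pr" unfolding pr_def by (rule continuous_on_closest_point[OF K])
  have Gc: "continuous_on S (\<lambda>z. G (pr (a z)) (b z))"
    if a: "continuous_on S a" and b: "continuous_on S b" for S :: "'z::metric_space set" and a b
  proof -
    have e: "G (pr (a z)) (b z) = (\<Sum>k\<in>Basis. (b z \<bullet> k) *\<^sub>R G (pr (a z)) k)" for z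
      by (rule linear_basis_expand[OF lin]) (use prK \<rho> in blast)
    have "continuous_on S (\<lambda>z. pr (a z))" by (rule continuous_on_compose2[OF prc a]) auto
    then have "continuous_on S (\<lambda>z. G (pr (a z)) k)" for k
      by (rule continuous_on_compose2[OF smooth_on_imp_continuous[OF smooth]]) (use prK \<rho> in blast)
    then show ?thesis unfolding e by (intro continuous_intros b)
  qed
  define F where "F u \<xi> t = G (pr (u (t *\<^sub>R \<kappa> \<xi>))) (\<kappa> \<xi>)" for u \<xi> and t :: real
  have Fc: "continuous_on (UNIV \<times> cbox 0 1) (\<lambda>(\<xi>, t). F u \<xi> t)" if u: "continuous_on UNIV u" for u
  proof -
    have k: "continuous_on (UNIV \<times> cbox 0 (1::real)) (\<lambda>z. \<kappa> (fst z))"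
      by (rule continuous_on_compose2[OF \<kappa>c continuous_on_fst[OF continuous_on_id]]) auto
    have "continuous_on (UNIV \<times> cbox 0 1) (\<lambda>z. u (snd z *\<^sub>R \<kappa> (fst z)))"
      by (rule continuous_on_compose2[OF u continuous_on_scaleR[OF continuous_on_snd[OF continuous_on_id] k]]) auto
    from Gc[OF this k] show ?thesis by (simp add: F_def split_beta)
  qed
  have Ft: "continuous_on {0..1} (F u \<xi>)" if u: "continuous_on UNIV u" for u \<xi>
    unfolding F_def by (rule Gc) (auto intro!: continuous_intros continuous_on_compose2[OF u])
  have Fb: "norm (F u \<xi> t) \<le> C * \<delta>" for u \<xi> t
    using order_trans[OF Gb[OF prK] mult_left_mono[OF \<kappa>B]] C by (simp add: F_def)
  define T where "T u \<xi> = x0 + integral {0..1} (F u \<xi>)" for u \<xi>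
  have Tc: "continuous_on UNIV (T u)" if "continuous_on UNIV u" for u
    unfolding T_def using integral_continuous_on_param[OF Fc[OF that]] by (intro continuous_intros) simp
  have Tb: "norm (T u \<xi> - x0) \<le> C * \<delta>" if "continuous_on UNIV u" for u \<xi>
    using integral_bound[of 0 1 "F u \<xi>" "C * \<delta>"] Ft[OF that] Fb by (simp add: T_def)
  have Tbc: "T (apply_bcontfun u) \<in> bcontfun" for u
  proof (rule bcontfun_normI[OF Tc])
    show "norm (T (apply_bcontfun u) \<xi>) \<le> C * \<delta> + norm x0" for \<xi>
      using Tb[OF continuous_on_apply_bcontfun, of u \<xi>] norm_triangle_sub[of "T (apply_bcontfun u) \<xi>" x0] by simp
  qed simp
  have app: "apply_bcontfun (Bcontfun (T (apply_bcontfun u))) = T (apply_bcontfun u)" for u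
    using Tbc Bcontfun_inverse by blast
  have "\<exists>!u. Bcontfun (T (apply_bcontfun u)) = u"
  proof (rule banach_fix_type[of "1 / 2"])
    show "\<forall>u w. dist (Bcontfun (T (apply_bcontfun u))) (Bcontfun (T (apply_bcontfun w))) \<le> 1 / 2 * dist u w"
    proof (intro allI dist_bound)
      fix u w :: "'e \<Rightarrow>\<^sub>C 'e" and \<xi> :: 'e
      have d: "norm (F u \<xi> t - F w \<xi> t) \<le> C * \<delta> * dist u w" for t
      proof -
        have "norm (F u \<xi> t - F w \<xi> t) \<le> C * norm (pr (u (t *\<^sub>R \<kappa> \<xi>)) - pr (w (t *\<^sub>R \<kappa> \<xi>))) * norm (\<kappa> \<xi>)"
          unfolding F_def by (rule Gl[OF prK prK])
        also have "\<dots> \<le> C * dist u w * \<delta>"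
        proof -
          have "norm (pr (u y) - pr (w y)) \<le> dist u w" for y
            using order_trans[OF pr_lip[of "u y" "w y"]] dist_bounded[of u y w]
            by (simp only: dist_norm[of "u y" "w y"])
          then show ?thesis using C \<kappa>B by (intro mult_mono mult_left_mono) auto
        qed
        finally show ?thesis by (simp add: mult_ac)
      qed
      have "T u \<xi> - T w \<xi> = integral {0..1} (\<lambda>t. F u \<xi> t - F w \<xi> t)"
        using integral_diff[OF integrable_continuous_real[OF Ft] integrable_continuous_real[OF Ft], of u w \<xi> \<xi>]
        by (simp add: T_def)
      then have "norm (T u \<xi> - T w \<xi>) \<le> C * \<delta> * dist u w"
        using integral_bound[of 0 1 "\<lambda>t. F u \<xi> t - F w \<xi> t" "C * \<delta> * dist u w"] d
        by (simp add: continuous_on_diff Ft)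
      also have "\<dots> \<le> 1 / 2 * dist u w" using \<delta>(3) by (intro mult_right_mono) auto
      finally show "dist (apply_bcontfun (Bcontfun (T (apply_bcontfun u))) \<xi>) (apply_bcontfun (Bcontfun (T (apply_bcontfun w))) \<xi>) \<le> 1 / 2 * dist u w"
        by (simp add: app dist_norm)
    qed
  qed auto
  then obtain u where "Bcontfun (T (apply_bcontfun u)) = u" by blast
  then have fp: "apply_bcontfun u \<xi> = T (apply_bcontfun u) \<xi>" for \<xi> using app by metis
  define X where "X = apply_bcontfun u"
  have Xc: "continuous_on S X" for S by (simp add: X_def)
  have XK: "X \<xi> \<in> ?K" for \<xi>
    using Tb[OF Xc, of \<xi>] fp \<delta>(2) unfolding X_def by (simp add: dist_norm norm_minus_commute)
  have Xeq: "X \<xi> = x0 + integral {0..1} (\<lambda>t. G (X (t *\<^sub>R \<xi>)) \<xi>)" if "\<xi> \<in> cball 0 \<delta>" for \<xi>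
  proof -
    have "F X \<xi> = (\<lambda>t. G (X (t *\<^sub>R \<xi>)) \<xi>)" by (simp add: fun_eq_iff F_def \<kappa>_id[OF that] pr_id[OF XK])
    then show ?thesis using fp[of \<xi>] by (simp add: X_def T_def)
  qed
  show ?thesis
  proof (rule that[OF XK])
    show "X 0 = x0" using Xeq[of 0] \<delta> XK \<rho> lin[THEN linear_0] by (simp add: subset_iff)
    fix \<xi> :: 'e and s :: real assume \<xi>: "\<xi> \<in> cball 0 \<delta>" and s: "s \<in> {0..1}"
    define \<phi> where "\<phi> \<tau> = G (X (\<tau> *\<^sub>R \<xi>)) \<xi>" for \<tau>
    have \<phi>c: "continuous_on {0..1} \<phi>"
      using Gc[of "{0..1}" "\<lambda>\<tau>. X (\<tau> *\<^sub>R \<xi>)" "\<lambda>_. \<xi>"] continuous_on_compose2[OF Xc[of UNIV], of "{0..1}" "\<lambda>\<tau>. \<tau> *\<^sub>R \<xi>"]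
      by (simp add: \<phi>_def[abs_def] pr_id[OF XK] continuous_intros)
    define U where "U s = integral {0..s} \<phi>" for s
    have U: "(U has_vector_derivative \<phi> s) (at s within {0..1})" if "s \<in> {0..1}" for s
      unfolding U_def by (rule integral_has_vector_derivative[OF \<phi>c that])
    \<comment> \<open>The fixed point equation concerns only the endpoint of each ray. Substituting
      \<open>t * s\<close> in the integral for the shortened ray turns it into an integral equation
      along the ray of \<xi>.\<close>
    have "X (s *\<^sub>R \<xi>) = x0 + U s" if s: "s \<in> {0..1}" for s
    proof -
      have sB: "s *\<^sub>R \<xi> \<in> cball 0 \<delta>" using \<xi> s \<delta> by (auto intro: order_trans[OF mult_left_le_one_le])
      have st: "(\<lambda>t. t * s) ` {0..1} \<subseteq> {0..1}" using s by (auto intro: mult_le_one)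
      have "((\<lambda>t. G (X (t *\<^sub>R s *\<^sub>R \<xi>)) (s *\<^sub>R \<xi>)) has_integral U (1 * s) - U (0 * s)) {0..1}"
      proof (rule fundamental_theorem_of_calculus)
        fix t :: real assume t: "t \<in> {0..1}"
        have ts: "t * s \<in> {0..1}" using st t by blast
        have "((\<lambda>t. t * s) has_vector_derivative s) (at t within {0..1})"
          by (auto simp: has_vector_derivative_def intro!: derivative_eq_intros)
        from vector_diff_chain_within[OF this has_vector_derivative_within_subset[OF U[OF ts] st]]
        have "((\<lambda>t. U (t * s)) has_vector_derivative s *\<^sub>R \<phi> (t * s)) (at t within {0..1})"
          by (simp add: o_def)
        then show "((\<lambda>t. U (t * s)) has_vector_derivative G (X (t *\<^sub>R s *\<^sub>R \<xi>)) (s *\<^sub>R \<xi>)) (at t within {0..1})"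
          using lin[THEN linear_scale] XK \<rho> by (simp add: \<phi>_def subset_iff)
      qed simp
      then show ?thesis using Xeq[OF sB] by (simp add: integral_unique U_def)
    qed
    moreover have "((\<lambda>s. x0 + U s) has_vector_derivative 0 + \<phi> s) (at s within {0..1})"
      by (intro has_vector_derivative_add has_vector_derivative_const U s)
    ultimately have "((\<lambda>s. X (s *\<^sub>R \<xi>)) has_vector_derivative 0 + \<phi> s) (at s within {0..1})"
      using has_vector_derivative_transform[OF s, of "\<lambda>s. X (s *\<^sub>R \<xi>)" "\<lambda>s. x0 + U s"] by simp
    then show "((\<lambda>s. X (s *\<^sub>R \<xi>)) has_vector_derivative G (X (s *\<^sub>R \<xi>)) \<xi>) (at s within {0..1})"
      by (simp add: \<phi>_def)
  qed
qed

text \<open>The solution is found along each ray separately; the compatibility condition enters when the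
  rays through \<open>\<xi>\<close> and \<open>\<xi> + h\<close> are compared: the difference of the two solutions agrees with
  \<open>t \<mapsto> t G(X(t\<xi>))h\<close> up to \<open>O(|h|\<^sup>2)\<close>, because both satisfy the same linear equation up to that order.\<close>

lemma solution_smooth:
  obtains \<rho> C \<delta> X where "\<rho> > 0" "cball x0 \<rho> \<subseteq> \<Omega>" "C > 0" "\<delta> > 0"
    "\<And>y z v. y \<in> cball x0 \<rho> \<Longrightarrow> z \<in> cball x0 \<rho> \<Longrightarrow> norm (G z v - G y v) \<le> C * norm (z - y) * norm v"
    "\<And>\<xi>. X \<xi> \<in> cball x0 \<rho>" "X 0 = x0"
    "\<And>\<xi>. \<xi> \<in> ball 0 \<delta> \<Longrightarrow> (X has_derivative G (X \<xi>)) (at \<xi>)" "smooth_on X (ball 0 \<delta>)"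
proof -
  obtain \<rho> C where \<rho>: "\<rho> > 0" "C > 0" "cball x0 \<rho> \<subseteq> \<Omega>"
    and Gb: "\<And>y v. y \<in> cball x0 \<rho> \<Longrightarrow> norm (G y v) \<le> C * norm v"
    and Gl: "\<And>y z v. y \<in> cball x0 \<rho> \<Longrightarrow> z \<in> cball x0 \<rho> \<Longrightarrow> norm (G z v - G y v) \<le> C * norm (z - y) * norm v"
    and Db: "\<And>y k v. y \<in> cball x0 \<rho> \<Longrightarrow> norm (frechet_derivative (\<lambda>y. G y v) (at y) k) \<le> C * norm k * norm v"
    and Gt: "\<And>y z v. y \<in> cball x0 \<rho> \<Longrightarrow> z \<in> cball x0 \<rho> \<Longrightarrow>
      norm (G z v - G y v - frechet_derivative (\<lambda>y. G y v) (at y) (z - y)) \<le> C * (norm (z - y))\<^sup>2 * norm v"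
    using local_bounds by metis
  \<comment> \<open>The two entries of the minimum are the two smallness conditions of
    \<open>solution_exists\<close>.\<close>
  define \<delta> where "\<delta> = min (\<rho> / C) (1 / (2 * C))"
  have \<delta>: "\<delta> > 0" "C * \<delta> \<le> \<rho>" "C * \<delta> \<le> 1 / 2"
    using \<rho> by (auto simp: \<delta>_def min_def field_simps)
  obtain X where XK: "\<And>\<xi>. X \<xi> \<in> cball x0 \<rho>" and X0: "X 0 = x0"
    and Xd: "\<And>\<xi> s. \<xi> \<in> cball 0 \<delta> \<Longrightarrow> s \<in> {0..1} \<Longrightarrow>
      ((\<lambda>s. X (s *\<^sub>R \<xi>)) has_vector_derivative G (X (s *\<^sub>R \<xi>)) \<xi>) (at s within {0..1})"
    using solution_exists[OF \<rho>(1,3,2) \<delta> Gb Gl] by metis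
  have X\<Omega>: "X \<xi> \<in> \<Omega>" for \<xi> using XK \<rho>(3) by blast
  note linX = lin[OF X\<Omega>]
  \<comment> \<open>Twice the constant \<open>c\<close> below without its factor
    \<open>(norm h)\<^sup>2\<close>, since \<open>curve_bound\<close> doubles
    \<open>c\<close>.\<close>
  define E where "E = 4 * C\<^sup>2 + 8 * C ^ 3 * \<delta>"
  have E: "E \<ge> 0" using \<rho>(2) \<delta>(1) by (simp add: E_def)
  have est: "norm (X (\<xi> + h) - X \<xi> - G (X \<xi>) h) \<le> E * (norm h)\<^sup>2"
    if \<xi>: "\<xi> \<in> cball 0 \<delta>" and \<xi>h: "\<xi> + h \<in> cball 0 \<delta>" for \<xi> h
  proof -
    define y where "y t = X (t *\<^sub>R \<xi>)" for t
    define \<phi> where "\<phi> t = X (t *\<^sub>R (\<xi> + h)) - y t" for t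
    define \<phi>' where "\<phi>' t = G (y t + \<phi> t) (\<xi> + h) - G (y t) \<xi>" for t
    have yK: "y t \<in> cball x0 \<rho>" "y t + \<phi> t \<in> cball x0 \<rho>" for t
      using XK by (auto simp: y_def \<phi>_def)
    have y\<Omega>: "y t \<in> \<Omega>" "y t + \<phi> t \<in> \<Omega>" for t using yK \<rho>(3) by blast+
    note ly = lin[OF y\<Omega>(1)] lin[OF y\<Omega>(2)]
    have yd: "(y has_vector_derivative G (y t) \<xi>) (at t within {0..1})" if "t \<in> {0..1}" for t
      using Xd[OF \<xi> that] by (simp add: y_def[abs_def])
    have \<phi>d: "(\<phi> has_vector_derivative \<phi>' t) (at t within {0..1})" if "t \<in> {0..1}" for t
      using has_vector_derivative_diff[OF Xd[OF \<xi>h that] Xd[OF \<xi> that]]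
      by (simp add: \<phi>_def[abs_def] \<phi>'_def y_def)
    have \<phi>b: "norm (\<phi> t) \<le> 2 * (C * norm h)" if t: "t \<in> {0..1}" for t
    proof (rule curve_bound[OF _ \<phi>d _ t])
      show "norm (\<phi>' t) \<le> norm (\<phi> t) / 2 + C * norm h" for t
      proof -
        have "\<phi>' t = (G (y t + \<phi> t) (\<xi> + h) - G (y t) (\<xi> + h)) + G (y t) h"
          using linear_add[OF ly(1)] by (simp add: \<phi>'_def)
        also have "norm \<dots> \<le> C * norm (\<phi> t) * norm (\<xi> + h) + C * norm h"
          using Gl[OF yK(1)[of t] yK(2)[of t], of "\<xi> + h"]
          by (intro norm_triangle_le add_mono Gb[OF yK(1)]) simp
        also have "\<dots> \<le> norm (\<phi> t) / 2 + C * norm h"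
        proof -
          have "C * norm (\<xi> + h) \<le> 1 / 2" using \<xi>h \<delta>(3) \<rho>(2) by (smt (verit) mem_cball_0 mult_left_mono)
          then show ?thesis using mult_left_mono[of "C * norm (\<xi> + h)" "1 / 2" "norm (\<phi> t)"] by (simp add: mult_ac)
        qed
        finally show ?thesis .
      qed
    qed (simp add: \<phi>_def y_def)
    define D where "D t v k = frechet_derivative (\<lambda>y. G y v) (at (y t)) k" for t v k
    have Dlin: "linear (D t v)" for t v
      unfolding D_def using linear_frechet_derivative[OF smooth y\<Omega>(1)] by blast
    \<comment> \<open>The difference of the two solutions minus its expected linear part. At
      \<open>t = 1\<close> it is the remainder in the definition of the derivative of
      \<open>X\<close>.\<close>
    define \<psi> where "\<psi> t = \<phi> t - t *\<^sub>R G (y t) h" for t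
    define \<psi>' where "\<psi>' t = \<phi>' t - (t *\<^sub>R D t h (G (y t) \<xi>) + 1 *\<^sub>R G (y t) h)" for t
    have \<psi>d: "(\<psi> has_vector_derivative \<psi>' t) (at t within {0..1})" if t: "t \<in> {0..1}" for t
    proof -
      have Gd: "((\<lambda>x. G x h) has_derivative D t h) (at (y t))"
        unfolding D_def by (rule smooth_onD[OF smooth y\<Omega>(1)])
      have "((\<lambda>t. G (y t) h) has_derivative (\<lambda>s. D t h (s *\<^sub>R G (y t) \<xi>))) (at t within {0..1})"
        using has_derivative_compose[OF yd[OF t, unfolded has_vector_derivative_def] Gd] .
      then have "((\<lambda>t. G (y t) h) has_vector_derivative D t h (G (y t) \<xi>)) (at t within {0..1})"
        by (simp add: has_vector_derivative_def linear_scale[OF Dlin])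
      from has_vector_derivative_scaleR[OF DERIV_ident this]
      have "((\<lambda>t. t *\<^sub>R G (y t) h) has_vector_derivative t *\<^sub>R D t h (G (y t) \<xi>) + 1 *\<^sub>R G (y t) h) (at t within {0..1})" .
      from has_vector_derivative_diff[OF \<phi>d[OF t] this]
      show ?thesis by (simp add: \<psi>_def[abs_def] \<psi>'_def)
    qed
    define c where "c = (2 * C\<^sup>2 + 4 * C ^ 3 * \<delta>) * (norm h)\<^sup>2"
    have "norm (\<psi> 1) \<le> 2 * c"
    proof (rule curve_bound[OF _ \<psi>d])
      show "norm (\<psi>' t) \<le> norm (\<psi> t) / 2 + c" if t: "t \<in> {0..1}" for t
      proof -
        \<comment> \<open>Exchanging \<open>h\<close> and \<xi> turns the derivative of the linear
          part into the linear operator that also governs \<phi>. What remains is that operator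
          applied to \<psi>, plus errors quadratic in \<open>h\<close>.\<close>
        have "D t h (G (y t) \<xi>) = D t \<xi> (G (y t) h)"
          unfolding D_def by (rule compat[OF y\<Omega>(1)])
        then have e: "\<psi>' t = (G (y t + \<phi> t) h - G (y t) h) + (G (y t + \<phi> t) \<xi> - G (y t) \<xi> - D t \<xi> (\<phi> t)) + D t \<xi> (\<psi> t)"
          using linear_add[OF ly(2)] linear_diff[OF Dlin] linear_scale[OF Dlin]
          by (simp add: \<psi>'_def \<phi>'_def \<psi>_def)
        have n\<xi>: "norm \<xi> \<le> \<delta>" using \<xi> by simp
        have 1: "norm (G (y t + \<phi> t) h - G (y t) h) \<le> 2 * C\<^sup>2 * (norm h)\<^sup>2"
        proof -
          have "norm (G (y t + \<phi> t) h - G (y t) h) \<le> C * norm (\<phi> t) * norm h" using Gl[OF yK(1)[of t] yK(2)[of t], of h] by simp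
          also have "\<dots> \<le> C * (2 * (C * norm h)) * norm h"
            using \<phi>b[OF t] \<rho>(2) by (intro mult_right_mono mult_left_mono) auto
          finally show ?thesis by (simp add: power2_eq_square mult_ac)
        qed
        have 2: "norm (G (y t + \<phi> t) \<xi> - G (y t) \<xi> - D t \<xi> (\<phi> t)) \<le> 4 * C ^ 3 * \<delta> * (norm h)\<^sup>2"
        proof -
          have "norm (G (y t + \<phi> t) \<xi> - G (y t) \<xi> - D t \<xi> (\<phi> t)) \<le> C * (norm (\<phi> t))\<^sup>2 * norm \<xi>"
            using Gt[OF yK(1)[of t] yK(2)[of t], of \<xi>] by (simp add: D_def)
          also have "\<dots> \<le> C * (2 * (C * norm h))\<^sup>2 * \<delta>"
            using \<phi>b[OF t] \<rho>(2) n\<xi> by (intro mult_mono mult_left_mono power_mono) auto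
          finally show ?thesis by (simp add: power2_eq_square power3_eq_cube mult_ac)
        qed
        have 3: "norm (D t \<xi> (\<psi> t)) \<le> norm (\<psi> t) / 2"
        proof -
          have "norm (D t \<xi> (\<psi> t)) \<le> C * norm (\<psi> t) * norm \<xi>" unfolding D_def by (rule Db[OF yK(1)])
          also have "\<dots> = norm (\<psi> t) * (C * norm \<xi>)" by simp
          also have "\<dots> \<le> norm (\<psi> t) * (1 / 2)"
            using order_trans[OF mult_left_mono[OF n\<xi>, of C] \<delta>(3)] \<rho>(2) by (intro mult_left_mono) auto
          finally show ?thesis by simp
        qed
        have "norm (\<psi>' t) \<le> norm (G (y t + \<phi> t) h - G (y t) h)
            + norm (G (y t + \<phi> t) \<xi> - G (y t) \<xi> - D t \<xi> (\<phi> t)) + norm (D t \<xi> (\<psi> t))"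
          unfolding e by (intro norm_triangle_le add_mono order_refl norm_triangle_ineq)
        then show ?thesis using 1 2 3 by (simp add: c_def algebra_simps)
      qed
    qed (auto simp: \<psi>_def \<phi>_def y_def)
    then show ?thesis by (simp add: \<psi>_def \<phi>_def y_def c_def E_def algebra_simps)
  qed
  have Xder: "(X has_derivative G (X \<xi>)) (at \<xi>)" if \<xi>: "\<xi> \<in> ball 0 \<delta>" for \<xi>
    unfolding has_derivative_at
  proof (intro conjI)
    show "bounded_linear (G (X \<xi>))" using linX linear_conv_bounded_linear by blast
    show "((\<lambda>h. norm (X (\<xi> + h) - X \<xi> - G (X \<xi>) h) / norm h) \<longlongrightarrow> 0) (at 0)"
    proof (rule Lim_null_comparison)
      have "\<forall>\<^sub>F h in at 0. h \<in> ball 0 (\<delta> - norm \<xi>)"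
        using \<xi> by (intro eventually_at_in_open') auto
      then show "\<forall>\<^sub>F h in at 0. norm (norm (X (\<xi> + h) - X \<xi> - G (X \<xi>) h) / norm h) \<le> E * norm h"
      proof eventually_elim
        case (elim h)
        have "\<xi> + h \<in> cball 0 \<delta>" using elim norm_triangle_ineq[of \<xi> h] by auto
        then have "norm (X (\<xi> + h) - X \<xi> - G (X \<xi>) h) \<le> E * (norm h)\<^sup>2" using est \<xi> by auto
        then show ?case using E by (cases "h = 0") (auto simp: power2_eq_square divide_le_eq mult.assoc)
      qed
      show "((\<lambda>h. E * norm h) \<longlongrightarrow> 0) (at 0)" by (auto intro!: tendsto_eq_intros)
    qed
  qed
  \<comment> \<open>Bootstrapping: the derivative of \<open>X\<close> is \<open>G\<close> evaluated
    along \<open>X\<close>, so each order of regularity of \<open>X\<close> gives the next.\<close>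
  have "Ck_on k X (ball 0 \<delta>)" for k
  proof (induction k)
    case 0
    show ?case using has_derivative_continuous[OF Xder] by (simp add: continuous_at_imp_continuous_on)
  next
    case (Suc k)
    show ?case
    proof (rule Ck_on_SucI[OF open_ball Xder])
      have "Ck_on k (\<lambda>x. G x v) \<Omega>" for v using smooth by (simp add: smooth_on_def)
      then show "Ck_on k (\<lambda>\<xi>. G (X \<xi>) v) (ball 0 \<delta>)" for v
        using Ck_on_compose[OF open_ball open_dom _ _ Suc] X\<Omega> by blast
    qed
  qed
  then have "smooth_on X (ball 0 \<delta>)" by (simp add: smooth_on_def)
  then show ?thesis using that[OF \<rho>(1,3,2) \<delta>(1) Gl XK X0 Xder] by blast
qed

end

text \<open>The distribution is a graph over its fibre at \<open>x0\<close>, and lifting the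
  constant fields of that fibre gives the coefficients \<open>G\<close> of a total differential
  equation, whose solution is an integral slice. \<Phi> straightens the slice through
  \<open>x0\<close>; its tangency is claimed on that slice alone. The last conclusion is uniqueness:
  a short curve from \<open>x0\<close> tangent to the distribution stays in the slice.\<close>

lemma frobenius_slice:
  fixes Q :: "'e::euclidean_space \<Rightarrow> 'e \<Rightarrow> 'e"
  assumes \<Omega>: "open \<Omega>" "x0 \<in> \<Omega>"
    and linQ: "\<And>x. x \<in> \<Omega> \<Longrightarrow> linear (Q x)" and idem: "\<And>x v. x \<in> \<Omega> \<Longrightarrow> Q x (Q x v) = Q x v"
    and smQ: "\<And>v. smooth_on (\<lambda>x. Q x v) \<Omega>" and dimQ: "\<And>x. x \<in> \<Omega> \<Longrightarrow> dim (range (Q x)) = r"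
    and invol: "\<And>X Y W x. open W \<Longrightarrow> W \<subseteq> \<Omega> \<Longrightarrow> smooth_on X W \<Longrightarrow> smooth_on Y W \<Longrightarrow>
      (\<And>x. x \<in> W \<Longrightarrow> X x \<in> range (Q x)) \<Longrightarrow> (\<And>x. x \<in> W \<Longrightarrow> Y x \<in> range (Q x)) \<Longrightarrow> x \<in> W \<Longrightarrow>
      frechet_derivative Y (at x) (X x) - frechet_derivative X (at x) (Y x) \<in> range (Q x)"
  obtains \<Omega>' \<Phi> \<Psi> \<epsilon> where "open \<Omega>'" "x0 \<in> \<Omega>'" "\<Omega>' \<subseteq> \<Omega>" "open (\<Phi> ` \<Omega>')" "smooth_on \<Phi> \<Omega>'"
    "smooth_on \<Psi> (\<Phi> ` \<Omega>')" "\<And>x. x \<in> \<Omega>' \<Longrightarrow> \<Psi> (\<Phi> x) = x" "\<Phi> x0 = x0"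
    "\<And>x. x \<in> \<Omega>' \<Longrightarrow> \<Phi> x - x0 \<in> range (Q x0) \<Longrightarrow> frechet_derivative \<Phi> (at x) ` range (Q x) = range (Q x0)"
    "\<epsilon> > 0"
    "\<And>\<gamma> \<gamma>'. \<gamma> 0 = x0 \<Longrightarrow> (\<And>t. t \<in> {0..1} \<Longrightarrow> (\<gamma> has_vector_derivative \<gamma>' t) (at t within {0..1}) \<and>
      \<gamma> t \<in> \<Omega>' \<and> \<gamma>' t \<in> range (Q (\<gamma> t)) \<and> norm (\<gamma>' t) \<le> \<epsilon>) \<Longrightarrow> \<Phi> (\<gamma> (1::real)) - x0 \<in> range (Q x0)"
proof -
  define \<pi> where "\<pi> = Q x0"
  have lp: "linear \<pi>" and pp: "\<pi> (\<pi> v) = \<pi> v" for v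
    using linQ[OF \<Omega>(2)] idem[OF \<Omega>(2)] by (auto simp: \<pi>_def)
  note p_simps = linear_add[OF lp] linear_diff[OF lp] linear_scale[OF lp] linear_0[OF lp] pp
  have bp: "bounded_linear \<pi>" using lp linear_conv_bounded_linear by blast
  \<comment> \<open>At \<open>x0\<close> this is the identity, hence it is invertible nearby, and on
    \<open>range (Q x)\<close> it coincides with \<pi>. Its inverse therefore lifts
    \<open>range \<pi>\<close> to \<open>range (Q x)\<close>.\<close>
  define K where "K x v = \<pi> v + v - Q x v" for x v
  have linK: "linear (K x)" if "x \<in> \<Omega>" for x
    unfolding K_def using linQ[OF that] lp
    by (auto intro!: linearI simp: linear_add linear_scale algebra_simps)
  have smK: "smooth_on (\<lambda>x. K x v) \<Omega>" for v
    unfolding K_def by (intro smooth_on_diff smooth_on_const smQ \<Omega>)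
  have "inj (K x0)" by (simp add: K_def \<pi>_def inj_def)
  then obtain m \<Omega>1 where m: "m > 0" "open \<Omega>1" "x0 \<in> \<Omega>1" "\<Omega>1 \<subseteq> \<Omega>" "\<And>x v. x \<in> \<Omega>1 \<Longrightarrow> norm v * m \<le> norm (K x v)"
    using linear_lower_bound_nearby[OF \<Omega> linK _ smooth_on_imp_continuous[OF smK]] by metis
  have injK: "inj (K x)" if "x \<in> \<Omega>1" for x
  proof -
    have "v = 0" if "K x v = 0" for v
      using m(5)[OF \<open>x \<in> \<Omega>1\<close>, of v] m(1) that by (simp add: mult_le_0_iff)
    then show ?thesis using linear_injective_0[OF linK] m(4) that by blast
  qed
  define G where "G x v = inv (K x) (\<pi> v)" for x v
  have linKi: "linear (inv (K x))" if "x \<in> \<Omega>1" for x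
    using linK injK[OF that] m(4) that linear_injective_imp_surjective inj_linear_imp_inv_linear by blast
  have linG: "linear (G x)" if "x \<in> \<Omega>1" for x
    using linear_compose[OF lp linKi[OF that]] by (simp add: G_def[abs_def] o_def)
  have smG: "smooth_on (\<lambda>x. G x v) \<Omega>1" for v
    unfolding G_def
    by (rule smooth_on_inverse_operator[OF m(2) linK injK smooth_on_subset[OF smK m(4)]]) (use m(4) in auto)
  have Kr: "K x w = \<pi> w" if "x \<in> \<Omega>" "w \<in> range (Q x)" for x w
    using that idem[OF that(1)] by (auto simp: K_def)
  have Gr: "G x w = w" if "x \<in> \<Omega>1" "w \<in> range (Q x)" for x w
    using Kr[OF _ that(2)] that(1) m(4) injK[OF that(1)] unfolding G_def by (metis inv_f_f subsetD)
  have GQ: "G x v \<in> range (Q x) \<and> \<pi> (G x v) = \<pi> v" if x: "x \<in> \<Omega>1" for x v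
  proof -
    have x\<Omega>: "x \<in> \<Omega>" using x m(4) by blast
    have sQ: "subspace (range (Q x))" "subspace (range \<pi>)"
      using linear_subspace_image[OF linQ[OF x\<Omega>] subspace_UNIV] linear_subspace_image[OF lp subspace_UNIV] by auto
    have "K x ` range (Q x) = range \<pi>"
    proof (rule subspace_dim_equal[OF linear_subspace_image[OF linK[OF x\<Omega>] sQ(1)] sQ(2)])
      show "K x ` range (Q x) \<subseteq> range \<pi>" using Kr[OF x\<Omega>] by blast
      have "dim (K x ` range (Q x)) = r"
        using dim_image_eq[OF linK[OF x\<Omega>] inj_on_subset[OF injK[OF x]]] dimQ[OF x\<Omega>] by simp
      then show "dim (range \<pi>) \<le> dim (K x ` range (Q x))" using dimQ[OF \<Omega>(2)] by (simp add: \<pi>_def)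
    qed
    then obtain w where w: "w \<in> range (Q x)" "\<pi> v = K x w" by (metis imageE rangeI)
    then have "G x v = w" using injK[OF x] by (simp add: G_def)
    then show ?thesis using w Kr[OF x\<Omega> w(1)] by simp
  qed
  have Gp: "G x (\<pi> v) = G x v" for x v by (simp add: G_def pp)
  interpret T: total_differential G \<Omega>1 x0
  proof
    fix x v w assume x: "x \<in> \<Omega>1"
    have cs: "frechet_derivative (\<lambda>y. \<pi> (G y a)) (at x) k = 0" for a k
    proof -
      have "((\<lambda>y. \<pi> (G y a)) has_derivative (\<lambda>_. 0)) (at x)"
        by (rule has_derivative_transform_within_open[OF has_derivative_const m(2) x]) (use GQ in auto)
      from fun_cong[OF frechet_derivative_at[OF this, symmetric]] show ?thesis .
    qed
    \<comment> \<open>The lifted fields have constant \<pi>-part, so \<pi> annihilates their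
      bracket. By involutivity the bracket lies in \<open>range (Q x)\<close>, where
      \<open>K x\<close> is injective and equals \<pi>; so it vanishes, and this is
      \<open>compat\<close>.\<close>
    have pd: "\<pi> (frechet_derivative (\<lambda>y. G y a) (at x) k) = 0" for a k
      using frechet_derivative_bounded_linear[OF bp differentiableI[OF smooth_onD[OF smG x]], of a k] cs by simp
    let ?b = "frechet_derivative (\<lambda>y. G y w) (at x) (G x v) - frechet_derivative (\<lambda>y. G y v) (at x) (G x w)"
    have "?b \<in> range (Q x)"
      by (rule invol[OF m(2,4) smG smG _ _ x]) (use GQ in auto)
    from Gr[OF x this] have "?b = inv (K x) (\<pi> ?b)" by (simp add: G_def)
    also have "\<pi> ?b = 0" by (simp add: p_simps pd)
    finally show "frechet_derivative (\<lambda>y. G y w) (at x) (G x v) = frechet_derivative (\<lambda>y. G y v) (at x) (G x w)"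
      using linear_0[OF linKi[OF x]] by simp
  qed (use m smG linG in \<open>auto simp: linear_add linear_scale\<close>)
  obtain \<rho> C \<delta> X where \<rho>: "\<rho> > 0" "cball x0 \<rho> \<subseteq> \<Omega>1" "C > 0" "\<delta> > 0"
    and Gl: "\<And>y z v. y \<in> cball x0 \<rho> \<Longrightarrow> z \<in> cball x0 \<rho> \<Longrightarrow> norm (G z v - G y v) \<le> C * norm (z - y) * norm v"
    and XK: "\<And>\<xi>. X \<xi> \<in> cball x0 \<rho>" and X0: "X 0 = x0"
    and Xd: "\<And>\<xi>. \<xi> \<in> ball 0 \<delta> \<Longrightarrow> (X has_derivative G (X \<xi>)) (at \<xi>)" and Xs: "smooth_on X (ball 0 \<delta>)"
    using T.solution_smooth by metis
  have pX: "\<pi> (X \<xi>) = \<pi> x0 + \<pi> \<xi>" if "\<xi> \<in> ball 0 \<delta>" for \<xi>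
  proof -
    have "((\<lambda>\<xi>. \<pi> (X \<xi>) - \<pi> \<xi>) has_derivative (\<lambda>h. 0)) (at \<zeta> within ball 0 \<delta>)" if "\<zeta> \<in> ball 0 \<delta>" for \<zeta>
      using has_derivative_diff[OF bounded_linear.has_derivative[OF bp Xd[OF that]] bounded_linear_imp_has_derivative[OF bp]]
        GQ XK \<rho>(2) by (simp add: subset_iff has_derivative_at_withinI)
    from has_derivative_zero_constant[OF convex_ball this]
    obtain c where c: "\<forall>\<zeta>\<in>ball 0 \<delta>. \<pi> (X \<zeta>) - \<pi> \<zeta> = c" by blast
    have "\<pi> (X \<xi>) - \<pi> \<xi> = \<pi> (X 0) - \<pi> 0"
      using bspec[OF c that] bspec[OF c, of 0] \<rho>(4) by simp
    then show ?thesis using X0 by (simp add: p_simps diff_eq_eq)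
  qed
  define q where "q x = \<pi> (x - x0)" for x
  have qs: "smooth_on q S" if "open S" for S
    unfolding q_def
    by (rule smooth_on_bounded_linear[OF that bp smooth_on_diff[OF that smooth_on_ident[OF that] smooth_on_const[OF that]]])
  have qc: "continuous_on UNIV q" by (rule smooth_on_imp_continuous[OF qs]) simp
  \<comment> \<open>A shear that preserves \<open>q\<close> and moves the point
    \<open>X \<xi>\<close> of the slice to \<open>x0 + \<xi>\<close>, for \<xi> in
    \<open>range \<pi>\<close>. Since \<open>q\<close> is preserved, \<Psi> undoes the shift
    explicitly, without the inverse function theorem.\<close>
  define \<Phi> where "\<Phi> x = x + x0 + q x - X (q x)" for x
  define \<Psi> where "\<Psi> y = y - x0 - q y + X (q y)" for y
  define \<Omega>' where "\<Omega>' = {x \<in> ball x0 \<rho>. q x \<in> ball 0 \<delta>}"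
  have \<Omega>'_eq: "\<Omega>' = ball x0 \<rho> \<inter> q -` ball 0 \<delta>" by (auto simp: \<Omega>'_def)
  have oq: "open (q -` ball 0 \<delta>)" using continuous_on_open_vimage[OF open_UNIV, of q] qc by auto
  have o\<Omega>': "open \<Omega>'" unfolding \<Omega>'_eq using oq by blast
  have q0: "q x0 = 0" by (simp add: q_def p_simps)
  have x0\<Omega>': "x0 \<in> \<Omega>'" using \<rho> q0 by (simp add: \<Omega>'_def)
  have \<Omega>'1: "\<Omega>' \<subseteq> \<Omega>1" using \<rho>(2) by (auto simp: \<Omega>'_def)
  have q\<Phi>: "q (\<Phi> x) = q x" if "q x \<in> ball 0 \<delta>" for x
    using pX[OF that] by (simp add: \<Phi>_def) (simp add: q_def p_simps)
  have q\<Psi>: "q (\<Psi> x) = q x" if "q x \<in> ball 0 \<delta>" for x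
    using pX[OF that] by (simp add: \<Psi>_def) (simp add: q_def p_simps)
  have Xq: "smooth_on (\<lambda>x. X (q x)) S" if "open S" "S \<subseteq> q -` ball 0 \<delta>" for S
    using smooth_on_compose[OF that(1) open_ball _ Xs qs[OF that(1)]] that(2) by blast
  have \<Phi>s: "smooth_on \<Phi> \<Omega>'"
    unfolding \<Phi>_def by (intro smooth_on_diff smooth_on_add smooth_on_ident smooth_on_const qs Xq o\<Omega>') (auto simp: \<Omega>'_eq)
  have \<Psi>s: "smooth_on \<Psi> (q -` ball 0 \<delta>)"
    unfolding \<Psi>_def by (intro smooth_on_diff smooth_on_add smooth_on_ident smooth_on_const qs Xq oq) auto
  have im: "\<Phi> ` \<Omega>' = q -` ball 0 \<delta> \<inter> \<Psi> -` ball x0 \<rho>"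
  proof (intro equalityI subsetI)
    fix y assume "y \<in> \<Phi> ` \<Omega>'"
    then obtain x where x: "x \<in> \<Omega>'" "y = \<Phi> x" by blast
    then show "y \<in> q -` ball 0 \<delta> \<inter> \<Psi> -` ball x0 \<rho>"
      using q\<Phi>[of x] by (simp add: \<Omega>'_def \<Psi>_def) (simp add: \<Phi>_def)
  next
    fix y assume y: "y \<in> q -` ball 0 \<delta> \<inter> \<Psi> -` ball x0 \<rho>"
    then have "\<Phi> (\<Psi> y) = y" using q\<Psi>[of y] by (simp add: \<Phi>_def) (simp add: \<Psi>_def)
    moreover have "\<Psi> y \<in> \<Omega>'" using y q\<Psi>[of y] by (simp add: \<Omega>'_def)
    ultimately show "y \<in> \<Phi> ` \<Omega>'" by (metis imageI)
  qed
  have o\<Phi>: "open (\<Phi> ` \<Omega>')"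
    unfolding im using continuous_on_open_vimage[OF oq, of \<Psi>] smooth_on_imp_continuous[OF \<Psi>s]
    by (simp add: Int_commute)
  have \<Psi>\<Phi>: "\<Psi> (\<Phi> x) = x" if "x \<in> \<Omega>'" for x
    using q\<Phi>[of x] that by (simp add: \<Omega>'_def \<Psi>_def) (simp add: \<Phi>_def)
  have \<Phi>0: "\<Phi> x0 = x0" by (simp add: \<Phi>_def q0 X0)
  have plaque: "X (q x) = x \<longleftrightarrow> \<Phi> x - x0 \<in> range \<pi>" if x: "x \<in> \<Omega>'" for x
  proof
    assume "X (q x) = x" then show "\<Phi> x - x0 \<in> range \<pi>" by (simp add: \<Phi>_def q_def)
  next
    assume "\<Phi> x - x0 \<in> range \<pi>"
    then have "\<pi> (\<Phi> x - x0) = \<Phi> x - x0" using pp by auto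
    then have "q (\<Phi> x) = \<Phi> x - x0" by (simp add: q_def)
    then show "X (q x) = x" using q\<Phi>[of x] x by (simp add: \<Omega>'_def) (simp add: \<Phi>_def)
  qed
  have tang: "frechet_derivative \<Phi> (at x) ` range (Q x) = range \<pi>" if x: "x \<in> \<Omega>'" "\<Phi> x - x0 \<in> range \<pi>" for x
  proof -
    have qx: "q x \<in> ball 0 \<delta>" using x by (simp add: \<Omega>'_def)
    have qd: "(q has_derivative \<pi>) (at x)"
      unfolding q_def using bounded_linear.has_derivative[OF bp has_derivative_diff[OF has_derivative_ident has_derivative_const]]
      by simp
    have "(\<Phi> has_derivative (\<lambda>v. v + 0 + \<pi> v - G (X (q x)) (\<pi> v))) (at x)"
      unfolding \<Phi>_def[abs_def]
      by (intro has_derivative_diff has_derivative_add has_derivative_ident has_derivative_const qd has_derivative_compose[OF qd Xd[OF qx]])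
    then have D: "frechet_derivative \<Phi> (at x) = (\<lambda>v. v + \<pi> v - G x v)"
      using frechet_derivative_at[of \<Phi>] plaque[OF x(1)] x(2) by (simp add: Gp)
    have x1: "x \<in> \<Omega>1" using x \<Omega>'1 by blast
    have "frechet_derivative \<Phi> (at x) v = \<pi> v" if "v \<in> range (Q x)" for v
      unfolding D using Gr[OF x1 that] by simp
    then have "frechet_derivative \<Phi> (at x) ` range (Q x) = \<pi> ` range (Q x)" by (rule image_cong[OF refl])
    moreover have "range \<pi> \<subseteq> \<pi> ` range (Q x)" using GQ[OF x1] by (metis image_eqI image_subsetI)
    ultimately show ?thesis by blast
  qed
  \<comment> \<open>For curves of this speed, the Lipschitz constant \<open>C\<close> of
    \<open>G\<close> gives exactly the rate 1/2 of \<open>curve_bound\<close>.\<close>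
  define \<epsilon> where "\<epsilon> = 1 / (2 * C)"
  have e: "\<epsilon> > 0" using \<rho>(3) by (simp add: \<epsilon>_def)
  have uniq: "\<Phi> (\<gamma> 1) - x0 \<in> range \<pi>" if \<gamma>0: "\<gamma> 0 = x0"
    and \<gamma>: "\<And>t. t \<in> {0..1} \<Longrightarrow> (\<gamma> has_vector_derivative \<gamma>' t) (at t within {0..1}) \<and>
      \<gamma> t \<in> \<Omega>' \<and> \<gamma>' t \<in> range (Q (\<gamma> t)) \<and> norm (\<gamma>' t) \<le> \<epsilon>" for \<gamma> :: "real \<Rightarrow> 'e" and \<gamma>'
  proof -
    \<comment> \<open>\<open>w\<close> measures the distance of the curve from the slice above the
      same \<open>q\<close>-value. The curve and this shadow on the slice have as velocities lifts
      of the same vector, at different points, so \<open>w\<close> satisfies a homogeneous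
      inequality and stays 0.\<close>
    define w where "w t = \<gamma> t - X (q (\<gamma> t))" for t
    have "norm (w 1) \<le> 2 * 0"
    proof (rule curve_bound[of w])
      fix t :: real assume t: "t \<in> {0..1}"
      have g1: "\<gamma> t \<in> \<Omega>1" using \<gamma>[OF t] \<Omega>'1 by blast
      have qt: "q (\<gamma> t) \<in> ball 0 \<delta>" using \<gamma>[OF t] by (simp add: \<Omega>'_def)
      have qd: "(q has_derivative \<pi>) (at (\<gamma> t))"
        unfolding q_def using bounded_linear.has_derivative[OF bp has_derivative_diff[OF has_derivative_ident has_derivative_const]]
        by simp
      have XqD: "((\<lambda>x. X (q x)) has_derivative G (X (q (\<gamma> t)))) (at (\<gamma> t))"
        using has_derivative_compose[OF qd Xd[OF qt]] by (simp add: Gp)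
      have gd: "(\<gamma> has_derivative (\<lambda>s. s *\<^sub>R \<gamma>' t)) (at t within {0..1})"
        using \<gamma>[OF t] by (simp add: has_vector_derivative_def)
      have "((\<lambda>t. X (q (\<gamma> t))) has_derivative (\<lambda>s. G (X (q (\<gamma> t))) (s *\<^sub>R \<gamma>' t))) (at t within {0..1})"
        using has_derivative_compose[OF gd XqD] .
      then have "((\<lambda>t. X (q (\<gamma> t))) has_vector_derivative G (X (q (\<gamma> t))) (\<gamma>' t)) (at t within {0..1})"
        using linear_scale[OF linG] XK \<rho>(2) by (simp add: has_vector_derivative_def subset_iff)
      then show "(w has_vector_derivative G (\<gamma> t) (\<gamma>' t) - G (X (q (\<gamma> t))) (\<gamma>' t)) (at t within {0..1})"
        unfolding w_def using \<gamma>[OF t] Gr[OF g1] has_vector_derivative_diff by force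
      have "norm (G (\<gamma> t) (\<gamma>' t) - G (X (q (\<gamma> t))) (\<gamma>' t)) \<le> C * norm (w t) * norm (\<gamma>' t)"
        unfolding w_def using \<gamma>[OF t] by (intro Gl XK) (auto simp: \<Omega>'_def)
      also have "\<dots> \<le> C * norm (w t) * \<epsilon>" using \<gamma>[OF t] \<rho>(3) by (intro mult_left_mono) auto
      also have "\<dots> = norm (w t) / 2 + 0" using \<rho>(3) by (simp add: \<epsilon>_def)
      finally show "norm (G (\<gamma> t) (\<gamma>' t) - G (X (q (\<gamma> t))) (\<gamma>' t)) \<le> norm (w t) / 2 + 0" .
    qed (auto simp: w_def \<gamma>0 q0 X0)
    then have "X (q (\<gamma> 1)) = \<gamma> 1" by (simp add: w_def)
    then show ?thesis using plaque[of "\<gamma> 1"] \<gamma>[of 1] by simp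
  qed
  show ?thesis
  proof (rule that[of \<Omega>' \<Phi> \<Psi> \<epsilon>])
    show "\<Omega>' \<subseteq> \<Omega>" using \<Omega>'1 m(4) by blast
    show "smooth_on \<Psi> (\<Phi> ` \<Omega>')" by (rule smooth_on_subset[OF \<Psi>s]) (simp add: im)
  qed (fact o\<Omega>' x0\<Omega>' o\<Phi> \<Phi>s \<Psi>\<Phi> \<Phi>0 e tang[unfolded \<pi>_def] uniq[unfolded \<pi>_def])+
qed

section \<open>Foliations\<close>

context smooth_mfd
begin

lemma max_atlasI':
  assumes "is_chart c" "\<And>d. d \<in> A \<Longrightarrow> smooth_on (cmap d \<circ> cinv c) (cmap c ` (cdom c \<inter> cdom d))"
    "\<And>d. d \<in> A \<Longrightarrow> smooth_on (cmap c \<circ> cinv d) (cmap d ` (cdom c \<inter> cdom d))"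
  shows "c \<in> max_atlas A"
  using assms by (simp add: max_atlas_def compatible_def)

lemma open_chart_vimage:
  assumes "c \<in> max_atlas A" "open S"
  shows "open (cdom c \<inter> cmap c -` S)"
  using continuous_on_open_vimage[OF open_cdom[OF assms(1)], of "cmap c"] continuous_on_cmap[OF assms(1)] assms(2)
  by (simp add: Int_commute)

lemma chart_transform:
  assumes c: "c \<in> max_atlas A" and \<Omega>: "open \<Omega>" "\<Omega> \<subseteq> cmap c ` cdom c"
    and \<Phi>: "open (\<Phi> ` \<Omega>)" "smooth_on \<Phi> \<Omega>" "smooth_on \<Psi> (\<Phi> ` \<Omega>)" "\<And>x. x \<in> \<Omega> \<Longrightarrow> \<Psi> (\<Phi> x) = x"
  defines "c' \<equiv> (cdom c \<inter> cmap c -` \<Omega>, \<Phi> \<circ> cmap c)"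
  shows "c' \<in> max_atlas A" and "cmap c' ` cdom c' = \<Phi> ` \<Omega>"
    and "p \<in> cdom c' \<Longrightarrow> to_chart A c' p v = frechet_derivative \<Phi> (at (cmap c p)) (to_chart A c p v)"
proof -
  have dom: "cdom c' = cdom c \<inter> cmap c -` \<Omega>" and map: "cmap c' = \<Phi> \<circ> cmap c" by (auto simp: c'_def)
  have im: "cmap c ` cdom c' = \<Omega>" using \<Omega>(2) by (auto simp: dom)
  show im': "cmap c' ` cdom c' = \<Phi> ` \<Omega>" by (simp only: map image_comp[symmetric] im)
  have inj: "inj_on (cmap c') (cdom c')"
  proof (rule inj_onI)
    fix p q assume "p \<in> cdom c'" "q \<in> cdom c'" "cmap c' p = cmap c' q"
    then show "p = q" using \<Phi>(4) cinv_cmap[OF c] by (simp add: dom map) metis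
  qed
  have inv: "cinv c' y = cinv c (\<Psi> y)" if y: "y \<in> \<Phi> ` \<Omega>" for y
  proof -
    obtain p where p: "p \<in> cdom c'" "y = cmap c' p" using y im' by blast
    then have "cinv c' y = p" using inv_into_f_f[OF inj] by simp
    moreover have "\<Psi> y = cmap c p" using p \<Phi>(4) by (simp add: dom map)
    ultimately show ?thesis using p cinv_cmap[OF c] by (simp add: dom)
  qed
  have \<Psi>im: "\<Psi> ` \<Phi> ` \<Omega> \<subseteq> cmap c ` cdom c" using \<Phi>(4) \<Omega>(2) by force
  have chart: "is_chart c'"
    unfolding is_chart_def
  proof (intro conjI)
    show "open (cdom c')" unfolding dom by (rule open_chart_vimage[OF c \<Omega>(1)])
    show "open (cmap c' ` cdom c')" using \<Phi>(1) im' by simp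
    show "homeomorphism (cdom c') (cmap c' ` cdom c') (cmap c') (cinv c')"
    proof (rule homeomorphismI)
      show "continuous_on (cdom c') (cmap c')"
        unfolding map o_def
        by (rule continuous_on_compose2[OF smooth_on_imp_continuous[OF \<Phi>(2)] continuous_on_subset[OF continuous_on_cmap[OF c]]])
           (auto simp: dom)
      have "continuous_on (\<Phi> ` \<Omega>) (\<lambda>y. cinv c (\<Psi> y))"
        by (rule continuous_on_compose2[OF continuous_on_cinv[OF c] smooth_on_imp_continuous[OF \<Phi>(3)] \<Psi>im])
      then show "continuous_on (cmap c' ` cdom c') (cinv c')"
        unfolding im' by (rule continuous_on_eq) (simp add: inv)
    qed (use inv_into_f_f[OF inj] in auto)
  qed
  show c': "c' \<in> max_atlas A"
  proof (rule max_atlasI'[OF chart])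
    fix d assume d: "d \<in> A"
    note dm = max_atlasI[OF d]
    have "cmap c' ` (cdom c' \<inter> cdom d) = cmap c' ` cdom c' \<inter> cinv c' -` cdom d"
      by (auto simp: inv_into_f_f[OF inj])
    then have "cmap c' ` (cdom c' \<inter> cdom d) = \<Phi> ` \<Omega> \<inter> cinv c' -` cdom d" unfolding im' .
    moreover have "continuous_on (\<Phi> ` \<Omega>) (cinv c')" using chart im' by (simp add: is_chart_def homeomorphism_def)
    ultimately have o: "open (cmap c' ` (cdom c' \<inter> cdom d))"
      using continuous_on_open_vimage[OF \<Phi>(1), of "cinv c'"] open_cdom[OF dm] by (simp add: Int_commute)
    have sub: "cmap c' ` (cdom c' \<inter> cdom d) \<subseteq> \<Phi> ` \<Omega>" using im' by blast
    have "smooth_on (\<lambda>y. (cmap d \<circ> cinv c) (\<Psi> y)) (cmap c' ` (cdom c' \<inter> cdom d))"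
    proof (rule smooth_on_compose[where f="cmap d \<circ> cinv c" and g=\<Psi>, OF o _ _ smooth_transition[OF c dm] smooth_on_subset[OF \<Phi>(3) sub]])
      show "open (cmap c ` (cdom c \<inter> cdom d))"
        using open_cmap_image[OF c open_cdom[OF dm]] by (simp add: Int_commute)
      show "\<Psi> ` cmap c' ` (cdom c' \<inter> cdom d) \<subseteq> cmap c ` (cdom c \<inter> cdom d)"
        using \<Phi>(4) by (auto simp: dom map)
    qed
    then show "smooth_on (cmap d \<circ> cinv c') (cmap c' ` (cdom c' \<inter> cdom d))"
      by (rule smooth_on_cong[OF o, rotated]) (use inv sub in auto)
    have o2: "open (cmap d ` (cdom c' \<inter> cdom d))"
      by (rule open_cmap_image[OF dm]) (simp add: dom open_chart_vimage[OF c \<Omega>(1)])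
    have "smooth_on (\<lambda>y. \<Phi> ((cmap c \<circ> cinv d) y)) (cmap d ` (cdom c' \<inter> cdom d))"
    proof (rule smooth_on_compose[where f=\<Phi> and g="cmap c \<circ> cinv d", OF o2 \<Omega>(1) _ \<Phi>(2)])
      show "smooth_on (cmap c \<circ> cinv d) (cmap d ` (cdom c' \<inter> cdom d))"
        by (rule smooth_on_subset[OF smooth_transition[OF dm c]]) (auto simp: dom)
    qed (auto simp: dom cinv_cmap[OF dm])
    then show "smooth_on (cmap c' \<circ> cinv d) (cmap d ` (cdom c' \<inter> cdom d))"
      by (rule smooth_on_cong[OF o2, rotated]) (simp add: map)
  qed
  show "to_chart A c' p v = frechet_derivative \<Phi> (at (cmap c p)) (to_chart A c p v)" if p: "p \<in> cdom c'" for p v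
  proof -
    have pc: "p \<in> cdom c" "cmap c p \<in> \<Omega>" using p by (auto simp: dom)
    have "(\<Phi> has_derivative frechet_derivative \<Phi> (at (cmap c p))) (at (cmap c p))"
      by (rule smooth_onD[OF \<Phi>(2) pc(2)])
    then have "((cmap c' \<circ> cinv c) has_derivative frechet_derivative \<Phi> (at (cmap c p))) (at (cmap c p))"
      by (rule has_derivative_transform_within_open[OF _ \<Omega>(1) pc(2)]) 
         (use \<Omega>(2) cinv_cmap[OF c] in \<open>auto simp: map\<close>)
    from has_derivative_unique[OF this transition_has_derivative[OF c c' pc(1) p]]
    show ?thesis using coord_change_to_chart[OF c pc(1) c' p, of v] by simp
  qed
qed

text \<open>Invariance of the Lie bracket: each component derivative picks up a second derivative of
  the transition, and these terms cancel in the difference by symmetry.\<close>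

lemma bracket_coord_change:
  assumes c: "c \<in> A" "p \<in> cdom c" and W: "open W" "p \<in> W"
    and X: "vector_field_on A W X" and Y: "vector_field_on A W Y"
  defines "loc Z \<equiv> \<lambda>x. to_chart A c (cinv c x) (Z (cinv c x))"
  shows "frechet_derivative (loc Y) (at (cmap c p)) (loc X (cmap c p)) - frechet_derivative (loc X) (at (cmap c p)) (loc Y (cmap c p))
    = to_chart A c p (dvf Y p (X p) - dvf X p (Y p))"
proof -
  let ?e = "chart_at A p" and ?x = "cmap (chart_at A p) p"
  note cm = max_atlasI[OF c(1)] and em = chart_at_max[of p] and pe = chart_at(2)[of p]
  define T where "T = cmap c \<circ> cinv ?e"
  define S where "S = cmap ?e ` (W \<inter> cdom c \<inter> cdom ?e)"
  have oS: "open S" unfolding S_def by (intro open_cmap_image em open_Int W open_cdom cm)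
  have xS: "?x \<in> S" using W c pe by (auto simp: S_def)
  have Ts: "smooth_on T S" unfolding T_def
    by (rule smooth_on_subset[OF smooth_transition[OF em cm]]) (auto simp: S_def)
  define DT where "DT v x = frechet_derivative T (at x) v" for v x
  have DTs: "smooth_on (DT v) S" for v unfolding DT_def by (rule smooth_on_frechet_derivative[OF Ts])
  have DTl: "linear (\<lambda>v. DT v x)" if "x \<in> S" for x
    unfolding DT_def using linear_frechet_derivative[OF Ts that] .
  have DTx: "DT v ?x = to_chart A c p v" for v
    by (simp add: DT_def T_def to_chart_def coord_change_def)
  have Tx: "T ?x = cmap c p" by (simp add: T_def cinv_cmap em pe)
  have key: "frechet_derivative (loc Z) (at (cmap c p)) (to_chart A c p u)
      = frechet_derivative (DT (Z p)) (at ?x) u + to_chart A c p (dvf Z p u)" if Z: "vector_field_on A W Z" for Z u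
  proof -
    have TD: "(T has_derivative (\<lambda>v. DT v ?x)) (at ?x)" unfolding DT_def by (rule smooth_onD[OF Ts xS])
    have "(loc Z has_derivative frechet_derivative (loc Z) (at (T ?x))) (at (T ?x))"
      unfolding loc_def Tx by (rule smooth_onD[OF vector_field_loc[OF Z c(1)]]) (use c W in auto)
    from has_derivative_compose[OF TD this]
    have 1: "((\<lambda>x. loc Z (T x)) has_derivative (\<lambda>u. frechet_derivative (loc Z) (at (cmap c p)) (to_chart A c p u))) (at ?x)"
      by (simp add: DTx Tx)
    have "((\<lambda>x. DT (to_chart A ?e (cinv ?e x) (Z (cinv ?e x))) x) has_derivative
        (\<lambda>u. frechet_derivative (DT (Z p)) (at ?x) u + to_chart A c p (dvf Z p u))) (at ?x)"
      using has_derivative_linear_apply[OF oS xS DTl smooth_onD[OF DTs xS] dvf[OF Z W(2)]]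
      by (simp add: DTx cinv_cmap em pe)
    then have 2: "((\<lambda>x. loc Z (T x)) has_derivative
        (\<lambda>u. frechet_derivative (DT (Z p)) (at ?x) u + to_chart A c p (dvf Z p u))) (at ?x)"
    proof (rule has_derivative_transform_within_open[OF _ oS xS])
      fix x assume "x \<in> S"
      then obtain q where q: "q \<in> cdom c" "q \<in> cdom ?e" "x = cmap ?e q" by (auto simp: S_def)
      then show "DT (to_chart A ?e (cinv ?e x) (Z (cinv ?e x))) x = loc Z (T x)"
        using coord_change_to_chart[OF em q(2) cm q(1), of "Z q"]
        by (simp add: DT_def T_def loc_def cinv_cmap em cm coord_change_def)
    qed
    show ?thesis using has_derivative_unique[OF 1 2] by metis
  qed
  have l: "loc Z (cmap c p) = to_chart A c p (Z p)" for Z by (simp add: loc_def cinv_cmap cm c)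
  have "frechet_derivative (DT (Y p)) (at ?x) (X p) = frechet_derivative (DT (X p)) (at ?x) (Y p)"
    unfolding DT_def by (rule symmetric_second_derivative[OF Ts oS xS])
  then show ?thesis
    unfolding l key[OF X] key[OF Y] by (simp add: linear_diff[OF linear_to_chart[OF cm c(2)]])
qed

lemma vector_field_from_chart:
  assumes c: "c \<in> A" and W: "open W" "W \<subseteq> cmap c ` cdom c" and X: "smooth_on X W"
  shows "vector_field_on A (cdom c \<inter> cmap c -` W) (\<lambda>p. from_chart A c p (X (cmap c p)))"
proof -
  interpret I: smooth_mfd_map A A id by (rule smooth_mfd_map_id)
  note cm = max_atlasI[OF c]
  have o: "open (cdom c \<inter> cmap c -` W)" by (rule open_chart_vimage[OF cm W(1)])
  have ld: "I.loc_dom c c (cdom c \<inter> cmap c -` W) = W"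
    using W(2) by (auto simp: I.loc_dom_def)
  have s: "smooth_on (I.loc_sec c c (\<lambda>p. from_chart A c p (X (cmap c p)))) W"
  proof (rule smooth_on_cong[OF W(1) _ X])
    fix x assume "x \<in> W"
    then obtain p where "p \<in> cdom c" "x = cmap c p" using W(2) by blast
    then show "X x = I.loc_sec c c (\<lambda>p. from_chart A c p (X (cmap c p))) x"
      by (simp add: I.loc_sec_def cinv_cmap[OF cm] to_chart_from_chart[OF cm])
  qed
  show ?thesis
  proof (rule I.smooth_alongI[OF o])
    fix p assume "p \<in> cdom c \<inter> cmap c -` W"
    then show "\<exists>c'\<in>A. \<exists>d\<in>A. \<exists>T. open T \<and> p \<in> T \<and> p \<in> cdom c' \<and> id p \<in> cdom d \<and>
        smooth_on (I.loc_sec c' d (\<lambda>p. from_chart A c p (X (cmap c p)))) (I.loc_dom c' d T)"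
      using s c o ld by (intro bexI[of _ c] exI[of _ "cdom c \<inter> cmap c -` W"]) auto
  qed
qed

end

section \<open>Integral patches and the leaf topology\<close>

locale foliation = smooth_mfd A for A :: "('a::t2_space, 'e::euclidean_space) chart set" +
  fixes P :: "'a \<Rightarrow> 'e \<Rightarrow> 'e" and r :: nat
  assumes linear_P: "linear (P p)" and idem_P: "P p (P p v) = P p v" and dim_P: "dim (range (P p)) = r"
    and smooth_P: "open W \<Longrightarrow> vector_field_on A W X \<Longrightarrow> vector_field_on A W (\<lambda>p. P p (X p))"
    and involutive: "open W \<Longrightarrow> vector_field_on A W X \<Longrightarrow> vector_field_on A W Y \<Longrightarrow>
      (\<And>p. p \<in> W \<Longrightarrow> X p \<in> range (P p)) \<Longrightarrow> (\<And>p. p \<in> W \<Longrightarrow> Y p \<in> range (P p)) \<Longrightarrow> p \<in> W \<Longrightarrow>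
      dvf Y p (X p) - dvf X p (Y p) \<in> range (P p)"
begin

text \<open>A plaque: an open piece of an affine plane in a chart, everywhere tangent to the
  distribution. It carries no topology of its own, because the patches are used to define the leaf
  topology.\<close>

definition patch :: "('a, 'e) chart \<Rightarrow> 'e set \<Rightarrow> 'a set \<Rightarrow> bool" where
  "patch c E S \<longleftrightarrow> c \<in> max_atlas A \<and> subspace E \<and> S \<subseteq> cdom c \<and>
     (\<exists>a. openin (top_of_set ((+) a ` E)) (cmap c ` S)) \<and> (\<forall>q\<in>S. to_chart A c q ` range (P q) = E)"

lemma plane_eq:
  assumes "subspace E" "b \<in> (+) a ` E"
  shows "(+) a ` E = (+) b ` (E::'e set)"
proof -
  obtain e where e: "e \<in> E" "b = a + e" using assms(2) by blast
  show ?thesis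
  proof (intro equalityI subsetI)
    fix y assume "y \<in> (+) a ` E"
    then obtain z where "z \<in> E" "y = a + z" by blast
    then show "y \<in> (+) b ` E" using subspace_diff[OF assms(1) _ e(1), of z] e(2)
      by (intro image_eqI[of _ _ "z - e"]) auto
  next
    fix y assume "y \<in> (+) b ` E"
    then obtain z where "z \<in> E" "y = b + z" by blast
    then show "y \<in> (+) a ` E" using subspace_add[OF assms(1) e(1), of z] e(2)
      by (intro image_eqI[of _ _ "e + z"]) auto
  qed
qed

lemma plane_iff: "y \<in> (+) a ` E \<longleftrightarrow> y - a \<in> (E::'e set)"
  by (auto intro: image_eqI[of _ _ "y - a"])

lemma patch_openin:
  assumes "patch c E S" "p \<in> S"
  shows "openin (top_of_set ((+) (cmap c p) ` E)) (cmap c ` S)"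
proof -
  obtain a where a: "openin (top_of_set ((+) a ` E)) (cmap c ` S)" and E: "subspace E"
    using assms(1) by (auto simp: patch_def)
  have "cmap c p \<in> (+) a ` E" using openin_imp_subset[OF a] assms(2) by blast
  from plane_eq[OF E this] a show ?thesis by simp
qed

lemma patch_subset:
  assumes "patch c E S" "T \<subseteq> S" "openin (top_of_set (cmap c ` S)) (cmap c ` T)"
  shows "patch c E T"
  using assms openin_trans unfolding patch_def by (metis subset_iff)

lemma dim_patch:
  assumes "patch c E S" "p \<in> S"
  shows "dim E = r"
proof -
  have c: "c \<in> max_atlas A" "p \<in> cdom c" "to_chart A c p ` range (P p) = E" using assms by (auto simp: patch_def)
  have "inj (to_chart A c p)" using from_chart_to_chart[OF c(1,2)] by (metis injI)
  then show ?thesis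
    using dim_image_eq[OF linear_to_chart[OF c(1,2)] inj_on_subset[OF _ subset_UNIV]] c(3) dim_P by metis
qed

definition loc_proj :: "('a, 'e) chart \<Rightarrow> 'e \<Rightarrow> 'e \<Rightarrow> 'e" where
  "loc_proj c x v = to_chart A c (cinv c x) (P (cinv c x) (from_chart A c (cinv c x) v))"

lemma range_loc_proj:
  assumes "c \<in> max_atlas A" "p \<in> cdom c"
  shows "range (loc_proj c (cmap c p)) = to_chart A c p ` range (P p)"
proof -
  have "surj (from_chart A c p)" using from_chart_to_chart[OF assms] by (metis surjI)
  moreover have "loc_proj c (cmap c p) = to_chart A c p \<circ> P p \<circ> from_chart A c p"
    using cinv_cmap[OF assms] by (auto simp: loc_proj_def fun_eq_iff)
  ultimately show ?thesis by (simp only: image_comp[symmetric])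
qed

text \<open>Every integral patch through \<open>p\<close> agrees near \<open>p\<close> with the one provided by the Frobenius
  theorem: curves in it that start at \<open>p\<close> stay in the Frobenius patch, and a continuous injection
  between planes of the same dimension is open.\<close>

lemma frobenius_patch:
  obtains c0 E0 S0 where "patch c0 E0 S0" "p \<in> S0"
    "\<And>c E S. patch c E S \<Longrightarrow> p \<in> S \<Longrightarrow> \<exists>T. p \<in> T \<and> T \<subseteq> S \<inter> S0 \<and>
      openin (top_of_set (cmap c ` S)) (cmap c ` T) \<and> openin (top_of_set (cmap c0 ` S0)) (cmap c0 ` T)"
proof -
  define c where "c = chart_at A p"
  have c: "c \<in> A" "p \<in> cdom c" and cm: "c \<in> max_atlas A" using chart_at chart_at_max by (auto simp: c_def)
  define \<Omega> where "\<Omega> = cmap c ` cdom c"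
  define x0 where "x0 = cmap c p"
  define Q where "Q = loc_proj c"
  have o\<Omega>: "open \<Omega>" unfolding \<Omega>_def by (rule open_cmap_image'[OF cm open_cdom[OF cm]]) simp
  have x0: "x0 \<in> \<Omega>" using c by (simp add: \<Omega>_def x0_def)
  have ci: "cinv c x \<in> cdom c" "cmap c (cinv c x) = x" if "x \<in> \<Omega>" for x
    using that cinv_cmap[OF cm] by (auto simp: \<Omega>_def)
  have rQ: "range (Q (cmap c q)) = to_chart A c q ` range (P q)" if "q \<in> cdom c" for q
    unfolding Q_def by (rule range_loc_proj[OF cm that])
  have linQ: "linear (Q x)" if "x \<in> \<Omega>" for x
    using linear_compose[OF linear_from_chart[OF cm ci(1)[OF that]] linear_compose[OF linear_P linear_to_chart[OF cm ci(1)[OF that]]]]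
    by (simp add: Q_def loc_proj_def[abs_def] o_def)
  have idemQ: "Q x (Q x v) = Q x v" if "x \<in> \<Omega>" for x v
    using from_chart_to_chart[OF cm ci(1)[OF that]] by (simp add: Q_def loc_proj_def idem_P)
  interpret I: smooth_mfd_map A A id by (rule smooth_mfd_map_id)
  have smQ: "smooth_on (\<lambda>x. Q x v) \<Omega>" for v
  proof -
    have "vector_field_on A (cdom c) (\<lambda>q. from_chart A c q v)"
      using I.smooth_along_const_coeff[OF c(1) open_cdom[OF cm]] by simp
    from vector_field_loc[OF smooth_P[OF open_cdom[OF cm] this] c(1)] show ?thesis
      by (simp add: Q_def loc_proj_def \<Omega>_def)
  qed
  have dimQ: "dim (range (Q x)) = r" if "x \<in> \<Omega>" for x
  proof -
    have "inj (to_chart A c (cinv c x))" using from_chart_to_chart[OF cm ci(1)[OF that]] by (metis injI)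
    then show ?thesis
      using dim_image_eq[OF linear_to_chart[OF cm ci(1)[OF that]] inj_on_subset[OF _ subset_UNIV], of "range (P (cinv c x))"]
        rQ[OF ci(1)[OF that]] ci(2)[OF that] dim_P by simp
  qed
  have invol: "frechet_derivative Y (at x) (X x) - frechet_derivative X (at x) (Y x) \<in> range (Q x)"
    if W: "open W" "W \<subseteq> \<Omega>" and X: "smooth_on X W" and Y: "smooth_on Y W"
      and XQ: "\<And>x. x \<in> W \<Longrightarrow> X x \<in> range (Q x)" and YQ: "\<And>x. x \<in> W \<Longrightarrow> Y x \<in> range (Q x)" and x: "x \<in> W"
    for X Y W x
  proof -
    let ?W = "cdom c \<inter> cmap c -` W" and ?F = "\<lambda>Z p. from_chart A c p (Z (cmap c p))"
    obtain q where q: "q \<in> cdom c" "x = cmap c q" using W(2) x by (auto simp: \<Omega>_def)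
    have oW: "open ?W" by (rule open_chart_vimage[OF cm W(1)])
    note vf = vector_field_from_chart[OF c(1) W[unfolded \<Omega>_def]]
    have rF: "?F Z q \<in> range (P q)" if Z: "\<And>x. x \<in> W \<Longrightarrow> Z x \<in> range (Q x)" and q: "q \<in> ?W" for Z q
    proof -
      obtain w where "Z (cmap c q) = to_chart A c q w" "w \<in> range (P q)"
        using Z[of "cmap c q"] q rQ[of q] by auto
      then show ?thesis using from_chart_to_chart[OF cm, of q] q by simp
    qed
    have loc: "frechet_derivative (\<lambda>x. to_chart A c (cinv c x) (?F Z (cinv c x))) (at x) = frechet_derivative Z (at x)"
      if Z: "smooth_on Z W" for Z
      by (rule sym, rule frechet_derivative_transform_within_open[OF _ W(1) x])
         (use smooth_onD[OF Z x] W(2) to_chart_from_chart[OF cm] ci in \<open>auto simp: subset_iff intro: differentiableI\<close>)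
    have "dvf (?F Y) q (?F X q) - dvf (?F X) q (?F Y q) \<in> range (P q)"
      by (rule involutive[OF oW vf[OF X] vf[OF Y] rF[OF XQ] rF[OF YQ]]) (use q x in auto)
    then have "to_chart A c q (dvf (?F Y) q (?F X q) - dvf (?F X) q (?F Y q)) \<in> range (Q x)"
      using rQ[OF q(1)] q(2) by blast
    moreover have "frechet_derivative Y (at x) (X x) - frechet_derivative X (at x) (Y x)
        = to_chart A c q (dvf (?F Y) q (?F X q) - dvf (?F X) q (?F Y q))"
      using bracket_coord_change[OF c(1) q(1) oW _ vf[OF X] vf[OF Y]] q x
      by (simp add: loc[OF X, unfolded q(2)] loc[OF Y, unfolded q(2)] cinv_cmap[OF cm q(1)] to_chart_from_chart[OF cm q(1)])
    ultimately show ?thesis by simp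
  qed
  obtain \<Omega>' \<Phi> \<Psi> \<epsilon> where \<Omega>': "open \<Omega>'" "x0 \<in> \<Omega>'" "\<Omega>' \<subseteq> \<Omega>"
    and \<Phi>: "open (\<Phi> ` \<Omega>')" "smooth_on \<Phi> \<Omega>'" "smooth_on \<Psi> (\<Phi> ` \<Omega>')" "\<And>x. x \<in> \<Omega>' \<Longrightarrow> \<Psi> (\<Phi> x) = x" "\<Phi> x0 = x0"
    and tang: "\<And>x. x \<in> \<Omega>' \<Longrightarrow> \<Phi> x - x0 \<in> range (Q x0) \<Longrightarrow> frechet_derivative \<Phi> (at x) ` range (Q x) = range (Q x0)"
    and e: "\<epsilon> > 0"
    and uniq: "\<And>\<gamma> \<gamma>'. \<gamma> 0 = x0 \<Longrightarrow> (\<And>t. t \<in> {0..1} \<Longrightarrow> (\<gamma> has_vector_derivative \<gamma>' t) (at t within {0..1}) \<and>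
      \<gamma> t \<in> \<Omega>' \<and> \<gamma>' t \<in> range (Q (\<gamma> t)) \<and> norm (\<gamma>' t) \<le> \<epsilon>) \<Longrightarrow> \<Phi> (\<gamma> (1::real)) - x0 \<in> range (Q x0)"
  proof (rule frobenius_slice[OF o\<Omega> x0 linQ idemQ smQ dimQ invol], assumption+, goal_cases)
    case (1 \<Omega>' \<Phi> \<Psi> \<epsilon>)
    show ?case by (rule that[of \<Omega>' \<Phi> \<Psi> \<epsilon>]) (fact 1)+
  qed
  define c0 where "c0 = (cdom c \<inter> cmap c -` \<Omega>', \<Phi> \<circ> cmap c)"
  define E where "E = range (Q x0)"
  define S0 where "S0 = {q \<in> cdom c0. cmap c0 q - x0 \<in> E}"
  have ct: "c0 \<in> max_atlas A" "cmap c0 ` cdom c0 = \<Phi> ` \<Omega>'"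
    "\<And>q v. q \<in> cdom c0 \<Longrightarrow> to_chart A c0 q v = frechet_derivative \<Phi> (at (cmap c q)) (to_chart A c q v)"
    unfolding c0_def
    using chart_transform[OF cm \<Omega>'(1) \<Omega>'(3)[unfolded \<Omega>_def] \<Phi>(1-3)] \<Phi>(4) by blast+
  note c0m = ct(1)
  have sE: "subspace E" unfolding E_def by (rule linear_subspace_image[OF linQ[OF x0] subspace_UNIV])
  have c0p: "p \<in> cdom c0" "cmap c0 p = x0" using c \<Omega>'(2) \<Phi>(5) by (auto simp: c0_def x0_def)
  have pS: "p \<in> S0" using c0p subspace_0[OF sE] by (simp add: S0_def)
  have S0im: "cmap c0 ` S0 = (+) x0 ` E \<inter> cmap c0 ` cdom c0"
    unfolding S0_def set_eq_iff Int_iff plane_iff by blast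
  have oS0: "openin (top_of_set ((+) x0 ` E)) (cmap c0 ` S0)"
    unfolding S0im ct(2) by (rule openin_open_Int[OF \<Phi>(1)])
  have pt: "patch c0 E S0"
    unfolding patch_def
  proof (intro conjI c0m sE exI[of _ x0] oS0 ballI)
    show "S0 \<subseteq> cdom c0" by (auto simp: S0_def)
    fix q assume q: "q \<in> S0"
    then have qc: "q \<in> cdom c0" "q \<in> cdom c" "cmap c q \<in> \<Omega>'" "\<Phi> (cmap c q) - x0 \<in> range (Q x0)"
      by (auto simp: S0_def c0_def E_def)
    have "to_chart A c0 q ` range (P q) = frechet_derivative \<Phi> (at (cmap c q)) ` to_chart A c q ` range (P q)"
      unfolding image_image using ct(3)[OF qc(1)] by simp
    also have "\<dots> = E" using tang[OF qc(3,4)] rQ[OF qc(2)] by (simp add: E_def)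
    finally show "to_chart A c0 q ` range (P q) = E" .
  qed
  show ?thesis
  proof (rule that[OF pt pS])
    fix c2 E2 S2 assume S2: "patch c2 E2 S2" and pS2: "p \<in> S2"
    have c2m: "c2 \<in> max_atlas A" and sE2: "subspace E2" and S2c: "S2 \<subseteq> cdom c2"
      and S2t: "\<And>q. q \<in> S2 \<Longrightarrow> to_chart A c2 q ` range (P q) = E2" using S2 by (auto simp: patch_def)
    have pc2: "p \<in> cdom c2" using S2c pS2 by blast
    define y2 where "y2 = cmap c2 p"
    define F where "F = cmap c \<circ> cinv c2"
    define V where "V = cmap c2 ` (cdom c0 \<inter> cdom c2)"
    have oV: "open V" unfolding V_def by (rule open_cmap_image[OF c2m open_cdom[OF c0m]])
    have c0c: "cdom c0 \<subseteq> cdom c" by (auto simp: c0_def)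
    have Fs: "smooth_on F V" unfolding F_def
      by (rule smooth_on_subset[OF smooth_transition[OF c2m cm]]) (use c0c in \<open>auto simp: V_def\<close>)
    obtain U where U: "open U" "cmap c2 ` S2 = (+) y2 ` E2 \<inter> U"
      using patch_openin[OF S2 pS2] by (auto simp: openin_open y2_def)
    have y2: "y2 \<in> V \<inter> U" using pc2 c0p pS2 U by (auto simp: V_def y2_def)
    obtain \<rho> where \<rho>: "\<rho> > 0" "cball y2 \<rho> \<subseteq> V \<inter> U"
      using y2 oV U(1) open_contains_cball[of "V \<inter> U"] by blast
    obtain C where C: "C \<ge> 0" "\<And>y v. y \<in> cball y2 \<rho> \<Longrightarrow> norm (frechet_derivative F (at y) v) \<le> C * norm v"
      using smooth_derivative_bound[of "cball y2 \<rho>" V F] \<rho>(2) Fs by auto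
    \<comment> \<open>Makes images of radial segments in the ball slow enough for the uniqueness
      clause of the Frobenius slice; \<open>C + 1\<close> avoids division by 0.\<close>
    define \<rho>' where "\<rho>' = min \<rho> (\<epsilon> / (C + 1))"
    have \<rho>': "\<rho>' > 0" "\<rho>' \<le> \<rho>" "C * \<rho>' \<le> \<epsilon>"
    proof -
      show "\<rho>' > 0" "\<rho>' \<le> \<rho>" using \<rho>(1) e C(1) by (auto simp: \<rho>'_def)
      have "C * \<rho>' \<le> C * (\<epsilon> / (C + 1))" using C(1) by (intro mult_left_mono) (auto simp: \<rho>'_def)
      also have "\<dots> \<le> \<epsilon>" using C(1) e by (simp add: field_simps)
      finally show "C * \<rho>' \<le> \<epsilon>" .
    qed
    define Z where "Z = (+) y2 ` E2 \<inter> ball y2 \<rho>'"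
    define T where "T = cinv c2 ` Z"
    have ZS2: "Z \<subseteq> cmap c2 ` S2" using U \<rho> \<rho>'(2) by (auto simp: Z_def)
    have ZV: "Z \<subseteq> V" using \<rho> \<rho>'(2) by (auto simp: Z_def)
    have cT: "cmap c2 ` T = Z"
    proof -
      have "cmap c2 (cinv c2 z) = z" if "z \<in> Z" for z
        using ZS2 S2c that cinv_cmap[OF c2m] by (metis f_inv_into_f image_mono subset_iff)
      then show ?thesis by (auto simp: T_def image_image)
    qed
    have TS2: "T \<subseteq> S2"
      using ZS2 S2c cinv_cmap[OF c2m] unfolding T_def by (smt (verit) image_iff image_subset_iff subset_iff)
    have TS0: "T \<subseteq> S0"
    proof
      fix q assume "q \<in> T"
      then obtain z where z: "z \<in> Z" "q = cinv c2 z" by (auto simp: T_def)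
      then obtain w where w: "w \<in> E2" "z = y2 + w" "norm w < \<rho>'" by (auto simp: Z_def dist_norm)
      \<comment> \<open>The radial segment to \<open>z\<close> runs in the plane of the second
        patch, so its image in the chart \<open>c\<close> is a curve from \<open>x0\<close> tangent
        to the distribution.\<close>
      define \<gamma> where "\<gamma> t = F (y2 + t *\<^sub>R w)" for t
      define \<gamma>' where "\<gamma>' t = frechet_derivative F (at (y2 + t *\<^sub>R w)) w" for t
      have "\<Phi> (\<gamma> 1) - x0 \<in> range (Q x0)"
      proof (rule uniq)
        show "\<gamma> 0 = x0" by (simp add: \<gamma>_def F_def y2_def x0_def cinv_cmap c2m pc2)
        fix t :: real assume t: "t \<in> {0..1}"
        let ?y = "y2 + t *\<^sub>R w"
        have "\<bar>t\<bar> * norm w \<le> norm w" using t by (simp add: mult_left_le_one_le)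
        then have yb: "?y \<in> ball y2 \<rho>'" using w(3) by (simp add: dist_norm)
        then have yZ: "?y \<in> Z" using w(1) sE2 by (auto simp: Z_def subspace_scale)
        have yV: "?y \<in> V" using yZ ZV by blast
        obtain q' where q': "q' \<in> S2" "?y = cmap c2 q'" using yZ ZS2 by blast
        have q'c2: "q' \<in> cdom c2" and cq': "cinv c2 ?y = q'" using q' S2c cinv_cmap[OF c2m] by auto
        have q'0: "q' \<in> cdom c0"
        proof -
          obtain q'' where "q'' \<in> cdom c0" "q'' \<in> cdom c2" "?y = cmap c2 q''" using yV by (auto simp: V_def)
          then show ?thesis using cinv_cmap[OF c2m] cq' by metis
        qed
        have q'c: "q' \<in> cdom c" using q'0 c0c by blast
        have "((\<lambda>t. y2 + t *\<^sub>R w) has_derivative (\<lambda>s. s *\<^sub>R w)) (at t within {0..1})"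
          by (auto intro!: derivative_eq_intros)
        from has_derivative_compose[OF this smooth_onD[OF Fs yV]]
        have 1: "(\<gamma> has_vector_derivative \<gamma>' t) (at t within {0..1})"
          using linear_scale[OF linear_frechet_derivative[OF Fs yV]]
          by (simp add: has_vector_derivative_def \<gamma>_def[abs_def] \<gamma>'_def)
        have \<gamma>t: "\<gamma> t = cmap c q'" by (simp add: \<gamma>_def F_def cq')
        have 2: "\<gamma> t \<in> \<Omega>'" using q'0 \<gamma>t by (simp add: c0_def)
        obtain u where u: "u \<in> range (P q')" "to_chart A c2 q' u = w" using S2t[OF q'(1)] w(1) by (metis imageE)
        have "\<gamma>' t = coord_change c2 c q' w" by (simp add: \<gamma>'_def F_def coord_change_def q'(2)[symmetric])
        also have "\<dots> = to_chart A c q' u"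
          using coord_change_to_chart[OF c2m q'c2 cm q'c, of u] u(2) by simp
        finally have 3: "\<gamma>' t \<in> range (Q (\<gamma> t))" using u(1) rQ[OF q'c] \<gamma>t by simp
        have "norm (\<gamma>' t) \<le> C * norm w"
          unfolding \<gamma>'_def using yb \<rho>'(2) by (intro C(2)) auto
        also have "\<dots> \<le> C * \<rho>'" using w(3) C(1) by (intro mult_left_mono) auto
        finally have 4: "norm (\<gamma>' t) \<le> \<epsilon>" using \<rho>'(3) by simp
        show "(\<gamma> has_vector_derivative \<gamma>' t) (at t within {0..1}) \<and> \<gamma> t \<in> \<Omega>' \<and> \<gamma>' t \<in> range (Q (\<gamma> t)) \<and> norm (\<gamma>' t) \<le> \<epsilon>"
          using 1 2 3 4 by blast
      qed
      moreover have "\<gamma> 1 = cmap c q" using z(2) w(2) by (simp add: \<gamma>_def F_def)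
      moreover have "q \<in> cdom c0"
        using ZV z cinv_cmap[OF c2m] unfolding V_def by auto
      ultimately show "q \<in> S0" by (simp add: S0_def c0_def E_def)
    qed
    have pT: "p \<in> T"
    proof -
      have "y2 \<in> Z" using \<rho>'(1) subspace_0[OF sE2] by (force simp: Z_def)
      moreover have "cinv c2 y2 = p" by (simp add: y2_def cinv_cmap c2m pc2)
      ultimately show ?thesis unfolding T_def by (metis imageI)
    qed
    have oZ: "openin (top_of_set ((+) y2 ` E2)) Z" unfolding Z_def by (rule openin_open_Int[OF open_ball])
    have o2: "openin (top_of_set (cmap c2 ` S2)) (cmap c2 ` T)"
      unfolding cT by (rule openin_subset_trans[OF oZ ZS2]) (simp add: U)
    have "openin (top_of_set ((+) x0 ` E)) ((cmap c0 \<circ> cinv c2) ` Z)"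
    proof (rule invariance_of_domain_affine_sets[OF oZ])
      show "affine ((+) y2 ` E2)" "affine ((+) x0 ` E)"
        using sE sE2 by (auto simp: affine_translation[symmetric] subspace_imp_affine)
      show "aff_dim ((+) x0 ` E) \<le> aff_dim ((+) y2 ` E2)"
        using dim_patch[OF S2 pS2] dim_patch[OF pt pS] aff_dim_subspace[OF sE] aff_dim_subspace[OF sE2]
        by (simp add: aff_dim_translation_eq)
      have cm0: "(cmap c0 \<circ> cinv c2) ` Z = cmap c0 ` T" by (simp only: T_def image_comp)
      have "cmap c0 ` T \<subseteq> (+) x0 ` E" using TS0 S0im by blast
      then show "cmap c0 \<circ> cinv c2 \<in> Z \<rightarrow> (+) x0 ` E" using cm0 by blast
      show "continuous_on Z (cmap c0 \<circ> cinv c2)"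
        by (rule continuous_on_subset[OF smooth_on_imp_continuous[OF smooth_transition[OF c2m c0m]]])
           (use ZV in \<open>auto simp: V_def\<close>)
      have "inj_on (cinv c2) Z" using cT unfolding T_def by (metis (no_types, lifting) ZV V_def Int_lower2 image_mono inj_on_inv_into order_trans)
      moreover have "inj_on (cmap c0) (cinv c2 ` Z)"
        using TS0 inj_on_cmap[OF c0m] unfolding T_def S0_def by (auto intro: inj_on_subset)
      ultimately show "inj_on (cmap c0 \<circ> cinv c2) Z" by (rule comp_inj_on)
    qed
    moreover have "(cmap c0 \<circ> cinv c2) ` Z = cmap c0 ` T" by (simp only: T_def image_comp)
    ultimately have "openin (top_of_set (cmap c0 ` S0)) (cmap c0 ` T)"
      using openin_subset_trans[of "(+) x0 ` E" "cmap c0 ` T" "cmap c0 ` S0"] image_mono[OF TS0, of "cmap c0"]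
        openin_imp_subset[OF oS0] by simp
    with pT TS2 TS0 o2 show "\<exists>T. p \<in> T \<and> T \<subseteq> S2 \<inter> S0 \<and>
      openin (top_of_set (cmap c2 ` S2)) (cmap c2 ` T) \<and> openin (top_of_set (cmap c0 ` S0)) (cmap c0 ` T)"
      by blast
  qed
qed

text \<open>Each of the two patches shares with the Frobenius patch at \<open>p\<close> a
  neighbourhood that is open in both; intersecting the two neighbourhoods compares the
  patches.\<close>

lemma patch_inter:
  assumes "patch c1 E1 S1" "patch c2 E2 S2" "p \<in> S1" "p \<in> S2"
  obtains T where "p \<in> T" "T \<subseteq> S1 \<inter> S2" "openin (top_of_set (cmap c1 ` S1)) (cmap c1 ` T)"
proof -
  obtain c0 E0 S0 where S0: "patch c0 E0 S0" "p \<in> S0"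
    and Ex: "\<And>c E S. patch c E S \<Longrightarrow> p \<in> S \<Longrightarrow> \<exists>T. p \<in> T \<and> T \<subseteq> S \<inter> S0 \<and>
      openin (top_of_set (cmap c ` S)) (cmap c ` T) \<and> openin (top_of_set (cmap c0 ` S0)) (cmap c0 ` T)"
  proof (rule frobenius_patch[of p], goal_cases)
    case (1 c0 E0 S0)
    show ?case by (rule that[of c0 E0 S0]) (fact 1)+
  qed
  obtain T1 where T1: "p \<in> T1" "T1 \<subseteq> S1 \<inter> S0" "openin (top_of_set (cmap c1 ` S1)) (cmap c1 ` T1)"
    "openin (top_of_set (cmap c0 ` S0)) (cmap c0 ` T1)" using Ex[OF assms(1,3)] by blast
  obtain T2 where T2: "p \<in> T2" "T2 \<subseteq> S2 \<inter> S0" "openin (top_of_set (cmap c0 ` S0)) (cmap c0 ` T2)"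
    using Ex[OF assms(2,4)] by blast
  have c: "c0 \<in> max_atlas A" "c1 \<in> max_atlas A" "S0 \<subseteq> cdom c0" "S1 \<subseteq> cdom c1"
    using S0 assms(1) by (auto simp: patch_def)
  \<comment> \<open>Openness of \<open>T2\<close> is known in the chart \<open>c0\<close> only; this
    identity transports it to \<open>c1\<close> through the continuous transition.\<close>
  have "cmap c1 ` (T1 \<inter> T2) = cmap c1 ` T1 \<inter> (cmap c0 \<circ> cinv c1) -` (cmap c0 ` T2)"
  proof (intro equalityI subsetI)
    fix y assume "y \<in> cmap c1 ` T1 \<inter> (cmap c0 \<circ> cinv c1) -` (cmap c0 ` T2)"
    then obtain q q' where q: "q \<in> T1" "y = cmap c1 q" "q' \<in> T2" "cmap c0 (cinv c1 y) = cmap c0 q'" by auto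
    have "cinv c1 y = q" using q c T1(2) cinv_cmap[OF c(2)] by blast
    moreover have "q \<in> cdom c0" "q' \<in> cdom c0" using q T1(2) T2(2) c(3) by blast+
    ultimately have "q = q'" using q inj_onD[OF inj_on_cmap[OF c(1)], of q q'] by simp
    then show "y \<in> cmap c1 ` (T1 \<inter> T2)" using q by blast
  qed (use T1(2) c cinv_cmap[OF c(2)] in \<open>auto simp: subset_iff\<close>)
  moreover have "openin (top_of_set (cmap c1 ` T1)) (cmap c1 ` T1 \<inter> (cmap c0 \<circ> cinv c1) -` (cmap c0 ` T2))"
  proof (rule continuous_openin_preimage[OF _ _ T2(3)])
    show "continuous_on (cmap c1 ` T1) (cmap c0 \<circ> cinv c1)"
      by (rule continuous_on_subset[OF smooth_on_imp_continuous[OF smooth_transition[OF c(2,1)]]], rule image_mono)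
         (use T1(2) c in blast)
    show "cmap c0 \<circ> cinv c1 \<in> cmap c1 ` T1 \<rightarrow> cmap c0 ` S0"
      using T1(2) c cinv_cmap[OF c(2)] by (auto simp: subset_iff)
  qed
  ultimately have "openin (top_of_set (cmap c1 ` S1)) (cmap c1 ` (T1 \<inter> T2))"
    using openin_trans[OF _ T1(3)] by simp
  then show ?thesis using that[of "T1 \<inter> T2"] T1 T2 by blast
qed

definition leaf_open :: "'a set \<Rightarrow> bool" where
  "leaf_open U \<longleftrightarrow> (\<forall>p\<in>U. \<exists>c E S. patch c E S \<and> p \<in> S \<and> S \<subseteq> U)"

text \<open>The patches form a base: by \<open>patch_inter\<close> an intersection of two of them
  contains a patch around each of its points.\<close>

lemma istopology_leaf_open: "istopology leaf_open"
  unfolding istopology_def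
proof (intro conjI allI impI)
  fix U V assume UV: "leaf_open U" "leaf_open V"
  show "leaf_open (U \<inter> V)"
    unfolding leaf_open_def
  proof
    fix p assume p: "p \<in> U \<inter> V"
    then obtain c E S c' E' S' where S: "patch c E S" "p \<in> S" "S \<subseteq> U" and S': "patch c' E' S'" "p \<in> S'" "S' \<subseteq> V"
      using UV unfolding leaf_open_def by (meson IntD1 IntD2)
    obtain T where T: "p \<in> T" "T \<subseteq> S \<inter> S'" "openin (top_of_set (cmap c ` S)) (cmap c ` T)"
      using patch_inter[OF S(1) S'(1) S(2) S'(2)] by blast
    have "patch c E T" using patch_subset[OF S(1) _ T(3)] T(2) by blast
    then show "\<exists>c E S. patch c E S \<and> p \<in> S \<and> S \<subseteq> U \<inter> V" using T S S' by blast
  qed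
next
  fix \<U> :: "'a set set" assume "\<forall>K\<in>\<U>. leaf_open K"
  then show "leaf_open (\<Union>\<U>)" unfolding leaf_open_def by (meson Union_iff Union_upper subset_trans)
qed

definition leaf_top :: "'a topology" where "leaf_top = topology leaf_open"

lemma openin_leaf_top: "openin leaf_top = leaf_open"
  unfolding leaf_top_def using istopology_leaf_open by (rule topology_inverse')

lemma patch_exists: obtains c E S where "patch c E S" "p \<in> S"
  using frobenius_patch[of p] by metis

lemma topspace_leaf_top: "topspace leaf_top = UNIV"
proof -
  have "openin leaf_top UNIV"
    unfolding openin_leaf_top leaf_open_def using patch_exists by (metis subset_UNIV)
  then show ?thesis using openin_subset by blast
qed

lemma openin_patch: "patch c E S \<Longrightarrow> openin leaf_top S"
  unfolding openin_leaf_top leaf_open_def by blast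

lemma patch_open_image:
  assumes S: "patch c E S" and U: "openin leaf_top U" "U \<subseteq> S"
  shows "openin (top_of_set (cmap c ` S)) (cmap c ` U)"
proof (subst openin_subopen, intro ballI)
  fix y assume "y \<in> cmap c ` U"
  then obtain q where q: "q \<in> U" "y = cmap c q" by blast
  obtain c' E' S' where S': "patch c' E' S'" "q \<in> S'" "S' \<subseteq> U"
    using U(1) q(1) unfolding openin_leaf_top leaf_open_def by blast
  obtain T where "q \<in> T" "T \<subseteq> S \<inter> S'" "openin (top_of_set (cmap c ` S)) (cmap c ` T)"
    using patch_inter[OF S S'(1) _ S'(2)] q(1) U(2) by blast
  then show "\<exists>T. openin (top_of_set (cmap c ` S)) T \<and> y \<in> T \<and> T \<subseteq> cmap c ` U"
    using q S'(3) by (intro exI[of _ "cmap c ` T"]) blast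
qed

lemma patch_homeomorphic:
  assumes S: "patch c E S"
  shows "homeomorphic_map (subtopology leaf_top S) (top_of_set (cmap c ` S)) (cmap c)"
proof (rule bijective_open_imp_homeomorphic_map)
  have c: "c \<in> max_atlas A" "S \<subseteq> cdom c" using S by (auto simp: patch_def)
  have ts: "topspace (subtopology leaf_top S) = S" by (simp add: topspace_leaf_top)
  show "inj_on (cmap c) (topspace (subtopology leaf_top S))"
    unfolding ts by (rule inj_on_subset[OF inj_on_cmap[OF c(1)] c(2)])
  show "cmap c ` topspace (subtopology leaf_top S) = topspace (top_of_set (cmap c ` S))"
    unfolding ts by simp
  show "continuous_map (subtopology leaf_top S) (top_of_set (cmap c ` S)) (cmap c)"
    unfolding continuous_map_def ts
  proof (intro conjI allI impI)
    fix V assume V: "openin (top_of_set (cmap c ` S)) V"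
    have "cmap c ` {x \<in> S. cmap c x \<in> V} = V" using openin_imp_subset[OF V] by blast
    then have "patch c E {x \<in> S. cmap c x \<in> V}" by (intro patch_subset[OF S]) (use V in auto)
    then show "openin (subtopology leaf_top S) {x \<in> S. cmap c x \<in> V}"
      using openin_patch openin_subtopology_Int2[of leaf_top "{x \<in> S. cmap c x \<in> V}" S]
      by (simp add: Int_absorb1)
  qed auto
  show "open_map (subtopology leaf_top S) (top_of_set (cmap c ` S)) (cmap c)"
    unfolding open_map_def
  proof (intro allI impI)
    fix U assume "openin (subtopology leaf_top S) U"
    then have "openin leaf_top U" "U \<subseteq> S"
      using openin_open_subtopology[OF openin_patch[OF S]] by auto
    then show "openin (top_of_set (cmap c ` S)) (cmap c ` U)" by (rule patch_open_image[OF S])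
  qed
qed

text \<open>A ball in a plane is convex. Hence the leaf topology is locally connected and its
  components are open, which makes a component a candidate for a leaf.\<close>

lemma connected_patch:
  assumes S: "patch c E S" "p \<in> S"
  obtains T where "patch c E T" "p \<in> T" "T \<subseteq> S" "connectedin leaf_top T"
proof -
  let ?H = "(+) (cmap c p) ` E"
  obtain U where U: "open U" "cmap c ` S = ?H \<inter> U" using patch_openin[OF S] by (auto simp: openin_open)
  have "cmap c p \<in> U" using U S(2) by blast
  then obtain \<rho> where \<rho>: "\<rho> > 0" "ball (cmap c p) \<rho> \<subseteq> U" using U(1) open_contains_ball by blast
  define T where "T = {q \<in> S. cmap c q \<in> ball (cmap c p) \<rho>}"
  have cTS: "cmap c ` T = cmap c ` S \<inter> ball (cmap c p) \<rho>" unfolding T_def by blast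
  then have cT: "cmap c ` T = ?H \<inter> ball (cmap c p) \<rho>" unfolding U(2) using \<rho>(2) by blast
  have "openin (top_of_set (cmap c ` S)) (cmap c ` T)"
    unfolding cTS by (rule openin_open_Int[OF open_ball])
  then have T: "patch c E T" by (intro patch_subset[OF S(1)]) (auto simp: T_def)
  have "convex (cmap c ` T)"
    unfolding cT using S(1) by (intro convex_Int convex_ball convex_translation subspace_imp_convex) (auto simp: patch_def)
  then have "connected_space (top_of_set (cmap c ` T))"
    using convex_connected connectedin_iff_connected connectedin_def by blast
  moreover have "subtopology leaf_top T homeomorphic_space top_of_set (cmap c ` T)"
    using homeomorphic_map_imp_homeomorphic_space[OF patch_homeomorphic[OF T]] .
  ultimately have "connected_space (subtopology leaf_top T)"
    using homeomorphic_connected_space by blast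
  then have "connectedin leaf_top T" by (simp add: connectedin_def topspace_leaf_top)
  then show ?thesis using that[OF T] S(2) \<rho>(1) by (auto simp: T_def)
qed

end

section \<open>Tangent spaces of slices\<close>

context smooth_mfd
begin

text \<open>A vector tangent to a slice is the velocity of a curve in the slice, so a function which is
  constant modulo \<open>Z\<close> along the slice has its derivative in \<open>Z\<close>.\<close>

lemma slice_derivative:
  assumes sl: "slice_chart A L c E V0" "p \<in> V0" and V: "openin L V" "p \<in> V"
    and e: "e \<in> max_atlas A" "p \<in> cdom e" and v: "to_chart A c p v \<in> E"
    and F: "(F has_derivative D) (at (cmap e p))" and Z: "subspace (Z :: 'f::euclidean_space set)"
    and FZ: "\<And>q. q \<in> V \<inter> V0 \<Longrightarrow> q \<in> cdom e \<Longrightarrow> F (cmap e q) - F (cmap e p) \<in> Z"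
  shows "D (to_chart A e p v) \<in> Z"
proof -
  have c: "c \<in> max_atlas A" "V0 \<subseteq> cdom c" "subspace E" "openin L V0"
    and hm: "homeomorphic_map (subtopology L V0) (top_of_set (cmap c ` V0)) (cmap c)"
    using sl(1) by (auto simp: slice_chart_def)
  obtain a where a: "openin (top_of_set ((+) a ` E)) (cmap c ` V0)" using sl(1) by (auto simp: slice_chart_def)
  have pc: "p \<in> cdom c" using c sl(2) by blast
  define x where "x = cmap c p"
  define w where "w = to_chart A c p v"
  have "openin (subtopology L V0) (V \<inter> V0)"
    by (rule openin_subtopology_Int[OF V(1)])
  then have "openin (top_of_set (cmap c ` V0)) (cmap c ` (V \<inter> V0))"
    using homeomorphic_imp_open_map[OF hm] unfolding open_map_def by blast
  then have "openin (top_of_set ((+) a ` E)) (cmap c ` (V \<inter> V0))" using a openin_trans by blast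
  then obtain U where U: "open U" "cmap c ` (V \<inter> V0) = (+) a ` E \<inter> U" by (auto simp: openin_open)
  have xU: "x \<in> (+) a ` E \<inter> U" using U(2) V(2) sl(2) by (auto simp: x_def)
  define U' where "U' = U \<inter> cmap c ` (cdom e \<inter> cdom c)"
  have U': "open U'" "x \<in> U'"
    using U(1) xU open_cmap_image[OF c(1) open_cdom[OF e(1)]] e(2) pc by (auto simp: U'_def x_def)
  define \<theta> where "\<theta> t = F ((cmap e \<circ> cinv c) (x + t *\<^sub>R w))" for t :: real
  have "((\<lambda>t. x + t *\<^sub>R w) has_derivative (\<lambda>s. s *\<^sub>R w)) (at 0)"
    by (auto intro!: derivative_eq_intros)
  from has_derivative_compose[OF this, of "cmap e \<circ> cinv c"]
  have "((\<lambda>t. (cmap e \<circ> cinv c) (x + t *\<^sub>R w)) has_derivative (\<lambda>s. coord_change c e p (s *\<^sub>R w))) (at 0)"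
    using transition_has_derivative[OF c(1) e(1) pc e(2)] by (simp add: x_def)
  from has_derivative_compose[OF this, of F]
  have "(\<theta> has_derivative (\<lambda>s. D (coord_change c e p (s *\<^sub>R w)))) (at 0)"
    using F by (simp add: \<theta>_def[abs_def] x_def cinv_cmap[OF c(1) pc])
  moreover have "coord_change c e p (s *\<^sub>R w) = s *\<^sub>R to_chart A e p v" for s
    using linear_scale[OF linear_coord_change[OF c(1) e(1) pc e(2)]] coord_change_to_chart[OF c(1) pc e(1,2)]
    by (simp add: w_def)
  ultimately have "(\<theta> has_vector_derivative D (to_chart A e p v)) (at 0)"
    using linear_scale[OF has_derivative_linear[OF F]] by (simp add: has_vector_derivative_def)
  then have l: "((\<lambda>h. norm (\<theta> (0 + h) - \<theta> 0 - h *\<^sub>R D (to_chart A e p v)) / norm h) \<longlongrightarrow> 0) (at 0)"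
    unfolding has_vector_derivative_def has_derivative_at by blast
  have "((\<lambda>h. norm ((\<theta> h - \<theta> 0) /\<^sub>R h - D (to_chart A e p v))) \<longlongrightarrow> 0) (at 0)"
  proof (rule Lim_transform_eventually[OF l])
    have "norm (\<theta> (0 + h) - \<theta> 0 - h *\<^sub>R D (to_chart A e p v)) / norm h = norm ((\<theta> h - \<theta> 0) /\<^sub>R h - D (to_chart A e p v))"
      if "h \<noteq> 0" for h :: real
    proof -
      have "(\<theta> h - \<theta> 0) /\<^sub>R h - D (to_chart A e p v) = (\<theta> (0 + h) - \<theta> 0 - h *\<^sub>R D (to_chart A e p v)) /\<^sub>R h"
        using that by (simp add: scaleR_diff_right)
      then show ?thesis by (simp add: divide_inverse_commute)
    qed
    then show "\<forall>\<^sub>F h in at 0. norm (\<theta> (0 + h) - \<theta> 0 - h *\<^sub>R D (to_chart A e p v)) / norm h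
        = norm ((\<theta> h - \<theta> 0) /\<^sub>R h - D (to_chart A e p v))"
      by (simp add: eventually_at_filter)
  qed
  then have lim: "((\<lambda>h. (\<theta> h - \<theta> 0) /\<^sub>R h) \<longlongrightarrow> D (to_chart A e p v)) (at 0)"
    by (rule LIM_zero_cancel[OF tendsto_norm_zero_cancel])
  have "isCont (\<lambda>t. x + t *\<^sub>R w) 0" by (intro continuous_intros)
  then have "\<forall>\<^sub>F t in at 0. x + t *\<^sub>R w \<in> U'"
    using U' by (auto simp: isCont_def dest: topological_tendstoD)
  then have "\<forall>\<^sub>F t in at 0. (\<theta> t - \<theta> 0) /\<^sub>R t \<in> Z"
  proof eventually_elim
    case (elim t)
    obtain b where b: "b \<in> E" "x = a + b" using xU by blast
    have "a + (b + t *\<^sub>R w) \<in> (+) a ` E"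
      using subspace_add[OF c(3) b(1) subspace_scale[OF c(3) v, of t]] by (simp add: w_def)
    then have "x + t *\<^sub>R w \<in> cmap c ` (V \<inter> V0)" using elim U(2) b(2) by (simp add: U'_def add.assoc)
    then obtain q where q: "q \<in> V \<inter> V0" "x + t *\<^sub>R w = cmap c q" by blast
    obtain q' where q': "q' \<in> cdom e" "q' \<in> cdom c" "x + t *\<^sub>R w = cmap c q'" using elim by (auto simp: U'_def)
    have "q' = q" using q q' c(2) inj_onD[OF inj_on_cmap[OF c(1)], of q q'] by auto
    then have "\<theta> t - \<theta> 0 \<in> Z"
      using FZ[OF q(1)] q' cinv_cmap[OF c(1)] pc by (simp add: \<theta>_def) (simp add: x_def cinv_cmap[OF c(1)])
    then show ?case by (rule subspace_scale[OF Z])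
  qed
  then show ?thesis
    using Lim_in_closed_set[OF closed_subspace[OF Z] _ _ lim] by simp
qed

text \<open>\<open>tangent_space_of\<close> asks for some slice chart, so independence of the chart
  has to be shown. In the second chart the slice lies in one translate of \<open>E'\<close>, so its
  coordinate map is constant modulo \<open>E'\<close>.\<close>

lemma slice_tangent_unique:
  assumes "slice_chart A L c E V" "slice_chart A L c' E' V'" "p \<in> V" "p \<in> V'" "to_chart A c p v \<in> E"
  shows "to_chart A c' p v \<in> E'"
proof -
  have c': "c' \<in> max_atlas A" "p \<in> cdom c'" "subspace E'" "openin L V'" "V' \<subseteq> cdom c'"
    using assms(2,4) by (auto simp: slice_chart_def)
  obtain a where a: "openin (top_of_set ((+) a ` E')) (cmap c' ` V')" using assms(2) by (auto simp: slice_chart_def)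
  show ?thesis
  proof (rule slice_derivative[OF assms(1,3) c'(4) assms(4) c'(1,2) assms(5) has_derivative_ident c'(3)])
    fix q assume "q \<in> V' \<inter> V"
    then obtain u w where "u \<in> E'" "w \<in> E'" "cmap c' q = a + u" "cmap c' p = a + w"
      using openin_imp_subset[OF a] assms(4) by blast
    then show "cmap c' q - cmap c' p \<in> E'" using subspace_diff[OF c'(3)] by simp
  qed
qed

lemma tangent_space_of_slice:
  assumes "slice_chart A L c E V" "p \<in> V"
  shows "tangent_space_of A L p = {v. to_chart A c p v \<in> E}"
  using assms slice_tangent_unique unfolding tangent_space_of_def by blast

end

section \<open>Existence of leaves\<close>

context foliation
begin

lemma patch_slice_chart:
  assumes S: "patch c E S" and C: "openin leaf_top C" "S \<subseteq> C"
  shows "slice_chart A (subtopology leaf_top C) c E S"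
proof -
  have "openin (subtopology leaf_top C) S"
    using openin_patch[OF S] C by (metis openin_open_subtopology)
  moreover have "subtopology (subtopology leaf_top C) S = subtopology leaf_top S"
    using C(2) by (simp add: subtopology_subtopology Int_absorb1)
  ultimately show ?thesis
    using S patch_homeomorphic[OF S] by (auto simp: slice_chart_def patch_def)
qed

lemma range_eq_patch:
  assumes "patch c E S" "p \<in> S"
  shows "range (P p) = {v. to_chart A c p v \<in> E}"
proof -
  have c: "c \<in> max_atlas A" "p \<in> cdom c" "to_chart A c p ` range (P p) = E" using assms by (auto simp: patch_def)
  then show ?thesis using to_chart_eq_iff[OF c(1,2)] by blast
qed

lemma integral_manifold_subtopology:
  assumes "openin leaf_top C"
  shows "integral_manifold A (\<lambda>q. range (P q)) (subtopology leaf_top C)"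
proof -
  have ts: "topspace (subtopology leaf_top C) = C" by (simp add: topspace_leaf_top)
  have ex: "\<exists>c E S. patch c E S \<and> q \<in> S \<and> S \<subseteq> C" if "q \<in> C" for q
    using assms that by (simp add: openin_leaf_top leaf_open_def)
  show ?thesis
    unfolding integral_manifold_def immersed_subset_def ts
  proof (intro conjI ballI)
    fix q assume "q \<in> C"
    then obtain c E S where S: "patch c E S" "q \<in> S" "S \<subseteq> C" using ex by blast
    note sl = patch_slice_chart[OF S(1) assms S(3)]
    show "\<exists>c E V. slice_chart A (subtopology leaf_top C) c E V \<and> q \<in> V" using sl S(2) by blast
    show "tangent_space_of A (subtopology leaf_top C) q = range (P q)"
      unfolding tangent_space_of_slice[OF sl S(2)] range_eq_patch[OF S(1,2)] ..
  qed
qed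

lemma slice_chart_patch:
  assumes L: "integral_manifold A (\<lambda>q. range (P q)) L" and sl: "slice_chart A L c E V"
  shows "patch c E V"
proof -
  have c: "c \<in> max_atlas A" "V \<subseteq> cdom c" "subspace E" "openin L V" using sl by (auto simp: slice_chart_def)
  have "to_chart A c q ` range (P q) = E" if q: "q \<in> V" for q
  proof -
    have qL: "q \<in> topspace L" using openin_subset[OF c(4)] q by blast
    have qc: "q \<in> cdom c" using c(2) q by blast
    have "range (P q) = {v. to_chart A c q v \<in> E}"
      using L qL tangent_space_of_slice[OF sl q] by (simp add: integral_manifold_def)
    moreover have "e \<in> to_chart A c q ` {v. to_chart A c q v \<in> E}" if "e \<in> E" for e
      using to_chart_from_chart[OF c(1) qc, of e] that by (intro image_eqI[of _ _ "from_chart A c q e"]) auto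
    ultimately show ?thesis by auto
  qed
  then show ?thesis using sl by (auto simp: patch_def slice_chart_def)
qed

text \<open>Slice charts of an integral manifold are patches, so its topology is at least as fine as
  the leaf topology. A connected integral manifold is therefore connected in the leaf topology, as
  maximality of leaves requires.\<close>

lemma integral_manifold_continuous:
  assumes L: "integral_manifold A (\<lambda>q. range (P q)) L"
  shows "continuous_map L leaf_top id"
  unfolding continuous_map_def
proof (intro conjI allI impI)
  fix U assume U: "openin leaf_top U"
  show "openin L {x \<in> topspace L. id x \<in> U}"
  proof (subst openin_subopen, intro ballI)
    fix q assume q: "q \<in> {x \<in> topspace L. id x \<in> U}"
    obtain c E V where sl: "slice_chart A L c E V" "q \<in> V"
      using L q by (auto simp: integral_manifold_def immersed_subset_def)
    have V: "patch c E V" by (rule slice_chart_patch[OF L sl(1)])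
    obtain c' E' S where S: "patch c' E' S" "q \<in> S" "S \<subseteq> U"
      using U q by (auto simp: openin_leaf_top leaf_open_def)
    obtain T where T: "q \<in> T" "T \<subseteq> V \<inter> S" "openin (top_of_set (cmap c ` V)) (cmap c ` T)"
      using patch_inter[OF V S(1) sl(2) S(2)] by blast
    have hm: "homeomorphic_map (subtopology L V) (top_of_set (cmap c ` V)) (cmap c)" and oV: "openin L V"
      using sl(1) by (auto simp: slice_chart_def)
    have tsV: "topspace (subtopology L V) = V" using openin_subset[OF oV] by auto
    have "openin (subtopology L V) T"
      using homeomorphic_map_openness[OF hm, of T] T tsV by auto
    then have "openin L T" using openin_trans_full[OF _ oV] by blast
    moreover have "T \<subseteq> {x \<in> topspace L. id x \<in> U}" using T S(3) openin_subset[OF oV] by auto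
    ultimately show "\<exists>T. openin L T \<and> q \<in> T \<and> T \<subseteq> {x \<in> topspace L. id x \<in> U}" using T(1) by blast
  qed
qed (simp add: topspace_leaf_top)

text \<open>The leaf is the component of \<open>p\<close> in the leaf topology. It is open, hence an
  integral manifold; a connected integral manifold containing it is connected in the leaf topology
  and so cannot be larger.\<close>

lemma leaf_exists:
  obtains L where "leaf A (\<lambda>q. range (P q)) L" "p \<in> topspace L"
proof -
  define C where "C = connected_component_of_set leaf_top p"
  have cC: "connectedin leaf_top C" unfolding C_def by (rule connectedin_connected_component_of)
  have pC: "p \<in> C" by (simp add: C_def connected_component_of_refl topspace_leaf_top)
  have max: "S \<subseteq> C" if "connectedin leaf_top S" "q \<in> S" "q \<in> C" for S q
  proof -
    have "connectedin leaf_top (S \<union> C)" using that by (intro connectedin_Un cC) auto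
    from connected_component_of_maximal[OF this, of p] pC show ?thesis by (simp add: C_def)
  qed
  have oC: "openin leaf_top C"
    unfolding openin_leaf_top leaf_open_def
  proof
    fix q assume q: "q \<in> C"
    obtain c E S where S: "patch c E S" "q \<in> S" by (rule patch_exists)
    obtain T where T: "patch c E T" "q \<in> T" "connectedin leaf_top T" using connected_patch[OF S] by metis
    then show "\<exists>c E S. patch c E S \<and> q \<in> S \<and> S \<subseteq> C" using max[OF T(3,2) q] by blast
  qed
  have ts: "topspace (subtopology leaf_top C) = C" by (simp add: topspace_leaf_top)
  have "leaf A (\<lambda>q. range (P q)) (subtopology leaf_top C)"
    unfolding leaf_def ts
  proof (intro conjI allI impI)
    show "integral_manifold A (\<lambda>q. range (P q)) (subtopology leaf_top C)"
      by (rule integral_manifold_subtopology[OF oC])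
    show "connected_space (subtopology leaf_top C)" using cC by (simp add: connectedin_def)
    show "C \<noteq> {}" using pC by blast
    fix L' assume L': "integral_manifold A (\<lambda>q. range (P q)) L' \<and> connected_space L' \<and> C \<subseteq> topspace L'"
    have "connectedin leaf_top (id ` topspace L')"
      using L' by (intro connectedin_continuous_map_image[OF integral_manifold_continuous]) (auto simp: connectedin_topspace)
    then have "topspace L' \<subseteq> C" using max[of "topspace L'" p] pC L' by auto
    then show "topspace L' = C" using L' by blast
  qed
  then show ?thesis using that pC ts by metis
qed

end

section \<open>Smoothness of orthogonal projections\<close>

text \<open>Inner products with the frame turn the projection into a Gram system with smooth
  entries. Non-degeneracy on the span makes it uniquely solvable, hence the coefficients are
  smooth.\<close>

lemma (in metric_map) frame_projection:
  fixes \<xi> :: "'n \<Rightarrow> 'b \<Rightarrow> 'm"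
  assumes W: "open W" and I: "I \<subseteq> Basis" and \<xi>: "\<And>i. i \<in> I \<Longrightarrow> smooth_along N M f W (\<xi> i)"
    and ind: "\<And>q t i. q \<in> W \<Longrightarrow> (\<Sum>i\<in>I. t i *\<^sub>R \<xi> i q) = 0 \<Longrightarrow> i \<in> I \<Longrightarrow> t i = 0"
    and nd: "\<And>q. q \<in> W \<Longrightarrow> nondegenerate_on (g (f q)) (span ((\<lambda>i. \<xi> i q) ` I))"
    and \<eta>: "smooth_along N M f W \<eta>"
  obtains a where "\<And>i. i \<in> I \<Longrightarrow> smooth_fun N W (a i)"
    "\<And>q. q \<in> W \<Longrightarrow> orth_proj (g (f q)) (span ((\<lambda>i. \<xi> i q) ` I)) (\<eta> q) = (\<Sum>i\<in>I. a i q *\<^sub>R \<xi> i q)"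
proof -
  let ?F = "\<lambda>q. span ((\<lambda>i. \<xi> i q) ` I)"
  have ext: "g (f q) u w = 0" if "\<And>i. i \<in> I \<Longrightarrow> g (f q) u (\<xi> i q) = 0" "w \<in> ?F q" for u w q
  proof -
    have "linear (g (f q) u)" using M.bil by (simp add: bilinear_def)
    from linear_eq_0_on_span[OF this _ that(2)] that(1) show ?thesis by blast
  qed
  have sF: "(\<Sum>i\<in>I. t i *\<^sub>R \<xi> i q) \<in> ?F q" for t q
    by (intro span_sum span_scale span_base) auto
  have nd': "t i = 0" if q: "q \<in> W" and t: "\<forall>j\<in>I. (\<Sum>i\<in>I. t i * g (f q) (\<xi> i q) (\<xi> j q)) = 0" and i: "i \<in> I" for q t i
  proof -
    let ?u = "\<Sum>i\<in>I. t i *\<^sub>R \<xi> i q"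
    have "g (f q) ?u (\<xi> j q) = 0" if "j \<in> I" for j
      using bspec[OF t that] by (simp add: bilinear_sums[OF M.bil] M.gs)
    then have "\<forall>w\<in>?F q. g (f q) ?u w = 0" using ext by blast
    then have "?u = 0" using nd[OF q] sF unfolding nondegenerate_on_def by blast
    then show ?thesis using ind[OF q _ i] by blast
  qed
  obtain a where a: "\<And>i. i \<in> I \<Longrightarrow> smooth_fun N W (a i)"
    "\<And>q j. q \<in> W \<Longrightarrow> j \<in> I \<Longrightarrow> (\<Sum>i\<in>I. a i q * g (f q) (\<xi> i q) (\<xi> j q)) = g (f q) (\<eta> q) (\<xi> j q)"
  proof (rule N.smooth_gram_solve[OF W I, of "\<lambda>i j q. g (f q) (\<xi> i q) (\<xi> j q)" "\<lambda>j q. g (f q) (\<eta> q) (\<xi> j q)"])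
    show "smooth_fun N W (\<lambda>q. g (f q) (\<xi> i q) (\<xi> j q))" if "i \<in> I" "j \<in> I" for i j
      by (rule smooth_metric[OF W \<xi>[OF that(1)] \<xi>[OF that(2)]])
    show "smooth_fun N W (\<lambda>q. g (f q) (\<eta> q) (\<xi> j q))" if "j \<in> I" for j
      by (rule smooth_metric[OF W \<eta> \<xi>[OF that]])
  qed (use nd' in blast)+
  have "orth_proj (g (f q)) (?F q) (\<eta> q) = (\<Sum>i\<in>I. a i q *\<^sub>R \<xi> i q)" if q: "q \<in> W" for q
  proof -
    interpret F: nondeg_subspace "g (f q)" "?F q"
      by unfold_locales (auto simp: M.bil nd[OF q] intro: M.sym)
    show ?thesis
    proof (rule F.orth_proj_unique[OF sF])
      fix u assume u: "u \<in> ?F q"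
      have "g (f q) ((\<Sum>i\<in>I. a i q *\<^sub>R \<xi> i q) - \<eta> q) u = 0"
        by (rule ext[OF _ u]) (use a(2)[OF q] in \<open>simp add: bilinear_sums[OF M.bil] M.gs\<close>)
      then show "g (f q) (\<Sum>i\<in>I. a i q *\<^sub>R \<xi> i q) u = g (f q) (\<eta> q) u" by (simp add: M.gs)
    qed
  qed
  then show ?thesis using that a(1) by blast
qed

lemma spanning_family_independent:
  fixes X :: "'i \<Rightarrow> 'e::euclidean_space"
  assumes "finite I" "dim (span (X ` I)) = card I" "(\<Sum>i\<in>I. t i *\<^sub>R X i) = 0" "i \<in> I"
  shows "t i = 0"
proof -
  have d: "dim (X ` I) = card I" using assms(2) by (simp add: dim_span)
  have c: "card (X ` I) = card I"
    using d dim_le_card'[of "X ` I"] card_image_le[of I X] assms(1) by simp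
  have inj: "inj_on X I" using c assms(1) eq_card_imp_inj_on by blast
  have "independent (X ` I)"
    by (rule card_le_dim_spanning[of "X ` I" "X ` I"]) (use d c assms(1) span_superset in simp_all)
  moreover have "(\<Sum>v\<in>X ` I. t (inv_into I X v) *\<^sub>R v) = 0"
    using assms(3) by (simp add: sum.reindex[OF inj] inv_into_f_f[OF inj])
  ultimately have "t (inv_into I X (X i)) = 0"
    using assms(1,4) independentD[of "X ` I" "X ` I" "\<lambda>v. t (inv_into I X v)" "X i"] by auto
  then show ?thesis using inv_into_f_f[OF inj assms(4)] by simp
qed

lemma nondegenerate_image:
  assumes "nondegenerate_on h S" "\<And>v w. v \<in> S \<Longrightarrow> w \<in> S \<Longrightarrow> g (L v) (L w) = h v w" "L 0 = 0"
  shows "nondegenerate_on g (L ` S)"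
  using assms unfolding nondegenerate_on_def by fastforce

context nondeg_submfd
begin

lemma g_df: "g (f p) (df p v) (df p w) = h p v w"
  by (simp add: induced_metric_def)

lemma tangent_nondeg: "nondeg_subspace (g (f q)) (range (df q))"
proof
  show "subspace (range (df q))" by (rule linear_subspace_image[OF linear_differential subspace_UNIV])
  show "nondegenerate_on (g (f q)) (range (df q))"
    by (rule nondegenerate_image[OF nondeg_induced]) (simp_all add: g_df df_0)
qed (auto simp: M.bil intro: M.sym)

text \<open>The adjoint of \<open>df q\<close> with respect to \<open>h\<close> and
  \<open>g\<close>. Its image under \<open>df q\<close> is the tangential part of \<eta>.\<close>

definition tan_vec :: "'b \<Rightarrow> 'm \<Rightarrow> 'n" where
  "tan_vec q \<eta> = (THE t. t \<in> UNIV \<and> (\<forall>v\<in>UNIV. h q t v = g (f q) \<eta> (df q v)))"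

lemma tan_vec: "h q (tan_vec q \<eta>) v = g (f q) \<eta> (df q v)"
proof -
  have "linear (\<lambda>v. g (f q) \<eta> (df q v))"
    by (auto intro!: linearI simp: df_add df_scale M.gs)
  from theI'[OF nondegenerate_riesz[OF H.bil subspace_UNIV nondeg_induced this]]
  show ?thesis unfolding tan_vec_def by blast
qed

lemma tan_vec_unique: "(\<And>v. h q t v = g (f q) \<eta> (df q v)) \<Longrightarrow> tan_vec q \<eta> = t"
  by (rule H.metric_eqI[of q]) (simp add: tan_vec)

text \<open>The coordinate fields map to a smooth frame of the tangent spaces along
  \<open>f\<close>. The coefficients of the projection to this frame are also the coefficients of
  \<open>tan_vec\<close> in the coordinate fields.\<close>

lemma smooth_tan_vec:
  assumes "open W" "smooth_along N M f W \<eta>"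
  shows "vector_field_on N W (\<lambda>q. tan_vec q (\<eta> q))"
proof -
  interpret I: smooth_mfd_map N N id by (rule N.smooth_mfd_map_id)
  show ?thesis
  proof (rule I.smooth_along_local[OF assms(1)])
    fix p assume p: "p \<in> W"
    let ?c = "chart_at N p"
    define V where "V = W \<inter> cdom ?c"
    have V: "open V" "p \<in> V" "V \<subseteq> W" using assms(1) p N.open_cdom[OF N.chart_at_max[of p]] N.chart_at(2)[of p] by (auto simp: V_def)
    define \<xi> where "\<xi> i q = df q (from_chart N ?c q i)" for i q
    have cs: "vector_field_on N V (\<lambda>q. from_chart N ?c q i)" for i
      by (rule I.smooth_along_subset[OF vector_field_const_coeff[OF N.chart_at(1)]]) (simp add: V_def)
    have \<xi>s: "smooth_along N M f V (\<xi> i)" for i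
      unfolding \<xi>_def by (rule smooth_along_differential[OF V(1) cs])
    have lin: "linear (\<lambda>i. \<xi> i q)" "inj (\<lambda>i. \<xi> i q)" "range (\<lambda>i. \<xi> i q) = range (df q)" if "q \<in> V" for q
    proof -
      have qc: "q \<in> cdom ?c" using that by (simp add: V_def)
      show "linear (\<lambda>i. \<xi> i q)"
        using linear_compose[OF N.linear_from_chart[OF N.chart_at_max qc] linear_differential[of q]] by (simp add: \<xi>_def o_def)
      have i: "inj (from_chart N ?c q)" "surj (from_chart N ?c q)"
        using N.to_chart_from_chart[OF N.chart_at_max qc] N.from_chart_to_chart[OF N.chart_at_max qc] by (metis injI, metis surjI)
      show "inj (\<lambda>i. \<xi> i q)" using inj_compose[OF inj_differential[of q] i(1)] by (simp add: \<xi>_def o_def)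
      show "range (\<lambda>i. \<xi> i q) = range (df q)" using i(2) unfolding \<xi>_def by (metis image_image)
    qed
    have sp: "span ((\<lambda>i. \<xi> i q) ` Basis) = range (df q)" if "q \<in> V" for q
      using linear_span_image[OF lin(1)[OF that], of Basis] lin(3)[OF that] by simp
    obtain a where a: "\<And>i. i \<in> Basis \<Longrightarrow> smooth_fun N V (a i)"
      "\<And>q. q \<in> V \<Longrightarrow> orth_proj (g (f q)) (span ((\<lambda>i. \<xi> i q) ` Basis)) (\<eta> q) = (\<Sum>i\<in>Basis. a i q *\<^sub>R \<xi> i q)"
    proof (rule frame_projection[OF V(1) order_refl \<xi>s _ _ smooth_along_subset[OF assms(2) V(3)]])
      show "t i = 0" if q: "q \<in> V" and t: "(\<Sum>i\<in>Basis. t i *\<^sub>R \<xi> i q) = 0" and i: "i \<in> Basis" for q t and i :: 'n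
      proof -
        let ?v = "\<Sum>i\<in>Basis. t i *\<^sub>R i"
        have "\<xi> ?v q = 0" using t by (simp add: linear_sum[OF lin(1)[OF q]] linear_scale[OF lin(1)[OF q]])
        then have "?v = 0" using lin(1,2)[OF q] linear_injective_0 by blast
        then have "?v \<bullet> i = 0" by simp
        then show ?thesis using i by simp
      qed
      show "nondegenerate_on (g (f q)) (span ((\<lambda>i. \<xi> i q) ` Basis))" if "q \<in> V" for q
        unfolding sp[OF that] using tangent_nondeg by (simp add: nondeg_subspace_def)
    qed blast
    have vs: "vector_field_on N V (\<lambda>q. \<Sum>i\<in>Basis. a i q *\<^sub>R from_chart N ?c q i)"
      by (intro I.smooth_along_sum I.smooth_along_scale V a cs)
    have eq: "(\<Sum>i\<in>Basis. a i q *\<^sub>R from_chart N ?c q i) = tan_vec q (\<eta> q)" if q: "q \<in> V" for q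
    proof (rule tan_vec_unique[symmetric])
      have "df q (\<Sum>i\<in>Basis. a i q *\<^sub>R from_chart N ?c q i) = orth_proj (g (f q)) (range (df q)) (\<eta> q)"
        using a(2)[OF q] sp[OF q] by (simp add: \<xi>_def linear_sum[OF linear_differential] df_scale)
      then show "h q (\<Sum>i\<in>Basis. a i q *\<^sub>R from_chart N ?c q i) v = g (f q) (\<eta> q) (df q v)" for v
        using nondeg_subspace.orth_proj(2)[OF tangent_nondeg, of "df q v" q "\<eta> q"] by (simp add: g_df[symmetric])
    qed
    have "vector_field_on N V (\<lambda>q. tan_vec q (\<eta> q))"
      by (rule I.smooth_along_cong[OF V(1) eq vs])
    then show "\<exists>V. open V \<and> p \<in> V \<and> vector_field_on N V (\<lambda>q. tan_vec q (\<eta> q))" using V by blast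
  qed
qed

lemma tangent_normal: "df p v \<in> normal_space N M g f p \<Longrightarrow> v = 0"
  by (rule H.metric_eqI[of p]) (simp add: g_df[symmetric] normal_df df_0 M.gs)

lemma subspace_normal: "subspace (normal_space N M g f p)"
  by (auto simp: subspace_def normal_space_def M.gs)

end

section \<open>Projections to D and D^perp, and global sections\<close>

locale nondeg_distribution = nondeg_submfd N M f g
  for N :: "('b::t2_space, 'n::euclidean_space) chart set"
    and M :: "('a::t2_space, 'm::euclidean_space) chart set" and f and g +
  fixes D :: "'b \<Rightarrow> 'n set"
  assumes dist: "distribution N D" and D_nondeg: "nondegenerate_on (h p) (D p)"
begin

definition rk :: nat where "rk = (SOME r. (\<forall>p. subspace (D p) \<and> dim (D p) = r) \<and>
     (\<forall>p. \<exists>W X. open W \<and> p \<in> W \<and> (\<forall>i<r. vector_field_on N W (X i)) \<and>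
        (\<forall>q\<in>W. D q = span ((\<lambda>i::nat. X i q) ` {..<r}))))"

lemma rk: "subspace (D p)" "dim (D p) = rk"
    "\<exists>W X. open W \<and> p \<in> W \<and> (\<forall>i<rk. vector_field_on N W (X i)) \<and> (\<forall>q\<in>W. D q = span ((\<lambda>i::nat. X i q) ` {..<rk}))"
  using someI_ex[OF dist[unfolded distribution_def]] unfolding rk_def[symmetric] by auto

lemma D_nondeg_subspace: "nondeg_subspace (h p) (D p)"
  by unfold_locales (auto simp: H.bil rk D_nondeg intro: H.sym)

abbreviation Dp :: "'b \<Rightarrow> 'n set" where "Dp \<equiv> Dperp N M g f D"

lemma Dp_eq: "Dp p = orth_compl (h p) (D p)"
  by (auto simp: Dperp_def orth_compl_def)

definition D_proj :: "'b \<Rightarrow> 'n \<Rightarrow> 'n" where "D_proj p = orth_proj (h p) (D p)"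

definition Dp_proj :: "'b \<Rightarrow> 'n \<Rightarrow> 'n" where "Dp_proj p v = v - D_proj p v"

lemma D_proj_in: "D_proj p v \<in> D p"
  unfolding D_proj_def by (rule nondeg_subspace.orth_proj(1)[OF D_nondeg_subspace])

lemma D_proj_ident: "v \<in> D p \<Longrightarrow> D_proj p v = v"
  unfolding D_proj_def by (rule nondeg_subspace.orth_proj_ident[OF D_nondeg_subspace])

lemma linear_D_proj: "linear (D_proj p)"
  unfolding D_proj_def by (rule nondeg_subspace.linear_orth_proj[OF D_nondeg_subspace])

lemma linear_Dp_proj: "linear (Dp_proj p)"
  unfolding Dp_proj_def[abs_def] by (intro linear_compose_sub linear_D_proj linear_ident)

lemma Dp_proj_in: "Dp_proj p v \<in> Dp p"
  unfolding Dp_proj_def D_proj_def Dp_eq by (rule nondeg_subspace.diff_orth_proj[OF D_nondeg_subspace])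

lemma Dp_proj_ident: "v \<in> Dp p \<Longrightarrow> Dp_proj p v = v"
  unfolding Dp_proj_def D_proj_def Dp_eq using nondeg_subspace.orth_proj_orth[OF D_nondeg_subspace] by simp

lemma range_Dp_proj: "range (Dp_proj p) = Dp p"
proof
  show "range (Dp_proj p) \<subseteq> Dp p" using Dp_proj_in by blast
  show "Dp p \<subseteq> range (Dp_proj p)"
  proof
    fix v assume "v \<in> Dp p"
    then show "v \<in> range (Dp_proj p)" using Dp_proj_ident by (metis rangeI)
  qed
qed

lemma subspace_Dp: "subspace (Dp p)"
  unfolding Dp_eq by (rule nondeg_subspace.subspace_orth_compl[OF D_nondeg_subspace])

lemma nondegenerate_Dp: "nondegenerate_on (h p) (Dp p)"
  unfolding Dp_eq by (rule nondeg_subspace.nondegenerate_orth_compl[OF D_nondeg_subspace nondeg_induced])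

lemma dim_Dp: "dim (Dp p) = DIM('n) - rk"
  using nondeg_subspace.dim_orth_compl[OF D_nondeg_subspace, of p] rk(2)[of p] by (simp add: Dp_eq)

lemma D_Dp: "v \<in> Dp p \<Longrightarrow> w \<in> D p \<Longrightarrow> h p v w = 0" "v \<in> Dp p \<Longrightarrow> w \<in> D p \<Longrightarrow> h p w v = 0"
  unfolding Dp_eq using nondeg_subspace.orth_complD[OF D_nondeg_subspace] by blast+

lemma in_D_if: "(\<And>w. w \<in> Dp p \<Longrightarrow> h p v w = 0) \<Longrightarrow> v \<in> D p"
  unfolding Dp_eq by (rule nondeg_subspace.double_orth_compl[OF D_nondeg_subspace nondeg_induced])

lemma smooth_D_proj:
  assumes "open W" "vector_field_on N W X"
  shows "vector_field_on N W (\<lambda>q. D_proj q (X q))"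
proof -
  interpret I: smooth_mfd_map N N id by (rule N.smooth_mfd_map_id)
  show ?thesis
  proof (rule I.smooth_along_local[OF assms(1)])
    fix p assume p: "p \<in> W"
    obtain W' Y where Y: "open W'" "p \<in> W'" "\<And>i. i < rk \<Longrightarrow> vector_field_on N W' (Y i)"
      "\<And>q. q \<in> W' \<Longrightarrow> D q = span ((\<lambda>i::nat. Y i q) ` {..<rk})" using rk(3)[of p] by metis
    define V where "V = W \<inter> W'"
    have V: "open V" "p \<in> V" "V \<subseteq> W" "V \<subseteq> W'" using assms(1) p Y by (auto simp: V_def)
    have "rk \<le> card (Basis :: 'n set)" using rk(2)[of p] dim_subset_UNIV[of "D p"] by simp
    \<comment> \<open>The frame of D is numbered by naturals, while Gram systems are solved with
      indices in \<open>Basis\<close>; it is renumbered by a set of basis vectors of the same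
      size.\<close>
    then obtain I :: "'n set" where I: "I \<subseteq> Basis" "card I = rk" by (meson obtain_subset_with_card_n)
    have fI: "finite I" using finite_subset[OF I(1) finite_Basis] .
    obtain k where k: "bij_betw k I {..<rk}"
      using ex_bij_betw_finite_nat[OF fI] I(2) by (auto simp: atLeast0LessThan)
    define Z where "Z i = Y (k i)" for i
    have Zs: "vector_field_on N V (Z i)" if "i \<in> I" for i
      using I.smooth_along_subset[OF Y(3) V(4)] bij_betwE[OF k] that by (simp add: Z_def)
    have Zsp: "D q = span ((\<lambda>i. Z i q) ` I)" if "q \<in> V" for q
    proof -
      have "(\<lambda>i. Z i q) ` I = (\<lambda>i. Y i q) ` k ` I" by (simp add: Z_def image_image)
      then show ?thesis using Y(4)[of q] V(4) that bij_betw_imp_surj_on[OF k] by auto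
    qed
    have sp: "span ((\<lambda>i. df q (Z i q)) ` I) = df q ` D q" if "q \<in> V" for q
      unfolding Zsp[OF that] using linear_span_image[OF linear_differential, of q "(\<lambda>i. Z i q) ` I"] by (simp add: image_image)
    obtain a where a: "\<And>i. i \<in> I \<Longrightarrow> smooth_fun N V (a i)"
      "\<And>q. q \<in> V \<Longrightarrow> orth_proj (g (f q)) (span ((\<lambda>i. df q (Z i q)) ` I)) (df q (X q)) = (\<Sum>i\<in>I. a i q *\<^sub>R df q (Z i q))"
    proof (rule frame_projection[OF V(1) I(1), of "\<lambda>i q. df q (Z i q)" "\<lambda>q. df q (X q)"])
      show "smooth_along N M f V (\<lambda>q. df q (Z i q))" if "i \<in> I" for i
        by (rule smooth_along_differential[OF V(1) Zs[OF that]])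
      show "smooth_along N M f V (\<lambda>q. df q (X q))"
        by (rule smooth_along_differential[OF V(1) I.smooth_along_subset[OF assms(2) V(3)]])
      show "nondegenerate_on (g (f q)) (span ((\<lambda>i. df q (Z i q)) ` I))" if "q \<in> V" for q
        unfolding sp[OF that] by (rule nondegenerate_image[OF D_nondeg]) (simp_all add: g_df df_0)
      show "t i = 0" if q: "q \<in> V" and t: "(\<Sum>i\<in>I. t i *\<^sub>R df q (Z i q)) = 0" and i: "i \<in> I" for q t i
      proof -
        have "df q (\<Sum>i\<in>I. t i *\<^sub>R Z i q) = 0" using t by (simp add: linear_sum[OF linear_differential] df_scale)
        then have "(\<Sum>i\<in>I. t i *\<^sub>R Z i q) = 0" using inj_differential linear_injective_0[OF linear_differential] by blast
        then show ?thesis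
          using spanning_family_independent[OF fI _ _ i, of "\<lambda>i. Z i q" t] rk(2)[of q] Zsp[OF q] I(2) by simp
      qed
    qed blast
    have vs: "vector_field_on N V (\<lambda>q. \<Sum>i\<in>I. a i q *\<^sub>R Z i q)"
      by (intro I.smooth_along_sum I.smooth_along_scale V a Zs)
    have eq: "(\<Sum>i\<in>I. a i q *\<^sub>R Z i q) = D_proj q (X q)" if q: "q \<in> V" for q
      unfolding D_proj_def
    proof (rule nondeg_subspace.orth_proj_unique[OF D_nondeg_subspace, symmetric])
      show "(\<Sum>i\<in>I. a i q *\<^sub>R Z i q) \<in> D q"
        unfolding Zsp[OF q] by (intro span_sum span_scale span_base) auto
      fix u assume u: "u \<in> D q"
      interpret F: nondeg_subspace "g (f q)" "df q ` D q"
        by unfold_locales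
          (auto simp: M.bil g_df df_0 rk intro: M.sym linear_subspace_image[OF linear_differential] nondegenerate_image[OF D_nondeg])
      have "df q (\<Sum>i\<in>I. a i q *\<^sub>R Z i q) = orth_proj (g (f q)) (df q ` D q) (df q (X q))"
        using a(2)[OF q] sp[OF q] by (simp add: linear_sum[OF linear_differential] df_scale)
      then show "h q (\<Sum>i\<in>I. a i q *\<^sub>R Z i q) u = h q (X q) u"
        using F.orth_proj(2)[of "df q u" "df q (X q)"] u by (simp add: g_df[symmetric])
    qed
    have "vector_field_on N V (\<lambda>q. D_proj q (X q))"
      by (rule I.smooth_along_cong[OF V(1) eq vs])
    then show "\<exists>V. open V \<and> p \<in> V \<and> vector_field_on N V (\<lambda>q. D_proj q (X q))" using V by blast
  qed
qed

lemma smooth_Dp_proj: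
  assumes "open W" "vector_field_on N W X"
  shows "vector_field_on N W (\<lambda>q. Dp_proj q (X q))"
  unfolding Dp_proj_def
  by (rule smooth_mfd_map.smooth_along_diff[OF N.smooth_mfd_map_id assms(1,2) smooth_D_proj[OF assms]])

text \<open>Project a field with constant components, then cut it off. This produces a global
  section with prescribed value and so turns conditions on sections into conditions on
  vectors.\<close>

lemma section_through:
  assumes "\<And>W X. open W \<Longrightarrow> vector_field_on N W X \<Longrightarrow> vector_field_on N W (\<lambda>q. P q (X q))"
    and "\<And>q v. P q v \<in> E q" "\<And>q. subspace (E q)" "P p v = v"
  shows "\<exists>X\<in>tangent_sections N E. X p = v"
proof -
  interpret I: smooth_mfd_map N N id by (rule N.smooth_mfd_map_id)
  let ?c = "chart_at N p" and ?W = "cdom (chart_at N p)"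
  have oW: "open ?W" "p \<in> ?W" by (auto intro: N.open_cdom N.chart_at_max N.chart_at)
  let ?X = "\<lambda>q. P q (from_chart N ?c q v)"
  obtain a where a: "a p = (1::real)"
    "\<And>\<xi>. smooth_along N N id ?W \<xi> \<Longrightarrow> smooth_along N N id UNIV (\<lambda>q. a q *\<^sub>R \<xi> q)" "\<And>q. q \<notin> ?W \<Longrightarrow> a q = 0"
    using I.smooth_cutoff[OF oW] by metis
  have "vector_field_on N UNIV (\<lambda>q. a q *\<^sub>R ?X q)"
    by (rule a(2)[OF assms(1)[OF oW(1) vector_field_const_coeff[OF N.chart_at(1)]]])
  moreover have "a q *\<^sub>R ?X q \<in> E q" for q using assms(2,3) subspace_scale by blast
  moreover have "a p *\<^sub>R ?X p = v" using a(1) assms(4) by simp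
  ultimately show ?thesis by (intro bexI[of _ "\<lambda>q. a q *\<^sub>R ?X q"]) (simp_all add: tangent_sections_def)
qed

lemma D_section: "v \<in> D p \<Longrightarrow> \<exists>X\<in>tangent_sections N D. X p = v"
  by (rule section_through[of D_proj])
     (auto intro: smooth_D_proj D_proj_in rk D_proj_ident)

lemma Dp_section: "v \<in> Dp p \<Longrightarrow> \<exists>X\<in>tangent_sections N Dp. X p = v"
  by (rule section_through[of Dp_proj]) (auto intro: smooth_Dp_proj Dp_proj_in subspace_Dp Dp_proj_ident)

lemma tangent_section: "\<exists>X\<in>tangent_sections N (\<lambda>_. UNIV). X p = v"
  by (rule section_through[of "\<lambda>_ v. v"]) simp_all

end

section \<open>Paraquaternionic CR-submanifolds\<close>

lemma eps_square: "eps \<alpha> * eps \<alpha> = 1" "eps \<alpha> * (eps \<alpha> * x) = x"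
  by (auto simp: eps_def)

text \<open>Modulo 3, distinct indices are cyclic neighbours. The two relations between J_\<alpha>
  and J_(\<alpha>+1) thus cover every mixed product.\<close>

lemma three_cases:
  fixes \<alpha> \<beta> :: 3
  obtains "\<beta> = \<alpha>" | "\<beta> = \<alpha> + 1" | "\<alpha> = \<beta> + 1"
proof -
  have "\<beta> = \<alpha> \<or> \<beta> = \<alpha> + 1 \<or> \<alpha> = \<beta> + 1"
    using exhaust_3[of \<alpha>] exhaust_3[of \<beta>] by auto
  then show ?thesis using that by blast
qed

locale pq_cr = nondeg_distribution N M f g D
  for N :: "('b::t2_space, 'n::euclidean_space) chart set"
    and M :: "('a::t2_space, 'm::euclidean_space) chart set" and f and g and D +
  fixes \<sigma> :: "'a \<Rightarrow> ('m \<Rightarrow>\<^sub>L 'm) set"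
  assumes kaehler: "paraquaternionic_kaehler M \<sigma> g" and cr: "paraquaternionic_CR_submanifold N M \<sigma> g f D"
begin

abbreviation "normal \<equiv> normal_space N M g f"
abbreviation "\<nu>p \<equiv> nu_perp N M \<sigma> g f D"
abbreviation "\<nu> \<equiv> nu N M \<sigma> g f D"

lemma basis_exists_at: "\<exists>U J. f p \<in> U \<and> canonical_local_basis M \<sigma> U J"
  using kaehler by (simp add: paraquaternionic_kaehler_def almost_paraquaternionic_hermitian_def almost_paraquaternionic_def)

end

section \<open>A canonical local basis on the submanifold\<close>

locale pq_basis = pq_cr N M f g D \<sigma>
  for N :: "('b::t2_space, 'n::euclidean_space) chart set"
    and M :: "('a::t2_space, 'm::euclidean_space) chart set" and f and g and D and \<sigma> +
  fixes U :: "'a set" and J :: "3 \<Rightarrow> 'a \<Rightarrow> 'm \<Rightarrow>\<^sub>L 'm"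
  assumes basis: "canonical_local_basis M \<sigma> U J"
begin

abbreviation j :: "'b \<Rightarrow> 3 \<Rightarrow> 'm \<Rightarrow> 'm" where "j q \<alpha> v \<equiv> blinfun_apply (J \<alpha> (f q)) v"

lemma open_U: "open U" and smooth_J: "smooth_endo M U (J \<alpha>)"
  using basis M.open_cdom by (force simp: canonical_local_basis_def coordinate_nbhd_def)+

lemma j_square: "f q \<in> U \<Longrightarrow> j q \<alpha> (j q \<alpha> v) = - eps \<alpha> *\<^sub>R v"
  and j_next: "f q \<in> U \<Longrightarrow> j q \<alpha> (j q (\<alpha> + 1) v) = eps (\<alpha> + 2) *\<^sub>R j q (\<alpha> + 2) v"
  and j_prev: "f q \<in> U \<Longrightarrow> j q (\<alpha> + 1) (j q \<alpha> v) = - eps (\<alpha> + 2) *\<^sub>R j q (\<alpha> + 2) v"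
proof -
  assume q: "f q \<in> U"
  have r: "J \<alpha> (f q) o\<^sub>L J \<alpha> (f q) = - eps \<alpha> *\<^sub>R id_blinfun"
    "J \<alpha> (f q) o\<^sub>L J (\<alpha> + 1) (f q) = eps (\<alpha> + 2) *\<^sub>R J (\<alpha> + 2) (f q)"
    "- (J (\<alpha> + 1) (f q) o\<^sub>L J \<alpha> (f q)) = eps (\<alpha> + 2) *\<^sub>R J (\<alpha> + 2) (f q)"
    using basis q by (auto simp: canonical_local_basis_def)
  show "j q \<alpha> (j q \<alpha> v) = - eps \<alpha> *\<^sub>R v"
    using arg_cong[OF r(1), of "\<lambda>T. blinfun_apply T v"] by (simp add: blinfun.minus_left blinfun.scaleR_left)
  show "j q \<alpha> (j q (\<alpha> + 1) v) = eps (\<alpha> + 2) *\<^sub>R j q (\<alpha> + 2) v"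
    using arg_cong[OF r(2), of "\<lambda>T. blinfun_apply T v"] by (simp add: blinfun.scaleR_left)
  have "- j q (\<alpha> + 1) (j q \<alpha> v) = eps (\<alpha> + 2) *\<^sub>R j q (\<alpha> + 2) v"
    using arg_cong[OF r(3), of "\<lambda>T. blinfun_apply T v"] by (simp add: blinfun.minus_left blinfun.scaleR_left)
  then show "j q (\<alpha> + 1) (j q \<alpha> v) = - eps (\<alpha> + 2) *\<^sub>R j q (\<alpha> + 2) v"
    by (metis minus_equation_iff scaleR_minus_left)
qed

lemma j_metric: "f q \<in> U \<Longrightarrow> g (f q) (j q \<alpha> v) (j q \<alpha> w) = eps \<alpha> * g (f q) v w"
  using kaehler basis by (simp add: paraquaternionic_kaehler_def almost_paraquaternionic_hermitian_def)

text \<open>J_\<alpha> multiplies the metric by \<epsilon>_\<alpha> and has square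
  -\<epsilon>_\<alpha>; the two signs combine to skewness for every index.\<close>

lemma j_skew:
  assumes "f q \<in> U"
  shows "g (f q) (j q \<alpha> v) w = - g (f q) v (j q \<alpha> w)"
proof -
  have "eps \<alpha> * g (f q) v (j q \<alpha> w) = g (f q) (j q \<alpha> v) (j q \<alpha> (j q \<alpha> w))"
    by (simp add: j_metric[OF assms])
  also have "\<dots> = - (eps \<alpha> * g (f q) (j q \<alpha> v) w)" by (simp add: j_square[OF assms] M.gs)
  finally have "eps \<alpha> * (eps \<alpha> * g (f q) v (j q \<alpha> w)) = eps \<alpha> * - (eps \<alpha> * g (f q) (j q \<alpha> v) w)" by simp
  then show ?thesis by (simp add: eps_square)
qed

lemma j_D: "f q \<in> U \<Longrightarrow> z \<in> D q \<Longrightarrow> j q \<alpha> (df q z) \<in> df q ` D q"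
  and j_D_surj: "f q \<in> U \<Longrightarrow> z \<in> D q \<Longrightarrow> \<exists>z'\<in>D q. df q z = j q \<alpha> (df q z')"
  and j_Dp: "f q \<in> U \<Longrightarrow> y \<in> Dp q \<Longrightarrow> j q \<alpha> (df q y) \<in> normal q"
proof -
  assume "f q \<in> U"
  then have 1: "blinfun_apply (J \<alpha> (f q)) ` df q ` D q = df q ` D q" "blinfun_apply (J \<alpha> (f q)) ` df q ` Dp q \<subseteq> normal q"
    using cr basis unfolding paraquaternionic_CR_submanifold_def by blast+
  show "z \<in> D q \<Longrightarrow> j q \<alpha> (df q z) \<in> df q ` D q" using 1(1) by blast
  show "\<exists>z'\<in>D q. df q z = j q \<alpha> (df q z')" if "z \<in> D q"
  proof -
    have "df q z \<in> blinfun_apply (J \<alpha> (f q)) ` df q ` D q" using 1(1) that by blast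
    then show ?thesis by blast
  qed
  show "y \<in> Dp q \<Longrightarrow> j q \<alpha> (df q y) \<in> normal q" using 1(2) by blast
qed

text \<open>By skewness the product becomes that of \<open>y\<close> with J_\<alpha> J_\<beta>
  \<open>z\<close>. This vector is, up to sign, the third J applied to \<open>z\<close>, which is
  normal.\<close>

lemma j_orth:
  assumes q: "f q \<in> U" and ne: "\<alpha> \<noteq> \<beta>" and y: "y \<in> Dp q" "z \<in> Dp q"
  shows "g (f q) (j q \<alpha> (df q y)) (j q \<beta> (df q z)) = 0"
proof -
  have s: "g (f q) (j q \<alpha> (df q y)) (j q \<beta> (df q z)) = - g (f q) (df q y) (j q \<alpha> (j q \<beta> (df q z)))"
    by (rule j_skew[OF q])
  show ?thesis
  proof (rule three_cases[of \<beta> \<alpha>])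
    assume "\<beta> = \<alpha> + 1"
    then show ?thesis unfolding s using j_next[OF q, of \<alpha> "df q z"] normal_df(2)[OF j_Dp[OF q y(2)], of y]
      by (simp add: M.gs)
  next
    assume "\<alpha> = \<beta> + 1"
    then show ?thesis unfolding s using j_prev[OF q, of \<beta> "df q z"] normal_df(2)[OF j_Dp[OF q y(2)], of y]
      by (simp add: M.gs)
  qed (use ne in simp)
qed

text \<open>\<open>nu_perp\<close> collects the sums over all canonical bases around the point. The
  transition matrix is absorbed into the vectors \<open>z\<close>, since D^perp is a subspace; so
  one basis gives the whole set.\<close>

lemma nu_perp_eq:
  assumes p: "f p \<in> U"
  shows "\<nu>p p = {\<Sum>\<alpha>\<in>UNIV. j p \<alpha> (df p (z \<alpha>)) | z. \<forall>\<alpha>. z \<alpha> \<in> Dp p}"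
proof (intro equalityI subsetI)
  fix x assume "x \<in> \<nu>p p"
  then obtain U' J' z where J': "canonical_local_basis M \<sigma> U' J'" "f p \<in> U'" and z: "\<And>\<alpha>. z \<alpha> \<in> Dp p"
    and x: "x = (\<Sum>\<alpha>\<in>UNIV. blinfun_apply (J' \<alpha> (f p)) (df p (z \<alpha>)))"
    by (auto simp: nu_perp_def)
  obtain a where a: "\<And>\<alpha>. J' \<alpha> (f p) = (\<Sum>\<beta>\<in>UNIV. (a $ \<alpha> $ \<beta>) *\<^sub>R J \<beta> (f p))"
  proof -
    have "\<exists>a\<in>SO21. \<forall>\<alpha>. J' \<alpha> (f p) = (\<Sum>\<beta>\<in>UNIV. (a $ \<alpha> $ \<beta>) *\<^sub>R J \<beta> (f p))"
      using kaehler J' basis p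
      by (simp add: paraquaternionic_kaehler_def almost_paraquaternionic_hermitian_def almost_paraquaternionic_def)
    then show ?thesis using that by blast
  qed
  define z' where "z' \<beta> = (\<Sum>\<alpha>\<in>UNIV. (a $ \<alpha> $ \<beta>) *\<^sub>R z \<alpha>)" for \<beta>
  have "x = (\<Sum>\<alpha>\<in>UNIV. \<Sum>\<beta>\<in>UNIV. (a $ \<alpha> $ \<beta>) *\<^sub>R j p \<beta> (df p (z \<alpha>)))"
    by (simp add: x a blinfun.sum_left blinfun.scaleR_left)
  also have "\<dots> = (\<Sum>\<beta>\<in>UNIV. \<Sum>\<alpha>\<in>UNIV. (a $ \<alpha> $ \<beta>) *\<^sub>R j p \<beta> (df p (z \<alpha>)))" by (rule sum.swap)
  also have "\<dots> = (\<Sum>\<beta>\<in>UNIV. j p \<beta> (df p (z' \<beta>)))"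
    by (simp add: z'_def linear_sum[OF linear_differential] df_scale blinfun.sum_right blinfun.scaleR_right)
  finally have "x = (\<Sum>\<beta>\<in>UNIV. j p \<beta> (df p (z' \<beta>)))" .
  moreover have "z' \<beta> \<in> Dp p" for \<beta>
    unfolding z'_def by (intro subspace_sum subspace_scale subspace_Dp z)
  ultimately show "x \<in> {\<Sum>\<alpha>\<in>UNIV. j p \<alpha> (df p (z \<alpha>)) | z. \<forall>\<alpha>. z \<alpha> \<in> Dp p}" by blast
next
  fix x assume "x \<in> {\<Sum>\<alpha>\<in>UNIV. j p \<alpha> (df p (z \<alpha>)) | z. \<forall>\<alpha>. z \<alpha> \<in> Dp p}"
  then show "x \<in> \<nu>p p" using basis p unfolding nu_perp_def by blast
qed

lemma nu_perpI:
  assumes "f p \<in> U" "y \<in> Dp p"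
  shows "j p \<alpha> (df p y) \<in> \<nu>p p"
proof -
  let ?z = "\<lambda>\<beta>. if \<beta> = \<alpha> then y else 0"
  have "(\<Sum>\<beta>\<in>UNIV. j p \<beta> (df p (?z \<beta>))) = (\<Sum>\<beta>\<in>UNIV. if \<beta> = \<alpha> then j p \<beta> (df p y) else 0)"
    by (intro sum.cong) (auto simp: df_0)
  then have "(\<Sum>\<beta>\<in>UNIV. j p \<beta> (df p (?z \<beta>))) = j p \<alpha> (df p y)" by simp
  moreover have "\<forall>\<beta>. ?z \<beta> \<in> Dp p" using assms(2) subspace_0[OF subspace_Dp] by auto
  ultimately show ?thesis unfolding nu_perp_eq[OF assms(1)] by (intro CollectI exI[of _ ?z]) auto
qed

lemma subspace_nu_perp:
  assumes p: "f p \<in> U"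
  shows "subspace (\<nu>p p)"
  unfolding nu_perp_eq[OF p] subspace_def
proof (intro conjI ballI allI)
  show "0 \<in> {\<Sum>\<alpha>\<in>UNIV. j p \<alpha> (df p (z \<alpha>)) | z. \<forall>\<alpha>. z \<alpha> \<in> Dp p}"
    using subspace_0[OF subspace_Dp] by (intro CollectI exI[of _ "\<lambda>_. 0"]) (simp add: df_0)
  fix x assume "x \<in> {\<Sum>\<alpha>\<in>UNIV. j p \<alpha> (df p (z \<alpha>)) | z. \<forall>\<alpha>. z \<alpha> \<in> Dp p}"
  then obtain u where u: "\<And>\<alpha>. u \<alpha> \<in> Dp p" "x = (\<Sum>\<alpha>\<in>UNIV. j p \<alpha> (df p (u \<alpha>)))" by blast
  show "c *\<^sub>R x \<in> {\<Sum>\<alpha>\<in>UNIV. j p \<alpha> (df p (z \<alpha>)) | z. \<forall>\<alpha>. z \<alpha> \<in> Dp p}" for c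
    using u(1) subspace_scale[OF subspace_Dp]
    by (intro CollectI exI[of _ "\<lambda>\<alpha>. c *\<^sub>R u \<alpha>"]) (simp add: u(2) df_scale blinfun.scaleR_right scaleR_sum_right)
  fix y assume "y \<in> {\<Sum>\<alpha>\<in>UNIV. j p \<alpha> (df p (z \<alpha>)) | z. \<forall>\<alpha>. z \<alpha> \<in> Dp p}"
  then obtain w where w: "\<And>\<alpha>. w \<alpha> \<in> Dp p" "y = (\<Sum>\<alpha>\<in>UNIV. j p \<alpha> (df p (w \<alpha>)))" by blast
  show "x + y \<in> {\<Sum>\<alpha>\<in>UNIV. j p \<alpha> (df p (z \<alpha>)) | z. \<forall>\<alpha>. z \<alpha> \<in> Dp p}"
    using u(1) w(1) subspace_add[OF subspace_Dp]
    by (intro CollectI exI[of _ "\<lambda>\<alpha>. u \<alpha> + w \<alpha>"]) (simp add: u(2) w(2) df_add blinfun.add_right sum.distrib)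
qed

lemma nu_perp_normal:
  assumes p: "f p \<in> U" and x: "x \<in> \<nu>p p"
  shows "x \<in> normal p"
proof -
  obtain z where z: "\<And>\<alpha>. z \<alpha> \<in> Dp p" "x = (\<Sum>\<alpha>\<in>UNIV. j p \<alpha> (df p (z \<alpha>)))"
    using x unfolding nu_perp_eq[OF p] by blast
  have "g (f p) x (df p v) = 0" for v
    by (simp add: z(2) bilinear_sums[OF M.bil] normal_df(1)[OF j_Dp[OF p z(1)]])
  then show ?thesis by (simp add: normal_space_def)
qed

lemma nu_iff:
  assumes p: "f p \<in> U"
  shows "x \<in> \<nu> p \<longleftrightarrow> x \<in> normal p \<and> (\<forall>\<alpha>. \<forall>y\<in>Dp p. g (f p) x (j p \<alpha> (df p y)) = 0)"
proof
  assume "x \<in> \<nu> p"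
  then show "x \<in> normal p \<and> (\<forall>\<alpha>. \<forall>y\<in>Dp p. g (f p) x (j p \<alpha> (df p y)) = 0)"
    using nu_perpI[OF p] by (auto simp: nu_def)
next
  assume x: "x \<in> normal p \<and> (\<forall>\<alpha>. \<forall>y\<in>Dp p. g (f p) x (j p \<alpha> (df p y)) = 0)"
  have "g (f p) x \<zeta> = 0" if "\<zeta> \<in> \<nu>p p" for \<zeta>
    using that x unfolding nu_perp_eq[OF p] by (auto simp: bilinear_sums[OF M.bil])
  then show "x \<in> \<nu> p" using x by (simp add: nu_def)
qed

text \<open>Pairing with J_\<alpha> \<open>y\<close> isolates the component
  \<open>z \<alpha>\<close>, because different J's give orthogonal spaces. Non-degeneracy on D^perp
  then kills it.\<close>

lemma nu_inter_nu_perp: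
  assumes p: "f p \<in> U" and x: "x \<in> \<nu> p" "x \<in> \<nu>p p"
  shows "x = 0"
proof -
  obtain z where z: "\<And>\<alpha>. z \<alpha> \<in> Dp p" "x = (\<Sum>\<alpha>\<in>UNIV. j p \<alpha> (df p (z \<alpha>)))"
    using x(2) unfolding nu_perp_eq[OF p] by blast
  have "z \<alpha> = 0" for \<alpha>
  proof -
    have "h p (z \<alpha>) y = 0" if y: "y \<in> Dp p" for y
    proof -
      have "0 = g (f p) x (j p \<alpha> (df p y))" using x(1) y nu_iff[OF p] by simp
      also have "\<dots> = (\<Sum>\<beta>\<in>UNIV. g (f p) (j p \<beta> (df p (z \<beta>))) (j p \<alpha> (df p y)))"
        by (simp add: z(2) bilinear_sums[OF M.bil])
      also have "\<dots> = (\<Sum>\<beta>\<in>UNIV. if \<beta> = \<alpha> then eps \<alpha> * h p (z \<alpha>) y else 0)"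
        by (intro sum.cong) (auto simp: j_metric[OF p] g_df j_orth[OF p _ z(1) y])
      finally have "eps \<alpha> * h p (z \<alpha>) y = 0" by simp
      then show ?thesis using eps_square(2)[of \<alpha> "h p (z \<alpha>) y"] by auto
    qed
    then show ?thesis using nondegenerate_Dp z(1) unfolding nondegenerate_on_def by blast
  qed
  then show ?thesis by (simp add: z(2) df_0)
qed

text \<open>Parallelism of \<sigma> makes the derivative of J_\<alpha> a combination of the J's at
  the same point, and each of these maps D^perp into \<open>\<nu>p\<close>. The connection forms
  themselves never have to be named.\<close>

lemma nabla_J_nu_perp:
  assumes p: "f p \<in> U" and y: "y \<in> Dp p"
  shows "levi_civita_endo M g (J \<alpha>) (f p) u (df p y) \<in> \<nu>p p"
proof -
  have s: "\<sigma> q = span (range (\<lambda>\<alpha>. J \<alpha> q))" if "q \<in> U" for q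
    using basis that by (simp add: canonical_local_basis_def)
  have "\<forall>q\<in>U. J \<alpha> q \<in> \<sigma> q" using s by (auto intro: span_base)
  then obtain T where T: "T \<in> \<sigma> (f p)" "blinfun_apply T = levi_civita_endo M g (J \<alpha>) (f p) u"
    using kaehler open_U smooth_J p unfolding paraquaternionic_kaehler_def parallel_subbundle_def by blast
  have "T \<in> span (range (\<lambda>\<alpha>. J \<alpha> (f p)))" using T(1) s[OF p] by simp
  then have "blinfun_apply T (df p y) \<in> \<nu>p p"
  proof (induction rule: span_induct)
    case base
    show ?case
      using subspace_0[OF subspace_nu_perp[OF p]] subspace_add[OF subspace_nu_perp[OF p]] subspace_scale[OF subspace_nu_perp[OF p]]
      by (auto simp: subspace_def blinfun.add_left blinfun.scaleR_left)
  qed (use nu_perpI[OF p y] in auto)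
  then show ?thesis by (simp add: T(2))
qed

lemma endo_along_eq: "endo_along N M f (J \<alpha>) Y = (\<lambda>q. j q \<alpha> (df q (Y q)))"
  by (simp add: endo_along_def fun_eq_iff)

lemma nabla_endo_along:
  assumes "open W" "p \<in> W" "f p \<in> U" "vector_field_on N W Y"
  shows "nabla (endo_along N M f (J \<alpha>) Y) p v
    = levi_civita_endo M g (J \<alpha>) (f p) (df p v) (df p (Y p)) + j p \<alpha> (nabla (\<lambda>q. df q (Y q)) p v)"
  unfolding endo_along_eq
  by (rule nabla_endo[OF assms(1,2) open_U assms(3) smooth_J smooth_along_differential[OF assms(1,4)]])

text \<open>J Y is normal, so differentiating its orthogonality to a tangent field moves the
  derivative to that field. For the second formula the term with the derivative of J drops out,
  being normal as well.\<close>

lemma nabla_endo_along_tangent: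
  assumes W: "open W" "p \<in> W" and p: "f p \<in> U" and Y: "vector_field_on N W Y" "\<And>q. q \<in> W \<Longrightarrow> Y q \<in> Dp q"
  shows "g (f p) (nabla (endo_along N M f (J \<alpha>) Y) p v) (df p z) = - g (f p) (j p \<alpha> (df p (Y p))) (hess p v z)"
    and "g (f p) (j p \<alpha> (nabla (\<lambda>q. df q (Y q)) p v)) (df p z) = - g (f p) (j p \<alpha> (df p (Y p))) (hess p v z)"
proof -
  \<comment> \<open>Shrunk to where J and the constant-component extension of \<open>z\<close> are
    both available.\<close>
  let ?V = "W \<inter> f -` U \<inter> cdom (chart_at N p)" and ?Z = "\<lambda>q. df q (from_chart N (chart_at N p) q z)"
  have V: "open ?V" "p \<in> ?V"
    using W p by (auto intro!: open_Int open_vimage_map open_U N.open_cdom N.chart_at_max N.chart_at)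
  have \<xi>: "smooth_along N M f ?V (endo_along N M f (J \<alpha>) Y)"
    unfolding endo_along_eq
    by (rule smooth_along_endo[OF V(1) open_U smooth_J smooth_along_subset[OF smooth_along_differential[OF W(1) Y(1)]]]) auto
  have Z: "smooth_along N M f ?V ?Z"
    by (rule smooth_along_subset[OF smooth_along_differential[OF N.open_cdom[OF N.chart_at_max] vector_field_const_coeff[OF N.chart_at(1)]]]) auto
  have 0: "g (f q) (endo_along N M f (J \<alpha>) Y q) (?Z q) = 0" if "q \<in> ?V" for q
    using normal_df(1)[OF j_Dp[of q "Y q" \<alpha>]] Y(2)[of q] that by (simp add: endo_along_def)
  show 1: "g (f p) (nabla (endo_along N M f (J \<alpha>) Y) p v) (df p z) = - g (f p) (j p \<alpha> (df p (Y p))) (hess p v z)"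
    using nabla_orthogonal[OF V \<xi> Z 0, of v] by (simp add: hess_eq_nabla endo_along_eq)
  have "g (f p) (levi_civita_endo M g (J \<alpha>) (f p) (df p v) (df p (Y p))) (df p z) = 0"
    by (rule normal_df(1)[OF nu_perp_normal[OF p nabla_J_nu_perp[OF p Y(2)[OF W(2)]]]])
  then show "g (f p) (j p \<alpha> (nabla (\<lambda>q. df q (Y q)) p v)) (df p z) = - g (f p) (j p \<alpha> (df p (Y p))) (hess p v z)"
    using 1 nabla_endo_along[OF W p Y(1), of \<alpha> v] by (simp add: M.gs)
qed

text \<open>Skewness moves J to the ambient derivative, where the preceding formula applies. The
  normal vector J Y sees only the normal part of the Hessian.\<close>

lemma nabla_J_D:
  assumes W: "open W" "p \<in> W" and p: "f p \<in> U" and Y: "vector_field_on N W Y" "\<And>q. q \<in> W \<Longrightarrow> Y q \<in> Dp q"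
  shows "g (f p) (nabla (\<lambda>q. df q (Y q)) p v) (j p \<alpha> (df p z)) = g (f p) (sff p v z) (j p \<alpha> (df p (Y p)))"
  using nabla_endo_along_tangent(2)[OF W p Y, of \<alpha> v z] sff_hess[OF j_Dp[OF p Y(2)[OF W(2)]], of v z]
    j_skew[OF p, of \<alpha> "nabla (\<lambda>q. df q (Y q)) p v" "df p z"] M.sym[of "f p" "j p \<alpha> (df p (Y p))" "hess p v z"]
  by simp

end

section \<open>Integrability of D^perp\<close>

context pq_cr
begin

text \<open>For \<open>X, Y\<close> in \<open>D\<^sup>\<perp>\<close> the \<open>D\<close>-component of \<open>\<nabla>\<^sub>X Y\<close> is measured by \<open>g(B(X, Z), J Y)\<close> with \<open>Z\<close> in \<open>D\<close>,
  which is symmetric in \<open>X\<close> and \<open>Y\<close>.\<close>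

lemma Dp_involutive:
  assumes W: "open W" and X: "vector_field_on N W X" "\<And>q. q \<in> W \<Longrightarrow> X q \<in> Dp q"
    and Y: "vector_field_on N W Y" "\<And>q. q \<in> W \<Longrightarrow> Y q \<in> Dp q" and p: "p \<in> W"
  shows "N.dvf Y p (X p) - N.dvf X p (Y p) \<in> Dp p"
proof -
  obtain U J where UJ: "f p \<in> U" "canonical_local_basis M \<sigma> U J" using basis_exists_at by blast
  interpret B: pq_basis N M f g D \<sigma> U J by unfold_locales (rule UJ)
  let ?b = "N.dvf Y p (X p) - N.dvf X p (Y p)"
  \<comment> \<open>The Hessian terms cancel by symmetry, so the difference of ambient derivatives
    is the image of the Lie bracket.\<close>
  have b: "df p ?b = nabla (\<lambda>q. df q (Y q)) p (X p) - nabla (\<lambda>q. df q (X q)) p (Y p)"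
    using nabla_differential[OF W p Y(1), of "X p"] nabla_differential[OF W p X(1), of "Y p"] hess_sym[of p "X p" "Y p"]
    by (simp add: df_diff)
  \<comment> \<open>For an extension \<open>Z\<close> of \<open>x\<close>, the product of its
    derivative along \<open>z\<close> with J \<open>y\<close> is computed twice: by the Gauss
    formula for \<open>Z\<close>, and by moving J onto the derivative and using that J
    \<open>Z\<close> is normal.\<close>
  have sym: "g (f p) (sff p z x) (B.j p 1 (df p y)) = g (f p) (sff p z y) (B.j p 1 (df p x))"
    if xyz: "x \<in> Dp p" "y \<in> Dp p" "z \<in> D p" for x y z
  proof -
    obtain Z where Z: "vector_field_on N UNIV Z" "\<And>q. Z q \<in> Dp q" "Z p = x"
      using Dp_section[OF xyz(1)] by (auto simp: tangent_sections_def)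
    let ?n = "nabla (\<lambda>q. df q (Z q)) p z"
    note n1 = B.j_Dp[OF UJ(1) that(1), of 1] and n2 = B.j_Dp[OF UJ(1) that(2), of 1]
    have "g (f p) ?n (B.j p 1 (df p y)) = g (f p) (sff p z x) (B.j p 1 (df p y))"
      using nabla_split[OF open_UNIV UNIV_I Z(1), of p z] normal_df(2)[OF n2] by (simp add: M.gs Z(3))
    moreover have "g (f p) ?n (B.j p 1 (df p y)) = g (f p) (B.j p 1 (df p x)) (hess p z y)"
      using B.nabla_endo_along_tangent(2)[OF open_UNIV UNIV_I UJ(1) Z(1,2), of 1 z y]
        B.j_skew[OF UJ(1), of 1 ?n "df p y"] by (simp add: Z(3))
    ultimately show ?thesis using sff_hess[OF n1, of z y] M.sym[of "f p" "B.j p 1 (df p x)"] by simp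
  qed
  have "h p ?b w = 0" if w: "w \<in> D p" for w
  proof -
    obtain z where z: "z \<in> D p" "df p w = B.j p 1 (df p z)" using B.j_D_surj[OF UJ(1) w] by blast
    have "h p ?b w = g (f p) (nabla (\<lambda>q. df q (Y q)) p (X p) - nabla (\<lambda>q. df q (X q)) p (Y p)) (B.j p 1 (df p z))"
      unfolding g_df[symmetric] b z(2) ..
    also have "\<dots> = g (f p) (sff p (X p) z) (B.j p 1 (df p (Y p))) - g (f p) (sff p (Y p) z) (B.j p 1 (df p (X p)))"
      using B.nabla_J_D[OF W p UJ(1) Y, of "X p" 1 z] B.nabla_J_D[OF W p UJ(1) X, of "Y p" 1 z]
      by (simp only: M.gs)
    also have "\<dots> = 0"
      using sym[OF X(2)[OF p] Y(2)[OF p] z(1)] by (simp add: sff_sym[of p _ z])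
    finally show ?thesis .
  qed
  then show ?thesis by (simp add: Dperp_def)
qed

sublocale F: foliation N Dp_proj "DIM('n) - rk"
proof (intro foliation.intro foliation_axioms.intro N.smooth_mfd_axioms)
  show "linear (Dp_proj p)" for p by (rule linear_Dp_proj)
  show "Dp_proj p (Dp_proj p v) = Dp_proj p v" for p v by (rule Dp_proj_ident[OF Dp_proj_in])
  show "dim (range (Dp_proj p)) = DIM('n) - rk" for p by (simp add: range_Dp_proj dim_Dp)
  show "vector_field_on N W (\<lambda>p. Dp_proj p (X p))" if "open W" "vector_field_on N W X" for W X
    by (rule smooth_Dp_proj[OF that])
  show "N.dvf Y p (X p) - N.dvf X p (Y p) \<in> range (Dp_proj p)"
    if "open W" "vector_field_on N W X" "vector_field_on N W Y" "\<And>p. p \<in> W \<Longrightarrow> X p \<in> range (Dp_proj p)"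
      "\<And>p. p \<in> W \<Longrightarrow> Y p \<in> range (Dp_proj p)" "p \<in> W" for W X Y p
    using Dp_involutive[OF that(1,2) _ that(3)] that(4-6) by (simp add: range_Dp_proj)
qed

lemma leaf_through: "\<exists>L. leaf N Dp L \<and> p \<in> topspace L"
proof -
  have "(\<lambda>q. range (Dp_proj q)) = Dp" using range_Dp_proj by blast
  then show ?thesis using F.leaf_exists[of p] by metis
qed

end

section \<open>The projection to \<nu>\<close>

context pq_basis
begin

text \<open>Orthogonal projection to \<nu> by an explicit formula. By skewness the component of
  \<eta> in J_\<alpha> D^perp is -\<epsilon>_\<alpha> J_\<alpha> applied to the D^perp-part of
  J_\<alpha> \<eta>; subtracting it gives the plus sign. Smoothness follows from that of the
  constituents, without a frame of \<nu>.\<close>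

definition nu_proj :: "'b \<Rightarrow> 'm \<Rightarrow> 'm" where
  "nu_proj q \<eta> = \<eta> - df q (tan_vec q \<eta>)
     + (\<Sum>\<alpha>\<in>UNIV. eps \<alpha> *\<^sub>R j q \<alpha> (df q (Dp_proj q (tan_vec q (j q \<alpha> \<eta>)))))"

lemma nu_proj_in:
  assumes q: "f q \<in> U"
  shows "nu_proj q \<eta> \<in> \<nu> q"
  unfolding nu_iff[OF q]
proof (intro conjI allI ballI)
  have "g (f q) (nu_proj q \<eta>) (df q v) = 0" for v
    by (simp add: nu_proj_def M.gs bilinear_sums[OF M.bil] normal_df(1)[OF j_Dp[OF q Dp_proj_in]] g_df tan_vec)
  then show "nu_proj q \<eta> \<in> normal q" by (simp add: normal_space_def)
next
  fix \<beta> y assume y: "y \<in> Dp q"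
  have "(\<Sum>\<alpha>\<in>UNIV. g (f q) (eps \<alpha> *\<^sub>R j q \<alpha> (df q (Dp_proj q (tan_vec q (j q \<alpha> \<eta>))))) (j q \<beta> (df q y)))
      = (\<Sum>\<alpha>\<in>UNIV. if \<alpha> = \<beta> then h q (Dp_proj q (tan_vec q (j q \<beta> \<eta>))) y else 0)"
    by (intro sum.cong) (auto simp: M.gs j_orth[OF q _ Dp_proj_in y] j_metric[OF q] g_df eps_square)
  also have "\<dots> = h q (Dp_proj q (tan_vec q (j q \<beta> \<eta>))) y" by simp
  also have "\<dots> = g (f q) (j q \<beta> \<eta>) (df q y)"
    using D_Dp(2)[OF y D_proj_in] by (simp add: Dp_proj_def H.gs tan_vec)
  also have "\<dots> = - g (f q) \<eta> (j q \<beta> (df q y))" by (rule j_skew[OF q])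
  finally show "g (f q) (nu_proj q \<eta>) (j q \<beta> (df q y)) = 0"
    unfolding nu_proj_def using normal_df(2)[OF j_Dp[OF q y]] by (simp add: M.gs bilinear_sums[OF M.bil])
qed

lemma nu_proj_ident:
  assumes q: "f q \<in> U" and \<xi>: "\<xi> \<in> \<nu> q"
  shows "nu_proj q \<xi> = \<xi>"
proof -
  have n: "\<xi> \<in> normal q" "\<And>\<alpha> y. y \<in> Dp q \<Longrightarrow> g (f q) \<xi> (j q \<alpha> (df q y)) = 0" using \<xi> nu_iff[OF q] by auto
  have "tan_vec q \<xi> = 0" by (rule tan_vec_unique) (simp add: normal_df(1)[OF n(1)] H.gs)
  moreover have "Dp_proj q (tan_vec q (j q \<alpha> \<xi>)) = 0" for \<alpha>
  proof -
    have "tan_vec q (j q \<alpha> \<xi>) \<in> D q" by (rule in_D_if) (simp add: tan_vec j_skew[OF q] n(2))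
    then show ?thesis by (simp add: Dp_proj_def D_proj_ident)
  qed
  ultimately show ?thesis by (simp add: nu_proj_def df_0)
qed

lemma smooth_nu_proj:
  assumes "open W" "smooth_along N M f W \<eta>" "W \<subseteq> f -` U"
  shows "smooth_along N M f W (\<lambda>q. nu_proj q (\<eta> q))"
proof -
  have J: "smooth_along N M f W (\<lambda>q. j q \<alpha> (\<zeta> q))" if "smooth_along N M f W \<zeta>" for \<alpha> \<zeta>
    by (rule smooth_along_endo[OF assms(1) open_U smooth_J that assms(3)])
  have c: "smooth_along N M f W (\<lambda>q. r *\<^sub>R \<zeta> q)" if "smooth_along N M f W \<zeta>" for r \<zeta>
    by (rule smooth_along_scale[OF assms(1) smooth_fun_const[OF assms(1)] that])
  show ?thesis
    unfolding nu_proj_def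
    by (intro smooth_along_add smooth_along_diff smooth_along_sum smooth_along_differential c J smooth_Dp_proj
        smooth_tan_vec assms(1,2))
qed

text \<open>A vector of \<nu> is orthogonal to everything that \<open>nu_proj\<close> removes, so
  its product with any \<eta> equals its product with a vector of \<nu>.\<close>

lemma nu_nondegenerate:
  assumes q: "f q \<in> U" and n: "n \<in> \<nu> q" "\<And>\<xi>. \<xi> \<in> \<nu> q \<Longrightarrow> g (f q) n \<xi> = 0"
  shows "n = 0"
proof (rule M.metric_eqI[of "f q"])
  fix \<eta>
  have "g (f q) n (nu_proj q \<eta>) = g (f q) n \<eta>"
    using n(1) unfolding nu_iff[OF q] nu_proj_def
    by (simp add: M.gs bilinear_sums[OF M.bil] normal_df(1) Dp_proj_in)
  then show "g (f q) n \<eta> = g (f q) 0 \<eta>" using n(2)[OF nu_proj_in[OF q]] by (simp add: M.gs)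
qed

text \<open>On the summand with its own index, J_\<alpha> leads back to D^perp; the other two
  summands it maps to summands of \<open>\<nu>p\<close>, by the multiplication rules.\<close>

lemma j_nu_perp:
  assumes p: "f p \<in> U" and w: "w \<in> \<nu>p p"
  shows "\<exists>y\<in>Dp p. j p \<alpha> w - df p y \<in> \<nu>p p"
proof -
  obtain z where z: "\<And>\<alpha>. z \<alpha> \<in> Dp p" "w = (\<Sum>\<beta>\<in>UNIV. j p \<beta> (df p (z \<beta>)))"
    using w unfolding nu_perp_eq[OF p] by blast
  define y where "y \<beta> = (if \<beta> = \<alpha> then - eps \<alpha> *\<^sub>R z \<alpha> else 0)" for \<beta>
  note s = subspace_nu_perp[OF p]
  have 1: "j p \<alpha> (j p \<beta> (df p (z \<beta>))) - df p (y \<beta>) \<in> \<nu>p p" for \<beta>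
  proof (rule three_cases[of \<beta> \<alpha>])
    assume "\<beta> = \<alpha>"
    then show ?thesis using subspace_0[OF s] by (simp add: y_def j_square[OF p] df_scale df_minus)
  next
    assume "\<beta> = \<alpha> + 1"
    then show ?thesis using subspace_scale[OF s nu_perpI[OF p z(1)], of "eps (\<alpha> + 2)" "\<alpha> + 2" "\<alpha> + 1"]
      j_next[OF p, of \<alpha> "df p (z \<beta>)"] by (simp add: y_def df_0)
  next
    assume "\<alpha> = \<beta> + 1"
    then show ?thesis using subspace_scale[OF s nu_perpI[OF p z(1)], of "- eps (\<beta> + 2)" "\<beta> + 2" \<beta>]
      j_prev[OF p, of \<beta> "df p (z \<beta>)"] by (simp add: y_def df_0)
  qed
  have "j p \<alpha> w - df p (\<Sum>\<beta>\<in>UNIV. y \<beta>) = (\<Sum>\<beta>\<in>UNIV. j p \<alpha> (j p \<beta> (df p (z \<beta>))) - df p (y \<beta>))"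
    by (simp add: z(2) blinfun.sum_right linear_sum[OF linear_differential] sum_subtractf)
  then have "j p \<alpha> w - df p (\<Sum>\<beta>\<in>UNIV. y \<beta>) \<in> \<nu>p p" using subspace_sum[OF s 1] by simp
  moreover have "(\<Sum>\<beta>\<in>UNIV. y \<beta>) \<in> Dp p"
    using z(1) by (intro subspace_sum[OF subspace_Dp]) (auto simp: y_def subspace_0[OF subspace_Dp] subspace_neg[OF subspace_Dp] subspace_scale[OF subspace_Dp])
  ultimately show ?thesis by blast
qed

end

section \<open>Totally real ruled submanifolds\<close>

text \<open>Along the submanifold the difference of the components is constantly 0, so its
  derivative in tangent directions is 0. This makes the leaf's second fundamental form independent
  of the extension.\<close>

lemma (in smooth_mfd) dvf_eq_on_submanifold:
  assumes L: "immersed_subset A L" "v \<in> tangent_space_of A L p" and V: "openin L V" "p \<in> V"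
    and W: "V \<subseteq> W" "vector_field_on A W X" "vector_field_on A W Y" and eq: "\<And>q. q \<in> V \<Longrightarrow> X q = Y q"
  shows "dvf X p v = dvf Y p v"
proof -
  let ?e = "chart_at A p"
  let ?r = "\<lambda>X x. to_chart A ?e (cinv ?e x) (X (cinv ?e x))"
  have "p \<in> topspace L" using openin_subset[OF V(1)] V(2) by blast
  then obtain c E V0 where sl: "slice_chart A L c E V0" "p \<in> V0" using L(1) unfolding immersed_subset_def by blast
  have v: "to_chart A c p v \<in> E" using L(2) tangent_space_of_slice[OF sl] by simp
  have pW: "p \<in> W" using V W by blast
  have "((\<lambda>x. ?r X x - ?r Y x) has_derivative (\<lambda>v. dvf X p v - dvf Y p v)) (at (cmap ?e p))"
    by (rule has_derivative_diff[OF dvf[OF W(2) pW] dvf[OF W(3) pW]])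
  then have "dvf X p (to_chart A ?e p v) - dvf Y p (to_chart A ?e p v) \<in> {0}"
  proof (rule slice_derivative[OF sl V chart_at_max chart_at(2) v])
    show "(?r X (cmap ?e q) - ?r Y (cmap ?e q)) - (?r X (cmap ?e p) - ?r Y (cmap ?e p)) \<in> {0}"
      if "q \<in> V \<inter> V0" "q \<in> cdom ?e" for q
      using that eq[of q] eq[OF V(2)] cinv_cmap[OF chart_at_max, of q p] cinv_cmap[OF chart_at_max chart_at(2), of p] by simp
  qed (rule subspace_single_0)
  then show ?thesis by simp
qed

lemma (in nondeg_subspace) diff_orth_proj_eq_0: "v - orth_proj h F v = 0 \<longleftrightarrow> v \<in> F"
  using orth_proj(1)[of v] orth_proj_ident[of v] by auto

context pq_cr
begin

text \<open>The metric is non-degenerate on the image of D^perp, so the form is the ambient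
  derivative minus its orthogonal projection to the leaf's tangent space. It vanishes exactly when
  nothing is removed.\<close>

lemma leaf_second_fundamental_form_eq_0:
  assumes "tangent_space_of N L p = Dp p"
  shows "leaf_second_fundamental_form N M g f L Y p v = 0 \<longleftrightarrow> nabla (\<lambda>q. df q (Y q)) p v \<in> df p ` Dp p"
proof -
  let ?F = "df p ` Dp p" and ?n = "nabla (\<lambda>q. df q (Y q)) p v"
  interpret F: nondeg_subspace "g (f p)" ?F
  proof
    show "subspace ?F" by (rule linear_subspace_image[OF linear_differential subspace_Dp])
    show "nondegenerate_on (g (f p)) ?F"
      by (rule nondegenerate_image[OF nondegenerate_Dp]) (simp_all add: g_df df_0)
  qed (rule M.bil, rule M.sym)
  have "leaf_second_fundamental_form N M g f L Y p v = ?n - orth_proj (g (f p)) ?F ?n"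
    unfolding leaf_second_fundamental_form_def assms
  proof (rule the_equality)
    show "(\<forall>w\<in>Dp p. g (f p) (?n - orth_proj (g (f p)) ?F ?n) (df p w) = 0) \<and>
        ?n - (?n - orth_proj (g (f p)) ?F ?n) \<in> ?F"
      using F.orth_proj by (simp add: M.gs)
    show "k = ?n - orth_proj (g (f p)) ?F ?n" if "(\<forall>w\<in>Dp p. g (f p) k (df p w) = 0) \<and> ?n - k \<in> ?F" for k
    proof -
      have "orth_proj (g (f p)) ?F ?n = ?n - k"
        by (rule F.orth_proj_unique) (use that in \<open>auto simp: M.gs\<close>)
      then show ?thesis by simp
    qed
  qed
  moreover have "?n - orth_proj (g (f p)) ?F ?n = 0 \<longleftrightarrow> ?n \<in> ?F" by (rule F.diff_orth_proj_eq_0)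
  ultimately show ?thesis by (rule ssubst)
qed

text \<open>\<open>geod\<close> removes the normal part of the derivative. The remaining tangent
  vector is tested against \<open>w = J z\<close> in D, where \<open>mixed\<close> applies.
  \<open>Y\<close> is allowed to be local because fields on leaves are.\<close>

lemma nabla_Dp:
  assumes W: "open W" "p \<in> W" and Y: "vector_field_on N W Y" "\<And>q. q \<in> W \<Longrightarrow> Y q \<in> Dp q" and v: "v \<in> Dp p"
    and geod: "\<And>y. y \<in> Dp p \<Longrightarrow> sff p v y = 0" and mixed: "\<And>z. z \<in> D p \<Longrightarrow> sff p v z \<in> \<nu> p"
  shows "nabla (\<lambda>q. df q (Y q)) p v \<in> df p ` Dp p"
proof -
  obtain U J where UJ: "f p \<in> U" "canonical_local_basis M \<sigma> U J" using basis_exists_at by blast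
  interpret B: pq_basis N M f g D \<sigma> U J by unfold_locales (rule UJ)
  define t where "t = N.dvf Y p v + christoffel N h p v (Y p)"
  have n: "nabla (\<lambda>q. df q (Y q)) p v = df p t"
    using nabla_split[OF W Y(1), of v] geod[OF Y(2)[OF W(2)]] by (simp add: t_def)
  have "h p t w = 0" if w: "w \<in> D p" for w
  proof -
    obtain z where z: "z \<in> D p" "df p w = B.j p 1 (df p z)" using B.j_D_surj[OF UJ(1) w] by blast
    have "h p t w = g (f p) (sff p v z) (B.j p 1 (df p (Y p)))"
      using B.nabla_J_D[OF W UJ(1) Y, of v 1 z] by (simp add: g_df[symmetric] n z(2))
    then show ?thesis using mixed[OF z(1)] Y(2)[OF W(2)] B.nu_iff[OF UJ(1)] by simp
  qed
  then have "t \<in> Dp p" by (simp add: Dperp_def)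
  then show ?thesis using n by blast
qed

text \<open>Assertion (i) with the leaves eliminated.\<close>

definition Dp_autoparallel :: bool where
  "Dp_autoparallel \<longleftrightarrow> (\<forall>Y\<in>tangent_sections N Dp. \<forall>p. \<forall>v\<in>Dp p. nabla (\<lambda>q. df q (Y q)) p v \<in> df p ` Dp p)"

definition Dp_geodesic :: bool where
  "Dp_geodesic \<longleftrightarrow> (\<forall>p. \<forall>x\<in>Dp p. \<forall>y\<in>Dp p. sff p x y = 0)"

definition mixed_nu :: bool where
  "mixed_nu \<longleftrightarrow> (\<forall>p. \<forall>x\<in>Dp p. \<forall>z\<in>D p. sff p x z \<in> \<nu> p)"

definition Dp_nu :: bool where
  "Dp_nu \<longleftrightarrow> (\<forall>p. \<forall>x\<in>Dp p. \<forall>w. sff p x w \<in> \<nu> p)"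

lemma subspace_nu: "subspace (\<nu> p)"
  by (auto simp: subspace_def nu_def normal_space_def M.gs)

text \<open>If the derivative is the image of a vector of D^perp, its normal part is tangent and
  normal, hence 0. Since J maps D to D, its product with J \<open>z\<close> is 0 for
  \<open>z\<close> in D, and this is the orthogonality of B to J D^perp.\<close>

lemma Dp_autoparallel_iff: "Dp_autoparallel \<longleftrightarrow> Dp_geodesic \<and> mixed_nu"
proof
  assume au: Dp_autoparallel
  have *: "sff p x y = 0 \<and> (\<forall>z\<in>D p. \<forall>\<alpha>. g (f p) (sff p x z) (blinfun_apply (J \<alpha> (f p)) (df p y)) = 0)"
    if xy: "x \<in> Dp p" "y \<in> Dp p" and UJ: "f p \<in> U" "canonical_local_basis M \<sigma> U J" for p x y U J
  proof -
    interpret B: pq_basis N M f g D \<sigma> U J by unfold_locales (rule UJ)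
    obtain Y where Y: "Y \<in> tangent_sections N Dp" "Y p = y" using Dp_section[OF xy(2)] by blast
    then have Ys: "vector_field_on N UNIV Y" "\<And>q. Y q \<in> Dp q" by (auto simp: tangent_sections_def)
    define t where "t = N.dvf Y p x + christoffel N h p x (Y p)"
    obtain t' where t': "t' \<in> Dp p" "nabla (\<lambda>q. df q (Y q)) p x = df p t'"
      using au Y(1) xy(1) unfolding Dp_autoparallel_def by blast
    have s: "sff p x y = df p (t' - t)"
      using nabla_split[OF open_UNIV UNIV_I Ys(1), of p x] t'(2) by (simp add: t_def Y(2) df_diff)
    then have "t' - t = 0" using tangent_normal[of p "t' - t"] sff_normal[of p x y] by simp
    then have "sff p x y = 0" using s by (simp add: df_0)
    moreover have "g (f p) (sff p x z) (B.j p \<alpha> (df p y)) = 0" if z: "z \<in> D p" for z \<alpha>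
    proof -
      obtain z' where z': "z' \<in> D p" "B.j p \<alpha> (df p z) = df p z'" using B.j_D[OF UJ(1) z, of \<alpha>] by blast
      have "g (f p) (sff p x z) (B.j p \<alpha> (df p y)) = h p t' z'"
        using B.nabla_J_D[OF open_UNIV UNIV_I UJ(1) Ys, of x \<alpha> z] by (simp add: t'(2) z'(2) Y(2) g_df)
      then show ?thesis using D_Dp(1)[OF t'(1) z'(1)] by simp
    qed
    ultimately show ?thesis by blast
  qed
  have Dp_geodesic
    unfolding Dp_geodesic_def
  proof (intro allI ballI)
    fix p x y assume xy: "x \<in> Dp p" "y \<in> Dp p"
    obtain U J where UJ: "f p \<in> U" "canonical_local_basis M \<sigma> U J" using basis_exists_at by blast
    show "sff p x y = 0" by (rule conjunct1[OF *[OF xy UJ]])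
  qed
  moreover have mixed_nu
    unfolding mixed_nu_def
  proof (intro allI ballI)
    fix p x z assume xz: "x \<in> Dp p" "z \<in> D p"
    obtain U J where UJ: "f p \<in> U" "canonical_local_basis M \<sigma> U J" using basis_exists_at by blast
    interpret B: pq_basis N M f g D \<sigma> U J by unfold_locales (rule UJ)
    show "sff p x z \<in> \<nu> p"
      unfolding B.nu_iff[OF UJ(1)] using conjunct2[OF *[OF xz(1) _ UJ]] xz(2) sff_normal[of p x z] by simp
  qed
  ultimately show "Dp_geodesic \<and> mixed_nu" ..
next
  assume "Dp_geodesic \<and> mixed_nu"
  then show Dp_autoparallel
    unfolding Dp_autoparallel_def Dp_geodesic_def mixed_nu_def
    by (auto intro!: nabla_Dp[OF open_UNIV UNIV_I] simp: tangent_sections_def)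
qed

lemma linear_sff: "linear (sff p v)"
  unfolding sff_def[abs_def]
  using linear_compose_sub[OF linear_hess(2) linear_compose[OF H.linear_christoffel linear_differential]] by (simp add: o_def)

text \<open>Split \<open>w\<close> into its parts in D^perp and D: the first contributes nothing,
  the second lies in \<nu>. This links the form of (i) and (ii) to that of (iii) and (iv).\<close>

lemma Dp_geodesic_mixed_nu: "Dp_geodesic \<and> mixed_nu \<longleftrightarrow> Dp_geodesic \<and> Dp_nu"
proof -
  have "sff p x w \<in> \<nu> p" if "Dp_geodesic" "mixed_nu" "x \<in> Dp p" for p x w
  proof -
    have "sff p x w = sff p x (Dp_proj p w) + sff p x (D_proj p w)"
      by (simp add: linear_add[OF linear_sff, symmetric] Dp_proj_def)
    then show ?thesis using that D_proj_in Dp_proj_in by (simp add: Dp_geodesic_def mixed_nu_def)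
  qed
  then show ?thesis by (auto simp: mixed_nu_def Dp_nu_def)
qed

lemma totally_real_ruled_iff: "totally_real_ruled N M g f D \<longleftrightarrow> Dp_autoparallel"
proof
  assume r: "totally_real_ruled N M g f D"
  show Dp_autoparallel
    unfolding Dp_autoparallel_def
  proof (intro ballI allI)
    fix Y p v assume Y: "Y \<in> tangent_sections N Dp" and v: "v \<in> Dp p"
    obtain L where L: "leaf N Dp L" "p \<in> topspace L" using leaf_through by blast
    then have t: "\<And>q. q \<in> topspace L \<Longrightarrow> tangent_space_of N L q = Dp q" and tg: "totally_geodesic N M g f L"
      using r by (auto simp: leaf_def integral_manifold_def totally_real_ruled_def)
    have "vector_field_on N UNIV Y" "\<And>q. Y q \<in> Dp q" using Y by (auto simp: tangent_sections_def)
    then have "leaf_second_fundamental_form N M g f L Y p v = 0"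
      using tg[unfolded totally_geodesic_def, rule_format, of UNIV Y "topspace L" p v] L(2) v t by simp
    then show "nabla (\<lambda>q. df q (Y q)) p v \<in> df p ` Dp p"
      by (rule iffD1[OF leaf_second_fundamental_form_eq_0[OF t[OF L(2)]]])
  qed
next
  assume au: Dp_autoparallel
  show "totally_real_ruled N M g f D"
    unfolding totally_real_ruled_def totally_geodesic_def
  proof (intro allI impI ballI)
    fix L W V Y p v
    assume L: "leaf N Dp L" and WV: "open W \<and> vector_field_on N W Y \<and> openin L V \<and> V \<subseteq> W \<and>
          (\<forall>q\<in>V. Y q \<in> tangent_space_of N L q)" and p: "p \<in> V" and v: "v \<in> tangent_space_of N L p"
    have t: "tangent_space_of N L q = Dp q" if "q \<in> V" for q
      using L that openin_subset[of L V] WV by (auto simp: leaf_def integral_manifold_def)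
    have im: "immersed_subset N L" using L by (simp add: leaf_def integral_manifold_def)
    have W: "open W" "p \<in> W" "vector_field_on N W Y" using WV p by auto
    \<comment> \<open>\<open>Y\<close> is tangent to D^perp on \<open>V\<close> only, which need not
      be open in \<open>N\<close>. Its projection lies in D^perp on all of \<open>W\<close>, as
      \<open>nabla_Dp\<close> requires.\<close>
    let ?Z = "\<lambda>q. Dp_proj q (Y q)"
    have Z: "vector_field_on N W ?Z" by (rule smooth_Dp_proj[OF W(1,3)])
    have eq: "Y q = ?Z q" if "q \<in> V" for q using WV t[OF that] that Dp_proj_ident by auto
    have "N.dvf Y p v = N.dvf ?Z p v"
      by (rule N.dvf_eq_on_submanifold[OF im v _ p _ W(3) Z eq]) (use WV in auto)
    then have "nabla (\<lambda>q. df q (Y q)) p v = nabla (\<lambda>q. df q (?Z q)) p v"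
      by (simp add: nabla_differential[OF W] nabla_differential[OF W(1,2) Z] eq[OF p, symmetric])
    also have "\<dots> \<in> df p ` Dp p"
      using au v unfolding Dp_autoparallel_iff Dp_geodesic_def mixed_nu_def t[OF p]
      by (auto intro!: nabla_Dp[OF W(1,2) Z] Dp_proj_in)
    finally show "leaf_second_fundamental_form N M g f L Y p v = 0"
      by (rule iffD2[OF leaf_second_fundamental_form_eq_0[OF t[OF p]]])
  qed
qed

end

section \<open>Shape operator and normal connection of J Z\<close>

context pq_basis
begin

lemma shape_operator_endo:
  assumes p: "f p \<in> U" and Z: "Z \<in> tangent_sections N Dp"
  shows "h p (shape_operator N M g f (endo_along N M f (J \<alpha>) Z) X p) z = g (f p) (sff p (X p) z) (j p \<alpha> (df p (Z p)))"
proof -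
  have Zs: "vector_field_on N UNIV Z" "\<And>q. Z q \<in> Dp q" using Z by (auto simp: tangent_sections_def)
  show ?thesis
    using nabla_endo_along_tangent(1)[OF open_UNIV UNIV_I p Zs, of \<alpha> "X p" z] sff_hess[OF j_Dp[OF p Zs(2)], of "X p" z]
    by (simp add: shape_operator M.sym[of "f p" "j p \<alpha> (df p (Z p))"])
qed

lemma shape_operator_endo_eq_0:
  assumes p: "f p \<in> U" and Z: "Z \<in> tangent_sections N Dp" and nu: "\<forall>w. sff p (X p) w \<in> \<nu> p"
  shows "shape_operator N M g f (endo_along N M f (J \<alpha>) Z) X p = 0"
proof (rule H.metric_eqI[of p])
  have "Z p \<in> Dp p" using Z by (simp add: tangent_sections_def)
  then show "h p (shape_operator N M g f (endo_along N M f (J \<alpha>) Z) X p) z = h p 0 z" for z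
    using nu nu_iff[OF p] by (simp add: shape_operator_endo[OF p Z] H.gs)
qed

text \<open>The shape operator vanishes here, so the normal derivative of J Z is its full ambient
  derivative. By the Leibniz rule this is J of the derivative of Z plus a term already in
  \<open>\<nu>p\<close>.\<close>

lemma normal_connection_endo_iff:
  assumes p: "f p \<in> U" and Z: "Z \<in> tangent_sections N Dp" and nu: "\<forall>w. sff p (X p) w \<in> \<nu> p"
  shows "normal_connection N M g f X (endo_along N M f (J \<alpha>) Z) p \<in> \<nu>p p
    \<longleftrightarrow> j p \<alpha> (nabla (\<lambda>q. df q (Z q)) p (X p)) \<in> \<nu>p p"
proof -
  have Zs: "vector_field_on N UNIV Z" "\<And>q. Z q \<in> Dp q" using Z by (auto simp: tangent_sections_def)
  let ?e = "levi_civita_endo M g (J \<alpha>) (f p) (df p (X p)) (df p (Z p))"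
    and ?n = "j p \<alpha> (nabla (\<lambda>q. df q (Z q)) p (X p))"
  have e: "?e \<in> \<nu>p p" by (rule nabla_J_nu_perp[OF p Zs(2)])
  have "normal_connection N M g f X (endo_along N M f (J \<alpha>) Z) p = ?e + ?n"
    using nabla_endo_along[OF open_UNIV UNIV_I p Zs(1), of \<alpha> "X p"] shape_operator_endo_eq_0[where X = X, OF p Z nu, of \<alpha>]
    by (simp add: normal_connection_def df_0)
  then show ?thesis
    using subspace_add[OF subspace_nu_perp[OF p] e, of ?n] subspace_diff[OF subspace_nu_perp[OF p] _ e, of "?e + ?n"]
    by auto
qed

text \<open>Applying J once more recovers the derivative itself, up to a factor, from
  \<open>\<nu>p\<close> and a tangent vector. Comparing tangent parts leaves B in
  \<open>\<nu>p\<close>; it lies in \<nu> as well, so it is 0.\<close>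

lemma sff_eq_0_if_j_nabla:
  assumes p: "f p \<in> U" and Z: "vector_field_on N UNIV Z" and nu: "sff p v (Z p) \<in> \<nu> p"
    and n: "j p \<alpha> (nabla (\<lambda>q. df q (Z q)) p v) \<in> \<nu>p p"
  shows "sff p v (Z p) = 0"
proof -
  let ?n = "nabla (\<lambda>q. df q (Z q)) p v"
  note s = subspace_nu_perp[OF p]
  obtain y where y: "j p \<alpha> (j p \<alpha> ?n) - df p y \<in> \<nu>p p" using j_nu_perp[OF p n] by blast
  have "- eps \<alpha> *\<^sub>R (j p \<alpha> (j p \<alpha> ?n) - df p y) = ?n + df p (eps \<alpha> *\<^sub>R y)"
    by (simp add: j_square[OF p] scaleR_diff_right eps_square df_scale)
  then have 1: "?n + df p (eps \<alpha> *\<^sub>R y) \<in> \<nu>p p" using subspace_scale[OF s y] by metis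
  obtain t where t: "?n = sff p v (Z p) + df p t" using nabla_split[OF open_UNIV UNIV_I Z] by blast
  then have 2: "sff p v (Z p) + df p (t + eps \<alpha> *\<^sub>R y) \<in> \<nu>p p" using 1 by (simp add: df_add add.assoc)
  have "df p (t + eps \<alpha> *\<^sub>R y) \<in> normal p"
    using subspace_diff[OF subspace_normal nu_perp_normal[OF p 2] sff_normal[of p v "Z p"]] by simp
  then have "t + eps \<alpha> *\<^sub>R y = 0" by (rule tangent_normal)
  then have "sff p v (Z p) \<in> \<nu>p p" using 2 by (simp add: df_0)
  then show ?thesis by (rule nu_inter_nu_perp[OF p nu])
qed

text \<open>The projection to \<nu> is given by a formula over \<open>U\<close> only; the cut-off
  supplies the global section through a prescribed vector.\<close>

lemma nu_section:
  assumes p: "f p \<in> U" and \<xi>: "\<xi>0 \<in> \<nu> p"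
  shows "\<exists>\<xi>\<in>sections_along N M f \<nu>. \<xi> p = \<xi>0"
proof -
  let ?d = "chart_at M (f p)"
  define W where "W = f -` (U \<inter> cdom ?d)"
  have W: "open W" "p \<in> W" "W \<subseteq> f -` U" "W \<subseteq> f -` cdom ?d"
    unfolding W_def using p M.chart_at by (auto intro!: open_vimage_map open_Int open_U M.open_cdom M.chart_at_max)
  let ?\<eta> = "\<lambda>q. nu_proj q (from_chart M ?d (f q) \<xi>0)"
  have "smooth_along N M f W ?\<eta>"
    by (rule smooth_nu_proj[OF W(1) smooth_along_const_coeff[OF M.chart_at(1) W(1,4)] W(3)])
  moreover obtain a where a: "a p = (1::real)"
    "\<And>\<xi>. smooth_along N M f W \<xi> \<Longrightarrow> smooth_along N M f UNIV (\<lambda>q. a q *\<^sub>R \<xi> q)" "\<And>q. q \<notin> W \<Longrightarrow> a q = 0"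
    using smooth_cutoff[OF W(1,2)] by metis
  ultimately have "smooth_along N M f UNIV (\<lambda>q. a q *\<^sub>R ?\<eta> q)" by blast
  moreover have "a q *\<^sub>R ?\<eta> q \<in> \<nu> q" for q
  proof (cases "q \<in> W")
    case True
    then have "f q \<in> U" using W(3) by blast
    then show ?thesis using subspace_scale[OF subspace_nu nu_proj_in] by blast
  qed (simp add: a(3) subspace_0[OF subspace_nu])
  moreover have "a p *\<^sub>R ?\<eta> p = \<xi>0" using a(1) nu_proj_ident[OF p \<xi>] by simp
  ultimately show ?thesis
    unfolding sections_along_def by (intro bexI[of _ "\<lambda>q. a q *\<^sub>R ?\<eta> q"] CollectI conjI allI)
qed

end

section \<open>The assertions as pointwise conditions\<close>

context pq_cr
begin

lemma Dperp_geodesic_iff: "Dperp_geodesic N M g f D \<longleftrightarrow> Dp_geodesic"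
proof
  assume r: Dp_geodesic
  show "Dperp_geodesic N M g f D"
    unfolding Dperp_geodesic_def
  proof (intro ballI allI)
    fix X Y x assume "X \<in> tangent_sections N Dp" "Y \<in> tangent_sections N Dp"
    then have "vector_field_on N UNIV Y" "X x \<in> Dp x" "Y x \<in> Dp x" by (auto simp: tangent_sections_def)
    then show "second_fundamental_form N M g f X Y x = 0"
      using r by (simp add: second_fundamental_form_eq[OF open_UNIV UNIV_I] Dp_geodesic_def)
  qed
next
  assume l: "Dperp_geodesic N M g f D"
  show Dp_geodesic
    unfolding Dp_geodesic_def
  proof (intro ballI allI)
    fix p x y assume "x \<in> Dp p" "y \<in> Dp p"
    then obtain X Y where X: "X \<in> tangent_sections N Dp" "X p = x" and Y: "Y \<in> tangent_sections N Dp" "Y p = y"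
      using Dp_section by metis
    then have "vector_field_on N UNIV Y" by (simp add: tangent_sections_def)
    from second_fundamental_form_eq[OF open_UNIV UNIV_I this, of X p]
    show "sff p x y = 0" using l X Y unfolding Dperp_geodesic_def by simp
  qed
qed

lemma second_fundamental_form_nu_iff:
  assumes E: "\<And>p v. v \<in> E p \<Longrightarrow> \<exists>X\<in>tangent_sections N E. X p = v" and F: "\<And>p v. v \<in> F p \<Longrightarrow> \<exists>X\<in>tangent_sections N F. X p = v"
  shows "(\<forall>X\<in>tangent_sections N E. \<forall>Y\<in>tangent_sections N F. \<forall>x. second_fundamental_form N M g f X Y x \<in> \<nu> x)
    \<longleftrightarrow> (\<forall>p. \<forall>x\<in>E p. \<forall>y\<in>F p. sff p x y \<in> \<nu> p)" (is "?l \<longleftrightarrow> ?r")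
proof
  assume r: ?r
  show ?l
  proof (intro ballI allI)
    fix X Y x assume "X \<in> tangent_sections N E" "Y \<in> tangent_sections N F"
    then have "vector_field_on N UNIV Y" "X x \<in> E x" "Y x \<in> F x" by (auto simp: tangent_sections_def)
    then show "second_fundamental_form N M g f X Y x \<in> \<nu> x"
      using r by (simp add: second_fundamental_form_eq[OF open_UNIV UNIV_I])
  qed
next
  assume l: ?l
  show ?r
  proof (intro ballI allI)
    fix p x y assume "x \<in> E p" "y \<in> F p"
    then obtain X Y where X: "X \<in> tangent_sections N E" "X p = x" and Y: "Y \<in> tangent_sections N F" "Y p = y"
      using E F by metis
    then have "vector_field_on N UNIV Y" by (simp add: tangent_sections_def)
    from second_fundamental_form_eq[OF open_UNIV UNIV_I this, of X p]
    show "sff p x y \<in> \<nu> p" using l X Y by metis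
  qed
qed

lemma mixed_nu_iff:
  "(\<forall>X\<in>tangent_sections N D. \<forall>Y\<in>tangent_sections N Dp. \<forall>x. second_fundamental_form N M g f X Y x \<in> \<nu> x) \<longleftrightarrow> mixed_nu"
proof -
  have "(\<forall>p. \<forall>x\<in>D p. \<forall>y\<in>Dp p. sff p x y \<in> \<nu> p) \<longleftrightarrow> mixed_nu"
    unfolding mixed_nu_def using sff_sym by metis
  then show ?thesis by (rule trans[OF second_fundamental_form_nu_iff, rotated -1]) (fact D_section Dp_section)+
qed

lemma Dp_nu_iff:
  "(\<forall>X\<in>tangent_sections N Dp. \<forall>Y\<in>tangent_sections N (\<lambda>_. UNIV). \<forall>x. second_fundamental_form N M g f X Y x \<in> \<nu> x) \<longleftrightarrow> Dp_nu"
proof -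
  have "(\<forall>p. \<forall>x\<in>Dp p. \<forall>y\<in>UNIV. sff p x y \<in> \<nu> p) \<longleftrightarrow> Dp_nu" by (simp add: Dp_nu_def)
  then show ?thesis by (rule trans[OF second_fundamental_form_nu_iff, rotated -1]) (rule Dp_section tangent_section, assumption?)+
qed

text \<open>\<open>Dp_nu\<close> is assumed because it makes the shape operators of J Z vanish, so
  that the normal derivative can be replaced by J of the ambient derivative of Z. Under it geodesic
  and autoparallel coincide.\<close>

lemma nu_perp_Dperp_parallel_iff:
  assumes Dp_nu
  shows "nu_perp_Dperp_parallel N M \<sigma> g f D \<longleftrightarrow> Dp_geodesic"
proof
  assume l: "nu_perp_Dperp_parallel N M \<sigma> g f D"
  show Dp_geodesic
    unfolding Dp_geodesic_def
  proof (intro ballI allI)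
    fix p x y assume xy: "x \<in> Dp p" "y \<in> Dp p"
    obtain U J where UJ: "f p \<in> U" "canonical_local_basis M \<sigma> U J" using basis_exists_at by blast
    interpret B: pq_basis N M f g D \<sigma> U J by unfold_locales (rule UJ)
    obtain X Y where X: "X \<in> tangent_sections N Dp" "X p = x" and Y: "Y \<in> tangent_sections N Dp" "Y p = y"
      using xy Dp_section by metis
    have nu: "\<forall>w. sff p (X p) w \<in> \<nu> p" using assms xy(1) X(2) by (simp add: Dp_nu_def)
    \<comment> \<open>One index suffices for this direction, since applying the same J twice returns
      to the derivative.\<close>
    have "normal_connection N M g f X (endo_along N M f (J 1) Y) p \<in> \<nu>p p"
      using l X(1) Y(1) UJ unfolding nu_perp_Dperp_parallel_def by blast
    then have "B.j p 1 (nabla (\<lambda>q. df q (Y q)) p (X p)) \<in> \<nu>p p"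
      by (rule iffD1[OF B.normal_connection_endo_iff[where X = X, OF UJ(1) Y(1) nu]])
    moreover have "vector_field_on N UNIV Y" using Y(1) by (simp add: tangent_sections_def)
    ultimately have "sff p (X p) (Y p) = 0" by (intro B.sff_eq_0_if_j_nabla[OF UJ(1) _ nu[rule_format]])
    then show "sff p x y = 0" by (simp add: X(2) Y(2))
  qed
next
  assume geod: Dp_geodesic
  then have au: Dp_autoparallel using assms Dp_autoparallel_iff Dp_geodesic_mixed_nu by blast
  show "nu_perp_Dperp_parallel N M \<sigma> g f D"
    unfolding nu_perp_Dperp_parallel_def
  proof (intro ballI allI impI)
    fix X Z U J \<alpha> p
    assume X: "X \<in> tangent_sections N Dp" and Z: "Z \<in> tangent_sections N Dp"
      and UJ: "canonical_local_basis M \<sigma> U J \<and> f p \<in> U"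
    interpret B: pq_basis N M f g D \<sigma> U J by unfold_locales (use UJ in blast)
    have p: "f p \<in> U" and Xp: "X p \<in> Dp p" using UJ X by (auto simp: tangent_sections_def)
    have nu: "\<forall>w. sff p (X p) w \<in> \<nu> p" using assms Xp by (simp add: Dp_nu_def)
    obtain y where "y \<in> Dp p" "nabla (\<lambda>q. df q (Z q)) p (X p) = df p y"
      using au Z Xp unfolding Dp_autoparallel_def by blast
    then have "B.j p \<alpha> (nabla (\<lambda>q. df q (Z q)) p (X p)) \<in> \<nu>p p" using B.nu_perpI[OF p] by simp
    then show "normal_connection N M g f X (endo_along N M f (J \<alpha>) Z) p \<in> \<nu>p p"
      by (rule iffD2[OF B.normal_connection_endo_iff[where X = X, OF p Z nu]])
  qed
qed

text \<open>The shape operator of J Z pairs with \<open>w\<close> to the product of B(X,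
  \<open>w\<close>) with J Z. As \<open>w\<close> is an arbitrary tangent vector, the condition on B
  concerns all of TN, whence \<open>Dp_nu\<close> rather than \<open>mixed_nu\<close>.\<close>

lemma shape_operator_endo_iff:
  "(\<forall>X\<in>tangent_sections N Dp. \<forall>Z\<in>tangent_sections N Dp. \<forall>U J \<alpha> x. canonical_local_basis M \<sigma> U J \<and> f x \<in> U \<longrightarrow>
      shape_operator N M g f (endo_along N M f (J \<alpha>) Z) X x = 0) \<longleftrightarrow> Dp_nu" (is "?l \<longleftrightarrow> _")
proof
  assume l: ?l
  show Dp_nu
    unfolding Dp_nu_def
  proof (intro ballI allI)
    fix p x w assume x: "x \<in> Dp p"
    obtain U J where UJ: "f p \<in> U" "canonical_local_basis M \<sigma> U J" using basis_exists_at by blast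
    interpret B: pq_basis N M f g D \<sigma> U J by unfold_locales (rule UJ)
    have "g (f p) (sff p x w) (B.j p \<alpha> (df p y)) = 0" if y: "y \<in> Dp p" for \<alpha> y
    proof -
      obtain X Y where X: "X \<in> tangent_sections N Dp" "X p = x" and Y: "Y \<in> tangent_sections N Dp" "Y p = y"
        using x y Dp_section by metis
      have "shape_operator N M g f (endo_along N M f (J \<alpha>) Y) X p = 0" using l X(1) Y(1) UJ by blast
      then show ?thesis using B.shape_operator_endo[OF UJ(1) Y(1), of \<alpha> X w] by (simp add: X(2) Y(2) H.gs)
    qed
    then show "sff p x w \<in> \<nu> p" unfolding B.nu_iff[OF UJ(1)] using sff_normal[of p x w] by simp
  qed
next
  assume r: Dp_nu
  show ?l
  proof (intro ballI allI impI)
    fix X Z U J \<alpha> p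
    assume X: "X \<in> tangent_sections N Dp" and Z: "Z \<in> tangent_sections N Dp"
      and UJ: "canonical_local_basis M \<sigma> U J \<and> f p \<in> U"
    interpret B: pq_basis N M f g D \<sigma> U J by unfold_locales (use UJ in blast)
    have "X p \<in> Dp p" using X by (simp add: tangent_sections_def)
    then have "\<forall>w. sff p (X p) w \<in> \<nu> p" using r by (simp add: Dp_nu_def)
    then show "shape_operator N M g f (endo_along N M f (J \<alpha>) Z) X p = 0"
      by (intro B.shape_operator_endo_eq_0[where X = X, OF _ Z]) (use UJ in blast)+
  qed
qed

lemma shape_operator_sff:
  assumes \<xi>: "\<xi> \<in> sections_along N M f normal"
  shows "h p (shape_operator N M g f \<xi> X p) y = g (f p) (\<xi> p) (sff p (X p) y)"
proof -
  let ?c = "chart_at N p"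
  have c: "open (cdom ?c)" "p \<in> cdom ?c" by (auto intro: N.open_cdom N.chart_at_max N.chart_at)
  have s: "smooth_along N M f (cdom ?c) \<xi>"
    by (rule smooth_along_subset[where W = UNIV]) (use \<xi> in \<open>auto simp: sections_along_def\<close>)
  have n: "\<xi> q \<in> normal q" for q using \<xi> by (simp add: sections_along_def)
  have "g (f p) (nabla \<xi> p (X p)) (df p (from_chart N ?c p y)) = - g (f p) (\<xi> p) (hess p (X p) y)"
    unfolding hess_eq_nabla
    by (rule nabla_orthogonal[OF c s smooth_along_differential[OF c(1) vector_field_const_coeff[OF N.chart_at(1)]] normal_df(1)[OF n]])
  then show ?thesis
    using sff_hess[OF n, of p "X p" y] by (simp add: shape_operator M.sym[of "f p" "\<xi> p"])
qed

text \<open>Lying in D means being orthogonal to D^perp, so the condition says that B(X,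
  \<open>y\<close>) is orthogonal to \<nu> for \<open>y\<close> in D^perp. Under
  \<open>Dp_nu\<close> this vector is itself in \<nu>, where the metric is non-degenerate.\<close>

lemma shape_operator_nu_iff:
  assumes Dp_nu
  shows "(\<forall>X\<in>tangent_sections N Dp. \<forall>\<xi>\<in>sections_along N M f \<nu>. \<forall>x. shape_operator N M g f \<xi> X x \<in> D x) \<longleftrightarrow> Dp_geodesic"
proof
  assume l: "\<forall>X\<in>tangent_sections N Dp. \<forall>\<xi>\<in>sections_along N M f \<nu>. \<forall>x. shape_operator N M g f \<xi> X x \<in> D x"
  show Dp_geodesic
    unfolding Dp_geodesic_def
  proof (intro ballI allI)
    fix p x y assume xy: "x \<in> Dp p" "y \<in> Dp p"
    obtain U J where UJ: "f p \<in> U" "canonical_local_basis M \<sigma> U J" using basis_exists_at by blast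
    interpret B: pq_basis N M f g D \<sigma> U J by unfold_locales (rule UJ)
    obtain X where X: "X \<in> tangent_sections N Dp" "X p = x" using xy(1) Dp_section by metis
    show "sff p x y = 0"
    proof (rule B.nu_nondegenerate[OF UJ(1)])
      show "sff p x y \<in> \<nu> p" using assms xy(1) by (simp add: Dp_nu_def)
      fix \<xi>0 assume "\<xi>0 \<in> \<nu> p"
      then obtain \<xi> where \<xi>: "\<xi> \<in> sections_along N M f \<nu>" "\<xi> p = \<xi>0" using B.nu_section[OF UJ(1)] by blast
      then have n: "\<xi> \<in> sections_along N M f normal" by (auto simp: sections_along_def nu_def)
      have "shape_operator N M g f \<xi> X p \<in> D p" using l X(1) \<xi>(1) by blast
      then have "g (f p) \<xi>0 (sff p x y) = 0"
        using D_Dp(2)[OF xy(2)] shape_operator_sff[OF n, of p X y] by (simp add: \<xi>(2) X(2))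
      then show "g (f p) (sff p x y) \<xi>0 = 0" by (simp add: M.sym[of "f p" \<xi>0])
    qed
  qed
next
  assume geod: Dp_geodesic
  show "\<forall>X\<in>tangent_sections N Dp. \<forall>\<xi>\<in>sections_along N M f \<nu>. \<forall>x. shape_operator N M g f \<xi> X x \<in> D x"
  proof (intro ballI allI in_D_if)
    fix X \<xi> p y assume X: "X \<in> tangent_sections N Dp" and \<xi>: "\<xi> \<in> sections_along N M f \<nu>" and y: "y \<in> Dp p"
    have "\<xi> \<in> sections_along N M f normal" using \<xi> by (auto simp: sections_along_def nu_def)
    moreover have "X p \<in> Dp p" using X by (simp add: tangent_sections_def)
    ultimately show "h p (shape_operator N M g f \<xi> X p) y = 0"
      using shape_operator_sff[of \<xi> p X y] geod y by (simp add: Dp_geodesic_def M.gs)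
  qed
qed

end

theorem theorem5p9:
  fixes M :: "('a::{t2_space, second_countable_topology}, 'm::euclidean_space) chart set"
    and N :: "('b::{t2_space, second_countable_topology}, 'n::euclidean_space) chart set"
    and \<sigma> :: "'a \<Rightarrow> ('m \<Rightarrow>\<^sub>L 'm) set"
    and g :: "'a \<Rightarrow> 'm \<Rightarrow> 'm \<Rightarrow> real"
    and f :: "'b \<Rightarrow> 'a"
    and D :: "'b \<Rightarrow> 'n set"
  assumes "smooth_manifold M" and "smooth_manifold N"
    and "paraquaternionic_kaehler M \<sigma> g"
    and "paraquaternionic_CR_submanifold N M \<sigma> g f D"
  defines "D' \<equiv> Dperp N M g f D"
    and "B \<equiv> second_fundamental_form N M g f"
    and "A \<equiv> shape_operator N M g f"
    and "\<nu> \<equiv> nu N M \<sigma> g f D"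
  defines "i \<equiv> totally_real_ruled N M g f D"
    and "ii \<equiv> Dperp_geodesic N M g f D \<and>
           (\<forall>X\<in>tangent_sections N D. \<forall>Y\<in>tangent_sections N D'. \<forall>x. B X Y x \<in> \<nu> x)"
    and "iii \<equiv> nu_perp_Dperp_parallel N M \<sigma> g f D \<and>
           (\<forall>X\<in>tangent_sections N D'. \<forall>Y\<in>tangent_sections N (\<lambda>_. UNIV). \<forall>x. B X Y x \<in> \<nu> x)"
    and "iv \<equiv>
           (\<forall>X\<in>tangent_sections N D'. \<forall>Z\<in>tangent_sections N D'.
             \<forall>U J \<alpha> x. canonical_local_basis M \<sigma> U J \<and> f x \<in> U \<longrightarrow>
               A (endo_along N M f (J \<alpha>) Z) X x = 0) \<and>
           (\<forall>X\<in>tangent_sections N D'. \<forall>\<xi>\<in>sections_along N M f \<nu>. \<forall>x. A \<xi> X x \<in> D x)"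
  shows "(i \<longleftrightarrow> ii) \<and> (i \<longleftrightarrow> iii) \<and> (i \<longleftrightarrow> iv)"
proof -
  have sr: "semi_riemannian_metric M g"
    using assms(3) by (simp add: paraquaternionic_kaehler_def almost_paraquaternionic_hermitian_def)
  have nd: "nondegenerate_submanifold N M g f"
    using assms(4) by (simp add: paraquaternionic_CR_submanifold_def)
  interpret M: smooth_mfd M by unfold_locales (rule assms(1))
  interpret N: smooth_mfd N by unfold_locales (rule assms(2))
  interpret pq_cr N M f g D \<sigma>
  proof unfold_locales
    show "smooth_map N M f" using nd by (simp add: nondegenerate_submanifold_def immersion_def)
    show "bilinear (g p)" "nondegenerate_on (g p) UNIV" for p
      using sr by (auto simp: semi_riemannian_metric_def)
    show "g p v w = g p w v" for p v w using sr unfolding semi_riemannian_metric_def by blast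
    show "smooth_on (metric_coeff M g c u v) (cmap c ` cdom c)" if "c \<in> M" for c u v
      using sr that by (simp add: semi_riemannian_metric_def)
    show "inj (differential N M f p)" "nondegenerate_on (induced_metric N M g f p) UNIV" for p
      using nd by (simp_all add: nondegenerate_submanifold_def immersion_def)
    show "distribution N D" "nondegenerate_on (induced_metric N M g f p) (D p)" for p
      using assms(4) by (simp_all add: paraquaternionic_CR_submanifold_def)
  qed (fact assms)+
  have 1: "i \<longleftrightarrow> Dp_geodesic \<and> mixed_nu"
    unfolding i_def totally_real_ruled_iff by (rule Dp_autoparallel_iff)
  have 2: "ii \<longleftrightarrow> Dp_geodesic \<and> mixed_nu"
    unfolding ii_def D'_def B_def \<nu>_def Dperp_geodesic_iff mixed_nu_iff ..
  \<comment> \<open>The conjuncts depend on each other: the second is \<open>Dp_nu\<close>, under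
    which the first becomes \<open>Dp_geodesic\<close>. For \<open>iv\<close> the roles are
    exchanged.\<close>
  have 3: "iii \<longleftrightarrow> Dp_geodesic \<and> Dp_nu"
    unfolding iii_def D'_def B_def \<nu>_def Dp_nu_iff using nu_perp_Dperp_parallel_iff by blast
  have 4: "iv \<longleftrightarrow> Dp_geodesic \<and> Dp_nu"
    unfolding iv_def D'_def A_def \<nu>_def shape_operator_endo_iff using shape_operator_nu_iff by blast
  show ?thesis using 1 2 3 4 Dp_geodesic_mixed_nu by simp
qed

end
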